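(* There exists a unitary oracle $\mathcal O$ relative to which an efficiently verifiable one-way puzzle (EV-OWPuzz) exists, and pseudodeterministic one-way functions (pd-OWFs) do not exist. Moreover, the separation holds even if all algorithms are allowed controlled access to the oracle and access to its inverse, conjugate, and transpose.
   Context: QPT means (uniform) quantum polynomial time; relative to an oracle, all algorithms (of the primitives and of the adversaries) may query the oracle. $\mathrm{negl}(\lambda)$ denotes a negligible function. A unitary oracle is a family of unitaries (indexed by width). EV-OWPuzz: a pair of QPT algorithms $(\mathsf{Samp},\mathsf{Ver})$, where $\mathsf{Samp}(1^\lambda)$ outputs a pair of classical strings $(s,k)$ ($s$ is the puzzle, $k$ the key) and $\mathsf{Ver}(s,k)$ outputs a bit, such that (Correctness) $\Pr_{(s,k)\gets\mathsf{Samp}(1^\lambda)}[\mathsf{Ver}(s,k)=1]\ge 1-\mathrm{negl}(\lambda)$; (Security) for every QPT algorithm $\mathcal A$ with (polynomial-length classical) advice $c$, $\Pr_{(s,k)\gets\mathsf{Samp}(1^\lambda)}[\mathsf{Ver}(s,\mathcal A(s,c))=1]\le \mathrm{negl}(\lambda)$. pd-OWF (with inverse-polynomial error): let $n=n(\lambda)$, $m=m(\lambda)$ be polynomials. A QPT algorithm $\mathrm{Gen}$ which on input $(1^\lambda,x)$ with $x\in\{0,1\}^n$ outputs a string in $\{0,1\}^m$ is a pd-OWF if for all sufficiently large $\lambda$ there exist a function $H=H_\lambda:\{0,1\}^n\to\{0,1\}^m$ and a set $\mathcal G\subset\{0,1\}^n$ such that (Pseudodeterminism) for every $x\in\mathcal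 G$, $\Pr[\mathrm{Gen}(1^\lambda,x)=H(x)]\ge 1-\mathrm{negl}(\lambda)$, and $|\mathcal G|\ge (1-\mu(\lambda))2^n$ with $\mu(\lambda)\le 1/3$ for sufficiently large $\lambda$; (Security) for every QPT algorithm $\mathcal A$ with advice $c$, $\Pr_{x\gets\{0,1\}^n,\,y:=H(x)}[H(\mathcal A(y,c))=y]\le\mathrm{negl}(\lambda)$. *)

theory Defs
  imports
    "HOL-Probability.Probability_Mass_Function"
    "HOL-Computational_Algebra.Polynomial"
    "Jordan_Normal_Form.Schur_Decomposition"
begin

section \<open>Classical polynomial time\<close>

text \<open>
  Deterministic one-tape Turing machines with a two-way infinite tape.  A single bound K limits both
  the states and the tape symbols.  State 0 is initial and state 1 halts; symbol 0 is blank, and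
  1 and 2 stand for the bits 0 and 1.
\<close>

type_synonym transition = "nat \<Rightarrow> nat \<Rightarrow> nat \<times> nat \<times> int"

type_synonym config = "nat \<times> (int \<Rightarrow> nat) \<times> int"

definition turing_machine :: "nat \<Rightarrow> transition \<Rightarrow> bool" where
  "turing_machine K \<delta> \<longleftrightarrow> K \<ge> 3 \<and>
     (\<forall>q<K. \<forall>a<K. case \<delta> q a of (q', a', d) \<Rightarrow> q' < K \<and> a' < K \<and> d \<in> {-1, 0, 1})"

fun tm_step :: "transition \<Rightarrow> config \<Rightarrow> config" where
  "tm_step \<delta> (q, t, i) =
     (if q = 1 then (q, t, i) else case \<delta> q (t i) of (q', a, d) \<Rightarrow> (q', t(i := a), i + d))"

definition tape_of :: "bool list \<Rightarrow> int \<Rightarrow> nat" where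
  "tape_of w i = (if 0 \<le> i \<and> i < int (length w) then if w ! nat i then 2 else 1 else 0)"

definition poly_time_computable :: "(bool list \<Rightarrow> bool list) \<Rightarrow> bool" where
  "poly_time_computable f \<longleftrightarrow> (\<exists>K \<delta> (p :: nat poly). turing_machine K \<delta> \<and>
     (\<forall>w. \<exists>i. (tm_step \<delta> ^^ poly p (length w)) (0, tape_of w, 0) = (1, tape_of (f w), i)))"


section \<open>Tuples of bit strings\<close>

text \<open>
  Self-delimiting code: every bit is preceded by a continuation bit \<open>True\<close>, and \<open>False\<close> terminates
  the string.  It serves for passing tuples of strings to algorithms and for reading strings of
  varying length off the fixed number of measured qubits.
\<close>

fun enc_str :: "bool list \<Rightarrow> bool list" where
  "enc_str [] = [False]"
| "enc_str (b # u) = True # b # enc_str u"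

definition enc_strs :: "bool list list \<Rightarrow> bool list" where
  "enc_strs us = concat (map enc_str us)"

text \<open>The first string of a code together with the rest; malformed codes are cut off.\<close>

fun read_str :: "bool list \<Rightarrow> bool list \<times> bool list" where
  "read_str (True # b # r) = (case read_str r of (u, r') \<Rightarrow> (b # u, r'))"
| "read_str (False # r) = ([], r)"
| "read_str _ = ([], [])"

lemma read_str_enc_str: "read_str (enc_str u @ r) = (u, r)"
  by (induction u) auto

definition read_pair :: "bool list \<Rightarrow> bool list \<times> bool list" where
  "read_pair x = (case read_str x of (u, r) \<Rightarrow> (u, fst (read_str r)))"

lemma read_pair_enc_strs: "read_pair (enc_strs [u, v] @ r) = (u, v)"
  by (simp add: read_pair_def enc_strs_def read_str_enc_str)


section \<open>Oracle circuits\<close>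

definition unitary :: "nat \<Rightarrow> complex mat \<Rightarrow> bool" where
  "unitary d A \<longleftrightarrow> A \<in> carrier_mat d d \<and> A * mat_adjoint A = 1\<^sub>m d \<and> mat_adjoint A * A = 1\<^sub>m d"

type_synonym unitary_family = "nat \<Rightarrow> complex mat"

definition unitary_oracle :: "unitary_family \<Rightarrow> bool" where
  "unitary_oracle U \<longleftrightarrow> (\<forall>n. unitary (2 ^ n) (U n))"

datatype variant = Forward | Inverse | Conjugate | Transpose

fun variant_mat :: "variant \<Rightarrow> complex mat \<Rightarrow> complex mat" where
  "variant_mat Forward A = A"
| "variant_mat Inverse A = mat_adjoint A"
| "variant_mat Conjugate A = map_mat cnj A"
| "variant_mat Transpose A = transpose_mat A"

text \<open>
  The elementary gates form the universal Clifford+T set.  \<open>Query c v qs\<close> applies variant \<open>v\<close> of the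
  family member of width \<open>length qs\<close> to the qubits \<open>qs\<close>, controlled by qubit \<open>q\<close> if \<open>c = Some q\<close>.
\<close>

datatype gate = Hadamard nat | Phase_T nat | CNOT nat nat | Query "nat option" variant "nat list"

datatype circuit = Circuit (width: nat) (gates: "gate list")

fun gate_qubits :: "gate \<Rightarrow> nat list" where
  "gate_qubits (Hadamard q) = [q]"
| "gate_qubits (Phase_T q) = [q]"
| "gate_qubits (CNOT p q) = [p, q]"
| "gate_qubits (Query None v qs) = qs"
| "gate_qubits (Query (Some q) v qs) = q # qs"

text \<open>Basis states are numbered with the first qubit as the most significant bit.\<close>

definition controlled :: "complex mat \<Rightarrow> complex mat" where
  "controlled A = (let d = dim_row A in four_block_mat (1\<^sub>m d) (0\<^sub>m d d) (0\<^sub>m d d) A)"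

fun gate_mat :: "unitary_family \<Rightarrow> gate \<Rightarrow> complex mat" where
  "gate_mat U (Hadamard q) =
     mat_of_rows_list 2 [[1 / sqrt 2, 1 / sqrt 2], [1 / sqrt 2, - 1 / sqrt 2]]"
| "gate_mat U (Phase_T q) = mat_of_rows_list 2 [[1, 0], [0, cis (pi / 4)]]"
| "gate_mat U (CNOT p q) = controlled (mat_of_rows_list 2 [[0, 1], [1, 0]])"
| "gate_mat U (Query None v qs) = variant_mat v (U (length qs))"
| "gate_mat U (Query (Some q) v qs) = controlled (variant_mat v (U (length qs)))"

definition valid_circuit :: "circuit \<Rightarrow> bool" where
  "valid_circuit C \<longleftrightarrow>
     (\<forall>g \<in> set (gates C). distinct (gate_qubits g) \<and> set (gate_qubits g) \<subseteq> {..<width C})"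


subsection \<open>Semantics\<close>

text \<open>A state of w qubits is given by its amplitudes on the computational basis \<open>bits w\<close>.\<close>

type_synonym state = "bool list \<Rightarrow> complex"

definition bits :: "nat \<Rightarrow> bool list set" where
  "bits n = {x. length x = n}"

definition basis_index :: "bool list \<Rightarrow> nat" where
  "basis_index x = horner_sum of_bool 2 (rev x)"

definition agree_off :: "nat list \<Rightarrow> bool list \<Rightarrow> bool list set" where
  "agree_off qs x = {y \<in> bits (length x). \<forall>i < length x. i \<notin> set qs \<longrightarrow> y ! i = x ! i}"

text \<open>The action of A on the qubits \<open>qs\<close> tensored with the identity on all other qubits.\<close>

definition apply_on :: "complex mat \<Rightarrow> nat list \<Rightarrow> state \<Rightarrow> state" where
  "apply_on A qs \<psi> x =
     (\<Sum>y \<in> agree_off qs x.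
        A $$ (basis_index (map ((!) x) qs), basis_index (map ((!) y) qs)) * \<psi> y)"

definition initial_state :: "nat \<Rightarrow> state" where
  "initial_state w x = (if x = replicate w False then 1 else 0)"

definition final_state :: "unitary_family \<Rightarrow> circuit \<Rightarrow> state" where
  "final_state U C =
     fold (\<lambda>g. apply_on (gate_mat U g) (gate_qubits g)) (gates C) (initial_state (width C))"

definition measure_all :: "unitary_family \<Rightarrow> circuit \<Rightarrow> bool list pmf" where
  "measure_all U C =
     embed_pmf (\<lambda>x. if x \<in> bits (width C) then (cmod (final_state U C x))\<^sup>2 else 0)"


subsection \<open>Outcome distributions are well defined\<close>

lemma finite_bits: "finite (bits n)"
  using finite_lists_length_eq[of "UNIV :: bool set" n] by (simp add: bits_def)

lemma card_bits: "card (bits n) = 2 ^ n"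
  using card_lists_length_eq[of "UNIV :: bool set" n] by (simp add: bits_def)

lemma basis_index_bij: "bij_betw basis_index (bits n) {..<2 ^ n}"
proof -
  have inj: "inj_on basis_index (bits n)"
  proof (rule inj_onI)
    fix x y assume *: "x \<in> bits n" "y \<in> bits n" "basis_index x = basis_index y"
    have "rev x ! i = rev y ! i" if "i < n" for i
    proof -
      have "bit (basis_index x) i = bit (basis_index y) i" using * by simp
      then show ?thesis using * that
        by (simp add: basis_index_def bits_def bit_horner_sum_bit_iff)
    qed
    then have "rev x = rev y" using * by (intro nth_equalityI) (auto simp: bits_def)
    then show "x = y" by simp
  qed
  have "basis_index ` bits n \<subseteq> {..<2 ^ n}"
  proof safe
    fix x assume "x \<in> bits n"
    then show "basis_index x < 2 ^ n"
      using nat_horner_sum[of "rev x"] horner_sum_of_bool_2_less[of "rev x"]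
      unfolding bits_def basis_index_def
      by (metis (mono_tags, lifting) length_rev mem_Collect_eq nat_less_numeral_power_cancel_iff)
  qed
  with inj show ?thesis
    by (simp add: bij_betw_def card_bits card_image card_subset_eq)
qed

lemma mat_adjoint_index:
  "A \<in> carrier_mat d e \<Longrightarrow> i < e \<Longrightarrow> j < d \<Longrightarrow> mat_adjoint A $$ (i, j) = cnj (A $$ (j, i))"
  by (auto simp: mat_adjoint_def mat_of_rows_def)

lemma mat_adjoint_eq: "mat_adjoint A = transpose_mat (map_mat cnj A)"
  by (rule eq_matI) (auto simp: mat_adjoint_def mat_of_rows_def)

lemma mat_adjoint_carrier: "(A :: complex mat) \<in> carrier_mat d e \<Longrightarrow> mat_adjoint A \<in> carrier_mat e d"
  unfolding mat_adjoint_eq by simp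

lemma agree_off_eq: 
  assumes "y \<in> agree_off qs x" shows "agree_off qs y = agree_off qs x"
  using assms by (auto simp: agree_off_def bits_def)

lemma agree_off_bij:
  assumes "distinct qs" "set qs \<subseteq> {..<length x}"
  shows "bij_betw (\<lambda>y. map ((!) y) qs) (agree_off qs x) (bits (length qs))"
proof (rule bij_betw_byWitness[where f' = "\<lambda>b. map (\<lambda>i. if i \<in> set qs then b ! (THE j. j < length qs \<and> qs ! j = i) else x ! i) [0..<length x]"])
  have the: "(THE j. j < length qs \<and> qs ! j = qs ! k) = k" if "k < length qs" for k
    using that assms(1) by (auto intro!: the_equality simp: nth_eq_iff_index_eq)
  show "\<forall>y\<in>agree_off qs x. map (\<lambda>i. if i \<in> set qs then map ((!) y) qs ! (THE j. j < length qs \<and> qs ! j = i) else x ! i) [0..<length x] = y"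
  proof
    fix y assume y: "y \<in> agree_off qs x"
    have eq: "(if i \<in> set qs then map ((!) y) qs ! (THE j. j < length qs \<and> qs ! j = i) else x ! i) = y ! i"
      if "i < length x" for i
    proof (cases "i \<in> set qs")
      case True
      then obtain k where "k < length qs" "i = qs ! k" by (auto simp: in_set_conv_nth)
      then show ?thesis by (simp add: the)
    qed (use that y in \<open>auto simp: agree_off_def\<close>)
    then show "map (\<lambda>i. if i \<in> set qs then map ((!) y) qs ! (THE j. j < length qs \<and> qs ! j = i) else x ! i) [0..<length x] = y"
      (is "?m = y")
    proof -
      have "[0..<length x] = [0..<length y]" using y by (simp add: agree_off_def bits_def)
      with map_nth[of y] have "map ((!) y) [0..<length x] = y" by simp
      moreover have "?m = map ((!) y) [0..<length x]"
        by (rule map_cong[OF HOL.refl]) (use eq in simp)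
      ultimately show ?thesis by simp
    qed
  qed
  show "\<forall>b\<in>bits (length qs). map ((!) (map (\<lambda>i. if i \<in> set qs then b ! (THE j. j < length qs \<and> qs ! j = i) else x ! i) [0..<length x])) qs = b"
  proof
    fix b assume "b \<in> bits (length qs)"
    moreover have "k < length qs \<Longrightarrow> qs ! k < length x" for k using assms(2) nth_mem[of k qs] by blast
    ultimately show "map ((!) (map (\<lambda>i. if i \<in> set qs then b ! (THE j. j < length qs \<and> qs ! j = i) else x ! i) [0..<length x])) qs = b"
      by (intro nth_equalityI) (auto simp: the bits_def)
  qed
qed (auto simp: agree_off_def bits_def)

lemma agree_off_index_bij:
  assumes "distinct qs" "set qs \<subseteq> {..<length x}"
  shows "bij_betw (\<lambda>y. basis_index (map ((!) y) qs)) (agree_off qs x) {..<2 ^ length qs}"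
  using bij_betw_trans[OF agree_off_bij[OF assms] basis_index_bij] by (simp add: comp_def)

lemma apply_on_norm:
  assumes A: "unitary (2 ^ length qs) A" and qs: "distinct qs" "set qs \<subseteq> {..<w}"
  shows "(\<Sum>x\<in>bits w. (cmod (apply_on A qs \<psi> x))\<^sup>2) = (\<Sum>x\<in>bits w. (cmod (\<psi> x))\<^sup>2)"
proof -
  define r where "r = (\<lambda>x. basis_index (map ((!) x) qs))"
  let ?d = "2 ^ length qs :: nat"
  have bij: "bij_betw r (agree_off qs x) {..<?d}" if "x \<in> bits w" for x
    using agree_off_index_bij[of qs x] that qs by (simp add: r_def bits_def)
  have fin: "finite (agree_off qs x)" for x
    by (rule finite_subset[OF _ finite_bits[of "length x"]]) (auto simp: agree_off_def)
  have sub: "y \<in> bits w" if "y \<in> agree_off qs x" "x \<in> bits w" for x y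
    using that by (auto simp: agree_off_def bits_def)
  have sym: "x \<in> agree_off qs y \<longleftrightarrow> y \<in> agree_off qs x" for x y
    by (auto simp: agree_off_def bits_def)
  have self: "x \<in> agree_off qs x" for x by (auto simp: agree_off_def bits_def)
  have orth: "(\<Sum>k<?d. A $$ (k, i) * cnj (A $$ (k, j))) = (if i = j then 1 else 0)"
    if "i < ?d" "j < ?d" for i j
  proof -
    have c: "A \<in> carrier_mat ?d ?d" and e: "mat_adjoint A * A = 1\<^sub>m ?d"
      using A by (auto simp: unitary_def)
    have "(mat_adjoint A * A) $$ (j, i) = (\<Sum>k<?d. cnj (A $$ (k, j)) * A $$ (k, i))"
      using c that mat_adjoint_carrier[OF c]
      by (auto simp: scalar_prod_def mat_adjoint_index atLeast0LessThan intro!: sum.cong)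
    then show ?thesis using that by (auto simp: e mult.commute split: if_splits)
  qed
  have "complex_of_real (\<Sum>x\<in>bits w. (cmod (apply_on A qs \<psi> x))\<^sup>2) =
     (\<Sum>x\<in>bits w. apply_on A qs \<psi> x * cnj (apply_on A qs \<psi> x))"
    by (simp only: of_real_sum complex_norm_square)
  also have "\<dots> = (\<Sum>x\<in>bits w. \<Sum>y\<in>agree_off qs x. \<Sum>z\<in>agree_off qs x.
      A $$ (r x, r y) * cnj (A $$ (r x, r z)) * (\<psi> y * cnj (\<psi> z)))"
    by (simp add: apply_on_def r_def sum_product mult_ac)
  also have "\<dots> = (\<Sum>x\<in>bits w. \<Sum>y\<in>{y \<in> bits w. y \<in> agree_off qs x}. \<Sum>z\<in>agree_off qs y.
      A $$ (r x, r y) * cnj (A $$ (r x, r z)) * (\<psi> y * cnj (\<psi> z)))"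
    by (intro sum.cong) (auto simp: agree_off_eq sub)
  also have "\<dots> = (\<Sum>y\<in>bits w. \<Sum>x\<in>{x \<in> bits w. y \<in> agree_off qs x}. \<Sum>z\<in>agree_off qs y.
      A $$ (r x, r y) * cnj (A $$ (r x, r z)) * (\<psi> y * cnj (\<psi> z)))"
    by (rule sum.swap_restrict) (auto simp: finite_bits)
  also have "\<dots> = (\<Sum>y\<in>bits w. \<Sum>x\<in>agree_off qs y. \<Sum>z\<in>agree_off qs y.
      A $$ (r x, r y) * cnj (A $$ (r x, r z)) * (\<psi> y * cnj (\<psi> z)))"
    by (intro sum.cong) (auto simp: sym intro: sub)
  also have "\<dots> = (\<Sum>y\<in>bits w. \<Sum>z\<in>agree_off qs y.
      (\<Sum>x\<in>agree_off qs y. A $$ (r x, r y) * cnj (A $$ (r x, r z))) * (\<psi> y * cnj (\<psi> z)))"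
    by (rule sum.cong[OF refl], subst sum.swap) (simp add: sum_distrib_right)
  also have "\<dots> = (\<Sum>y\<in>bits w. \<Sum>z\<in>agree_off qs y. (if z = y then 1 else 0) * (\<psi> y * cnj (\<psi> z)))"
  proof (intro sum.cong refl)
    fix y z assume y: "y \<in> bits w" and z: "z \<in> agree_off qs y"
    have "(\<Sum>x\<in>agree_off qs y. A $$ (r x, r y) * cnj (A $$ (r x, r z))) =
        (\<Sum>k<?d. A $$ (k, r y) * cnj (A $$ (k, r z)))"
      by (rule sum.reindex_bij_betw[OF bij[OF y]])
    also have "\<dots> = (if r y = r z then 1 else 0)"
      using bij[OF y] z self[of y] by (intro orth) (auto simp: bij_betw_def)
    also have "r y = r z \<longleftrightarrow> z = y"
      using bij[OF y] z self[of y] by (auto simp: bij_betw_def inj_on_def)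
    finally show "(\<Sum>x\<in>agree_off qs y. A $$ (r x, r y) * cnj (A $$ (r x, r z))) * (\<psi> y * cnj (\<psi> z))
      = (if z = y then 1 else 0) * (\<psi> y * cnj (\<psi> z))" by simp
  qed
  also have "\<dots> = (\<Sum>y\<in>bits w. \<psi> y * cnj (\<psi> y))"
    using fin self by (intro sum.cong refl) (simp add: if_distrib[of "\<lambda>c. c * _"] sum.delta' cong: if_cong)
  also have "\<dots> = complex_of_real (\<Sum>x\<in>bits w. (cmod (\<psi> x))\<^sup>2)"
    by (simp only: of_real_sum complex_norm_square)
  finally show ?thesis using of_real_eq_iff by blast
qed

lemma unitaryI:
  assumes "A \<in> carrier_mat d d" "mat_adjoint A * A = 1\<^sub>m d" shows "unitary d A"
  using assms mat_mult_left_right_inverse[OF mat_adjoint_carrier[OF assms(1)] assms(1)]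
  by (simp add: unitary_def)

lemma map_mat_cnj_mult:
  "A \<in> carrier_mat d d \<Longrightarrow> B \<in> carrier_mat d d \<Longrightarrow> map_mat cnj (A * B) = map_mat cnj A * map_mat cnj B"
  by (rule eq_matI) (auto simp: scalar_prod_def)

lemma map_mat_cnj_one: "map_mat cnj (1\<^sub>m d) = 1\<^sub>m d"
  by (rule eq_matI) auto

lemma adjoint_adjoint: "mat_adjoint (mat_adjoint A) = (A :: complex mat)"
  by (rule eq_matI) (auto simp: mat_adjoint_eq)

lemma unitary_conj: assumes "unitary d A" shows "unitary d (map_mat cnj A)"
proof -
  have c: "A \<in> carrier_mat d d" and e: "mat_adjoint A * A = 1\<^sub>m d" using assms by (auto simp: unitary_def)
  have "mat_adjoint (map_mat cnj A) = map_mat cnj (mat_adjoint A)"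
    by (rule eq_matI) (auto simp: mat_adjoint_eq)
  then have "mat_adjoint (map_mat cnj A) * map_mat cnj A = 1\<^sub>m d"
    using map_mat_cnj_mult[OF mat_adjoint_carrier[OF c] c] e by (simp add: map_mat_cnj_one)
  with c show ?thesis by (intro unitaryI) auto
qed

lemma unitary_adjoint: "unitary d A \<Longrightarrow> unitary d (mat_adjoint A)"
  by (auto simp: unitary_def adjoint_adjoint mat_adjoint_carrier)

lemma unitary_variant: assumes "unitary d A" shows "unitary d (variant_mat v A)"
proof (cases v)
  case Transpose
  have "transpose_mat A = mat_adjoint (map_mat cnj A)"
    by (rule eq_matI) (auto simp: mat_adjoint_eq)
  then show ?thesis using Transpose unitary_adjoint[OF unitary_conj[OF assms]] by simp
qed (use assms unitary_adjoint unitary_conj in auto)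

lemma unitary_controlled: assumes "unitary d A" shows "unitary (2 * d) (controlled A)"
proof -
  have c: "A \<in> carrier_mat d d" and e: "mat_adjoint A * A = 1\<^sub>m d" using assms by (auto simp: unitary_def)
  have c': "mat_adjoint A \<in> carrier_mat d d" using mat_adjoint_carrier[OF c] .
  have "mat_adjoint (controlled A) = four_block_mat (1\<^sub>m d) (0\<^sub>m d d) (0\<^sub>m d d) (mat_adjoint A)"
    using c by (intro eq_matI) (auto simp: mat_adjoint_eq controlled_def Let_def)
  then have "mat_adjoint (controlled A) * controlled A =
    four_block_mat (1\<^sub>m d) (0\<^sub>m d d) (0\<^sub>m d d) (mat_adjoint A) * four_block_mat (1\<^sub>m d) (0\<^sub>m d d) (0\<^sub>m d d) A"
    using c by (simp add: controlled_def Let_def)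
  also have "\<dots> = four_block_mat (1\<^sub>m d) (0\<^sub>m d d) (0\<^sub>m d d) (1\<^sub>m d)"
    using c c' e by (subst mult_four_block_mat[where ?nr1.0=d and ?n1.0=d and ?n2.0=d and ?nr2.0=d and ?nc1.0=d and ?nc2.0=d]) auto
  also have "\<dots> = 1\<^sub>m (2 * d)" by (rule eq_matI) auto
  finally show ?thesis using c by (intro unitaryI) (auto simp: controlled_def Let_def)
qed

lemma unitary_gate:
  assumes "unitary_oracle U" shows "unitary (2 ^ length (gate_qubits g)) (gate_mat U g)"
proof -
  have U: "unitary (2 ^ n) (U n)" for n using assms by (simp add: unitary_oracle_def)
  have s: "complex_of_real (sqrt 2) * complex_of_real (sqrt 2) = 2"
    by (simp flip: of_real_mult)
  have two: "i < 2 \<longleftrightarrow> i = 0 \<or> i = 1" for i :: nat by auto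
  have X: "unitary 2 (mat_of_rows_list 2 [[0, 1], [1, 0]])"
    by (rule unitaryI) (auto simp: mat_adjoint_eq mat_of_rows_list_def scalar_prod_def two intro!: eq_matI)
  show ?thesis
  proof (cases g)
    case (Hadamard q)
    have "unitary 2 (mat_of_rows_list 2 [[1 / sqrt 2, 1 / sqrt 2], [1 / sqrt 2, - 1 / sqrt 2]])"
      by (rule unitaryI) (auto simp: mat_adjoint_eq mat_of_rows_list_def scalar_prod_def two s intro!: eq_matI)
    then show ?thesis by (simp add: Hadamard)
  next
    case (Phase_T q)
    have "unitary 2 (mat_of_rows_list 2 [[1, 0], [0, cis (pi / 4)]])"
      by (rule unitaryI) (auto simp: mat_adjoint_eq mat_of_rows_list_def scalar_prod_def two cis_cnj cis_mult intro!: eq_matI)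
    then show ?thesis by (simp add: Phase_T)
  next
    case (CNOT p q)
    then show ?thesis using unitary_controlled[OF X] by simp
  next
    case (Query c v qs)
    then show ?thesis using unitary_variant[OF U, of "length qs" v] unitary_controlled
      by (cases c) auto
  qed
qed

lemma final_state_norm:
  assumes "unitary_oracle U" "valid_circuit C"
  shows "(\<Sum>x\<in>bits (width C). (cmod (final_state U C x))\<^sup>2) = 1"
proof -
  have "(\<Sum>x\<in>bits w. (cmod (fold (\<lambda>g. apply_on (gate_mat U g) (gate_qubits g)) gs \<psi> x))\<^sup>2) =
     (\<Sum>x\<in>bits w. (cmod (\<psi> x))\<^sup>2)"
    if "\<forall>g \<in> set gs. distinct (gate_qubits g) \<and> set (gate_qubits g) \<subseteq> {..<w}" for gs w \<psi>
    using that
    by (induction gs arbitrary: \<psi>) (simp_all add: apply_on_norm[OF unitary_gate[OF assms(1)]])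
  moreover have "(\<Sum>x\<in>bits w. (cmod (initial_state w x))\<^sup>2) = 1" for w
  proof -
    have "(\<Sum>x\<in>bits w. (cmod (initial_state w x))\<^sup>2) =
        (\<Sum>x\<in>bits w. if x = replicate w False then 1 else 0)"
      by (intro sum.cong) (auto simp: initial_state_def)
    then show ?thesis using finite_bits by (simp add: bits_def)
  qed
  ultimately show ?thesis using assms(2) by (simp add: final_state_def valid_circuit_def)
qed

lemma pmf_measure_all:
  assumes "unitary_oracle U" "valid_circuit C"
  shows "pmf (measure_all U C) x = (if x \<in> bits (width C) then (cmod (final_state U C x))\<^sup>2 else 0)"
  unfolding measure_all_def
proof (rule pmf_embed_pmf)
  let ?f = "\<lambda>x. if x \<in> bits (width C) then (cmod (final_state U C x))\<^sup>2 else 0"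
  have "(\<integral>\<^sup>+x. ennreal (?f x) \<partial>count_space UNIV) = (\<Sum>x\<in>bits (width C). ennreal (?f x))"
    by (rule nn_integral_count_space'[OF finite_bits]) (auto split: if_splits)
  also have "\<dots> = ennreal (\<Sum>x\<in>bits (width C). ?f x)" by (rule sum_ennreal) auto
  also have "\<dots> = 1" using final_state_norm[OF assms] by simp
  finally show "(\<integral>\<^sup>+x. ennreal (?f x) \<partial>count_space UNIV) = 1" .
qed simp


subsection \<open>Encoding of circuits\<close>

text \<open>Numbers are written in unary, so the size of a code is polynomial in width and number of gates.\<close>

definition enc_nats :: "nat list \<Rightarrow> bool list" where
  "enc_nats ns = concat (map (\<lambda>n. replicate n True @ [False]) ns)"

fun variant_code :: "variant \<Rightarrow> nat" where
  "variant_code Forward = 0"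
| "variant_code Inverse = 1"
| "variant_code Conjugate = 2"
| "variant_code Transpose = 3"

fun gate_code :: "gate \<Rightarrow> nat list" where
  "gate_code (Hadamard q) = [0, q]"
| "gate_code (Phase_T q) = [1, q]"
| "gate_code (CNOT p q) = [2, p, q]"
| "gate_code (Query None v qs) = [3, variant_code v, length qs] @ qs"
| "gate_code (Query (Some q) v qs) = [4, q, variant_code v, length qs] @ qs"

definition enc_circuit :: "circuit \<Rightarrow> bool list" where
  "enc_circuit C = enc_nats (width C # length (gates C) # concat (map gate_code (gates C)))"

lemma enc_nats_inj: "enc_nats ms = enc_nats ns \<Longrightarrow> ms = ns"
proof (induction ms arbitrary: ns)
  case Nil then show ?case by (cases ns) (auto simp: enc_nats_def)
next
  case (Cons m ms)
  then obtain n ns' where ns: "ns = n # ns'" by (cases ns) (auto simp: enc_nats_def)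
  have *: "replicate m True @ False # u = replicate n True @ False # v \<Longrightarrow> m = n \<and> u = v" for m n u v
    by (induction m arbitrary: n) (case_tac n; auto)+
  show ?case using Cons.prems Cons.IH *[of m "enc_nats ms" n "enc_nats ns'"] by (auto simp: ns enc_nats_def)
qed

lemma gate_code_prefix: "gate_code g @ r = gate_code g' @ r' \<Longrightarrow> g = g' \<and> r = r'"
proof -
  have v: "variant_code v = variant_code v' \<longleftrightarrow> v = v'" for v v' by (cases v; cases v') auto
  show "gate_code g @ r = gate_code g' @ r' \<Longrightarrow> g = g' \<and> r = r'"
    by (cases g rule: gate_code.cases; cases g' rule: gate_code.cases) (auto simp: v)
qed

lemma enc_circuit_inj: "enc_circuit C = enc_circuit C' \<Longrightarrow> C = C'"
proof -
  have "length gs = length gs' \<Longrightarrow> concat (map gate_code gs) = concat (map gate_code gs') \<Longrightarrow> gs = gs'" for gs gs'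
    by (induction gs gs' rule: list_induct2) (auto dest: gate_code_prefix)
  then show "enc_circuit C = enc_circuit C' \<Longrightarrow> C = C'"
    by (cases C; cases C') (auto simp: enc_circuit_def dest!: enc_nats_inj)
qed


section \<open>QPT algorithms\<close>

text \<open>
  An algorithm maps its classical input to the circuit that is run on it: all qubits start in
  state 0 and are measured at the end, and the output is the string (or pair of strings) encoded by
  the outcome.
\<close>

type_synonym algorithm = "bool list \<Rightarrow> circuit"

definition out :: "unitary_family \<Rightarrow> algorithm \<Rightarrow> bool list list \<Rightarrow> bool list pmf" where
  "out U A us = map_pmf (\<lambda>x. fst (read_str x)) (measure_all U (A (enc_strs us)))"

definition out_pair :: "unitary_family \<Rightarrow> algorithm \<Rightarrow> bool list list \<Rightarrow> (bool list \<times> bool list) pmf" where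
  "out_pair U A us = map_pmf read_pair (measure_all U (A (enc_strs us)))"

text \<open>The permitted queries: whether controlled, and which variants.\<close>

type_synonym access = "(bool \<times> variant) set"

definition plain_access :: access where
  "plain_access = {(False, Forward)}"

definition full_access :: access where
  "full_access = UNIV"

definition QPT :: "access \<Rightarrow> algorithm \<Rightarrow> bool" where
  "QPT acc A \<longleftrightarrow> poly_time_computable (\<lambda>w. enc_circuit (A w)) \<and>
     (\<forall>w. valid_circuit (A w) \<and>
        (\<forall>c v qs. Query c v qs \<in> set (gates (A w)) \<longrightarrow> (c \<noteq> None, v) \<in> acc))"

definition advice :: "(nat \<Rightarrow> bool list) \<Rightarrow> bool" where
  "advice c \<longleftrightarrow> (\<exists>p :: nat poly. \<forall>l. length (c l) \<le> poly p l)"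


section \<open>Cryptographic primitives\<close>

definition negligible :: "(nat \<Rightarrow> real) \<Rightarrow> bool" where
  "negligible \<epsilon> \<longleftrightarrow> (\<forall>c :: nat. \<forall>\<^sub>F l in sequentially. \<bar>\<epsilon> l\<bar> \<le> 1 / real l ^ c)"

definition unary :: "nat \<Rightarrow> bool list" where
  "unary l = replicate l True"

text \<open>The output \<open>[True]\<close> of the verifier is the bit 1.\<close>

definition EV_OWPuzz :: "unitary_family \<Rightarrow> access \<Rightarrow> algorithm \<Rightarrow> algorithm \<Rightarrow> bool" where
  "EV_OWPuzz U acc Samp Ver \<longleftrightarrow> QPT acc Samp \<and> QPT acc Ver \<and>
     (\<exists>\<epsilon>. negligible \<epsilon> \<and> (\<forall>l.
        pmf (do { (s, k) \<leftarrow> out_pair U Samp [unary l]; out U Ver [s, k] }) [True] \<ge> 1 - \<epsilon> l)) \<and>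
     (\<forall>A c. QPT acc A \<and> advice c \<longrightarrow> (\<exists>\<epsilon>. negligible \<epsilon> \<and> (\<forall>l.
        pmf (do { (s, _) \<leftarrow> out_pair U Samp [unary l];
                  k \<leftarrow> out U A [s, c l];
                  out U Ver [s, k] }) [True] \<le> \<epsilon> l)))"

definition polynomial :: "(nat \<Rightarrow> nat) \<Rightarrow> bool" where
  "polynomial n \<longleftrightarrow> (\<exists>p :: real poly. \<forall>l. real (n l) = poly p (real l))"

definition pd_OWF :: "unitary_family \<Rightarrow> access \<Rightarrow> (nat \<Rightarrow> nat) \<Rightarrow> (nat \<Rightarrow> nat) \<Rightarrow> algorithm \<Rightarrow> bool" where
  "pd_OWF U acc n m Gen \<longleftrightarrow> polynomial n \<and> polynomial m \<and> QPT acc Gen \<and>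
     (\<forall>l. \<forall>x \<in> bits (n l). set_pmf (out U Gen [unary l, x]) \<subseteq> bits (m l)) \<and>
     (\<exists>(H :: nat \<Rightarrow> bool list \<Rightarrow> bool list) (\<G> :: nat \<Rightarrow> bool list set).
        (\<forall>\<^sub>F l in sequentially. H l \<in> bits (n l) \<rightarrow> bits (m l) \<and> \<G> l \<subseteq> bits (n l)) \<and>
        (\<exists>\<epsilon>. negligible \<epsilon> \<and> (\<forall>\<^sub>F l in sequentially. \<forall>x \<in> \<G> l.
           pmf (out U Gen [unary l, x]) (H l x) \<ge> 1 - \<epsilon> l)) \<and>
        (\<exists>\<mu> :: nat \<Rightarrow> real. \<forall>\<^sub>F l in sequentially.
           \<mu> l \<le> 1 / 3 \<and> real (card (\<G> l)) \<ge> (1 - \<mu> l) * 2 ^ n l) \<and>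
        (\<forall>A c. QPT acc A \<and> advice c \<longrightarrow> (\<exists>\<epsilon>. negligible \<epsilon> \<and> (\<forall>\<^sub>F l in sequentially.
           measure_pmf.prob
             (do { x \<leftarrow> pmf_of_set (bits (n l));
                   let y = H l x;
                   x' \<leftarrow> out U A [y, c l];
                   return_pmf (y, x') })
             {(y, x'). x' \<in> bits (n l) \<and> H l x' = y} \<le> \<epsilon> l))))"

end

theory Submission
  imports Defs "HOL-Real_Asymp.Real_Asymp"
begin

text \<open>
  The oracle hides a key function \<open>f\<close>, which assigns to every string \<open>s\<close> (a puzzle) a key of
  length \<open>2 * length s\<close>.  A classical query \<open>w\<close> has a set of answers, and the oracle maps
  \<open>0\<close> in an answer register next to \<open>w\<close> to the uniform superposition of these answers by a reflection.
  The matrices are real, symmetric and involutory, so inverse, conjugate and transpose are the oracle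
  itself.  The answers (\<open>answers\<close>) are: to the query \<open>1^m\<close> all pairs \<open>(s, f s)\<close> with \<open>s\<close> of length
  \<open>m\<close>; to a pair \<open>(s, k)\<close> with \<open>k\<close> of key length an acceptance if \<open>f s = k\<close>; to a pair of a
  string \<open>y\<close> and a request, which names an algorithm \<open>G\<close> and the lengths \<open>l\<close> and \<open>n\<close>, all \<open>x\<close> of
  length \<open>n\<close> on which \<open>G\<close> outputs \<open>y\<close> with probability above \<open>1/2\<close> on average over all keys
  of more than logarithmic length.  Here the logarithm is that of a threshold, polynomial in \<open>l\<close>, \<open>n\<close>
  and the size of the circuits of \<open>G\<close>, that is written in unary into the request.  Hence a request has
  polynomial length, and yet the answers to queries of the third kind that are shorter than \<open>2^m\<close> are
  independent of the keys of length \<open>m\<close>.  One algorithm, \<open>loader\<close>, measures a random answer to its input; it samples puzzles, verifies keys, and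
  inverts.

  Security of the puzzle, for a random \<open>f\<close>.  A circuit below width \<open>2^m\<close> sees the keys of length
  \<open>m\<close> only through sampling and verification.  Replacing the keys of a set \<open>R\<close> of \<open>r\<close> puzzles by
  dummies changes a run by \<open>O(sqrt (r / 2^m))\<close> per sampling query and otherwise by the amplitude on
  verifications of the right keys (\<open>nrm_run_hide\<close>).  If an attack succeeds noticeably often, then there
  is a large set \<open>R\<close> of solved puzzles such that the run for one of them does not query the keys of the
  others (\<open>exists_independent_set\<close>), and with all keys of \<open>R\<close> hidden the attack must still output or
  query each of them.  Only few keys are likely to be found in this way, and they do not depend on
  \<open>f\<close> at \<open>R\<close>, so that the \<open>r\<close> keys are all among them with probability at most \<open>2^-r\<close> (\<open>attack_fails\<close>).  For
  \<open>r = u^4\<close> this outweighs the number of advice strings of length \<open>u\<close> (\<open>broken_rare\<close>).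

  Inversion.  For random \<open>f\<close> the output probabilities of an algorithm concentrate around their
  averages over the hidden keys.  By the Efron--Stein inequality it suffices to bound the effect of hiding
  one key, summed over all keys.  For \<open>T\<close> gates and the keys of length \<open>m\<close> the squared changes sum up
  to \<open>O(T^4 / 2^m)\<close> (\<open>key_influence\<close>), and not just to \<open>O(T^2)\<close>: the first-order terms that
  come from sampling are orthogonal for different puzzles, so that Bessel's inequality applies, and the
  masses on the right verifications are small on average.  The sum over all hidden lengths is
  \<open>O(T^4)\<close> divided by the threshold (\<open>output_concentration\<close>).  So for most \<open>x\<close> the value of a
  pseudodeterministic \<open>G\<close> at \<open>x\<close> also has average probability above \<open>1/2\<close>; a random answer to the
  request then is a preimage with probability at least \<open>1/4\<close>
  (\<open>inversion_probability\<close>).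

  There are countably many algorithms (\<open>alg\<close>).  The bad events for security and inversion have total
  probability below \<open>1\<close>, and each of them depends on finitely many keys, so by compactness some \<open>f\<close>
  avoids all of them (\<open>exists_good_keys\<close>).
\<close>

section \<open>Loop programs on Turing machines\<close>

text \<open>
  That \<open>loader\<close> is uniform has to be shown on Turing machines.  The circuit descriptions are produced by a
  small language of nested loops over the input positions, which is compiled once and for all.

  \<open>Emit\<close> outputs one bit.  \<open>Rep below u\<close> outputs \<open>u\<close> once for every input position, or for every
  position below the current one of the outer loop.  \<open>Bit u v\<close> outputs \<open>u\<close> or \<open>v\<close>, depending on the
  input bit at the current position.  \<open>Again\<close> and \<open>Next\<close> are the loop ends; they occur only during
  execution.  \<open>Each b\<close> is the outer loop with body \<open>b\<close>.
\<close>

datatype atom = Emit bool | Rep bool "bool list" | Again bool "bool list" | Bit "bool list" "bool list"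

datatype instr = Atom atom | Each "atom list" | Next "atom list"

fun atom_out :: "bool list \<Rightarrow> nat \<Rightarrow> atom \<Rightarrow> bool list" where
  "atom_out w i (Emit b) = [b]"
| "atom_out w i (Rep below u) = concat (replicate (if below then i else length w) u)"
| "atom_out w i (Again below u) = []"
| "atom_out w i (Bit u v) = (if w ! i then u else v)"

fun instr_out :: "bool list \<Rightarrow> instr \<Rightarrow> bool list" where
  "instr_out w (Atom a) = atom_out w 0 a"
| "instr_out w (Each b) = concat (map (\<lambda>i. concat (map (atom_out w i) b)) [0..<length w])"
| "instr_out w (Next b) = []"

text \<open>The output of a program on input \<open>w\<close>.\<close>

definition program_out :: "instr list \<Rightarrow> bool list \<Rightarrow> bool list" where
  "program_out P w = concat (map (instr_out w) P)"

text \<open>Source programs: loops over a prefix and bit tests occur only in the body of an outer loop.\<close>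

fun source_atom :: "bool \<Rightarrow> atom \<Rightarrow> bool" where
  "source_atom nested (Emit b) = True"
| "source_atom nested (Rep below u) = (below \<longrightarrow> nested)"
| "source_atom nested (Again below u) = False"
| "source_atom nested (Bit u v) = nested"

fun source_instr :: "instr \<Rightarrow> bool" where
  "source_instr (Atom a) = source_atom False a"
| "source_instr (Each b) = list_all (source_atom True) b"
| "source_instr (Next b) = False"

subsection \<open>Small steps\<close>

text \<open>
  The control state is the list of instructions still to be executed; besides, there are the positions
  of the outer and the inner loop and the output so far.
\<close>

type_synonym mstate = "instr list \<times> nat option \<times> nat option \<times> bool list"

abbreviation emits :: "bool list \<Rightarrow> instr list" where
  "emits u \<equiv> map (\<lambda>b. Atom (Emit b)) u"

fun small_step :: "bool list \<Rightarrow> mstate \<Rightarrow> mstate" where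
  "small_step w ([], i, j, r) = ([], i, j, r)"
| "small_step w (Atom (Emit b) # k, i, j, r) = (k, i, j, r @ [b])"
| "small_step w (Atom (Rep below u) # k, i, j, r) =
     (if 0 < length w \<and> (below \<longrightarrow> i \<noteq> Some 0)
      then (emits u @ Atom (Again below u) # k, i, Some 0, r) else (k, i, None, r))"
| "small_step w (Atom (Again below u) # k, i, j, r) =
     (case j of None \<Rightarrow> (k, i, None, r) | Some p \<Rightarrow>
        if Suc p < length w \<and> (below \<longrightarrow> i \<noteq> Some (Suc p))
        then (emits u @ Atom (Again below u) # k, i, Some (Suc p), r) else (k, i, None, r))"
| "small_step w (Atom (Bit u v) # k, i, j, r) =
     (emits (if \<exists>p < length w. i = Some p \<and> w ! p then u else v) @ k, i, j, r)"
| "small_step w (Each b # k, i, j, r) =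
     (if 0 < length w then (map Atom b @ Next b # k, Some 0, j, r) else (k, None, j, r))"
| "small_step w (Next b # k, i, j, r) =
     (case i of None \<Rightarrow> (k, None, j, r) | Some p \<Rightarrow>
        if Suc p < length w then (map Atom b @ Next b # k, Some (Suc p), j, r) else (k, None, j, r))"

text \<open>At most \<open>n\<close> small steps lead from \<open>s\<close> to \<open>s'\<close>.\<close>

definition steps_to :: "bool list \<Rightarrow> mstate \<Rightarrow> nat \<Rightarrow> mstate \<Rightarrow> bool" where
  "steps_to w s n s' \<longleftrightarrow> (\<exists>m\<le>n. (small_step w ^^ m) s = s')"

lemma steps_to_refl: "steps_to w s n s"
  by (auto simp: steps_to_def intro: exI[of _ 0])

lemma steps_to_trans: "steps_to w s m s' \<Longrightarrow> steps_to w s' n s'' \<Longrightarrow> steps_to w s (m + n) s''"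
  unfolding steps_to_def
proof safe
  fix p q assume "p \<le> m" "q \<le> n"
  then show "\<exists>r\<le>m + n. (small_step w ^^ r) s = (small_step w ^^ q) ((small_step w ^^ p) s)"
    by (intro exI[of _ "q + p"]) (simp add: funpow_add)
qed

lemma steps_to_step: "steps_to w (small_step w s) n s' \<Longrightarrow> steps_to w s (Suc n) s'"
  unfolding steps_to_def
proof safe
  fix q assume "q \<le> n"
  then show "\<exists>r\<le>Suc n. (small_step w ^^ r) s = (small_step w ^^ q) (small_step w s)"
    by (intro exI[of _ "Suc q"]) (simp add: funpow_Suc_right del: funpow.simps)
qed

lemma steps_to_mono: "steps_to w s m s' \<Longrightarrow> m \<le> n \<Longrightarrow> steps_to w s n s'"
  unfolding steps_to_def by (elim exE conjE) (intro exI conjI, erule (1) order_trans)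

lemma steps_emits: "steps_to w (emits u @ k, i, j, r) (length u) (k, i, j, r @ u)"
proof (induction u arbitrary: r)
  case (Cons b u)
  have "steps_to w (small_step w (emits (b # u) @ k, i, j, r)) (length u) (k, i, j, r @ b # u)"
    using Cons[of "r @ [b]"] by simp
  then show ?case using steps_to_step by simp
qed (simp add: steps_to_refl)

lemma steps_again:
  assumes "Suc p \<le> M" "if below then i = Some M \<and> M < length w else M = length w"
  shows "steps_to w (emits u @ Atom (Again below u) # k, i, Some p, r)
     ((M - p) * (length u + 1)) (k, i, None, r @ concat (replicate (M - p) u))"
  using assms(1)
proof (induction "M - Suc p" arbitrary: p r)
  case 0
  have "steps_to w (Atom (Again below u) # k, i, Some p, r @ u) (Suc 0) (k, i, None, r @ u)"
    using 0 assms(2) by (intro steps_to_step) (auto simp: steps_to_refl split: if_splits)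
  from steps_to_trans[OF steps_emits this]
  have "steps_to w (emits u @ Atom (Again below u) # k, i, Some p, r) (length u + 1) (k, i, None, r @ u)"
    by simp
  moreover have "M = Suc p" using 0 by simp
  ultimately show ?case by simp
next
  case (Suc d)
  have IH: "steps_to w (emits u @ Atom (Again below u) # k, i, Some (Suc p), r @ u)
     ((M - Suc p) * (length u + 1)) (k, i, None, (r @ u) @ concat (replicate (M - Suc p) u))"
    using Suc(2) by (intro Suc(1)) auto
  have "small_step w (Atom (Again below u) # k, i, Some p, r @ u) =
      (emits u @ Atom (Again below u) # k, i, Some (Suc p), r @ u)"
    using Suc(2) assms(2) by (auto split: if_splits)
  with IH have "steps_to w (Atom (Again below u) # k, i, Some p, r @ u) (Suc ((M - Suc p) * (length u + 1)))
    (k, i, None, (r @ u) @ concat (replicate (M - Suc p) u))"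
    by (metis steps_to_step)
  from steps_to_trans[OF steps_emits this]
  have "steps_to w (emits u @ Atom (Again below u) # k, i, Some p, r)
    (length u + Suc ((M - Suc p) * (length u + 1))) (k, i, None, r @ concat (replicate (Suc (M - Suc p)) u))"
    by simp
  moreover have "Suc (M - Suc p) = M - p" using Suc by arith
  moreover have "length u + Suc ((M - Suc p) * (length u + 1)) = Suc (M - Suc p) * (length u + 1)" by simp
  ultimately show ?case by metis
qed

text \<open>
  The number of small steps is at most the cost times \<open>length w + 1\<close>, and for instructions times its square.
\<close>

fun atom_cost :: "atom \<Rightarrow> nat" where
  "atom_cost (Emit b) = 1"
| "atom_cost (Rep below u) = length u + 2"
| "atom_cost (Again below u) = 0"
| "atom_cost (Bit u v) = 1 + length u + length v"

lemma steps_atom: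
  assumes "source_atom nested a" "nested \<Longrightarrow> i < length w"
  shows "steps_to w (Atom a # k, (if nested then Some i else None), None, r) (atom_cost a * (length w + 1))
     (k, (if nested then Some i else None), None, r @ atom_out w i a)"
proof (cases a)
  case (Emit b)
  let ?i = "if nested then Some i else None"
  have "steps_to w (Atom a # k, ?i, None, r) (Suc 0) (k, ?i, None, r @ atom_out w i a)"
    using Emit by (intro steps_to_step) (simp add: steps_to_refl)
  then show ?thesis by (rule steps_to_mono) (simp add: Emit)
next
  case (Rep below u)
  define M where "M = (if below then i else length w)"
  have M: "M \<le> length w" using assms Rep by (auto simp: M_def less_imp_le)
  let ?i = "if nested then Some i else None"
  have M': "if below then ?i = Some M \<and> M < length w else M = length w"
    using assms Rep by (auto simp: M_def)
  show ?thesis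
  proof (cases "M = 0")
    case True
    then have "small_step w (Atom a # k, ?i, None, r) = (k, ?i, None, r @ atom_out w i a)"
      using M' by (auto simp: Rep M_def split: if_splits)
    then show ?thesis using steps_to_mono[OF steps_to_step[of w _ 0]] steps_to_refl Rep
      by (metis Suc_eq_plus1 add_gr_0 atom_cost.simps(2) less_eq_Suc_le mult_pos_pos zero_less_Suc add_2_eq_Suc')
  next
    case False
    have s: "small_step w (Atom a # k, ?i, None, r) = (emits u @ Atom (Again below u) # k, ?i, Some 0, r)"
      using M' False by (auto simp: Rep M_def split: if_splits)
    have "steps_to w (emits u @ Atom (Again below u) # k, ?i, Some 0, r)
       ((M - 0) * (length u + 1)) (k, ?i, None, r @ concat (replicate (M - 0) u))"
      using False by (intro steps_again[OF _ M']) simp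
    then have "steps_to w (Atom a # k, ?i, None, r) (Suc (M * (length u + 1))) (k, ?i, None, r @ atom_out w i a)"
      using s by (intro steps_to_step) (simp add: Rep M_def)
    moreover have "Suc (M * (length u + 1)) \<le> atom_cost a * (length w + 1)"
      using mult_right_mono[OF M, of "length u + 1"] by (simp add: Rep algebra_simps)
    ultimately show ?thesis using steps_to_mono by blast
  qed
next
  case (Bit u v)
  let ?x = "if w ! i then u else v"
  have "steps_to w (Atom a # k, Some i, None, r) (Suc (length ?x)) (k, Some i, None, r @ ?x)"
    using steps_emits[of w ?x k "Some i" None r] assms(2)[unfolded Bit] assms(1)
    by (intro steps_to_step) (auto simp: Bit)
  moreover have "Suc (length ?x) \<le> atom_cost a * (length w + 1)" by (simp add: Bit)
  ultimately show ?thesis using assms(1) Bit steps_to_mono by (auto simp del: atom_cost.simps)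
qed (use assms in auto)

lemma steps_atoms:
  assumes "list_all (source_atom True) b" "i < length w"
  shows "steps_to w (map Atom b @ k, Some i, None, r) (sum_list (map atom_cost b) * (length w + 1))
     (k, Some i, None, r @ concat (map (atom_out w i) b))"
  using assms(1)
proof (induction b arbitrary: r)
  case (Cons a b)
  from Cons.prems have "source_atom True a" by simp
  from steps_atom[OF this, of i w "map Atom b @ k" r] assms(2)
  have "steps_to w (map Atom (a # b) @ k, Some i, None, r) (atom_cost a * (length w + 1))
     (map Atom b @ k, Some i, None, r @ atom_out w i a)" by simp
  from steps_to_trans[OF this Cons.IH] Cons.prems show ?case by (simp add: algebra_simps)
qed (simp add: steps_to_refl)

lemma steps_next:
  assumes "list_all (source_atom True) b" "i < length w"
  shows "steps_to w (map Atom b @ Next b # k, Some i, None, r)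
    ((length w - i) * (sum_list (map atom_cost b) * (length w + 1) + 1))
    (k, None, None, r @ concat (map (\<lambda>i. concat (map (atom_out w i) b)) [i..<length w]))"
  using assms(2)
proof (induction "length w - Suc i" arbitrary: i r)
  let ?c = "sum_list (map atom_cost b) * (length w + 1)"
  case 0
  let ?r = "r @ concat (map (atom_out w i) b)"
  have "steps_to w (Next b # k, Some i, None, ?r) (Suc 0) (k, None, None, ?r)"
    using 0 by (intro steps_to_step) (auto simp: steps_to_refl)
  then have "steps_to w (map Atom b @ Next b # k, Some i, None, r) (?c + 1) (k, None, None, ?r)"
    using steps_to_trans steps_atoms[OF assms(1) 0(2)] by fastforce
  moreover have "length w - i = 1" "[i..<length w] = [i]" using 0 by (auto simp: upt_conv_Cons)
  ultimately show ?case by (simp del: mult_Suc_right)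
next
  let ?c = "sum_list (map atom_cost b) * (length w + 1)"
  case (Suc d)
  let ?r = "r @ concat (map (atom_out w i) b)"
  let ?o = "\<lambda>i. concat (map (\<lambda>i. concat (map (atom_out w i) b)) [i..<length w])"
  have lt: "Suc i < length w" using Suc by arith
  have "steps_to w (map Atom b @ Next b # k, Some (Suc i), None, ?r) ((length w - Suc i) * (?c + 1))
     (k, None, None, ?r @ ?o (Suc i))"
    using Suc(2) lt by (intro Suc(1)) auto
  then have "steps_to w (Next b # k, Some i, None, ?r) (Suc ((length w - Suc i) * (?c + 1)))
      (k, None, None, ?r @ ?o (Suc i))"
    using lt by (intro steps_to_step) simp
  then have "steps_to w (map Atom b @ Next b # k, Some i, None, r) (?c + Suc ((length w - Suc i) * (?c + 1)))
     (k, None, None, ?r @ ?o (Suc i))"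
    by (rule steps_to_trans[OF steps_atoms[OF assms(1) Suc(3)]])
  moreover have "?c + Suc ((length w - Suc i) * (?c + 1)) = (length w - i) * (?c + 1)"
  proof -
    have "length w - i = Suc (length w - Suc i)" using lt by arith
    then show ?thesis by simp
  qed
  moreover have "?r @ ?o (Suc i) = r @ ?o i" using lt by (simp add: upt_conv_Cons)
  ultimately show ?case by (simp only:)
qed

fun instr_cost :: "instr \<Rightarrow> nat" where
  "instr_cost (Atom a) = atom_cost a"
| "instr_cost (Each b) = sum_list (map atom_cost b) + 2"
| "instr_cost (Next b) = 0"

lemma steps_instr:
  assumes "source_instr x"
  shows "steps_to w (x # k, None, None, r) (instr_cost x * (length w + 1)\<^sup>2) (k, None, None, r @ instr_out w x)"
proof (cases x)
  case (Atom a)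
  have "steps_to w (x # k, None, None, r) (atom_cost a * (length w + 1)) (k, None, None, r @ instr_out w x)"
    using steps_atom[of False a 0 w k r] assms Atom by simp
  moreover have "atom_cost a * (length w + 1) \<le> instr_cost x * (length w + 1)\<^sup>2"
    by (simp add: Atom power2_eq_square)
  ultimately show ?thesis using steps_to_mono by blast
next
  case (Each b)
  let ?S = "sum_list (map atom_cost b)"
  show ?thesis
  proof (cases "length w = 0")
    case True
    then have "small_step w (x # k, None, None, r) = (k, None, None, r @ instr_out w x)" by (simp add: Each)
    then have "steps_to w (x # k, None, None, r) (Suc 0) (k, None, None, r @ instr_out w x)"
      by (intro steps_to_step) (simp add: steps_to_refl)
    moreover have "0 < instr_cost x * (length w + 1)\<^sup>2" by (simp add: Each)
    then have "Suc 0 \<le> instr_cost x * (length w + 1)\<^sup>2" by (rule Suc_leI)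
    ultimately show ?thesis by (rule steps_to_mono)
  next
    case False
    have "steps_to w (map Atom b @ Next b # k, Some 0, None, r) ((length w - 0) * (?S * (length w + 1) + 1))
      (k, None, None, r @ instr_out w x)"
      using steps_next[of b 0 w k r] assms False Each by simp
    then have "steps_to w (x # k, None, None, r) (Suc (length w * (?S * (length w + 1) + 1)))
      (k, None, None, r @ instr_out w x)"
      using False by (intro steps_to_step) (simp add: Each)
    then show ?thesis by (rule steps_to_mono) (simp add: Each power2_eq_square algebra_simps)
  qed
qed (use assms in auto)

lemma steps_program:
  assumes "list_all source_instr P"
  shows "steps_to w (P, None, None, r) (sum_list (map instr_cost P) * (length w + 1)\<^sup>2)
    ([], None, None, r @ program_out P w)"
  using assms
proof (induction P arbitrary: r)
  case (Cons x P)
  then have "source_instr x" by simp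
  from steps_to_trans[OF steps_instr[OF this, of w P r] Cons.IH] Cons.prems
  show ?case by (simp add: program_out_def algebra_simps)
qed (simp add: steps_to_refl program_out_def)

subsection \<open>Execution on a tape\<close>

text \<open>
  A cell of the tape holds an input bit, marks for the two loop positions, and an output bit.
  Every small step is one sweep over the tape from left to right, during which \<open>mealy\<close> updates the
  cells and a flag; \<open>finish\<close> turns the final flag into the next control state and possibly a new cell
  at the right end.
\<close>

type_synonym cell = "bool option \<times> bool \<times> bool \<times> bool option"

definition blank :: cell where "blank = (None, False, False, None)"

fun mealy :: "instr list \<Rightarrow> nat \<Rightarrow> cell \<Rightarrow> nat \<times> cell" where
  "mealy [] f (x, mi, mj, y) = (f, (y, False, False, None))"
| "mealy (Atom (Emit b) # k) f (x, mi, mj, y) =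
     (if f = 0 \<and> y = None then (1, (x, mi, mj, Some b)) else (f, (x, mi, mj, y)))"
| "mealy (Atom (Rep below u) # k) f (x, mi, mj, y) =
     (if f = 0 then if x = None \<or> (below \<and> mi) then (2, (x, mi, False, y)) else (1, (x, mi, True, y))
      else (f, (x, mi, False, y)))"
| "mealy (Atom (Again below u) # k) f (x, mi, mj, y) =
     (if f = 0 then if mj then (1, (x, mi, False, y)) else (0, (x, mi, False, y))
      else if f = 1 then if x = None \<or> (below \<and> mi) then (3, (x, mi, False, y)) else (2, (x, mi, True, y))
      else (f, (x, mi, False, y)))"
| "mealy (Atom (Bit u v) # k) f (x, mi, mj, y) =
     (if mi then if x = Some True then 1 else f else f, (x, mi, mj, y))"
| "mealy (Each b # k) f (x, mi, mj, y) =
     (if f = 0 then if x = None then (2, (x, False, mj, y)) else (1, (x, True, mj, y))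
      else (f, (x, False, mj, y)))"
| "mealy (Next b # k) f (x, mi, mj, y) =
     (if f = 0 then if mi then (1, (x, False, mj, y)) else (0, (x, False, mj, y))
      else if f = 1 then if x = None then (3, (x, False, mj, y)) else (2, (x, True, mj, y))
      else (f, (x, False, mj, y)))"

fun finish :: "instr list \<Rightarrow> nat \<Rightarrow> instr list \<times> cell" where
  "finish [] f = ([], blank)"
| "finish (Atom (Emit b) # k) f = (k, if f = 0 then (None, False, False, Some b) else blank)"
| "finish (Atom (Rep below u) # k) f = (if f = 1 then emits u @ Atom (Again below u) # k else k, blank)"
| "finish (Atom (Again below u) # k) f = (if f = 2 then emits u @ Atom (Again below u) # k else k, blank)"
| "finish (Atom (Bit u v) # k) f = (emits (if f = 1 then u else v) @ k, blank)"
| "finish (Each b # k) f = (if f = 1 then map Atom b @ Next b # k else k, blank)"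
| "finish (Next b # k) f = (if f = 2 then map Atom b @ Next b # k else k, blank)"

text \<open>
  The states of the simulating machine: moving right while simulating the given control state with the
  given flag, and moving back to the left end.  In the final sweep, for the empty program, the output
  track is turned into the tape content.
\<close>

datatype sweep = Halted | Rightward "instr list" nat | Leftward "instr list"

fun sweep_delta :: "sweep \<Rightarrow> cell \<Rightarrow> sweep \<times> cell \<times> int" where
  "sweep_delta Halted c = (Halted, c, 0)"
| "sweep_delta (Rightward k f) c =
     (if c = blank then if k = [] then (Halted, blank, 0)
        else case finish k f of (k', c') \<Rightarrow> (Leftward k', c', -1)
      else case mealy k f c of (f', c') \<Rightarrow> (Rightward k f', c', 1))"
| "sweep_delta (Leftward k) c = (if c = blank then (Rightward k 0, blank, 1) else (Leftward k, c, -1))"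

fun sweep_step :: "sweep \<times> (int \<Rightarrow> cell) \<times> int \<Rightarrow> sweep \<times> (int \<Rightarrow> cell) \<times> int" where
  "sweep_step (q, t, i) =
     (if q = Halted then (q, t, i) else case sweep_delta q (t i) of (q', a, d) \<Rightarrow> (q', t(i := a), i + d))"

definition tape :: "cell list \<Rightarrow> int \<Rightarrow> cell" where
  "tape cs i = (if 0 \<le> i \<and> i < int (length cs) then cs ! nat i else blank)"

lemma sweep_right:
  assumes "\<And>p. p < length cs \<Longrightarrow> cs ! p \<noteq> blank" "length cs' = length cs" "fl 0 = 0"
    and "\<And>p. p < length cs \<Longrightarrow> mealy k (fl p) (cs ! p) = (fl (Suc p), cs' ! p)"
    and "p \<le> length cs"
  shows "(sweep_step ^^ p) (Rightward k 0, tape cs, 0) = (Rightward k (fl p), tape (take p cs' @ drop p cs), int p)"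
  using assms(5)
proof (induction p)
  case (Suc p)
  have t: "tape (take p cs' @ drop p cs) (int p) = cs ! p"
    using Suc.prems assms(2) by (simp add: tape_def nth_append)
  have "(tape (take p cs' @ drop p cs))(int p := cs' ! p) = tape (take (Suc p) cs' @ drop (Suc p) cs)"
  proof
    fix i
    show "((tape (take p cs' @ drop p cs))(int p := cs' ! p)) i = tape (take (Suc p) cs' @ drop (Suc p) cs) i"
      using Suc.prems assms(2)
      by (cases "i = int p")
        (auto simp: tape_def nth_append nat_less_iff less_Suc_eq split: if_splits)
  qed
  then show ?case using Suc assms(1)[of p] assms(4)[of p] t by simp
qed (simp add: assms(3))

lemma sweep_left:
  assumes "\<And>p. p < n \<Longrightarrow> t (int p) \<noteq> blank" "t (-1) = blank"
  shows "(sweep_step ^^ (Suc n)) (Leftward k, t, int n - 1) = (Rightward k 0, t, 0)"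
  using assms(1)
proof (induction n)
  case 0
  then show ?case using assms(2) by (simp add: fun_upd_idem)
next
  case (Suc n)
  have "sweep_step (Leftward k, t, int (Suc n) - 1) = (Leftward k, t, int n - 1)"
    using Suc.prems[of n] by simp
  then show ?case using Suc by (simp add: funpow_Suc_right del: funpow.simps)
qed

text \<open>The tape that represents a state of the small-step machine.\<close>

fun config_cell :: "bool list \<Rightarrow> mstate \<Rightarrow> nat \<Rightarrow> cell" where
  "config_cell w (k, i, j, r) p =
     (if p < length w then Some (w ! p) else None, i = Some p, j = Some p,
      if p < length r then Some (r ! p) else None)"

fun config_size :: "bool list \<Rightarrow> mstate \<Rightarrow> nat" where
  "config_size w (k, i, j, r) = max (length w) (length r)"

definition config_tape :: "bool list \<Rightarrow> mstate \<Rightarrow> int \<Rightarrow> cell" where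
  "config_tape w s = tape (map (config_cell w s) [0..<config_size w s])"

lemma config_cell_nonblank: "p < config_size w s \<Longrightarrow> config_cell w s p \<noteq> blank"
  by (cases s) (auto simp: blank_def)

text \<open>The flag before cell \<open>p\<close> is visited, when one small step is simulated.\<close>

fun sweep_flag :: "bool list \<Rightarrow> mstate \<Rightarrow> nat \<Rightarrow> nat" where
  "sweep_flag w ([], i, j, r) p = 0"
| "sweep_flag w (Atom (Emit b) # k, i, j, r) p = (if p \<le> length r then 0 else 1)"
| "sweep_flag w (Atom (Rep below u) # k, i, j, r) p =
     (if p = 0 then 0 else if 0 < length w \<and> (below \<longrightarrow> i \<noteq> Some 0) then 1 else 2)"
| "sweep_flag w (Atom (Again below u) # k, i, j, r) p =
     (case j of None \<Rightarrow> 0 | Some q \<Rightarrow> if p \<le> q then 0 else if p = Suc q then 1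
        else if Suc q < length w \<and> (below \<longrightarrow> i \<noteq> Some (Suc q)) then 2 else 3)"
| "sweep_flag w (Atom (Bit u v) # k, i, j, r) p =
     (if \<exists>q < length w. i = Some q \<and> q < p \<and> w ! q then 1 else 0)"
| "sweep_flag w (Each b # k, i, j, r) p = (if p = 0 then 0 else if 0 < length w then 1 else 2)"
| "sweep_flag w (Next b # k, i, j, r) p =
     (case i of None \<Rightarrow> 0 | Some q \<Rightarrow> if p \<le> q then 0 else if p = Suc q then 1
        else if Suc q < length w then 2 else 3)"

lemma sweep_flag_step:
  assumes "fst s \<noteq> []" "p < config_size w s"
  shows "mealy (fst s) (sweep_flag w s p) (config_cell w s p) =
       (sweep_flag w s (Suc p), config_cell w (small_step w s) p)"
proof -
  obtain k0 i j r where "s = (k0, i, j, r)" by (rule prod_cases4)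
  moreover from this obtain x k where "k0 = x # k" using assms(1) by (cases k0) auto
  ultimately have s: "s = (x # k, i, j, r)" by simp
  show ?thesis
  proof (cases x)
    case (Atom a)
    show ?thesis
    proof (cases a)
      case (Emit b)
      then show ?thesis by (auto simp: s Atom nth_append less_Suc_eq)
    next
      case (Rep below u)
      then show ?thesis by (cases "p = 0") (auto simp: s Atom)
    next
      case (Again below u)
      then show ?thesis
        by (cases j; cases "p = Suc (the j)"; cases "p = the j"; cases "p < the j") (auto simp: s Atom)
    next
      case (Bit u v)
      then show ?thesis by (cases "i = Some p") (auto simp: s Atom less_Suc_eq)
    qed
  next
    case (Each b)
    then show ?thesis by (cases "p = 0") (auto simp: s)
  next
    case (Next b)
    then show ?thesis
      by (cases i; cases "p = Suc (the i)"; cases "p = the i"; cases "p < the i") (auto simp: s)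
  qed
qed

lemma small_step_size:
  "config_size w (small_step w s) = config_size w s \<or>
   config_size w (small_step w s) = Suc (config_size w s)"
  by (cases "(w, s)" rule: small_step.cases) (auto split: option.splits)

text \<open>Loop marks beyond the input would be lost on the tape.\<close>

definition marks_inside :: "bool list \<Rightarrow> mstate \<Rightarrow> bool" where
  "marks_inside w s \<longleftrightarrow> (case s of (k, i, j, r) \<Rightarrow> set_option i \<union> set_option j \<subseteq> {..<length w})"

lemma marks_inside_step: "marks_inside w s \<Longrightarrow> marks_inside w (small_step w s)"
  by (cases "(w, s)" rule: small_step.cases) (auto simp: marks_inside_def split: option.splits)

lemma sweep_flag_finish:
  assumes "fst s \<noteq> []" "marks_inside w s"
  shows "finish (fst s) (sweep_flag w s (config_size w s)) =
    (fst (small_step w s), if config_size w s < config_size w (small_step w s)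
      then config_cell w (small_step w s) (config_size w s) else blank)"
proof (cases "\<exists>b k. fst s = Atom (Emit b) # k")
  case True
  then obtain b k where "fst s = Atom (Emit b) # k" by blast
  moreover obtain k' i j r where "s = (k', i, j, r)" by (rule prod_cases4)
  ultimately have s: "s = (Atom (Emit b) # k, i, j, r)" by simp
  show ?thesis
  proof (cases "length r < length w")
    case False
    then have "i \<noteq> Some (length r)" "j \<noteq> Some (length r)" "max (length w) (length r) = length r"
      "max (length w) (Suc (length r)) = Suc (length r)"
      using assms(2) by (auto simp: s marks_inside_def)
    then show ?thesis using False by (simp add: s)
  next
    case True
    then have "max (length w) (length r) = length w" "max (length w) (Suc (length r)) = length w" by auto
    then show ?thesis using True by (simp add: s)
  qed
next
  case False
  have "config_size w (small_step w s) = config_size w s"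
    using False by (cases "(w, s)" rule: small_step.cases) (auto split: option.split)
  moreover have "finish (fst s) (sweep_flag w s M) = (fst (small_step w s), blank)" if M: "length w \<le> M" for M
  proof -
    obtain x k i j r where s: "s = (x # k, i, j, r)"
      using assms(1) by (cases s) (auto simp: neq_Nil_conv)
    have M0: "w \<noteq> [] \<longrightarrow> 0 < M" using M by (cases w) auto
    show ?thesis
    proof (cases x)
      case (Atom a)
      then show ?thesis
        using assms(2) False M M0 by (cases a; cases i; cases j) (auto simp: s marks_inside_def)
    next
      case (Each b)
      then show ?thesis using M0 by (auto simp: s)
    next
      case (Next b)
      then show ?thesis using assms(2) M by (cases i) (auto simp: s marks_inside_def)
    qed
  qed
  from this[of "config_size w s"] have "finish (fst s) (sweep_flag w s (config_size w s)) =
      (fst (small_step w s), blank)" by (cases s) simp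
  ultimately show ?thesis by simp
qed

lemma sweep_simulates_small_step:
  assumes "fst s \<noteq> []" "marks_inside w s"
  shows "(sweep_step ^^ (2 * config_size w s + 2)) (Rightward (fst s) 0, config_tape w s, 0) =
     (Rightward (fst (small_step w s)) 0, config_tape w (small_step w s), 0)"
proof -
  let ?s = "small_step w s"
  define M where "M = config_size w s"
  define cs where "cs = map (config_cell w s) [0..<M]"
  define cs' where "cs' = map (config_cell w ?s) [0..<M]"
  have len: "length cs = M" "length cs' = M" by (auto simp: cs_def cs'_def)
  have "(sweep_step ^^ M) (Rightward (fst s) 0, tape cs, 0) =
      (Rightward (fst s) (sweep_flag w s M), tape (take M cs' @ drop M cs), int M)"
  proof (rule sweep_right)
    show "sweep_flag w s 0 = 0"
      using assms(1) by (cases "(w, s)" rule: small_step.cases) (auto split: option.splits)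
  qed (use assms in \<open>auto simp: cs_def cs'_def M_def config_cell_nonblank sweep_flag_step\<close>)
  then have 1: "(sweep_step ^^ M) (Rightward (fst s) 0, config_tape w s, 0) =
      (Rightward (fst s) (sweep_flag w s M), tape cs', int M)"
    by (simp add: len config_tape_def M_def[symmetric] cs_def[symmetric])
  have blank: "tape cs' (int M) = blank" by (simp add: tape_def len)
  have M': "config_size w ?s = M \<or> config_size w ?s = Suc M"
    using small_step_size[of w s] by (simp add: M_def)
  have upd: "(tape cs')(int M := if M < config_size w ?s then config_cell w ?s M else blank) = config_tape w ?s"
  proof
    fix i :: int
    consider "i < 0" | "0 \<le> i" "i < int M" | "i = int M" | "int M < i" by arith
    then show "((tape cs')(int M := if M < config_size w ?s then config_cell w ?s M else blank)) i =
        config_tape w ?s i"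
      using M' unfolding config_tape_def
      by cases (auto simp: tape_def cs'_def)
  qed
  have 2: "sweep_step (Rightward (fst s) (sweep_flag w s M), tape cs', int M) =
      (Leftward (fst ?s), config_tape w ?s, int M - 1)"
    using assms(1) blank sweep_flag_finish[OF assms] unfolding upd[symmetric]
    by (simp add: M_def[symmetric] del: fun_upd_apply)
  have 3: "(sweep_step ^^ (Suc M)) (Leftward (fst ?s), config_tape w ?s, int M - 1) =
      (Rightward (fst ?s) 0, config_tape w ?s, 0)"
  proof (rule sweep_left)
    fix p assume "p < M"
    then have "p < config_size w ?s" using M' by auto
    then show "config_tape w ?s (int p) \<noteq> blank"
      using config_cell_nonblank by (simp add: config_tape_def tape_def)
  qed (simp add: config_tape_def tape_def)
  have "(sweep_step ^^ Suc (Suc M + M)) x = (sweep_step ^^ Suc M) (sweep_step ((sweep_step ^^ M) x))" for x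
    by (simp only: funpow_Suc_right[symmetric] comp_apply[symmetric, of "_ ^^ Suc M"] flip: add_Suc_right)
      (simp add: funpow_add funpow_swap1)
  moreover have "2 * M + 2 = Suc (Suc M + M)" by simp
  ultimately show ?thesis unfolding M_def[symmetric] by (simp only: 1 2 3)
qed

lemma sweep_simulates_small_steps:
  assumes "config_size w s + m \<le> L" "marks_inside w s"
  shows "\<exists>n \<le> m * (2 * L + 2). (sweep_step ^^ n) (Rightward (fst s) 0, config_tape w s, 0) =
    (Rightward (fst ((small_step w ^^ m) s)) 0, config_tape w ((small_step w ^^ m) s), 0)"
  using assms
proof (induction m arbitrary: s)
  case (Suc m)
  let ?s = "small_step w s"
  have "config_size w ?s + m \<le> L" using Suc.prems small_step_size[of w s] by auto
  from Suc.IH[OF this marks_inside_step[OF Suc.prems(2)]] obtain n where n: "n \<le> m * (2 * L + 2)"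
    "(sweep_step ^^ n) (Rightward (fst ?s) 0, config_tape w ?s, 0) =
      (Rightward (fst ((small_step w ^^ m) ?s)) 0, config_tape w ((small_step w ^^ m) ?s), 0)" by blast
  show ?case
  proof (cases "fst s = []")
    case True
    then have "?s = s" by (cases s) auto
    then show ?thesis using n by (intro exI[of _ n]) (simp add: funpow_Suc_right del: funpow.simps)
  next
    case False
    have "(sweep_step ^^ (n + (2 * config_size w s + 2))) (Rightward (fst s) 0, config_tape w s, 0) =
      (Rightward (fst ((small_step w ^^ m) ?s)) 0, config_tape w ((small_step w ^^ m) ?s), 0)"
      unfolding funpow_add[of n] comp_apply sweep_simulates_small_step[OF False Suc.prems(2)] by (rule n(2))
    moreover have "n + (2 * config_size w s + 2) \<le> Suc m * (2 * L + 2)" using n(1) Suc.prems by simp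
    ultimately show ?thesis
      by (intro exI[of _ "n + (2 * config_size w s + 2)"]) (simp add: funpow_Suc_right del: funpow.simps)
  qed
qed (auto intro: exI[of _ 0])

definition bit_cell :: "bool option \<Rightarrow> cell" where
  "bit_cell x = (x, False, False, None)"

definition bit_tape :: "bool list \<Rightarrow> int \<Rightarrow> cell" where
  "bit_tape w i = bit_cell (if 0 \<le> i \<and> i < int (length w) then Some (w ! nat i) else None)"

lemma sweep_initial: "config_tape w (P, None, None, []) = bit_tape w"
proof
  fix i
  show "config_tape w (P, None, None, []) i = bit_tape w i"
    by (cases "0 \<le> i \<and> i < int (length w)")
      (simp_all add: config_tape_def tape_def bit_tape_def bit_cell_def blank_def nat_less_iff)
qed

lemma sweep_final:
  "(sweep_step ^^ (config_size w ([], i, j, r) + 1)) (Rightward [] 0, config_tape w ([], i, j, r), 0) =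
     (Halted, bit_tape r, int (config_size w ([], i, j, r)))"
proof -
  let ?s = "([], i, j, r)"
  define M where "M = config_size w ?s"
  define cs where "cs = map (config_cell w ?s) [0..<M]"
  define cs' where "cs' = map (\<lambda>p. bit_cell (if p < length r then Some (r ! p) else None)) [0..<M]"
  have len: "length cs = M" "length cs' = M" by (auto simp: cs_def cs'_def)
  have "(sweep_step ^^ M) (Rightward [] 0, tape cs, 0) =
      (Rightward [] ((\<lambda>p. 0) M), tape (take M cs' @ drop M cs), int M)"
    by (rule sweep_right) (auto simp: cs_def cs'_def M_def bit_cell_def blank_def)
  moreover have "config_tape w ?s = tape cs" by (simp only: config_tape_def M_def cs_def)
  ultimately have "(sweep_step ^^ M) (Rightward [] 0, config_tape w ?s, 0) =
      (Rightward [] 0, tape cs', int M)"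
    by (simp add: len)
  moreover have "tape cs' = bit_tape r"
    by (auto simp: fun_eq_iff tape_def len bit_tape_def cs'_def M_def bit_cell_def blank_def nat_less_iff)
  moreover have "tape cs' (int M) = blank" by (simp add: tape_def len)
  ultimately show ?thesis unfolding M_def[symmetric] by (simp add: fun_upd_idem)
qed

lemma sweep_computes_program:
  assumes "list_all source_instr P"
  shows "\<exists>p :: nat poly. \<forall>w. \<exists>n \<le> poly p (length w). \<exists>i.
    (sweep_step ^^ n) (Rightward P 0, bit_tape w, 0) = (Halted, bit_tape (program_out P w), i)"
proof -
  define c where "c = sum_list (map instr_cost P)"
  define q :: "nat poly" where "q = [:c:] * ([:1, 1:] ^ 2)"
  define l :: "nat poly" where "l = [:0, 1:] + q"
  define p :: "nat poly" where "p = q * ([:2:] * l + [:2:]) + l + [:1:]"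
  have "\<exists>n \<le> poly p (length w). \<exists>i.
    (sweep_step ^^ n) (Rightward P 0, bit_tape w, 0) = (Halted, bit_tape (program_out P w), i)" for w
  proof -
    let ?s = "(P, None, None, [])"
    define Q where "Q = c * (length w + 1)\<^sup>2"
    have Q: "poly q (length w) = Q" by (simp add: q_def Q_def)
    obtain m where m: "m \<le> Q" "(small_step w ^^ m) ?s = ([], None, None, program_out P w)"
      using steps_program[OF assms, of w "[]"] by (auto simp: steps_to_def Q_def c_def)
    let ?t = "([], None, None, program_out P w) :: mstate"
    have marks: "marks_inside w ?s" by (simp add: marks_inside_def)
    have "config_size w ?s + m \<le> length w + Q" using m(1) by simp
    from sweep_simulates_small_steps[OF this] marks obtain n where n: "n \<le> m * (2 * (length w + Q) + 2)"
      "(sweep_step ^^ n) (Rightward P 0, bit_tape w, 0) = (Rightward [] 0, config_tape w ?t, 0)"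
      by (auto simp: m(2) sweep_initial)
    have size: "config_size w ((small_step w ^^ m') s) \<le> config_size w s + m'" for m' s
    proof (induction m')
      case (Suc m') then show ?case using small_step_size[of w "(small_step w ^^ m') s"] by auto
    qed simp
    have sz: "config_size w ?t \<le> length w + Q" using size[of m ?s] m by simp
    let ?n = "config_size w ?t + 1 + n"
    have "(sweep_step ^^ ?n) (Rightward P 0, bit_tape w, 0) =
        (Halted, bit_tape (program_out P w), int (config_size w ?t))"
      unfolding funpow_add[of "config_size w ?t + 1" n] comp_apply n(2) by (rule sweep_final)
    moreover have "?n \<le> poly p (length w)"
    proof -
      have "n \<le> Q * (2 * (length w + Q) + 2)" by (rule le_trans[OF n(1) mult_le_mono1[OF m(1)]])
      then show ?thesis using sz by (simp add: p_def l_def Q)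
    qed
    ultimately show ?thesis by blast
  qed
  then show ?thesis by blast
qed

subsection \<open>The finitely many control states\<close>

text \<open>
  The control states that can occur during the execution of a program: rests of emitted strings, of loop
  bodies and of the program itself.
\<close>

definition emit_conts :: "bool list \<Rightarrow> instr list \<Rightarrow> instr list set" where
  "emit_conts u k = (\<lambda>n. emits (drop n u) @ k) ` {..length u}"

fun atom_conts :: "atom \<Rightarrow> instr list \<Rightarrow> instr list set" where
  "atom_conts (Emit b) k = {}"
| "atom_conts (Rep below u) k = emit_conts u (Atom (Again below u) # k)"
| "atom_conts (Again below u) k = emit_conts u (Atom (Again below u) # k)"
| "atom_conts (Bit u v) k = emit_conts u k \<union> emit_conts v k"

fun atoms_conts :: "atom list \<Rightarrow> instr list \<Rightarrow> instr list set" where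
  "atoms_conts [] k = {k}"
| "atoms_conts (a # b) k = insert (map Atom (a # b) @ k) (atom_conts a (map Atom b @ k) \<union> atoms_conts b k)"

fun conts :: "instr list \<Rightarrow> instr list set" where
  "conts [] = {[]}"
| "conts (Atom a # k) = insert (Atom a # k) (atom_conts a k \<union> conts k)"
| "conts (Each b # k) = insert (Each b # k) (atoms_conts b (Next b # k) \<union> conts k)"
| "conts (Next b # k) = insert (Next b # k) (atoms_conts b (Next b # k) \<union> conts k)"

lemma emit_conts_finish:
  "e \<in> emit_conts u k \<Longrightarrow> fst (finish e f) \<in> emit_conts u k \<or> e = k"
proof -
  assume "e \<in> emit_conts u k"
  then obtain n where n: "n \<le> length u" "e = emits (drop n u) @ k" by (auto simp: emit_conts_def)
  show ?thesis
  proof (cases "n = length u")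
    case False
    then have "drop n u = u ! n # drop (Suc n) u" using n(1) by (simp add: Cons_nth_drop_Suc)
    then have "fst (finish e f) = emits (drop (Suc n) u) @ k" using n by simp
    then show ?thesis using False n(1) by (auto simp: emit_conts_def intro!: image_eqI[of _ _ "Suc n"])
  qed (use n in simp)
qed

lemma emit_conts_start: "emits u @ k \<in> emit_conts u k"
  unfolding emit_conts_def by (intro image_eqI[of _ _ 0]) auto

lemma atom_conts_finish_head: "fst (finish (Atom a # k) f) \<in> insert k (atom_conts a k)"
  by (cases a) (auto simp: emit_conts_start)

lemma atom_conts_finish:
  "e \<in> atom_conts a k \<Longrightarrow> fst (finish e f) \<in> insert k (atom_conts a k) \<or> e = k"
  by (cases a) (auto dest!: emit_conts_finish[of _ _ _ f] simp: emit_conts_start)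

lemma atoms_conts_self: "map Atom b @ k \<in> atoms_conts b k"
  by (cases b) auto

lemma atoms_conts_finish:
  "e \<in> atoms_conts b k \<Longrightarrow> fst (finish e f) \<in> atoms_conts b k \<or> e = k"
proof (induction b)
  case (Cons a b)
  from Cons.prems consider "e = Atom a # map Atom b @ k" | "e \<in> atom_conts a (map Atom b @ k)"
    | "e \<in> atoms_conts b k" by auto
  then show ?case
  proof cases
    case 1
    then show ?thesis using atom_conts_finish_head[of a "map Atom b @ k" f] atoms_conts_self[of b k] by auto
  next
    case 2
    from atom_conts_finish[OF this, of f] Cons.IH atoms_conts_self[of b k] show ?thesis by auto
  qed (use Cons.IH in auto)
qed simp

lemma conts_self: "k \<in> conts k"
  by (cases k rule: conts.cases) auto

lemma loop_conts_finish:
  assumes "e \<in> atoms_conts b (Next b # k)"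
  shows "fst (finish e f) \<in> atoms_conts b (Next b # k) \<or> fst (finish e f) = k"
  using atoms_conts_finish[OF assms, of f] atoms_conts_self[of b "Next b # k"] by auto

lemma conts_finish: "e \<in> conts P \<Longrightarrow> fst (finish e f) \<in> conts P"
proof (induction P rule: conts.induct)
  case (2 a k)
  from 2(2) have "e = Atom a # k \<or> e \<in> atom_conts a k \<or> e \<in> conts k" by simp
  then consider "e = Atom a # k" | "e \<in> atom_conts a k" | "e \<in> conts k" by (elim disjE)
  then show ?case
  proof cases
    case 1
    show ?thesis unfolding 1
      using atom_conts_finish_head[of a k f] conts_self[of k] by (elim insertE) simp_all
  next
    case e: 2
    from atom_conts_finish[OF this, of f] 2(1) conts_self[of k] show ?thesis
      unfolding conts.simps by blast
  qed (use 2(1) in auto)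
next
  case (3 b k)
  from 3(2) have "e = Each b # k \<or> e \<in> atoms_conts b (Next b # k) \<or> e \<in> conts k" by simp
  then consider "e = Each b # k" | "e \<in> atoms_conts b (Next b # k)" | "e \<in> conts k" by (elim disjE)
  then show ?case
  proof cases
    case 1
    then show ?thesis using conts_self[of k] atoms_conts_self[of b "Next b # k"] by simp
  next
    case e: 2
    from loop_conts_finish[OF e, of f] show ?thesis
      by (rule disjE) (use conts_self[of k] in simp_all)
  next
    case e: 3
    then show ?thesis using 3(1) by simp
  qed
next
  case (4 b k)
  from 4(2) have "e = Next b # k \<or> e \<in> atoms_conts b (Next b # k) \<or> e \<in> conts k" by simp
  then consider "e = Next b # k" | "e \<in> atoms_conts b (Next b # k)" | "e \<in> conts k" by (elim disjE)
  then show ?case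
  proof cases
    case 1
    then show ?thesis using conts_self[of k] atoms_conts_self[of b "Next b # k"] by simp
  next
    case e: 2
    from loop_conts_finish[OF e, of f] show ?thesis
      by (rule disjE) (use conts_self[of k] in simp_all)
  next
    case e: 3
    then show ?thesis using 4(1) by simp
  qed
qed simp

lemma finite_conts: "finite (conts P)"
proof -
  have "finite (atom_conts a k)" for a k by (cases a) (auto simp: emit_conts_def)
  moreover from this have "finite (atoms_conts b k)" for b k by (induction b) auto
  ultimately show ?thesis by (induction P rule: conts.induct) auto
qed

lemma mealy_flag: "f \<le> 3 \<Longrightarrow> fst (mealy k f c) \<le> 3"
  by (cases "(k, f, c)" rule: mealy.cases) auto

definition sweep_states :: "instr list \<Rightarrow> sweep set" where
  "sweep_states P = insert Halted ((\<lambda>(k, f). Rightward k f) ` (conts P \<times> {..3}) \<union> Leftward ` conts P)"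

lemma sweep_states_closed: "q \<in> sweep_states P \<Longrightarrow> fst (sweep_delta q c) \<in> sweep_states P"
proof -
  assume "q \<in> sweep_states P"
  then consider "q = Halted" | k f where "q = Rightward k f" "k \<in> conts P" "f \<le> 3"
    | k where "q = Leftward k" "k \<in> conts P" by (auto simp: sweep_states_def)
  then show ?thesis
  proof cases
    case 2
    then show ?thesis using mealy_flag[of f k c] conts_finish[of k P f]
      by (auto simp: sweep_states_def split: prod.split)
  qed (auto simp: sweep_states_def)
qed

subsection \<open>Numbering of states and symbols\<close>

text \<open>
  The Turing machine model fixes the numbers of the initial and the halting state and of the blank and the
  bit symbols, so the numbering has to respect a given initial segment.
\<close>

lemma finite_numbering:
  assumes "finite A" "distinct xs"
  obtains h :: "'a \<Rightarrow> nat" where "inj_on h A" "\<And>i. i < length xs \<Longrightarrow> h (xs ! i) = i"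
proof -
  have "finite (A - set xs)" using assms by simp
  then obtain g :: "'a \<Rightarrow> nat" where g: "inj_on g (A - set xs)"
    using finite_imp_inj_to_nat_seg by blast
  define idx where "idx = inv_into {..<length xs} ((!) xs)"
  have inj: "inj_on ((!) xs) {..<length xs}" using assms(2) by (simp add: inj_on_nth)
  have idx: "idx (xs ! i) = i" if "i < length xs" for i
    unfolding idx_def using that by (intro inv_into_f_f inj) simp
  have idx': "idx x < length xs \<and> xs ! idx x = x" if x: "x \<in> set xs" for x
  proof -
    from x obtain i where "i < length xs" "xs ! i = x" unfolding in_set_conv_nth by blast
    with idx[of i] show ?thesis by simp
  qed
  define h where "h = (\<lambda>x. if x \<in> set xs then idx x else g x + length xs)"
  have "inj_on h A"
  proof (rule inj_onI)
    fix x y assume xy: "x \<in> A" "y \<in> A" "h x = h y"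
    have "x \<in> set xs \<longleftrightarrow> y \<in> set xs"
    proof (rule ccontr)
      assume "\<not> ?thesis"
      then consider "x \<in> set xs" "y \<notin> set xs" | "x \<notin> set xs" "y \<in> set xs" by blast
      then show False
      proof cases
        case 1
        then show ?thesis using xy(3) idx'[OF 1(1)] by (simp add: h_def)
      next
        case 2
        then show ?thesis using xy(3) idx'[OF 2(2)] by (simp add: h_def)
      qed
    qed
    moreover have "x = y" if "x \<in> set xs" "y \<in> set xs"
    proof -
      have "idx x = idx y" using xy(3) that by (simp add: h_def)
      then show ?thesis using idx'[OF that(1)] idx'[OF that(2)] by metis
    qed
    moreover have "x = y" if "x \<notin> set xs" "y \<notin> set xs"
    proof -
      have "g x = g y" using xy(3) that by (simp add: h_def)
      then show ?thesis using inj_onD[OF g] xy(1,2) that by simp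
    qed
    ultimately show "x = y" by blast
  qed
  moreover have "h (xs ! i) = i" if "i < length xs" for i using that idx by (simp add: h_def)
  ultimately show ?thesis using that by blast
qed

text \<open>On a finite invariant set of states, the sweep machine is a Turing machine up to numbering.\<close>

lemma sweep_numbered:
  assumes "finite Q" "\<And>q c. q \<in> Q \<Longrightarrow> fst (sweep_delta q c) \<in> Q" "q0 \<in> Q" "Halted \<in> Q" "q0 \<noteq> Halted"
    and run: "\<And>w. \<exists>n \<le> poly p (length w). \<exists>i.
      (sweep_step ^^ n) (q0, bit_tape w, 0) = (Halted, bit_tape (f w), i)"
  shows "poly_time_computable f"
proof -
  obtain hq :: "sweep \<Rightarrow> nat" where hq: "inj_on hq Q" "hq q0 = 0" "hq Halted = 1"
  proof -
    have "distinct [q0, Halted]" using assms(5) by simp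
    from finite_numbering[OF assms(1) this] obtain h where h: "inj_on h Q"
      and h': "\<And>i. i < length [q0, Halted] \<Longrightarrow> h ([q0, Halted] ! i) = i" by blast
    from h'[of 0] h'[of 1] h that show ?thesis by simp
  qed
  obtain hc :: "cell \<Rightarrow> nat" where hc: "inj hc" "hc (bit_cell None) = 0"
    "hc (bit_cell (Some False)) = 1" "hc (bit_cell (Some True)) = 2"
  proof -
    let ?xs = "[bit_cell None, bit_cell (Some False), bit_cell (Some True)]"
    have "distinct ?xs" by (simp add: bit_cell_def)
    from finite_numbering[OF finite[of UNIV] this] obtain h where h: "inj h"
      and h': "\<And>i. i < length ?xs \<Longrightarrow> h (?xs ! i) = i" by blast
    from h'[of 0] h'[of 1] h'[of 2] h that show ?thesis by simp
  qed
  define K where "K = Suc (Max (insert 3 (hq ` Q \<union> range hc)))"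
  have fin: "finite (insert 3 (hq ` Q \<union> range hc))" using assms(1) by simp
  have K: "hq q < K" "hc c < K" "3 < K" if "q \<in> Q" for q c
    using that Max_ge[OF fin] by (auto simp: K_def less_Suc_eq_le)
  define tr :: transition where "tr = (\<lambda>q a. if q \<in> hq ` Q \<and> a \<in> range hc
     then case sweep_delta (inv_into Q hq q) (inv_into UNIV hc a) of (q', c, d) \<Rightarrow> (hq q', hc c, d) else (0, 0, 0))"
  have tr: "tr (hq q) (hc c) = (case sweep_delta q c of (q', c, d) \<Rightarrow> (hq q', hc c, d))" if "q \<in> Q" for q c
    using that hq(1) hc(1) by (simp add: tr_def)
  have dir: "snd (snd (sweep_delta q c)) \<in> {-1, 0, 1}" for q c
    by (cases "(q, c)" rule: sweep_delta.cases) (auto split: prod.split)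
  have tm: "turing_machine K tr"
    unfolding turing_machine_def
  proof (intro conjI allI impI)
    show "3 \<le> K" using K(3)[OF assms(3)] by simp
    fix q a assume "q < K" "a < K"
    show "case tr q a of (q', a', d) \<Rightarrow> q' < K \<and> a' < K \<and> d \<in> {-1, 0, 1}"
    proof (cases "q \<in> hq ` Q \<and> a \<in> range hc")
      case True
      then obtain q' c where qc: "q' \<in> Q" "q = hq q'" "a = hc c" by auto
      obtain q1 c1 d1 where s: "sweep_delta q' c = (q1, c1, d1)" by (metis surj_pair)
      with assms(2)[OF qc(1), of c] have "q1 \<in> Q" by simp
      then show ?thesis using K(1)[of q1] K(2)[of q1 c1] dir[of q' c] s unfolding qc(2,3) tr[OF qc(1)] by simp
    next
      case False
      then have "tr q a = (0, 0, 0)" unfolding tr_def by (simp only: if_False)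
      then show ?thesis using K(3)[OF assms(3)] by simp
    qed
  qed
  have sim: "(tm_step tr ^^ n) (hq q, hc \<circ> t, i) =
      (case (sweep_step ^^ n) (q, t, i) of (q', t', i') \<Rightarrow> (hq q', hc \<circ> t', i')) \<and> fst ((sweep_step ^^ n) (q, t, i)) \<in> Q"
    if "q \<in> Q" for n q t i
  proof (induction n)
    case (Suc n)
    obtain q' t' i' where s: "(sweep_step ^^ n) (q, t, i) = (q', t', i')" by (metis surj_pair)
    obtain q1 c1 d1 where d: "sweep_delta q' (t' i') = (q1, c1, d1)" by (metis surj_pair)
    have q': "q' \<in> Q" using Suc s by simp
    have halt: "hq q' = Suc 0 \<longleftrightarrow> q' = Halted"
      using inj_onD[OF hq(1) _ q' assms(4)] hq(3) by auto
    have "q1 \<in> Q" using assms(2)[OF q', of "t' i'"] d by simp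
    then show ?case using Suc s d q' tr[OF q', of "t' i'"] by (auto simp: halt fun_upd_comp comp_def hq(3))
  qed (use that in simp)
  have bit: "hc \<circ> bit_tape w = tape_of w" for w
    by (auto simp: bit_tape_def tape_of_def hc)
  have "\<exists>i. (tm_step tr ^^ poly p (length w)) (0, tape_of w, 0) = (1, tape_of (f w), i)" for w
  proof -
    obtain n i where n: "n \<le> poly p (length w)"
      "(sweep_step ^^ n) (q0, bit_tape w, 0) = (Halted, bit_tape (f w), i)" using run by blast
    have "(sweep_step ^^ m) (Halted, t, i) = (Halted, t, i)" for m t i by (induction m) auto
    then have "(sweep_step ^^ (poly p (length w) - n + n)) (q0, bit_tape w, 0) = (Halted, bit_tape (f w), i)"
      unfolding funpow_add comp_apply n(2) by simp
    then have "(sweep_step ^^ poly p (length w)) (q0, bit_tape w, 0) = (Halted, bit_tape (f w), i)"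
      using n(1) by simp
    with sim[OF assms(3), of "poly p (length w)" "bit_tape w" 0] show ?thesis by (simp add: bit hq)
  qed
  with tm show ?thesis unfolding poly_time_computable_def by blast
qed

theorem poly_time_program:
  assumes "list_all source_instr P" shows "poly_time_computable (program_out P)"
proof -
  obtain p :: "nat poly" where "\<forall>w. \<exists>n \<le> poly p (length w). \<exists>i.
    (sweep_step ^^ n) (Rightward P 0, bit_tape w, 0) = (Halted, bit_tape (program_out P w), i)"
    using sweep_computes_program[OF assms] by blast
  then show ?thesis
    using sweep_states_closed conts_self[of P] finite_conts[of P]
    by (intro sweep_numbered[of "sweep_states P" "Rightward P 0" p]) (auto simp: sweep_states_def)
qed

section \<open>One algorithm for sampling, verifying and inverting\<close>

text \<open>
  On input \<open>w\<close>, write \<open>w\<close> onto the last quarter of the \<open>4 * length w\<close> qubits and query the oracle.  At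
  width 1 the oracle is a bit flip; the phase gate, which fixes the basis state 0, is a placeholder that keeps the
  code of the circuit easy to generate.
\<close>

definition loader :: algorithm where
  "loader w = Circuit (4 * length w)
     (map (\<lambda>i. if w ! i then Query None Forward [3 * length w + i] else Phase_T (3 * length w + i))
       [0..<length w] @ [Query None Forward [0..<4 * length w]])"

text \<open>The code of the circuit, produced by loops.  The constants are the unary codes of the gates.\<close>

definition loader_program :: "instr list" where
  "loader_program =
    [Atom (Rep False (replicate 4 True)), Atom (Emit False),
     Atom (Rep False [True]), Atom (Emit True), Atom (Emit False),
     Each [Bit [True, True, True, False, False, True, False] [True, False],
       Rep False (replicate 3 True), Rep True [True], Emit False]] @
    emits [True, True, True, False, False] @
    [Atom (Rep False (replicate 4 True)), Atom (Emit False)] @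
    map (\<lambda>c. Each [Rep False (replicate c True), Rep True [True], Emit False]) [0, 1, 2, 3]"

lemma enc_nats_append: "enc_nats (u @ v) = enc_nats u @ enc_nats v"
  by (simp add: enc_nats_def)

lemma enc_nats_concat: "enc_nats (concat us) = concat (map enc_nats us)"
  by (induction us) (simp_all add: enc_nats_append, simp add: enc_nats_def)

lemma concat_replicate_replicate: "concat (replicate n (replicate c x)) = replicate (c * n) x"
  by (induction n) (simp_all add: replicate_add[symmetric])

text \<open>
  Qubit numbers up to \<open>4 * n\<close> in blocks of length \<open>n\<close>, since loops run over the input positions only.
\<close>

lemma upt_blocks: "[0..<4 * n] = concat (map (\<lambda>c. map (\<lambda>i. c * n + i) [0..<n]) [0, 1, 2, 3])" for n :: nat
proof -
  have m: "map (\<lambda>i. c + i) [0..<n] = [c..<c + n]" for c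
    by (induction n) auto
  have split: "[i..<k] = [i..<j] @ [j..<k]" if "i \<le> j" "j \<le> k" for i j k :: nat
    using upt_add_eq_append[of i j "k - j"] that by simp
  have "[0..<4 * n] = [0..<n] @ [n..<n + n] @ [2 * n..<2 * n + n] @ [3 * n..<3 * n + n]"
  proof -
    have "[0..<4 * n] = [0..<n] @ [n..<4 * n]" by (rule split) auto
    also have "[n..<4 * n] = [n..<2 * n] @ [2 * n..<4 * n]" by (rule split) auto
    also have "[2 * n..<4 * n] = [2 * n..<3 * n] @ [3 * n..<4 * n]" by (rule split) auto
    finally show ?thesis by (simp add: mult.commute numeral_eq_Suc add.assoc)
  qed
  moreover have "map ((+) 0) [0..<n] = [0..<n]" by (simp add: map_idI)
  ultimately show ?thesis using m[of n] m[of "2 * n"] m[of "3 * n"] by simp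
qed

lemma loader_program_out: "program_out loader_program w = enc_circuit (loader w)"
proof -
  let ?n = "length w"
  have r3: "replicate 3 True = [True, True, True]" by (simp add: numeral_eq_Suc)
  have r: "concat (replicate m [True]) = replicate m True" for m by (induction m) auto
  have "enc_circuit (loader w) = replicate (4 * ?n) True @ [False] @ replicate ?n True @ [True, False] @
     enc_nats (concat (map gate_code (map (\<lambda>i. if w ! i then Query None Forward [3 * ?n + i] else Phase_T (3 * ?n + i)) [0..<?n])))
     @ enc_nats [3, 0, 4 * ?n] @ enc_nats [0..<4 * ?n]"
    by (simp add: enc_circuit_def loader_def enc_nats_append) (simp add: enc_nats_def replicate_append_same numeral_eq_Suc)
  also have "enc_nats (concat (map gate_code (map (\<lambda>i. if w ! i then Query None Forward [3 * ?n + i] else Phase_T (3 * ?n + i)) [0..<?n])))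
    = instr_out w (Each [Bit [True, True, True, False, False, True, False] [True, False],
       Rep False (replicate 3 True), Rep True [True], Emit False])"
  proof -
    have "enc_nats (gate_code (if w ! i then Query None Forward [3 * ?n + i] else Phase_T (3 * ?n + i))) =
      concat (map (atom_out w i) [Bit [True, True, True, False, False, True, False] [True, False],
       Rep False (replicate 3 True), Rep True [True], Emit False])" for i
      by (simp add: enc_nats_def concat_replicate_replicate r replicate_add r3 concat_replicate_replicate[of _ 3 True, unfolded r3])
    then show ?thesis unfolding enc_nats_concat map_map comp_def instr_out.simps by simp
  qed
  also have "enc_nats [0..<4 * ?n] = concat (map (\<lambda>c. concat (map (\<lambda>i. enc_nats [c * ?n + i]) [0..<?n])) [0, 1, 2, 3])"
    unfolding upt_blocks enc_nats_concat by (simp add: enc_nats_def comp_def)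
  also have "(\<lambda>c. concat (map (\<lambda>i. enc_nats [c * ?n + i]) [0..<?n])) =
     (\<lambda>c. instr_out w (Each [Rep False (replicate c True), Rep True [True], Emit False]))"
    by (rule ext) (simp add: enc_nats_def concat_replicate_replicate r replicate_add)
  finally show ?thesis
    by (simp add: program_out_def loader_program_def concat_replicate_replicate r enc_nats_def r3
        del: instr_out.simps(2))
qed

lemma source_loader_program: "list_all source_instr loader_program"
  by (simp add: loader_program_def)

lemma QPT_loader: "(False, Forward) \<in> acc \<Longrightarrow> QPT acc loader"
proof -
  assume acc: "(False, Forward) \<in> acc"
  have "(\<lambda>w. enc_circuit (loader w)) = program_out loader_program" by (rule ext) (rule loader_program_out[symmetric])
  then have "poly_time_computable (\<lambda>w. enc_circuit (loader w))"
    using poly_time_program[OF source_loader_program] by simp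
  moreover have "valid_circuit (loader w)" for w
    by (auto simp: valid_circuit_def loader_def)
  moreover have "(c \<noteq> None, v) \<in> acc" if "Query c v qs \<in> set (gates (loader w))" for w c v qs
    using that acc by (auto simp: loader_def split: if_splits)
  ultimately show ?thesis by (simp add: QPT_def)
qed

section \<open>Sizes and enumeration of algorithms\<close>

text \<open>The length of the code bounds both the width and the number of gates.\<close>

definition size_of :: "circuit \<Rightarrow> nat" where
  "size_of C = length (enc_circuit C)"

lemma length_enc_nats: "length (enc_nats ns) = sum_list ns + length ns"
  by (induction ns) (simp_all add: enc_nats_def)

lemma width_le_size: "width C < size_of C" and gates_le_size: "length (gates C) < size_of C"
  by (simp_all add: size_of_def enc_circuit_def length_enc_nats)

lemma tape_of_inj: "tape_of u = tape_of v \<Longrightarrow> u = v"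
proof -
  assume eq: "tape_of u = tape_of v"
  have supp: "tape_of w i \<noteq> 0 \<longleftrightarrow> 0 \<le> i \<and> i < int (length w)" for w i by (simp add: tape_of_def)
  have len: "length u = length v"
  proof (rule ccontr)
    assume "length u \<noteq> length v"
    then consider "length u < length v" | "length v < length u" by arith
    then show False
      by cases (use supp[of u "int (length u)"] supp[of v "int (length u)"]
        supp[of u "int (length v)"] supp[of v "int (length v)"] eq in auto)
  qed
  show "u = v"
  proof (rule nth_equalityI[OF len])
    fix i assume "i < length u"
    then show "u ! i = v ! i" using fun_cong[OF eq, of "int i"] len
      by (simp add: tape_of_def split: if_splits)
  qed
qed

text \<open>A machine writes at most one new cell per step.\<close>

lemma poly_time_length:
  assumes "poly_time_computable f" obtains p :: "nat poly" where "\<And>w. length (f w) \<le> poly p (length w)"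
proof -
  obtain K tr and p :: "nat poly" where
    p: "\<And>w. \<exists>i. (tm_step tr ^^ poly p (length w)) (0, tape_of w, 0) = (1, tape_of (f w), i)"
    using assms unfolding poly_time_computable_def by blast
  define S where "S = (\<lambda>c :: config. {i. fst (snd c) i \<noteq> 0})"
  have step: "S (tm_step tr c) \<subseteq> insert (snd (snd c)) (S c)" for c
    by (cases c) (auto simp: S_def split: prod.splits if_splits)
  have fin: "finite (S ((tm_step tr ^^ n) c)) \<and> card (S ((tm_step tr ^^ n) c)) \<le> card (S c) + n"
    if "finite (S c)" for c n
  proof (induction n)
    case (Suc n)
    let ?c = "(tm_step tr ^^ n) c"
    have "card (S (tm_step tr ?c)) \<le> card (insert (snd (snd ?c)) (S ?c))"
      using Suc step by (intro card_mono) auto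
    also have "\<dots> \<le> Suc (card (S ?c))" by (rule card_insert_le_m1) auto
    finally show ?case using Suc finite_subset[OF step] by auto
  qed (use that in simp)
  have supp: "S (q, tape_of w, i) = {0..<int (length w)}" for q w i
    by (auto simp: S_def tape_of_def)
  have "length (f w) \<le> poly (p + [:0, 1:]) (length w)" for w
    using p[of w] fin[of "(0, tape_of w, 0)" "poly p (length w)"] by (auto simp: supp)
  then show ?thesis using that by blast
qed

text \<open>
  A machine and its time bound are determined by finite data: the transition table below \<open>K\<close> and the
  coefficients of the polynomial.
\<close>

lemma countable_poly_time: "countable {f. poly_time_computable f}"
proof -
  define run where "run = (\<lambda>(tab :: ((nat \<times> nat) \<times> nat \<times> nat \<times> int) list, cs :: nat list) w.
     (tm_step (\<lambda>q a. the (map_of tab (q, a))) ^^ poly (Poly cs) (length w)) (0, tape_of w, 0))"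
  define F where "F = (\<lambda>x. THE f. \<forall>w. \<exists>i. run x w = (1, tape_of (f w), i))"
  have "{f. poly_time_computable f} \<subseteq> range F"
  proof
    fix f assume "f \<in> {f. poly_time_computable f}"
    then obtain K tr and p :: "nat poly" where tm: "turing_machine K tr" and
      p: "\<And>w. \<exists>i. (tm_step tr ^^ poly p (length w)) (0, tape_of w, 0) = (1, tape_of (f w), i)"
      unfolding poly_time_computable_def by blast
    define tab where "tab = map (\<lambda>(q, a). ((q, a), tr q a)) (List.product [0..<K] [0..<K])"
    have tab: "the (map_of tab (q, a)) = tr q a" if "q < K" "a < K" for q a
    proof -
      have "distinct (map fst tab)"
        by (simp add: tab_def comp_def case_prod_beta distinct_product)
      moreover have "((q, a), tr q a) \<in> set tab" using that by (force simp: tab_def)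
      ultimately show ?thesis by simp
    qed
    have sim: "(tm_step (\<lambda>q a. the (map_of tab (q, a))) ^^ n) c = (tm_step tr ^^ n) c \<and>
        (case (tm_step tr ^^ n) c of (q, t, i) \<Rightarrow> q < K \<and> (\<forall>i. t i < K))"
      if "case c of (q, t, i) \<Rightarrow> q < K \<and> (\<forall>i. t i < K)" for n c
    proof (induction n)
      case (Suc n)
      obtain q t i where c: "(tm_step tr ^^ n) c = (q, t, i)" by (metis surj_pair)
      obtain q' a' d where d: "tr q (t i) = (q', a', d)" by (metis surj_pair)
      have qt: "q < K" "\<forall>i. t i < K" using Suc c by auto
      then have "q' < K \<and> a' < K" using tm d unfolding turing_machine_def
        by (metis (mono_tags, lifting) case_prod_conv)
      then show ?case using Suc c d qt tab[of q "t i"] by auto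
    qed (use that in simp)
    have K: "K \<ge> 3" using tm by (simp add: turing_machine_def)
    have run: "run (tab, coeffs p) w = (tm_step tr ^^ poly p (length w)) (0, tape_of w, 0)" for w
      using sim[of "(0, tape_of w, 0)" "poly p (length w)"] K by (auto simp: run_def tape_of_def)
    have "F (tab, coeffs p) = f"
      unfolding F_def
    proof (rule the_equality)
      show "\<forall>w. \<exists>i. run (tab, coeffs p) w = (1, tape_of (f w), i)" using p run by simp
      fix g assume g: "\<forall>w. \<exists>i. run (tab, coeffs p) w = (1, tape_of (g w), i)"
      show "g = f"
      proof
        fix w
        have "tape_of (g w) = tape_of (f w)" using g[rule_format, of w] p[of w] run by auto
        then show "g w = f w" by (rule tape_of_inj)
      qed
    qed
    then show "f \<in> range F" by blast
  qed
  then show ?thesis by (rule countable_subset) simp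
qed

lemma countable_QPT: "countable {A. QPT acc A}"
proof -
  have "inj_on (\<lambda>A w. enc_circuit (A w)) {A. QPT acc A}"
    by (rule inj_onI) (metis enc_circuit_inj ext)
  moreover have "countable ((\<lambda>A w. enc_circuit (A w)) ` {A. QPT acc A})"
    by (rule countable_subset[OF _ countable_poly_time]) (auto simp: QPT_def)
  ultimately show ?thesis using countable_image_inj_on by blast
qed

text \<open>An enumeration of all algorithms with full access to the oracle.\<close>

definition alg :: "nat \<Rightarrow> algorithm" where
  "alg = from_nat_into {A. QPT full_access A}"

lemma QPT_alg: "QPT full_access (alg g)"
proof -
  have "loader \<in> {A. QPT full_access A}" by (simp add: QPT_loader full_access_def)
  then show ?thesis unfolding alg_def by (metis empty_iff from_nat_into mem_Collect_eq)
qed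

lemma alg_surj:
  assumes "QPT acc A" obtains g where "alg g = A"
proof -
  have "QPT full_access A" using assms by (simp add: QPT_def full_access_def)
  then show ?thesis using that from_nat_into_surj[OF countable_QPT, of A full_access]
    unfolding alg_def by auto
qed

lemma QPT_size:
  assumes "QPT acc A" obtains p :: "nat poly" where "\<And>w. size_of (A w) \<le> poly p (length w)"
proof -
  have "poly_time_computable (\<lambda>w. enc_circuit (A w))" using assms by (simp add: QPT_def)
  then show ?thesis using that unfolding size_of_def by (rule poly_time_length)
qed

section \<open>Averages over finite product spaces\<close>

text \<open>
  The average of \<open>Z\<close> when the coordinates \<open>ss\<close> of \<open>h\<close> are redrawn independently and uniformly, the
  coordinate \<open>s\<close> from \<open>D s\<close>; all other coordinates keep their value in \<open>h\<close>.
\<close>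

primrec avg :: "('a \<Rightarrow> 'b set) \<Rightarrow> 'a list \<Rightarrow> (('a \<Rightarrow> 'b) \<Rightarrow> real) \<Rightarrow> ('a \<Rightarrow> 'b) \<Rightarrow> real" where
  "avg D [] Z h = Z h"
| "avg D (s # ss) Z h = (\<Sum>v\<in>D s. avg D ss Z (h(s := v))) / real (card (D s))"

text \<open>The arguments at which \<open>avg D ss Z h\<close> evaluates \<open>Z\<close>.\<close>

definition redraws :: "('a \<Rightarrow> 'b set) \<Rightarrow> 'a list \<Rightarrow> ('a \<Rightarrow> 'b) \<Rightarrow> ('a \<Rightarrow> 'b) set" where
  "redraws D ss h = {h'. (\<forall>s\<in>set ss. h' s \<in> D s) \<and> (\<forall>s. s \<notin> set ss \<longrightarrow> h' s = h s)}"

locale finite_product =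
  fixes D :: "'a \<Rightarrow> 'b set"
  assumes finite_D: "finite (D s)" and nonempty_D: "D s \<noteq> {}"
begin

lemma card_D_pos: "0 < real (card (D s))"
  using finite_D[of s] nonempty_D[of s] by (simp add: card_gt_0_iff)

lemma redraws_update: "v \<in> D s \<Longrightarrow> redraws D ss (h(s := v)) \<subseteq> redraws D (s # ss) h"
  by (auto simp: redraws_def split: if_splits)

lemma avg_mono:
  assumes "\<And>h'. h' \<in> redraws D ss h \<Longrightarrow> Z h' \<le> Z' h'"
  shows "avg D ss Z h \<le> avg D ss Z' h"
  using assms
proof (induction ss arbitrary: h)
  case (Cons s ss)
  have "avg D ss Z (h(s := v)) \<le> avg D ss Z' (h(s := v))" if "v \<in> D s" for v
    by (intro Cons.IH Cons.prems subsetD[OF redraws_update[OF that]])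
  then show ?case by (auto intro!: divide_right_mono sum_mono)
qed (auto simp: redraws_def)

lemma avg_const [simp]: "avg D ss (\<lambda>_. c) h = c"
  by (induction ss arbitrary: h) (use card_D_pos in \<open>simp_all add: less_imp_neq[symmetric]\<close>)

lemma avg_le_const: "(\<And>h'. h' \<in> redraws D ss h \<Longrightarrow> Z h' \<le> c) \<Longrightarrow> avg D ss Z h \<le> c"
  using avg_mono[of ss h Z "\<lambda>_. c"] by simp

lemma avg_ge_const: "(\<And>h'. h' \<in> redraws D ss h \<Longrightarrow> c \<le> Z h') \<Longrightarrow> c \<le> avg D ss Z h"
  using avg_mono[of ss h "\<lambda>_. c" Z] by simp

lemma avg_add: "avg D ss (\<lambda>h. Z h + Z' h) h = avg D ss Z h + avg D ss Z' h"
  by (induction ss arbitrary: h) (simp_all add: sum.distrib add_divide_distrib)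

lemma avg_cmult: "avg D ss (\<lambda>h. c * Z h) h = c * avg D ss Z h"
  by (induction ss arbitrary: h) (simp_all add: sum_distrib_left)

lemma avg_diff: "avg D ss (\<lambda>h. Z h - Z' h) h = avg D ss Z h - avg D ss Z' h"
  using avg_add[of ss Z "\<lambda>h. - 1 * Z' h" h] avg_cmult[of ss "-1" Z' h] by simp

lemma avg_sum: "avg D ss (\<lambda>h. \<Sum>i\<in>I. Z i h) h = (\<Sum>i\<in>I. avg D ss (Z i) h)"
  by (induction I rule: infinite_finite_induct) (simp_all add: avg_add)

lemma avg_exists_less:
  assumes "avg D ss Z h < c"
  obtains h' where "h' \<in> redraws D ss h" "Z h' < c"
  using avg_ge_const[of ss h c Z] assms by force

lemma avg_square_le: "(avg D ss Z h)\<^sup>2 \<le> avg D ss (\<lambda>h. (Z h)\<^sup>2) h"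
proof -
  let ?m = "avg D ss Z h"
  have "0 \<le> avg D ss (\<lambda>h'. (Z h' - ?m)\<^sup>2) h" by (rule avg_ge_const) simp
  also have "(\<lambda>h'. (Z h' - ?m)\<^sup>2) = (\<lambda>h'. ((Z h')\<^sup>2 - 2 * ?m * Z h') + ?m\<^sup>2)"
    by (auto simp: power2_eq_square algebra_simps)
  also have "avg D ss \<dots> h = avg D ss (\<lambda>h. (Z h)\<^sup>2) h - 2 * ?m * ?m + ?m\<^sup>2"
    by (simp only: avg_add avg_diff avg_cmult avg_const)
  finally show ?thesis by (simp add: power2_eq_square)
qed

lemma avg_variance:
  "avg D ss (\<lambda>h'. (Z h' - c)\<^sup>2) h =
     avg D ss (\<lambda>h'. (Z h' - avg D ss Z h)\<^sup>2) h + (avg D ss Z h - c)\<^sup>2"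
proof -
  have *: "avg D ss (\<lambda>h'. (Z h' - a)\<^sup>2) h = avg D ss (\<lambda>h. (Z h)\<^sup>2) h - 2 * a * avg D ss Z h + a\<^sup>2" for a
  proof -
    have "(\<lambda>h'. (Z h' - a)\<^sup>2) = (\<lambda>h'. ((Z h')\<^sup>2 - 2 * a * Z h') + a\<^sup>2)"
      by (auto simp: power2_eq_square algebra_simps)
    then show ?thesis by (simp only: avg_add avg_diff avg_cmult avg_const)
  qed
  show ?thesis by (simp only: *) (simp add: power2_eq_square algebra_simps)
qed

text \<open>
  An average does not depend on the redrawn coordinates, nor on those that \<open>Z\<close> ignores.
\<close>

lemma avg_cong:
  assumes "\<And>h h'. (\<forall>s\<in>S. h s = h' s) \<Longrightarrow> Z h = Z h'" "\<forall>s\<in>S - set ss. h s = h' s"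
  shows "avg D ss Z h = avg D ss Z h'"
  using assms(2)
proof (induction ss arbitrary: h h')
  case (Cons s ss)
  have "avg D ss Z (h(s := v)) = avg D ss Z (h'(s := v))" for v
    using Cons.prems by (intro Cons.IH) auto
  then show ?case by simp
qed (simp add: assms(1))

lemma avg_update:
  "s \<notin> set ss \<Longrightarrow> avg D ss Z (h(s := v)) = avg D ss (\<lambda>h. Z (h(s := v))) h"
  by (induction ss arbitrary: h) (auto simp: fun_upd_twist intro!: sum.cong)

lemma avg_append: "avg D (ss @ ss') Z h = avg D ss (avg D ss' Z) h"
  by (induction ss arbitrary: h) auto

lemma avg_swap1:
  assumes "s \<notin> set ss" shows "avg D ss (avg D [s] Z) h = avg D [s] (avg D ss Z) h"
proof -
  have "avg D [s] Z = (\<lambda>h. 1 / real (card (D s)) * (\<Sum>v\<in>D s. Z (h(s := v))))" by (rule ext) simp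
  then have "avg D ss (avg D [s] Z) h =
      1 / real (card (D s)) * (\<Sum>v\<in>D s. avg D ss (\<lambda>h. Z (h(s := v))) h)"
    by (simp only: avg_cmult avg_sum)
  then show ?thesis using assms by (simp add: avg_update)
qed

lemma avg_swap:
  "set ss \<inter> set ss' = {} \<Longrightarrow> avg D ss (avg D ss' Z) h = avg D ss' (avg D ss Z) h"
proof (induction ss arbitrary: h)
  case (Cons s ss)
  have "avg D (s # ss) (avg D ss' Z) h = avg D [s] (avg D ss (avg D ss' Z)) h" by simp
  also have "avg D ss (avg D ss' Z) = avg D ss' (avg D ss Z)"
    using Cons by (intro ext) auto
  also have "avg D [s] \<dots> h = avg D ss' (avg D [s] (avg D ss Z)) h"
    using Cons.prems by (intro avg_swap1[symmetric]) auto
  also have "avg D [s] (avg D ss Z) = avg D (s # ss) Z" by (rule ext) simp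
  finally show ?case .
next
  case Nil
  have "avg D [] F = F" for F by (rule ext) simp
  then show ?case by simp
qed

text \<open>A bound on a partial average bounds the full average.\<close>

lemma avg_le_block:
  assumes "distinct (as @ bs @ cs)"
    and "\<And>h'. h' \<in> redraws D (as @ cs) h \<Longrightarrow> avg D bs Z h' \<le> avg D bs Z' h'"
  shows "avg D (as @ bs @ cs) Z h \<le> avg D (as @ bs @ cs) Z' h"
proof -
  have eq: "avg D (as @ bs @ cs) F h = avg D (as @ cs) (avg D bs F) h" for F
  proof -
    have "avg D bs (avg D cs F) = avg D cs (avg D bs F)"
      using assms(1) by (intro ext avg_swap) auto
    moreover have "avg D (bs @ cs) F = avg D bs (avg D cs F)" by (intro ext avg_append)
    ultimately show ?thesis by (simp only: avg_append)
  qed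
  show ?thesis unfolding eq by (intro avg_mono assms(2))
qed

lemma avg_le_coordinate:
  assumes "distinct ss" "s \<in> set ss"
    and "\<And>h'. h' \<in> redraws D (remove1 s ss) h \<Longrightarrow> avg D [s] Z h' \<le> avg D [s] Z' h'"
  shows "avg D ss Z h \<le> avg D ss Z' h"
proof -
  obtain as cs where ss: "ss = as @ [s] @ cs" using split_list[OF assms(2)] by auto
  then have "s \<notin> set as" using assms(1) by auto
  with ss have "remove1 s ss = as @ cs" by (simp add: remove1_append)
  then show ?thesis unfolding ss using assms(1,3) by (intro avg_le_block) (auto simp: ss)
qed

text \<open>
  The Efron--Stein inequality: \<open>W s\<close> is any estimate of \<open>Z\<close> that ignores the coordinate \<open>s\<close>.
\<close>

lemma Efron_Stein:
  assumes "distinct ss" and W: "\<And>s h v. s \<in> set ss \<Longrightarrow> W s (h(s := v)) = W s h"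
  shows "avg D ss (\<lambda>h'. (Z h' - avg D ss Z h)\<^sup>2) h \<le>
    (\<Sum>s\<in>set ss. avg D ss (\<lambda>h'. (Z h' - W s h')\<^sup>2) h)"
  using assms
proof (induction ss arbitrary: h)
  case (Cons s ss)
  define m where "m = (\<lambda>v. avg D ss Z (h(s := v)))"
  define m0 where "m0 = avg D (s # ss) Z h"
  let ?d = "real (card (D s))"
  let ?A = "\<lambda>F. avg D (s # ss) F h"
  have d: "0 < ?d" by (rule card_D_pos)
  define c where "c = avg D ss (W s) h"
  have c: "avg D ss (W s) (h(s := v)) = c" for v
  proof -
    have "(\<lambda>h. W s (h(s := v))) = W s" by (intro ext Cons.prems(2)) simp
    then show ?thesis using avg_update[of s ss "W s" h v] Cons.prems(1) by (simp add: c_def)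
  qed
  have m0: "m0 * ?d = (\<Sum>v\<in>D s. m v)" using d by (simp add: m0_def m_def)
  have "(\<Sum>v\<in>D s. (m v - m0)\<^sup>2) \<le> (\<Sum>v\<in>D s. (m v - c)\<^sup>2)"
  proof -
    have "(\<Sum>v\<in>D s. (m v - c)\<^sup>2) - (\<Sum>v\<in>D s. (m v - m0)\<^sup>2) = (\<Sum>v\<in>D s. (c\<^sup>2 - m0\<^sup>2) + 2 * (m0 - c) * m v)"
      by (simp add: sum_subtractf[symmetric] power2_eq_square algebra_simps)
    also have "\<dots> = ?d * (c\<^sup>2 - m0\<^sup>2) + 2 * (m0 - c) * (m0 * ?d)"
      by (simp add: sum.distrib sum_distrib_left[symmetric] m0)
    also have "\<dots> = ?d * (m0 - c)\<^sup>2" by (simp add: power2_eq_square algebra_simps)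
    finally show ?thesis using d by (smt (verit) mult_nonneg_nonneg zero_le_power2)
  qed
  also have "\<dots> \<le> (\<Sum>v\<in>D s. avg D ss (\<lambda>h'. (Z h' - W s h')\<^sup>2) (h(s := v)))"
  proof (rule sum_mono)
    fix v
    have "m v - c = avg D ss (\<lambda>h'. Z h' - W s h') (h(s := v))" by (simp add: avg_diff m_def c)
    then show "(m v - c)\<^sup>2 \<le> avg D ss (\<lambda>h'. (Z h' - W s h')\<^sup>2) (h(s := v))"
      using avg_square_le by simp
  qed
  finally have 1: "(\<Sum>v\<in>D s. (m v - m0)\<^sup>2) / ?d \<le> ?A (\<lambda>h'. (Z h' - W s h')\<^sup>2)"
    using d by (simp add: divide_right_mono)
  have "(\<Sum>v\<in>D s. avg D ss (\<lambda>h'. (Z h' - m v)\<^sup>2) (h(s := v))) \<le>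
      (\<Sum>v\<in>D s. \<Sum>s'\<in>set ss. avg D ss (\<lambda>h'. (Z h' - W s' h')\<^sup>2) (h(s := v)))"
    unfolding m_def using Cons.prems by (intro sum_mono Cons.IH) auto
  also have "\<dots> = (\<Sum>s'\<in>set ss. \<Sum>v\<in>D s. avg D ss (\<lambda>h'. (Z h' - W s' h')\<^sup>2) (h(s := v)))"
    by (rule sum.swap)
  finally have 2: "(\<Sum>v\<in>D s. avg D ss (\<lambda>h'. (Z h' - m v)\<^sup>2) (h(s := v))) / ?d \<le>
      (\<Sum>s'\<in>set ss. ?A (\<lambda>h'. (Z h' - W s' h')\<^sup>2))"
    using d by (simp add: divide_right_mono sum_divide_distrib[symmetric])
  have "?A (\<lambda>h'. (Z h' - m0)\<^sup>2) =
      (\<Sum>v\<in>D s. avg D ss (\<lambda>h'. (Z h' - m v)\<^sup>2) (h(s := v)) + (m v - m0)\<^sup>2) / ?d"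
    unfolding avg.simps m_def using avg_variance[of ss Z m0] by simp
  also have "\<dots> = (\<Sum>v\<in>D s. avg D ss (\<lambda>h'. (Z h' - m v)\<^sup>2) (h(s := v))) / ?d + (\<Sum>v\<in>D s. (m v - m0)\<^sup>2) / ?d"
    by (simp add: sum.distrib add_divide_distrib)
  also have "\<dots> \<le> (\<Sum>s'\<in>set (s # ss). ?A (\<lambda>h'. (Z h' - W s' h')\<^sup>2))"
    using 1 2 Cons.prems by simp
  finally show ?case unfolding m0_def .
qed simp

end

text \<open>Compactness: finitely determined events that are finitely avoidable are avoidable.\<close>

lemma avoid_all_events:
  fixes D :: "'a :: countable \<Rightarrow> 'b set"
  assumes finite_D: "\<And>s. finite (D s)"
    and support: "\<And>j. \<exists>S. finite S \<and> (\<forall>h h'. (\<forall>s\<in>S. h s = h' s) \<longrightarrow> B j h \<longrightarrow> B j h')"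
    and avoid: "\<And>J. \<exists>h. (\<forall>s. h s \<in> D s) \<and> (\<forall>j < (J::nat). \<not> B j h)"
  shows "\<exists>h. (\<forall>s. h s \<in> D s) \<and> (\<forall>j. \<not> B j h)"
proof -
  define F where "F = (\<lambda>J. SOME h. (\<forall>s. h s \<in> D s) \<and> (\<forall>j < J. \<not> B j h))"
  have "(\<forall>s. F J s \<in> D s) \<and> (\<forall>j < J. \<not> B j (F J))" for J
    unfolding F_def by (rule someI_ex[OF avoid])
  then have F: "\<And>J s. F J s \<in> D s" "\<And>J j. j < J \<Longrightarrow> \<not> B j (F J)" by auto
  define P where "P = (\<lambda>n X. infinite X \<and> (n > 0 \<longrightarrow> (\<forall>J\<in>X. \<forall>J'\<in>X. F J (from_nat (n - 1)) = F J' (from_nat (n - 1)))))"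
  (* nested infinite sets of indices J on which F J is constant at more and more coordinates *)
  have "\<exists>X. \<forall>n. P n (X n) \<and> X (Suc n) \<subseteq> X n"
  proof (rule dependent_nat_choice)
    show "\<exists>X. P 0 X" by (intro exI[of _ UNIV]) (simp add: P_def)
    fix X n assume "P n X"
    then have inf: "infinite X" unfolding P_def by (rule conjunct1)
    have ex: "\<exists>v\<in>D (from_nat n). infinite {J \<in> X. F J (from_nat n) = v}"
    proof (rule ccontr)
      assume "\<not> ?thesis"
      then have "finite (\<Union>v\<in>D (from_nat n). {J \<in> X. F J (from_nat n) = v})" using finite_D by auto
      moreover have "X \<subseteq> (\<Union>v\<in>D (from_nat n). {J \<in> X. F J (from_nat n) = v})" using F(1) by auto
      ultimately show False using inf finite_subset[of X] by simp
    qed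
    from ex obtain v where "infinite {J \<in> X. F J (from_nat n) = v}" by (rule bexE)
    then show "\<exists>X'. P (Suc n) X' \<and> X' \<subseteq> X"
      by (intro exI[of _ "{J \<in> X. F J (from_nat n) = v}"]) (auto simp: P_def)
  qed
  then obtain X where "\<forall>n. P n (X n) \<and> X (Suc n) \<subseteq> X n" by (rule exE)
  then have X: "\<And>n. P n (X n)" "\<And>n. X (Suc n) \<subseteq> X n" by simp_all
  have sub: "n \<le> n' \<Longrightarrow> X n' \<subseteq> X n" for n n' using X(2) by (rule lift_Suc_antimono_le)
  define h where "h = (\<lambda>s. F (SOME J. J \<in> X (Suc (to_nat s))) s)"
  have h: "F J s = h s" if "J \<in> X n" "n > to_nat s" for J n s
  proof -
    have J: "J \<in> X (Suc (to_nat s))" using that sub[of "Suc (to_nat s)" n] by auto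
    then have "(SOME J. J \<in> X (Suc (to_nat s))) \<in> X (Suc (to_nat s))" by (rule someI)
    moreover have "\<forall>J\<in>X (Suc (to_nat s)). \<forall>J'\<in>X (Suc (to_nat s)). F J s = F J' s"
      using X(1)[of "Suc (to_nat s)"] unfolding P_def by (metis diff_Suc_1 from_nat_to_nat zero_less_Suc)
    ultimately show ?thesis using J unfolding h_def by blast
  qed
  have "\<not> B j h" for j
  proof
    assume B: "B j h"
    from support[of j] obtain S where S: "finite S"
      and S': "\<forall>h h'. (\<forall>s\<in>S. h s = h' s) \<longrightarrow> B j h \<longrightarrow> B j h'" by blast
    define n where "n = Suc (Max (insert 0 (to_nat ` S)))"
    have n: "s \<in> S \<Longrightarrow> to_nat s < n" for s using S by (auto simp: n_def less_Suc_eq_le)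
    have "infinite (X n)" using X(1)[of n] unfolding P_def by (rule conjunct1)
    then obtain J where J: "J \<in> X n" "j < J"
      using infinite_nat_iff_unbounded[of "X n"] by blast
    have "\<forall>s\<in>S. h s = F J s" using h[OF J(1)] n by auto
    then have "B j (F J)" using S' B by blast
    then show False using F(2) J(2) by blast
  qed
  moreover have "h s \<in> D s" for s using F(1) by (simp add: h_def)
  ultimately show ?thesis by blast
qed

section \<open>The oracle\<close>

text \<open>The set of possible answers to each classical query.\<close>

type_synonym answers = "bool list \<Rightarrow> bool list set"

definition zeros :: "nat \<Rightarrow> bool list" where
  "zeros n = replicate n False"

text \<open>
  The proper answers of length \<open>n\<close>; the string 0 is reserved for the initial state of the answer register.
\<close>

definition nonzero_part :: "nat \<Rightarrow> bool list set \<Rightarrow> bool list set" where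
  "nonzero_part n S = S \<inter> bits n - {zeros n}"

text \<open>
  The vector \<open>|0> - |P>\<close>, where \<open>|P>\<close> is the uniform superposition of the proper answers \<open>P\<close>.  Its
  squared norm is 2, so \<open>1 - v v^T\<close> for this \<open>v\<close> is the reflection that exchanges \<open>|0>\<close> and
  \<open>|P>\<close>.  If there is no proper answer, then the vector is 0 and the reflection is the identity.
\<close>

definition reflector :: "nat \<Rightarrow> bool list set \<Rightarrow> bool list \<Rightarrow> real" where
  "reflector n S a = (if nonzero_part n S = {} then 0 else if a = zeros n then 1
     else if a \<in> nonzero_part n S then - 1 / sqrt (card (nonzero_part n S)) else 0)"

text \<open>
  The reflections for all queries of length \<open>n\<close>: the first \<open>3 * n\<close> qubits hold the answer and the last \<open>n\<close> the query.
\<close>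

definition oracle_entry :: "answers \<Rightarrow> nat \<Rightarrow> bool list \<Rightarrow> bool list \<Rightarrow> real" where
  "oracle_entry A n x y = (if drop (3 * n) x = drop (3 * n) y
     then of_bool (x = y) - reflector (3 * n) (A (drop (3 * n) x)) (take (3 * n) x)
       * reflector (3 * n) (A (drop (3 * n) x)) (take (3 * n) y) else 0)"

definition oracle_mat :: "answers \<Rightarrow> nat \<Rightarrow> complex mat" where
  "oracle_mat A n = mat (2 ^ (4 * n)) (2 ^ (4 * n)) (\<lambda>(i, j). complex_of_real (oracle_entry A n
     (inv_into (bits (4 * n)) basis_index i) (inv_into (bits (4 * n)) basis_index j)))"

text \<open>
  Width 1 provides the bit flip, width \<open>4 * n\<close> the queries of length \<open>n\<close>.
\<close>

definition reflection_oracle :: "answers \<Rightarrow> unitary_family" where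
  "reflection_oracle A k = (if k = 1 then mat_of_rows_list 2 [[0, 1], [1, 0]]
     else if 4 dvd k then oracle_mat A (k div 4) else 1\<^sub>m (2 ^ k))"

subsection \<open>Unitarity\<close>

lemma zeros_in_bits: "zeros n \<in> bits n"
  by (simp add: zeros_def bits_def)

lemma finite_nonzero_part: "finite (nonzero_part n S)"
  unfolding nonzero_part_def using finite_bits by blast

lemma sum_reflector_sq:
  "(\<Sum>a\<in>bits n. (reflector n S a)\<^sup>2) = (if nonzero_part n S = {} then 0 else 2)"
proof (cases "nonzero_part n S = {}")
  case False
  let ?P = "nonzero_part n S"
  have sub: "insert (zeros n) ?P \<subseteq> bits n" using zeros_in_bits by (auto simp: nonzero_part_def)
  have z: "zeros n \<notin> ?P" by (simp add: nonzero_part_def)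
  have c: "real (card ?P) > 0" using False finite_nonzero_part by (simp add: card_gt_0_iff)
  have "(\<Sum>a\<in>bits n. (reflector n S a)\<^sup>2) = (\<Sum>a\<in>insert (zeros n) ?P. (reflector n S a)\<^sup>2)"
    by (rule sum.mono_neutral_right[OF finite_bits sub]) (use False in \<open>auto simp: reflector_def\<close>)
  also have "\<dots> = 1 + (\<Sum>a\<in>?P. 1 / card ?P)"
    using z False finite_nonzero_part
  proof (subst sum.insert)
    have "(reflector n S a)\<^sup>2 = 1 / card ?P" if "a \<in> ?P" for a
      using that z False by (auto simp: reflector_def power_divide)
    then show "(reflector n S (zeros n))\<^sup>2 + (\<Sum>a\<in>?P. (reflector n S a)\<^sup>2) = 1 + (\<Sum>a\<in>?P. 1 / card ?P)"
      using False by (simp add: reflector_def)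
  qed auto
  also have "\<dots> = 2" using c by simp
  finally show ?thesis using False by simp
qed (simp add: reflector_def)

lemma sum_bits_append:
  assumes "w \<in> bits n"
  shows "(\<Sum>z\<in>bits (m + n). if drop m z = w then g z else 0) = (\<Sum>a\<in>bits m. g (a @ w))"
proof -
  have "(\<Sum>z\<in>bits (m + n). if drop m z = w then g z else 0) = (\<Sum>z\<in>{z\<in>bits (m + n). drop m z = w}. g z)"
    by (simp add: sum.inter_filter finite_bits)
  also have "\<dots> = (\<Sum>a\<in>bits m. g (a @ w))"
  proof (rule sum.reindex_bij_witness[where i = "\<lambda>a. a @ w" and j = "take m"])
    fix z assume z: "z \<in> {z \<in> bits (m + n). drop m z = w}"
    then show "take m z @ w = z" using append_take_drop_id[of m z] by simp
    then show "g (take m z @ w) = g z" by simp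
    show "take m z \<in> bits m" using z by (simp add: bits_def)
  qed (use assms in \<open>auto simp: bits_def\<close>)
  finally show ?thesis .
qed

lemma oracle_entry_sym: "oracle_entry A n x y = oracle_entry A n y x"
  by (auto simp: oracle_entry_def)

lemma oracle_entry_square:
  assumes "x \<in> bits (4 * n)" "y \<in> bits (4 * n)"
  shows "(\<Sum>z\<in>bits (4 * n). oracle_entry A n x z * oracle_entry A n z y) = of_bool (x = y)"
proof (cases "drop (3 * n) x = drop (3 * n) y")
  case True
  define w where "w = drop (3 * n) x"
  define r where "r = reflector (3 * n) (A w)"
  define x1 where "x1 = take (3 * n) x"
  define y1 where "y1 = take (3 * n) y"
  have w: "w \<in> bits n" using assms by (simp add: w_def bits_def)
  have x: "x = x1 @ w" and y: "y = y1 @ w"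
    using append_take_drop_id[of "3 * n" x] append_take_drop_id[of "3 * n" y] True
    by (simp_all add: x1_def y1_def w_def)
  have x1: "x1 \<in> bits (3 * n)" and y1: "y1 \<in> bits (3 * n)"
    using assms by (simp_all add: x1_def y1_def bits_def)
  have n: "4 * n = 3 * n + n" by simp
  have "(\<Sum>z\<in>bits (4 * n). oracle_entry A n x z * oracle_entry A n z y) =
    (\<Sum>z\<in>bits (3 * n + n). if drop (3 * n) z = w then oracle_entry A n x z * oracle_entry A n z y else 0)"
    unfolding n[symmetric] using True by (intro sum.cong) (auto simp: oracle_entry_def w_def)
  also have "\<dots> = (\<Sum>a\<in>bits (3 * n). oracle_entry A n x (a @ w) * oracle_entry A n (a @ w) y)"
    by (rule sum_bits_append[OF w])
  also have "\<dots> = (\<Sum>a\<in>bits (3 * n). (of_bool (x1 = a) - r x1 * r a) * (of_bool (a = y1) - r a * r y1))"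
    using x1 y1 by (intro sum.cong) (auto simp: oracle_entry_def x y r_def bits_def)
  also have "\<dots> = (\<Sum>a\<in>bits (3 * n). of_bool (x1 = a) * of_bool (a = y1)) -
     (\<Sum>a\<in>bits (3 * n). of_bool (a = x1) * (r a * r y1)) - (\<Sum>a\<in>bits (3 * n). of_bool (a = y1) * (r x1 * r a))
     + r x1 * r y1 * (\<Sum>a\<in>bits (3 * n). (r a)\<^sup>2)"
  proof -
    have "(of_bool (x1 = a) - r x1 * r a) * (of_bool (a = y1) - r a * r y1) =
      of_bool (x1 = a) * of_bool (a = y1) - of_bool (a = x1) * (r a * r y1) - of_bool (a = y1) * (r x1 * r a)
      + r x1 * r y1 * (r a)\<^sup>2" for a
      by (cases "a = x1"; cases "a = y1") (simp_all add: power2_eq_square algebra_simps)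
    then show ?thesis by (simp only: sum.distrib sum_subtractf sum_distrib_left)
  qed
  also have "\<dots> = of_bool (x1 = y1) - 2 * (r x1 * r y1) + r x1 * r y1 * (\<Sum>a\<in>bits (3 * n). (r a)\<^sup>2)"
  proof -
    have "(\<Sum>a\<in>bits (3 * n). of_bool (a = b) * g a) = g b" if "b \<in> bits (3 * n)" for b and g :: "_ \<Rightarrow> real"
      using that finite_bits by (simp add: of_bool_def if_distrib[of "\<lambda>c. c * _"] sum.delta cong: if_cong)
    from this[OF x1, of "\<lambda>a. of_bool (a = y1)"] this[OF x1, of "\<lambda>a. r a * r y1"] this[OF y1, of "\<lambda>a. r x1 * r a"]
    show ?thesis by (simp add: eq_commute[of x1])
  qed
  also have "\<dots> = of_bool (x = y)"
    unfolding r_def sum_reflector_sq by (simp add: x y) (simp add: reflector_def)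
  finally show ?thesis .
next
  case False
  then have "oracle_entry A n x z * oracle_entry A n z y = 0" for z by (auto simp: oracle_entry_def)
  then show ?thesis using False by auto
qed

lemma oracle_mat_index:
  assumes "x \<in> bits (4 * n)" "y \<in> bits (4 * n)"
  shows "oracle_mat A n $$ (basis_index x, basis_index y) = complex_of_real (oracle_entry A n x y)"
proof -
  have "basis_index z < 2 ^ (4 * n)" "inv_into (bits (4 * n)) basis_index (basis_index z) = z"
    if "z \<in> bits (4 * n)" for z
    using basis_index_bij[of "4 * n"] that by (auto simp: bij_betw_def)
  with assms show ?thesis by (simp add: oracle_mat_def)
qed

lemma oracle_mat_real_symmetric:
  "transpose_mat (oracle_mat A n) = oracle_mat A n" "map_mat cnj (oracle_mat A n) = oracle_mat A n"
  by (auto intro!: eq_matI simp: oracle_mat_def oracle_entry_sym)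

lemma unitary_oracle_mat: "unitary (2 ^ (4 * n)) (oracle_mat A n)"
proof (rule unitaryI)
  let ?d = "2 ^ (4 * n) :: nat" and ?b = "inv_into (bits (4 * n)) basis_index"
  show c: "oracle_mat A n \<in> carrier_mat ?d ?d" by (simp add: oracle_mat_def)
  have b: "?b i \<in> bits (4 * n)" "basis_index (?b i) = i" if "i < ?d" for i
  proof -
    have "i \<in> basis_index ` bits (4 * n)" using that basis_index_bij[of "4 * n"] by (simp add: bij_betw_def)
    then show "?b i \<in> bits (4 * n)" "basis_index (?b i) = i" by (rule inv_into_into, rule f_inv_into_f)
  qed
  have "(oracle_mat A n * oracle_mat A n) $$ (i, j) = 1\<^sub>m ?d $$ (i, j)" if ij: "i < ?d" "j < ?d" for i j
  proof -
    let ?M = "oracle_mat A n"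
    have "(?M * ?M) $$ (i, j) = (\<Sum>k<?d. ?M $$ (i, k) * ?M $$ (k, j))"
      using c ij by (auto simp: scalar_prod_def atLeast0LessThan intro!: sum.cong)
    also have "\<dots> = (\<Sum>z\<in>bits (4 * n). ?M $$ (i, basis_index z) * ?M $$ (basis_index z, j))"
      by (rule sum.reindex_bij_betw[OF basis_index_bij, symmetric])
    also have "\<dots> = (\<Sum>z\<in>bits (4 * n). complex_of_real (oracle_entry A n (?b i) z * oracle_entry A n z (?b j)))"
      using oracle_mat_index[OF b(1)[OF ij(1)], of _ A] oracle_mat_index[OF _ b(1)[OF ij(2)], of _ A] b(2) ij
      by (intro sum.cong) simp_all
    also have "\<dots> = complex_of_real (\<Sum>z\<in>bits (4 * n). oracle_entry A n (?b i) z * oracle_entry A n z (?b j))"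
      by (rule of_real_sum[symmetric])
    also have "\<dots> = of_bool (?b i = ?b j)"
      unfolding oracle_entry_square[OF b(1)[OF ij(1)] b(1)[OF ij(2)], of A] by simp
    also have "?b i = ?b j \<longleftrightarrow> i = j" using b(2) ij by metis
    finally show ?thesis using ij by simp
  qed
  then show "mat_adjoint (oracle_mat A n) * oracle_mat A n = 1\<^sub>m ?d"
    unfolding mat_adjoint_eq oracle_mat_real_symmetric using c by (intro eq_matI) auto
qed

lemma unitary_one: "unitary d (1\<^sub>m d)"
  by (rule unitaryI) (auto simp: mat_adjoint_eq map_mat_cnj_one)

lemma unitary_reflection_oracle: "unitary_oracle (reflection_oracle A)"
  unfolding unitary_oracle_def
proof
  fix k
  have two: "i < 2 \<longleftrightarrow> i = 0 \<or> i = 1" for i :: nat by auto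
  have "unitary 2 (mat_of_rows_list 2 [[0, 1], [1, 0]])"
    by (rule unitaryI) (auto simp: mat_adjoint_eq mat_of_rows_list_def scalar_prod_def two intro!: eq_matI)
  moreover have "unitary (2 ^ k) (oracle_mat A (k div 4))" if "4 dvd k"
    using unitary_oracle_mat[of "k div 4" A] that by (simp only: dvd_mult_div_cancel)
  ultimately show "unitary (2 ^ k) (reflection_oracle A k)"
    using unitary_one by (simp add: reflection_oracle_def)
qed

text \<open>Access to inverse, conjugate and transpose is no additional power.\<close>

lemma oracle_variant: "variant_mat v (reflection_oracle A k) = reflection_oracle A k"
proof -
  have two: "i < 2 \<longleftrightarrow> i = 0 \<or> i = 1" for i :: nat by auto
  let ?X = "mat_of_rows_list 2 [[0, 1], [1, 0]] :: complex mat"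
  have "transpose_mat ?X = ?X" "map_mat cnj ?X = ?X"
    by (rule eq_matI; auto simp: mat_of_rows_list_def less_Suc_eq numeral_2_eq_2)+
  then have "transpose_mat (reflection_oracle A k) = reflection_oracle A k"
    "map_mat cnj (reflection_oracle A k) = reflection_oracle A k"
    using oracle_mat_real_symmetric[of A "k div 4"]
    by (simp_all add: reflection_oracle_def map_mat_cnj_one)
  then show ?thesis by (cases v) (simp_all add: mat_adjoint_eq)
qed

subsection \<open>The action of a query\<close>

lemma agree_off_self: "x \<in> agree_off qs x"
  by (auto simp: agree_off_def bits_def)

lemma finite_agree_off: "finite (agree_off qs x)"
  by (rule finite_subset[OF _ finite_bits[of "length x"]]) (auto simp: agree_off_def)

lemma agree_off_length: "y \<in> agree_off qs x \<Longrightarrow> length y = length x"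
  by (simp add: agree_off_def bits_def)

lemma agree_off_sym: "x \<in> agree_off qs y \<longleftrightarrow> y \<in> agree_off qs x"
  by (auto simp: agree_off_def bits_def)

text \<open>
  The contents of the answer and query registers among the queried qubits \<open>qs\<close>; the block consists of all basis states that differ from \<open>x\<close> in the answer register only.
\<close>

definition answer_reg :: "nat list \<Rightarrow> bool list \<Rightarrow> bool list" where
  "answer_reg qs x = map ((!) x) (take (3 * (length qs div 4)) qs)"

definition query_reg :: "nat list \<Rightarrow> bool list \<Rightarrow> bool list" where
  "query_reg qs x = map ((!) x) (drop (3 * (length qs div 4)) qs)"

definition answer_block :: "nat list \<Rightarrow> bool list \<Rightarrow> bool list set" where
  "answer_block qs x = agree_off (take (3 * (length qs div 4)) qs) x"

text \<open>The state of the control qubit, if there is one.\<close>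

fun control :: "nat option \<Rightarrow> bool list \<Rightarrow> bool" where
  "control None x = True"
| "control (Some q) x = x ! q"

lemma agree_off_inj:
  assumes "distinct qs" "set qs \<subseteq> {..<length x}" "y \<in> agree_off qs x" "z \<in> agree_off qs x"
    "map ((!) y) qs = map ((!) z) qs"
  shows "y = z"
  using inj_onD[OF bij_betw_imp_inj_on[OF agree_off_bij[OF assms(1,2)]] assms(5,3,4)] .

lemma agree_off_drop:
  assumes "distinct qs" "set qs \<subseteq> {..<length x}"
  shows "{y \<in> agree_off qs x. map ((!) y) (drop m qs) = map ((!) x) (drop m qs)} = agree_off (take m qs) x"
proof -
  have un: "set qs = set (take m qs) \<union> set (drop m qs)"
    using set_append[of "take m qs" "drop m qs"] by simp
  have disj: "set (take m qs) \<inter> set (drop m qs) = {}"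
    using assms(1) by (rule set_take_disj_set_drop_if_distinct) simp
  have bd: "i < length x" if "i \<in> set (drop m qs)" for i using that un assms(2) by blast
  show ?thesis
    unfolding agree_off_def map_eq_conv un using disj bd by blast
qed

lemma apply_on_oracle_mat:
  assumes qs: "distinct qs" "set qs \<subseteq> {..<length x}" "length qs = 4 * n"
  shows "apply_on (oracle_mat A n) qs \<psi> x = \<psi> x -
    complex_of_real (reflector (3 * n) (A (query_reg qs x)) (answer_reg qs x)) *
      (\<Sum>y\<in>answer_block qs x. complex_of_real (reflector (3 * n) (A (query_reg qs x)) (answer_reg qs y)) * \<psi> y)"
proof -
  let ?m = "\<lambda>y. map ((!) y) qs"
  let ?v = "reflector (3 * n) (A (query_reg qs x))"
  have n: "length qs div 4 = n" using qs(3) by simp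
  have m: "?m y \<in> bits (4 * n)" for y using qs(3) by (simp add: bits_def)
  have reg: "drop (3 * n) (?m y) = query_reg qs y" "take (3 * n) (?m y) = answer_reg qs y" for y
    by (simp_all add: query_reg_def answer_reg_def n take_map drop_map)
  have block: "answer_block qs x = {y \<in> agree_off qs x. query_reg qs y = query_reg qs x}"
    unfolding answer_block_def n query_reg_def using agree_off_drop[OF qs(1,2)] by simp
  have "apply_on (oracle_mat A n) qs \<psi> x = (\<Sum>y\<in>agree_off qs x. complex_of_real (oracle_entry A n (?m x) (?m y)) * \<psi> y)"
    by (simp add: apply_on_def oracle_mat_index m)
  also have "\<dots> = (\<Sum>y\<in>answer_block qs x. complex_of_real (oracle_entry A n (?m x) (?m y)) * \<psi> y)"
    unfolding block by (rule sum.mono_neutral_right) (auto simp: finite_agree_off oracle_entry_def reg)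
  also have "\<dots> = (\<Sum>y\<in>answer_block qs x. (if y = x then \<psi> y else 0) -
      complex_of_real (?v (answer_reg qs x)) * (complex_of_real (?v (answer_reg qs y)) * \<psi> y))"
  proof (rule sum.cong[OF refl])
    fix y assume y: "y \<in> answer_block qs x"
    then have wy: "query_reg qs y = query_reg qs x" and "y \<in> agree_off qs x" unfolding block by simp_all
    then have eq: "(?m x = ?m y) = (y = x)"
      using agree_off_inj[OF qs(1,2) agree_off_self, of y] by blast
    show "complex_of_real (oracle_entry A n (?m x) (?m y)) * \<psi> y = (if y = x then \<psi> y else 0) -
      complex_of_real (?v (answer_reg qs x)) * (complex_of_real (?v (answer_reg qs y)) * \<psi> y)"
      unfolding oracle_entry_def reg wy eq by (simp add: left_diff_distrib mult.assoc)
  qed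
  also have "\<dots> = (\<Sum>y\<in>answer_block qs x. if y = x then \<psi> y else 0) - complex_of_real (?v (answer_reg qs x)) *
      (\<Sum>y\<in>answer_block qs x. complex_of_real (?v (answer_reg qs y)) * \<psi> y)"
    unfolding sum_subtractf sum_distrib_left ..
  also have "(\<Sum>y\<in>answer_block qs x. if y = x then \<psi> y else 0) = \<psi> x"
    unfolding answer_block_def using finite_agree_off agree_off_self by simp
  finally show ?thesis .
qed

lemma basis_index_Cons: "basis_index (b # z) = of_bool b * 2 ^ length z + basis_index z"
  by (simp add: basis_index_def horner_sum_append)

lemma apply_on_controlled:
  assumes q: "distinct (q # qs)" "set (q # qs) \<subseteq> {..<length x}" and M: "M \<in> carrier_mat (2 ^ length qs) (2 ^ length qs)"
  shows "apply_on (controlled M) (q # qs) \<psi> x = (if x ! q then apply_on M qs \<psi> x else \<psi> x)"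
proof -
  let ?d = "2 ^ length qs :: nat"
  have bi: "basis_index (map ((!) y) qs) < ?d" for y
    using basis_index_bij[of "length qs"] by (auto simp: bij_betw_def bits_def)
  let ?e = "\<lambda>y. controlled M $$ (basis_index (map ((!) x) (q # qs)), basis_index (map ((!) y) (q # qs)))"
  have e: "?e y = (if y ! q \<noteq> x ! q then 0
      else if x ! q then M $$ (basis_index (map ((!) x) qs), basis_index (map ((!) y) qs))
      else of_bool (map ((!) x) qs = map ((!) y) qs))" for y
  proof -
    have "basis_index (map ((!) x) qs) = basis_index (map ((!) y) qs) \<longleftrightarrow> map ((!) x) qs = map ((!) y) qs"
      by (rule inj_on_eq_iff[OF bij_betw_imp_inj_on[OF basis_index_bij[of "length qs"]]]) (simp_all add: bits_def)
    then show ?thesis using bi[of x] bi[of y] M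
      by (auto simp: controlled_def Let_def basis_index_Cons simp del: map_eq_conv)
  qed
  have block: "{y \<in> agree_off (q # qs) x. y ! q = x ! q} = agree_off qs x"
    using q by (auto simp: agree_off_def)
  have "apply_on (controlled M) (q # qs) \<psi> x = (\<Sum>y\<in>agree_off (q # qs) x. ?e y * \<psi> y)"
    by (simp only: apply_on_def)
  also have "\<dots> = (\<Sum>y\<in>agree_off qs x. ?e y * \<psi> y)"
    unfolding block[symmetric]
    by (rule sum.mono_neutral_right) (auto simp: finite_agree_off e simp del: list.map)
  also have "\<dots> = (if x ! q then apply_on M qs \<psi> x else \<psi> x)"
  proof (cases "x ! q")
    case True
    have "y ! q = x ! q" if "y \<in> agree_off qs x" for y using that block by auto
    then show ?thesis using True by (auto simp: e apply_on_def simp del: list.map intro!: sum.cong)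
  next
    case False
    have "?e y * \<psi> y = (if y = x then \<psi> y else 0)" if y: "y \<in> agree_off qs x" for y
    proof -
      have "y ! q = x ! q" using y block by auto
      moreover have "map ((!) x) qs = map ((!) y) qs \<longleftrightarrow> y = x"
        using agree_off_inj[of qs x x y] y q agree_off_self by auto
      ultimately show ?thesis using False by (auto simp: e simp del: list.map map_eq_conv)
    qed
    then have "(\<Sum>y\<in>agree_off qs x. ?e y * \<psi> y) = (\<Sum>y\<in>agree_off qs x. if y = x then \<psi> y else 0)"
      by (intro sum.cong) auto
    then show ?thesis using False agree_off_self finite_agree_off by simp
  qed
  finally show ?thesis .
qed

text \<open>The action of a gate relative to the reflection oracle for \<open>A\<close>.\<close>

definition act :: "answers \<Rightarrow> gate \<Rightarrow> state \<Rightarrow> state" where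
  "act A g = apply_on (gate_mat (reflection_oracle A) g) (gate_qubits g)"

text \<open>The reflection that a query performs on the block of a basis state \<open>x\<close>.\<close>

lemma act_query:
  assumes "distinct (gate_qubits (Query c v qs))" "set (gate_qubits (Query c v qs)) \<subseteq> {..<length x}"
    "length qs = 4 * n"
  shows "act A (Query c v qs) \<psi> x = (if control c x then \<psi> x -
    complex_of_real (reflector (3 * n) (A (query_reg qs x)) (answer_reg qs x)) *
      (\<Sum>y\<in>answer_block qs x. complex_of_real (reflector (3 * n) (A (query_reg qs x)) (answer_reg qs y)) * \<psi> y)
    else \<psi> x)"
proof -
  have mat: "variant_mat v (reflection_oracle A (4 * n)) = oracle_mat A n"
    using oracle_variant[of v A "4 * n"] by (simp add: reflection_oracle_def)
  have car: "oracle_mat A n \<in> carrier_mat (2 ^ length qs) (2 ^ length qs)"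
    using unitary_oracle_mat[of n A] assms(3) by (simp add: unitary_def)
  show ?thesis
  proof (cases c)
    case None
    then show ?thesis using apply_on_oracle_mat[of qs x n A \<psi>] assms by (simp add: act_def mat)
  next
    case (Some q)
    then show ?thesis using apply_on_controlled[of q qs x "oracle_mat A n" \<psi>] apply_on_oracle_mat[of qs x n A \<psi>] assms car
      by (simp add: act_def mat)
  qed
qed

text \<open>Gates that query nothing do not depend on \<open>A\<close>.\<close>

lemma act_other:
  assumes "\<And>c v qs. g = Query c v qs \<Longrightarrow> \<not> 4 dvd length qs \<or> length qs = 0"
  shows "act A g = act B g"
proof (cases g)
  case (Query c v qs)
  have "oracle_mat A 0 = oracle_mat B 0"
  proof -
    have "nonzero_part 0 S = {}" for S by (auto simp: nonzero_part_def bits_def zeros_def)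
    then show ?thesis by (simp add: oracle_mat_def oracle_entry_def reflector_def cong: if_cong)
  qed
  then have "reflection_oracle A (length qs) = reflection_oracle B (length qs)"
    using assms[OF Query] by (auto simp: reflection_oracle_def)
  then show ?thesis using Query by (cases c) (auto simp: act_def)
qed (simp_all add: act_def)

subsection \<open>Running the loader\<close>

text \<open>The basis state \<open>b\<close>.\<close>

definition ket :: "bool list \<Rightarrow> state" where
  "ket b x = (if x = b then 1 else 0)"

lemma apply_on_ket:
  "apply_on M qs (ket b) x = (if x \<in> agree_off qs b
     then M $$ (basis_index (map ((!) x) qs), basis_index (map ((!) b) qs)) else 0)"
proof -
  have "apply_on M qs (ket b) x = (\<Sum>y\<in>agree_off qs x. if y = b
      then M $$ (basis_index (map ((!) x) qs), basis_index (map ((!) b) qs)) else 0)"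
    unfolding apply_on_def ket_def by (rule sum.cong) auto
  then show ?thesis using finite_agree_off by (simp add: agree_off_sym[of b])
qed

lemma basis_index_single: "basis_index [c] = of_bool c"
  by (simp add: basis_index_def)

lemma agree_off_single:
  assumes "q < length b" "x \<in> agree_off [q] b" shows "x = b[q := x ! q]"
  using assms by (intro nth_equalityI) (auto simp: agree_off_def bits_def nth_list_update)

lemma act_flip:
  assumes "q < length b" "\<not> b ! q"
  shows "act A (Query None Forward [q]) (ket b) = ket (b[q := True])"
proof
  fix x
  have "x \<in> agree_off [q] b \<and> x ! q \<longleftrightarrow> x = b[q := True]"
  proof
    assume "x \<in> agree_off [q] b \<and> x ! q"
    then show "x = b[q := True]" using agree_off_single[OF assms(1), of x] by simp
  qed (use assms in \<open>auto simp: agree_off_def bits_def\<close>)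
  then show "act A (Query None Forward [q]) (ket b) x = ket (b[q := True]) x"
    using assms(2) by (auto simp: act_def apply_on_ket reflection_oracle_def basis_index_single
        mat_of_rows_list_def ket_def)
qed

lemma act_phase:
  assumes "q < length b" "\<not> b ! q"
  shows "act A (Phase_T q) (ket b) = ket b"
proof
  fix x
  have "x \<in> agree_off [q] b \<and> \<not> x ! q \<longleftrightarrow> x = b"
  proof
    assume "x \<in> agree_off [q] b \<and> \<not> x ! q"
    then show "x = b" using agree_off_single[OF assms(1), of x] list_update_id[of b q] assms(2) by simp
  qed (use assms agree_off_self in auto)
  then show "act A (Phase_T q) (ket b) x = ket b x"
    using assms(2) by (auto simp: act_def apply_on_ket basis_index_single mat_of_rows_list_def ket_def)
qed

lemma final_state_act: "final_state (reflection_oracle A) C = fold (act A) (gates C) (initial_state (width C))"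
proof -
  have "act A = (\<lambda>g. apply_on (gate_mat (reflection_oracle A) g) (gate_qubits g))"
    by (rule ext) (simp add: act_def)
  then show ?thesis by (simp add: final_state_def)
qed

lemma loader_loads:
  assumes "k \<le> length w"
  shows "fold (act A) (map (\<lambda>i. if w ! i then Query None Forward [3 * length w + i] else Phase_T (3 * length w + i))
      [0..<k]) (initial_state (4 * length w)) = ket (zeros (3 * length w) @ take k w @ zeros (length w - k))"
  using assms
proof (induction k)
  case 0
  show ?case by (auto simp: initial_state_def ket_def zeros_def replicate_add[symmetric])
next
  case (Suc k)
  let ?b = "zeros (3 * length w) @ take k w @ zeros (length w - k)"
  let ?q = "3 * length w + k"
  have z: "zeros (length w - k) = False # zeros (length w - Suc k)"
    using Suc.prems by (simp add: zeros_def Suc_diff_Suc[symmetric])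
  have q: "?q < length ?b" "\<not> ?b ! ?q"
    using Suc.prems by (simp_all add: zeros_def nth_append)
  have upd: "?b[?q := w ! k] = zeros (3 * length w) @ take (Suc k) w @ zeros (length w - Suc k)"
    using Suc.prems by (simp add: z list_update_append take_Suc_conv_app_nth) (simp add: zeros_def)
  have "?b[?q := False] = ?b" using q list_update_id[of ?b ?q] by simp
  then show ?case using Suc upd act_flip[OF q, of A] act_phase[OF q, of A] by (cases "w ! k") auto
qed

text \<open>The outcomes on the answer register when it starts in 0.\<close>

definition measured_answers :: "answers \<Rightarrow> bool list \<Rightarrow> bool list set" where
  "measured_answers A w = (let P = nonzero_part (3 * length w) (A w) in
     if P = {} then {zeros (3 * length w)} else P)"

lemma measured_answers_finite: "finite (measured_answers A w)" "measured_answers A w \<noteq> {}"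
  "measured_answers A w \<subseteq> bits (3 * length w)"
  using finite_nonzero_part zeros_in_bits by (auto simp: measured_answers_def Let_def nonzero_part_def)

lemma valid_loader: "valid_circuit (loader w)"
  using QPT_loader[of UNIV] by (simp add: QPT_def)

lemma final_state_loader:
  assumes x: "x \<in> bits (4 * length w)"
  shows "(cmod (final_state (reflection_oracle A) (loader w) x))\<^sup>2 =
    (if drop (3 * length w) x = w \<and> take (3 * length w) x \<in> measured_answers A w
     then 1 / card (measured_answers A w) else 0)"
proof -
  let ?n = "length w" and ?qs = "[0..<4 * length w]" and ?z = "zeros (3 * length w)"
  let ?b = "?z @ w"
  define r where "r = reflector (3 * ?n) (A w)"
  have len: "length x = 4 * ?n" using x by (simp add: bits_def)
  have m: "map ((!) y) ?qs = y" if "length y = 4 * ?n" for y using map_nth[of y] that by simp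
  have reg: "query_reg ?qs y = drop (3 * ?n) y" "answer_reg ?qs y = take (3 * ?n) y" if "length y = 4 * ?n" for y
    unfolding query_reg_def answer_reg_def take_map[symmetric] drop_map[symmetric] m[OF that] by simp_all
  have b: "length ?b = 4 * ?n" by (simp add: zeros_def)
  have block: "?b \<in> answer_block ?qs x \<longleftrightarrow> drop (3 * ?n) x = w"
  proof -
    have "?b \<in> answer_block ?qs x \<longleftrightarrow> (\<forall>i<4 * ?n. \<not> i < 3 * ?n \<longrightarrow> ?b ! i = x ! i)"
    proof -
      have "answer_block ?qs x = agree_off [0..<3 * ?n] x" by (simp add: answer_block_def)
      then show ?thesis unfolding agree_off_def bits_def using len b by simp
    qed
    also have "\<dots> \<longleftrightarrow> (\<forall>j<?n. w ! j = x ! (3 * ?n + j))"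
    proof
      assume *: "\<forall>i<4 * ?n. \<not> i < 3 * ?n \<longrightarrow> ?b ! i = x ! i"
      show "\<forall>j<?n. w ! j = x ! (3 * ?n + j)"
      proof (intro allI impI)
        fix j assume "j < ?n"
        then show "w ! j = x ! (3 * ?n + j)" using *[rule_format, of "3 * ?n + j"] by (simp add: nth_append zeros_def)
      qed
    next
      assume *: "\<forall>j<?n. w ! j = x ! (3 * ?n + j)"
      show "\<forall>i<4 * ?n. \<not> i < 3 * ?n \<longrightarrow> ?b ! i = x ! i"
      proof (intro allI impI)
        fix i assume "i < 4 * ?n" "\<not> i < 3 * ?n"
        then show "?b ! i = x ! i" using *[rule_format, of "i - 3 * ?n"] by (simp add: nth_append zeros_def)
      qed
    qed
    also have "\<dots> \<longleftrightarrow> drop (3 * ?n) x = w"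
    proof
      assume *: "\<forall>j<?n. w ! j = x ! (3 * ?n + j)"
      show "drop (3 * ?n) x = w" by (rule nth_equalityI) (use len * in simp_all)
    next
      assume *: "drop (3 * ?n) x = w"
      have "drop (3 * ?n) x ! j = x ! (3 * ?n + j)" if "j < ?n" for j using len that by simp
      then show "\<forall>j<?n. w ! j = x ! (3 * ?n + j)" unfolding * by simp
    qed
    finally show ?thesis .
  qed
  have "final_state (reflection_oracle A) (loader w) = act A (Query None Forward ?qs) (ket ?b)"
    using loader_loads[of ?n w A] by (simp add: final_state_act loader_def) (simp add: zeros_def)
  then have "final_state (reflection_oracle A) (loader w) x = ket ?b x -
     complex_of_real (reflector (3 * ?n) (A (drop (3 * ?n) x)) (take (3 * ?n) x)) *
      (\<Sum>y\<in>answer_block ?qs x. complex_of_real (reflector (3 * ?n) (A (drop (3 * ?n) x)) (answer_reg ?qs y)) * ket ?b y)"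
    using act_query[of None Forward ?qs x ?n A "ket ?b"] len by (simp add: reg atLeast0LessThan)
  also have "(\<Sum>y\<in>answer_block ?qs x. complex_of_real (reflector (3 * ?n) (A (drop (3 * ?n) x)) (answer_reg ?qs y)) * ket ?b y)
    = (\<Sum>y\<in>answer_block ?qs x. if y = ?b then complex_of_real (reflector (3 * ?n) (A (drop (3 * ?n) x)) (answer_reg ?qs ?b)) else 0)"
    by (rule sum.cong) (auto simp: ket_def)
  also have "\<dots> = (if drop (3 * ?n) x = w then complex_of_real (r ?z) else 0)"
  proof -
    have "answer_reg ?qs ?b = ?z" using reg(2)[OF b] by (simp add: zeros_def)
    then show ?thesis using block finite_agree_off by (simp add: answer_block_def r_def)
  qed
  finally have fin: "final_state (reflection_oracle A) (loader w) x = ket ?b x -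
     complex_of_real (reflector (3 * ?n) (A (drop (3 * ?n) x)) (take (3 * ?n) x)) *
     (if drop (3 * ?n) x = w then complex_of_real (r ?z) else 0)" .
  show ?thesis
  proof (cases "drop (3 * ?n) x = w")
    case False
    then have "x \<noteq> ?b" by (auto simp: zeros_def)
    then show ?thesis using False fin by (simp add: ket_def)
  next
    case True
    let ?a = "take (3 * ?n) x" and ?P = "nonzero_part (3 * ?n) (A w)"
    have "x = ?b \<longleftrightarrow> ?a = ?z"
      using True append_take_drop_id[of "3 * ?n" x] by (auto simp: zeros_def)
    then have f: "final_state (reflection_oracle A) (loader w) x = complex_of_real (of_bool (?a = ?z) - r ?a * r ?z)"
      using True fin by (simp add: ket_def r_def)
    have z: "?z \<notin> ?P" by (simp add: nonzero_part_def)
    show ?thesis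
    proof (cases "?P = {}")
      case True
      then show ?thesis using f \<open>drop (3 * ?n) x = w\<close> by (auto simp: r_def reflector_def measured_answers_def)
    next
      case False
      then have "real (card ?P) > 0" using finite_nonzero_part by (simp add: card_gt_0_iff)
      then have c: "(1 / sqrt (real (card ?P)))\<^sup>2 = 1 / real (card ?P)" by (simp add: power_divide)
      have M: "measured_answers A w = ?P" using False by (simp add: measured_answers_def)
      have rz: "r ?z = 1" using False by (simp add: r_def reflector_def)
      have ra: "r ?a = (if ?a = ?z then 1 else if ?a \<in> ?P then - 1 / sqrt (real (card ?P)) else 0)"
        using False by (simp add: r_def reflector_def)
      have "(of_bool (?a = ?z) - r ?a * r ?z)\<^sup>2 = (if ?a \<in> ?P then 1 / real (card ?P) else 0)"
        unfolding rz ra using z c by (cases "?a = ?z") simp_all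
      then have "(cmod (final_state (reflection_oracle A) (loader w) x))\<^sup>2 =
          (if ?a \<in> ?P then 1 / real (card ?P) else 0)"
        unfolding f norm_of_real power2_abs .
      then show ?thesis using \<open>drop (3 * ?n) x = w\<close> M by simp
    qed
  qed
qed

text \<open>
  The loader returns a uniformly random answer to its input, followed by the input.
\<close>

lemma measure_loader:
  "measure_all (reflection_oracle A) (loader w) =
    map_pmf (\<lambda>a. a @ w) (pmf_of_set (measured_answers A w))"
proof (rule pmf_eqI)
  fix x
  let ?S = "measured_answers A w"
  have card: "card ?S > 0" using measured_answers_finite by (simp add: card_gt_0_iff)
  have inj: "inj (\<lambda>a. a @ w)" by (simp add: inj_on_def)
  have r: "pmf (map_pmf (\<lambda>a. a @ w) (pmf_of_set ?S)) x =
     (if drop (3 * length w) x = w \<and> take (3 * length w) x \<in> ?S then 1 / card ?S else 0)"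
  proof (cases "\<exists>a\<in>?S. x = a @ w")
    case True
    then obtain a where a: "a \<in> ?S" "x = a @ w" by blast
    have "pmf (map_pmf (\<lambda>a. a @ w) (pmf_of_set ?S)) x = pmf (pmf_of_set ?S) a"
      unfolding a(2) by (rule pmf_map_inj'[OF inj])
    moreover have "length a = 3 * length w" using a(1) measured_answers_finite(3) by (auto simp: bits_def)
    ultimately show ?thesis using a measured_answers_finite by (simp add: pmf_of_set)
  next
    case False
    then have "x \<notin> set_pmf (map_pmf (\<lambda>a. a @ w) (pmf_of_set ?S))"
      using measured_answers_finite by (simp add: set_pmf_of_set image_iff)
    then have "pmf (map_pmf (\<lambda>a. a @ w) (pmf_of_set ?S)) x = 0" by (simp add: set_pmf_iff del: set_map_pmf)
    moreover have "\<not> (drop (3 * length w) x = w \<and> take (3 * length w) x \<in> ?S)"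
      using False append_take_drop_id[of "3 * length w" x] by metis
    ultimately show ?thesis by (simp only: if_not_P if_False)
  qed
  have w: "width (loader w) = 4 * length w" by (simp add: loader_def)
  show "pmf (measure_all (reflection_oracle A) (loader w)) x = pmf (map_pmf (\<lambda>a. a @ w) (pmf_of_set ?S)) x"
    unfolding pmf_measure_all[OF unitary_reflection_oracle valid_loader] r w
  proof (cases "x \<in> bits (4 * length w)")
    case False
    have "\<not> (drop (3 * length w) x = w \<and> take (3 * length w) x \<in> ?S)"
    proof
      assume *: "drop (3 * length w) x = w \<and> take (3 * length w) x \<in> ?S"
      then have "length (take (3 * length w) x) = 3 * length w"
        using measured_answers_finite(3)[of A w] unfolding bits_def by blast
      moreover have "length (drop (3 * length w) x) = length w" using * by simp
      ultimately have "length x = 4 * length w" by (simp add: min_def split: if_splits)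
      then show False using False by (simp add: bits_def)
    qed
    then show "(if x \<in> bits (4 * length w) then (cmod (final_state (reflection_oracle A) (loader w) x))\<^sup>2 else 0) =
      (if drop (3 * length w) x = w \<and> take (3 * length w) x \<in> ?S then 1 / card ?S else 0)"
      using False by (simp only: if_not_P if_False)
  qed (simp add: final_state_loader)
qed

subsection \<open>The three kinds of queries\<close>

lemma enc_strs_inj: "enc_strs us = enc_strs vs \<Longrightarrow> us = vs"
proof (induction us arbitrary: vs)
  case Nil
  then show ?case by (cases vs; cases "hd vs") (auto simp: enc_strs_def)
next
  case (Cons u us)
  then obtain v vs' where vs: "vs = v # vs'" by (cases vs; cases u) (auto simp: enc_strs_def)
  have "read_str (enc_str u @ enc_strs us) = read_str (enc_str v @ enc_strs vs')"
    using Cons.prems by (simp add: vs enc_strs_def)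
  then show ?case using Cons.IH[of vs'] by (simp add: vs read_str_enc_str)
qed

text \<open>All strings of length \<open>n\<close>.\<close>

definition strings :: "nat \<Rightarrow> bool list list" where
  "strings n = List.n_lists n [False, True]"

lemma set_strings: "set (strings n) = bits n"
  by (auto simp: strings_def set_n_lists bits_def)

lemma distinct_strings: "distinct (strings n)"
  by (simp add: strings_def distinct_n_lists)

text \<open>All strings of length at least \<open>a\<close> and below \<open>b\<close>.\<close>

definition coords :: "nat \<Rightarrow> nat \<Rightarrow> bool list list" where
  "coords a b = concat (map strings [a..<b])"

lemma set_coords: "set (coords a b) = {s. a \<le> length s \<and> length s < b}"
  by (auto simp: coords_def set_strings bits_def)

lemma distinct_coords: "distinct (coords a b)"
  by (induction b) (auto simp: coords_def distinct_strings set_strings bits_def)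

lemma coords_append: "a \<le> b \<Longrightarrow> b \<le> c \<Longrightarrow> coords a c = coords a b @ coords b c"
  using upt_add_eq_append[of a b "c - b"] by (simp add: coords_def)

text \<open>
  Keys are twice as long as puzzles; this pays for the union bound over sets of puzzles in \<open>attack_fails\<close>.
\<close>

definition keys :: "bool list \<Rightarrow> bool list set" where
  "keys s = bits (2 * length s)"

lemma finite_product_keys: "finite_product keys"
proof
  fix s :: "bool list"
  show "finite (keys s)" by (simp add: keys_def finite_bits)
  have "zeros (2 * length s) \<in> keys s" by (simp add: keys_def zeros_in_bits)
  then show "keys s \<noteq> {}" by blast
qed

text \<open>
  A bound on the circuits of algorithm \<open>g\<close> on all inputs \<open>(1^l, x)\<close> with \<open>x\<close> of length \<open>n\<close>.
\<close>

definition max_size :: "nat \<Rightarrow> nat \<Rightarrow> nat \<Rightarrow> nat" where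
  "max_size g l n = Max ((\<lambda>x. size_of (alg g (enc_strs [unary l, x]))) ` bits n)"

text \<open>
  The number of the bad event that belongs to \<open>g\<close>, \<open>l\<close> and \<open>n\<close>.
\<close>

definition code :: "nat \<Rightarrow> nat \<Rightarrow> nat \<Rightarrow> nat" where
  "code g l n = prod_encode (g, prod_encode (l, n))"

text \<open>
  The fourth power is that of the concentration bound \<open>output_concentration\<close>; the factor at the end makes
  the failure probabilities summable.  The constant is \<open>4 * 96 * 72000\<close>, rounded up, from
  \<open>deviating_rare\<close>.
\<close>

definition threshold :: "nat \<Rightarrow> nat \<Rightarrow> nat \<Rightarrow> nat" where
  "threshold g l n = 30000000 * (max_size g l n + 1) ^ 4 * ((code g l n + 1) * (code g l n + 2))"

text \<open>
  Unary numbers: a request is longer than its threshold, so a short query cannot contain a request with a large threshold.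
\<close>

definition request :: "nat \<Rightarrow> nat \<Rightarrow> nat \<Rightarrow> bool list" where
  "request g l n = enc_nats [g, l, n, threshold g l n]"

text \<open>The shortest length of keys that are averaged out.\<close>

definition first_hidden :: "nat \<Rightarrow> nat" where
  "first_hidden \<theta> = (LEAST k. \<theta> < 2 ^ k)"

definition pad :: "nat \<Rightarrow> bool list \<Rightarrow> bool list" where
  "pad n u = u @ zeros (n - length u)"

text \<open>Queries of length \<open>\<theta>\<close> or more have no answer.\<close>

definition shorter :: "nat \<Rightarrow> answers \<Rightarrow> answers" where
  "shorter \<theta> A w = (if length w < \<theta> then A w else {})"

lemma length_request: "length (request g l n) = g + l + n + threshold g l n + 4"
  by (simp add: request_def length_enc_nats)

lemma length_enc_str: "length (enc_str u) = 2 * length u + 1"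
  by (induction u) auto

text \<open>
  Samples, acceptance, and preimages, in this order.  All answers are self-delimiting and padded to the length of the
  answer register; the code of an acceptance is that of \<open>[True]\<close> followed by 0.  The output \<open>[True]\<close> means acceptance and is therefore never given as a preimage.
  A request whose length is that of a key for \<open>y\<close> is ignored, to keep the last two kinds apart.
  The probability in the last clause refers to the same answers, restricted to queries below the threshold
  and thus to queries shorter than \<open>w\<close>; the guard \<open>length w' < length w\<close> makes this evident.
\<close>

function answers :: "(bool list \<Rightarrow> bool list) \<Rightarrow> answers" where
  "answers f w =
    {pad (3 * length w) (enc_strs [s, f s]) | s l. w = enc_strs [unary l] \<and> s \<in> bits l} \<union>
    {pad (3 * length w) [True, True] | s k. w = enc_strs [s, k] \<and> length k = 2 * length s \<and> f s = k} \<union>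
    {pad (3 * length w) (enc_str x) | x y g l n.
       w = enc_strs [y, request g l n] \<and> length (request g l n) \<noteq> 2 * length y \<and> x \<in> bits n \<and> x \<noteq> [True] \<and>
       1 / 2 < avg keys (coords (first_hidden (threshold g l n)) (threshold g l n)) (\<lambda>f'.
         pmf (out (reflection_oracle (shorter (threshold g l n) (\<lambda>w'. if length w' < length w then answers f' w' else {})))
           (alg g) [unary l, x]) y) f}"
  by pat_completeness auto
termination
  by (relation "Wellfounded.measure (\<lambda>(f, w). length w)") auto

declare answers.simps [simp del]

lemma threshold_pos: "0 < threshold g l n"
  by (simp add: threshold_def)

lemma request_eq_iff: "request g l n = request g' l' n' \<longleftrightarrow> g = g' \<and> l = l' \<and> n = n'"
proof
  assume "request g l n = request g' l' n'"
  from enc_nats_inj[OF this[unfolded request_def]] show "g = g' \<and> l = l' \<and> n = n'" by simp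
qed simp

lemma enc_strs_eq_iff: "enc_strs us = enc_strs vs \<longleftrightarrow> us = vs"
  using enc_strs_inj by blast

lemma unary_eq_iff: "unary l = unary l' \<longleftrightarrow> l = l'"
  by (simp add: unary_def replicate_eq_replicate)

lemma length_enc_strs1: "length (enc_strs [u]) = 2 * length u + 1"
  and length_enc_strs2: "length (enc_strs [u, v]) = 2 * length u + 2 * length v + 2"
  by (simp_all add: enc_strs_def length_enc_str)

lemma answers_sample:
  "answers f (enc_strs [unary l]) = (\<lambda>s. pad (3 * (2 * l + 1)) (enc_strs [s, f s])) ` bits l"
proof -
  have len: "length (enc_strs [unary l]) = 2 * l + 1" by (simp add: length_enc_strs1 unary_def)
  show ?thesis
    by (subst answers.simps) (simp only: len enc_strs_eq_iff unary_eq_iff list.inject list.distinct simp_thms, blast)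
qed

lemma answers_verify:
  assumes "length k = 2 * length s"
  shows "answers f (enc_strs [s, k]) = (if f s = k then {pad (3 * (6 * length s + 2)) [True, True]} else {})"
  using assms by (subst answers.simps) (auto simp: enc_strs_eq_iff length_enc_strs2)

text \<open>
  The probability that algorithm \<open>g\<close> outputs \<open>y\<close> on input \<open>(1^l, x)\<close>, averaged over the hidden keys.
\<close>

definition avg_output :: "nat \<Rightarrow> nat \<Rightarrow> nat \<Rightarrow> (bool list \<Rightarrow> bool list) \<Rightarrow> bool list \<Rightarrow> bool list \<Rightarrow> real" where
  "avg_output g l n f x y =
     avg keys (coords (first_hidden (threshold g l n)) (threshold g l n)) (\<lambda>f'.
       pmf (out (reflection_oracle (shorter (threshold g l n) (answers f'))) (alg g) [unary l, x]) y) f"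

lemma answers_invert:
  assumes "length (request g l n) \<noteq> 2 * length y"
  shows "answers f (enc_strs [y, request g l n]) =
    (\<lambda>x. pad (3 * length (enc_strs [y, request g l n])) (enc_str x)) ` {x \<in> bits n. x \<noteq> [True] \<and> 1 / 2 < avg_output g l n f x y}"
proof -
  let ?w = "enc_strs [y, request g l n]" and ?t = "threshold g l n"
  have "shorter ?t (\<lambda>w'. if length w' < length ?w then answers f' w' else {}) = shorter ?t (answers f')" for f'
    by (rule ext) (simp add: shorter_def length_enc_strs2 length_request)
  then show ?thesis
    using assms
    by (subst answers.simps) (auto simp: enc_strs_eq_iff request_eq_iff avg_output_def)
qed

lemma answers_cases:
  obtains (sample) l where "w = enc_strs [unary l]"
  | (verify) s k where "w = enc_strs [s, k]" "length k = 2 * length s"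
  | (invert) y g l n where "w = enc_strs [y, request g l n]" "length (request g l n) \<noteq> 2 * length y"
  | (other) "\<And>f. answers f w = {}"
proof (cases "(\<exists>l. w = enc_strs [unary l]) \<or> (\<exists>s k. w = enc_strs [s, k] \<and> length k = 2 * length s) \<or>
   (\<exists>y g l n. w = enc_strs [y, request g l n] \<and> length (request g l n) \<noteq> 2 * length y)")
  case False
  then have "answers f w = {}" for f
    by (subst answers.simps) (simp only: Un_empty Collect_empty_eq, blast)
  then show ?thesis by (rule other)
next
  case True
  then show ?thesis
  proof (elim disjE exE conjE)
    fix l assume "w = enc_strs [unary l]" then show ?thesis by (rule sample)
  next
    fix s k assume "w = enc_strs [s, k]" "length k = 2 * length s" then show ?thesis by (rule verify)
  next
    fix y g l n assume "w = enc_strs [y, request g l n]" "length (request g l n) \<noteq> 2 * length y"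
    then show ?thesis by (rule invert)
  qed
qed

lemma below_first_hidden: "k < first_hidden \<theta> \<longleftrightarrow> 2 ^ k \<le> \<theta>"
proof
  assume "k < first_hidden \<theta>"
  then have "\<not> \<theta> < 2 ^ k" unfolding first_hidden_def by (rule not_less_Least)
  then show "2 ^ k \<le> \<theta>" by simp
next
  assume *: "2 ^ k \<le> \<theta>"
  have "\<theta> < 2 ^ \<theta>" by simp
  then have "\<theta> < 2 ^ first_hidden \<theta>" unfolding first_hidden_def by (rule LeastI)
  with * have "(2::nat) ^ k < 2 ^ first_hidden \<theta>" by (rule le_less_trans)
  then show "k < first_hidden \<theta>" by (rule power_less_imp_less_exp[rotated]) simp
qed

text \<open>Answers depend only on keys that are shorter than the query, \<dots>\<close>

lemma answers_local:
  "(\<And>s. length s < length w \<Longrightarrow> f s = f' s) \<Longrightarrow> answers f w = answers f' w"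
proof (induction "length w" arbitrary: w f f' rule: less_induct)
  case less
  show ?case
  proof (cases w rule: answers_cases)
    case (sample l)
    then have "f s = f' s" if "s \<in> bits l" for s
      using that less.prems by (simp add: length_enc_strs1 bits_def unary_def)
    then show ?thesis unfolding sample answers_sample by (intro image_cong) auto
  next
    case (verify s k)
    then have "f s = f' s" using less.prems by (simp add: length_enc_strs2)
    then show ?thesis unfolding verify(1) answers_verify[OF verify(2)] by simp
  next
    case (invert y g l n)
    let ?t = "threshold g l n"
    have t: "?t < length w" by (simp add: invert(1) length_enc_strs2 length_request)
    have "avg_output g l n f x y = avg_output g l n f' x y" for x
      unfolding avg_output_def
    proof (rule finite_product.avg_cong[OF finite_product_keys, where S = "{s. length s < ?t}"])
      fix h h' :: "bool list \<Rightarrow> bool list" assume h: "\<forall>s\<in>{s. length s < ?t}. h s = h' s"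
      have "shorter ?t (answers h) = shorter ?t (answers h')"
      proof
        fix w'
        show "shorter ?t (answers h) w' = shorter ?t (answers h') w'"
        proof (cases "length w' < ?t")
          case True
          then have "answers h w' = answers h' w'" using h t by (intro less.hyps) auto
          then show ?thesis by (simp add: shorter_def)
        qed (simp add: shorter_def)
      qed
      then show "pmf (out (reflection_oracle (shorter ?t (answers h))) (alg g) [unary l, x]) y =
        pmf (out (reflection_oracle (shorter ?t (answers h'))) (alg g) [unary l, x]) y" by simp
    next
      show "\<forall>s\<in>{s. length s < ?t} - set (coords (first_hidden ?t) ?t). f s = f' s"
      proof
        fix s :: "bool list" assume "s \<in> {s. length s < ?t} - set (coords (first_hidden ?t) ?t)"
        then have "length s < length w" using t by simp
        then show "f s = f' s" by (rule less.prems)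
      qed
    qed
    then show ?thesis unfolding invert(1) answers_invert[OF invert(2)] by simp
  qed simp
qed

lemma shorter_answers_local:
  "(\<And>s. length s < \<theta> \<Longrightarrow> f s = f' s) \<Longrightarrow> shorter \<theta> (answers f) = shorter \<theta> (answers f')"
proof
  fix w
  assume *: "\<And>s. length s < \<theta> \<Longrightarrow> f s = f' s"
  have "answers f w = answers f' w" if "length w < \<theta>"
    by (rule answers_local, rule *) (use that in simp)
  then show "shorter \<theta> (answers f) w = shorter \<theta> (answers f') w" by (simp add: shorter_def)
qed

text \<open>\<dots> and answers to inversion requests only on keys that are at most logarithmic in the query.\<close>

lemma avg_output_local:
  assumes "\<And>s. 2 ^ length s \<le> threshold g l n \<Longrightarrow> f s = f' s"
  shows "avg_output g l n f x y = avg_output g l n f' x y"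
  unfolding avg_output_def
proof (rule finite_product.avg_cong[OF finite_product_keys, where S = "{s. length s < threshold g l n}"])
  fix h h' :: "bool list \<Rightarrow> bool list" assume *: "\<forall>s\<in>{s. length s < threshold g l n}. h s = h' s"
  have "shorter (threshold g l n) (answers h) = shorter (threshold g l n) (answers h')"
    by (rule shorter_answers_local, rule bspec[OF *], rule CollectI)
  then show "pmf (out (reflection_oracle (shorter (threshold g l n) (answers h))) (alg g) [unary l, x]) y =
      pmf (out (reflection_oracle (shorter (threshold g l n) (answers h'))) (alg g) [unary l, x]) y" by simp
next
  show "\<forall>s\<in>{s. length s < threshold g l n} - set (coords (first_hidden (threshold g l n)) (threshold g l n)). f s = f' s"
  proof
    fix s :: "bool list"
    assume "s \<in> {s. length s < threshold g l n} - set (coords (first_hidden (threshold g l n)) (threshold g l n))"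
    then have "\<not> first_hidden (threshold g l n) \<le> length s" unfolding set_coords by blast
    then have "length s < first_hidden (threshold g l n)" by (rule not_le_imp_less)
    then show "f s = f' s" unfolding below_first_hidden by (rule assms)
  qed
qed

text \<open>
  Short queries see the keys of length \<open>m\<close> only by sampling or by verifying at this length.
\<close>

lemma answers_level:
  assumes agree: "\<And>s. length s \<noteq> m \<Longrightarrow> f s = f' s" and w: "length w < 2 ^ m"
    and "w \<noteq> enc_strs [unary m]" "\<And>s k. w = enc_strs [s, k] \<Longrightarrow> length s = m \<Longrightarrow> length k \<noteq> 2 * m"
  shows "answers f w = answers f' w"
proof (cases w rule: answers_cases)
  case (sample l)
  have "l \<noteq> m" using assms(3) sample by blast
  then have "f s = f' s" if "s \<in> bits l" for s
    using that by (intro agree) (simp add: bits_def)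
  then show ?thesis unfolding sample answers_sample by (intro image_cong) auto
next
  case (verify s k)
  have "length s \<noteq> m" using assms(4)[OF verify(1)] verify(2) by blast
  then have "f s = f' s" by (rule agree)
  then show ?thesis unfolding verify(1) answers_verify[OF verify(2)] by simp
next
  case (invert y g l n)
  have "threshold g l n < 2 ^ m" using w by (simp add: invert(1) length_enc_strs2 length_request)
  then have "f s = f' s" if "2 ^ length s \<le> threshold g l n" for s
    using that by (intro agree notI) simp
  then have "avg_output g l n f x y = avg_output g l n f' x y" for x by (rule avg_output_local)
  then show ?thesis unfolding invert(1) answers_invert[OF invert(2)] by simp
qed simp

subsection \<open>Hiding keys\<close>

text \<open>
  The keys of the puzzles in \<open>R\<close> are replaced by the empty string, which is not accepted for any
  nonempty puzzle.
\<close>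

definition hide :: "bool list set \<Rightarrow> (bool list \<Rightarrow> bool list) \<Rightarrow> bool list \<Rightarrow> bool list" where
  "hide R f s = (if s \<in> R then [] else f s)"

text \<open>
  The answer to a sampling query that presents the puzzle \<open>s\<close> with the key \<open>k\<close>.
\<close>

definition sample_point :: "bool list \<Rightarrow> bool list \<Rightarrow> bool list" where
  "sample_point s k = pad (3 * (2 * length s + 1)) (enc_strs [s, k])"

lemma pad_length: "length u \<le> n \<Longrightarrow> pad n u \<in> bits n"
  by (simp add: pad_def bits_def zeros_def)

lemma read_pair_sample_point: "read_pair (sample_point s k @ r) = (s, k)"
  by (simp add: sample_point_def pad_def read_pair_enc_strs)

lemma sample_point_inj: "sample_point s k = sample_point s' k' \<longleftrightarrow> s = s' \<and> k = k'"
proof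
  assume "sample_point s k = sample_point s' k'"
  then have "read_pair (sample_point s k @ []) = read_pair (sample_point s' k' @ [])" by (simp only:)
  then show "s = s' \<and> k = k'" unfolding read_pair_sample_point by simp
qed simp

lemma sample_point_bits:
  "length k \<le> 2 * length s \<Longrightarrow> sample_point s k \<in> bits (3 * (2 * length s + 1))"
  unfolding sample_point_def by (rule pad_length) (simp add: length_enc_strs2)

lemma sample_point_nonzero: "s \<noteq> [] \<Longrightarrow> sample_point s k \<noteq> zeros n"
proof
  assume "s \<noteq> []" "sample_point s k = zeros n"
  then obtain b u where "s = b # u" by (cases s) auto
  then have "True \<in> set (sample_point s k)" by (simp add: sample_point_def pad_def enc_strs_def)
  moreover have "True \<notin> set (zeros n)" by (simp add: zeros_def)
  ultimately show False using \<open>sample_point s k = zeros n\<close> by simp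
qed

lemma nonzero_sample:
  assumes "m > 0" "\<And>s. s \<in> bits m \<Longrightarrow> length (f s) \<le> 2 * m"
  shows "nonzero_part (3 * (2 * m + 1)) (answers f (enc_strs [unary m])) = (\<lambda>s. sample_point s (f s)) ` bits m"
proof -
  have eq: "answers f (enc_strs [unary m]) = (\<lambda>s. sample_point s (f s)) ` bits m"
    unfolding answers_sample by (rule image_cong) (auto simp: sample_point_def bits_def)
  have "sample_point s (f s) \<in> bits (3 * (2 * m + 1)) \<and> sample_point s (f s) \<noteq> zeros (3 * (2 * m + 1))"
    if "s \<in> bits m" for s
    using sample_point_bits[of "f s" s] sample_point_nonzero[of s "f s"] assms(1) assms(2)[OF that] that
    by (auto simp: bits_def)
  then show ?thesis unfolding eq nonzero_part_def by auto
qed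

lemma card_sample: "card ((\<lambda>s. sample_point s (f s)) ` bits m) = 2 ^ m"
  by (subst card_image) (auto simp: inj_on_def sample_point_inj card_bits)

lemma reflector_sample:
  assumes "m > 0" "\<And>s. s \<in> bits m \<Longrightarrow> length (f s) \<le> 2 * m"
  shows "reflector (3 * (2 * m + 1)) (answers f (enc_strs [unary m])) a =
    of_bool (a = zeros (3 * (2 * m + 1))) - of_bool (a \<in> (\<lambda>s. sample_point s (f s)) ` bits m) / sqrt (2 ^ m)"
proof -
  define n where "n = 3 * (2 * m + 1)"
  define P where "P = (\<lambda>s. sample_point s (f s)) ` bits m"
  have P: "nonzero_part n (answers f (enc_strs [unary m])) = P"
    unfolding n_def P_def by (rule nonzero_sample[OF assms])
  have card: "card P = 2 ^ m" unfolding P_def by (rule card_sample)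
  have ne: "P \<noteq> {}" using zeros_in_bits[of m] unfolding P_def by blast
  have z: "zeros n \<notin> P"
    unfolding n_def P_def
  proof
    assume "zeros (3 * (2 * m + 1)) \<in> (\<lambda>s. sample_point s (f s)) ` bits m"
    then obtain s where "s \<in> bits m" "zeros (3 * (2 * m + 1)) = sample_point s (f s)" by blast
    then show False using sample_point_nonzero[of s "f s" "3 * (2 * m + 1)"] assms(1) by (auto simp: bits_def)
  qed
  show ?thesis
    unfolding n_def[symmetric] P_def[symmetric] reflector_def P card
    using ne z by (cases "a = zeros n") simp_all
qed

section \<open>Perturbation of circuits\<close>

text \<open>The Euclidean norm of a state of \<open>W\<close> qubits.\<close>

definition nrm :: "nat \<Rightarrow> state \<Rightarrow> real" where
  "nrm W \<psi> = L2_set (\<lambda>x. cmod (\<psi> x)) (bits W)"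

lemma nrm_sq: "(nrm W \<psi>)\<^sup>2 = (\<Sum>x\<in>bits W. (cmod (\<psi> x))\<^sup>2)"
  by (simp add: nrm_def L2_set_def sum_nonneg)

lemma nrm_nonneg [simp]: "0 \<le> nrm W \<psi>"
  by (simp add: nrm_def)

lemma nrm_cong: "(\<And>x. x \<in> bits W \<Longrightarrow> \<psi> x = \<phi> x) \<Longrightarrow> nrm W \<psi> = nrm W \<phi>"
  unfolding nrm_def by (intro L2_set_cong) auto

lemma nrm_triangle: "nrm W (\<lambda>x. \<psi> x + \<phi> x) \<le> nrm W \<psi> + nrm W \<phi>"
proof -
  have "nrm W (\<lambda>x. \<psi> x + \<phi> x) \<le> L2_set (\<lambda>x. cmod (\<psi> x) + cmod (\<phi> x)) (bits W)"
    unfolding nrm_def by (rule L2_set_mono) (auto intro: norm_triangle_ineq)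
  also have "\<dots> \<le> nrm W \<psi> + nrm W \<phi>" unfolding nrm_def by (rule L2_set_triangle_ineq)
  finally show ?thesis .
qed

lemma nrm_uminus: "nrm W (\<lambda>x. - \<psi> x) = nrm W \<psi>"
  by (simp add: nrm_def)

lemma nrm_minus_commute: "nrm W (\<lambda>x. \<psi> x - \<phi> x) = nrm W (\<lambda>x. \<phi> x - \<psi> x)"
  by (simp add: nrm_def norm_minus_commute)

lemma nrm_triangle_diff: "nrm W (\<lambda>x. \<psi> x - \<phi> x) \<le> nrm W \<psi> + nrm W \<phi>"
  using nrm_triangle[of W \<psi> "\<lambda>x. - \<phi> x"] by (simp add: nrm_uminus)

lemma nrm_zero [simp]: "nrm W (\<lambda>x. 0) = 0"
  by (simp add: nrm_def L2_set_def)

lemma nrm_sum: "nrm W (\<lambda>x. \<Sum>i\<in>I. \<psi> i x) \<le> (\<Sum>i\<in>I. nrm W (\<psi> i))"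
proof (induction I rule: infinite_finite_induct)
  case (insert i I)
  have "nrm W (\<lambda>x. \<Sum>i\<in>insert i I. \<psi> i x) = nrm W (\<lambda>x. \<psi> i x + (\<Sum>i\<in>I. \<psi> i x))"
    using insert by simp
  also have "\<dots> \<le> nrm W (\<psi> i) + nrm W (\<lambda>x. \<Sum>i\<in>I. \<psi> i x)" by (rule nrm_triangle)
  finally show ?case using insert by simp
qed simp_all

text \<open>
  The squared norm of the component of a state on the basis states with property \<open>P\<close>.
\<close>

definition mass :: "nat \<Rightarrow> (bool list \<Rightarrow> bool) \<Rightarrow> state \<Rightarrow> real" where
  "mass W P \<psi> = (\<Sum>x\<in>bits W. if P x then (cmod (\<psi> x))\<^sup>2 else 0)"

lemma mass_nonneg [simp]: "0 \<le> mass W P \<psi>"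
  unfolding mass_def by (rule sum_nonneg) simp

lemma mass_le_nrm: "mass W P \<psi> \<le> (nrm W \<psi>)\<^sup>2"
  unfolding nrm_sq mass_def by (rule sum_mono) simp

lemma sum_mass_le:
  assumes "finite I" "\<And>x i j. x \<in> bits W \<Longrightarrow> i \<in> I \<Longrightarrow> j \<in> I \<Longrightarrow> P i x \<Longrightarrow> P j x \<Longrightarrow> i = j"
  shows "(\<Sum>i\<in>I. mass W (P i) \<psi>) \<le> (nrm W \<psi>)\<^sup>2"
proof -
  have "(\<Sum>i\<in>I. mass W (P i) \<psi>) = (\<Sum>x\<in>bits W. \<Sum>i\<in>I. if P i x then (cmod (\<psi> x))\<^sup>2 else 0)"
    unfolding mass_def by (rule sum.swap)
  also have "\<dots> \<le> (\<Sum>x\<in>bits W. (cmod (\<psi> x))\<^sup>2)"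
  proof (rule sum_mono)
    fix x assume x: "x \<in> bits W"
    show "(\<Sum>i\<in>I. if P i x then (cmod (\<psi> x))\<^sup>2 else 0) \<le> (cmod (\<psi> x))\<^sup>2"
    proof (cases "\<exists>i\<in>I. P i x")
      case True
      then obtain i where i: "i \<in> I" "P i x" by blast
      have "(\<Sum>j\<in>I. if P j x then (cmod (\<psi> x))\<^sup>2 else 0) = (\<Sum>j\<in>I. if j = i then (cmod (\<psi> x))\<^sup>2 else 0)"
        using assms(2)[OF x] i by (intro sum.cong refl) metis
      then show ?thesis using i(1) assms(1) by simp
    next
      case False
      then have "(\<Sum>j\<in>I. if P j x then (cmod (\<psi> x))\<^sup>2 else 0) = (\<Sum>j\<in>I. 0)" by (intro sum.cong refl) auto
      then show ?thesis by simp
    qed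
  qed
  finally show ?thesis unfolding nrm_sq .
qed

subsection \<open>Runs\<close>

definition valid_gate :: "nat \<Rightarrow> gate \<Rightarrow> bool" where
  "valid_gate W g \<longleftrightarrow> distinct (gate_qubits g) \<and> set (gate_qubits g) \<subseteq> {..<W}"

definition run :: "answers \<Rightarrow> gate list \<Rightarrow> state \<Rightarrow> state" where
  "run A gs = fold (act A) gs"

lemma run_append: "run A (gs @ hs) \<psi> = run A hs (run A gs \<psi>)"
  by (simp add: run_def)

lemma run_Nil [simp]: "run A [] \<psi> = \<psi>"
  by (simp add: run_def)

lemma run_single [simp]: "run A [g] \<psi> = act A g \<psi>"
  by (simp add: run_def)

lemma act_linear: "act A g (\<lambda>x. \<Sum>i\<in>I. c i * \<psi> i x) x = (\<Sum>i\<in>I. c i * act A g (\<psi> i) x)"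
proof -
  have "act A g (\<lambda>x. \<Sum>i\<in>I. c i * \<psi> i x) x = (\<Sum>y\<in>agree_off (gate_qubits g) x. \<Sum>i\<in>I.
     c i * (gate_mat (reflection_oracle A) g $$ (basis_index (map ((!) x) (gate_qubits g)), basis_index (map ((!) y) (gate_qubits g))) * \<psi> i y))"
    unfolding act_def apply_on_def by (intro sum.cong) (simp add: sum_distrib_left, simp only: sum_distrib_left, simp only: mult.left_commute)
  also have "\<dots> = (\<Sum>i\<in>I. \<Sum>y\<in>agree_off (gate_qubits g) x.
     c i * (gate_mat (reflection_oracle A) g $$ (basis_index (map ((!) x) (gate_qubits g)), basis_index (map ((!) y) (gate_qubits g))) * \<psi> i y))"
    by (rule sum.swap)
  finally show ?thesis by (simp add: act_def apply_on_def sum_distrib_left)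
qed

lemma act_diff: "act A g (\<lambda>x. \<psi> x - \<phi> x) x = act A g \<psi> x - act A g \<phi> x"
  by (simp add: act_def apply_on_def right_diff_distrib sum_subtractf)

lemma act_sum: "act A g (\<lambda>x. \<Sum>i\<in>I. \<psi> i x) x = (\<Sum>i\<in>I. act A g (\<psi> i) x)"
  using act_linear[where c = "\<lambda>_. 1" and \<psi> = \<psi> and I = I and A = A and g = g and x = x] by simp

lemma run_linear: "run A gs (\<lambda>x. \<Sum>i\<in>I. c i * \<psi> i x) x = (\<Sum>i\<in>I. c i * run A gs (\<psi> i) x)"
proof (induction gs arbitrary: \<psi>)
  case (Cons g gs)
  have "act A g (\<lambda>x. \<Sum>i\<in>I. c i * \<psi> i x) = (\<lambda>x. \<Sum>i\<in>I. c i * act A g (\<psi> i) x)"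
    by (rule ext) (rule act_linear)
  then show ?case using Cons[of "\<lambda>i. act A g (\<psi> i)"] by (simp add: run_def)
qed simp

lemma run_diff: "run A gs (\<lambda>x. \<psi> x - \<phi> x) x = run A gs \<psi> x - run A gs \<phi> x"
proof (induction gs arbitrary: \<psi> \<phi>)
  case (Cons g gs)
  have "act A g (\<lambda>x. \<psi> x - \<phi> x) = (\<lambda>x. act A g \<psi> x - act A g \<phi> x)"
    by (rule ext) (rule act_diff)
  then show ?case using Cons[of "act A g \<psi>" "act A g \<phi>"] by (simp add: run_def)
qed simp

lemma nrm_act: "valid_gate W g \<Longrightarrow> nrm W (act A g \<psi>) = nrm W \<psi>"
  unfolding nrm_def L2_set_def act_def valid_gate_def
  using apply_on_norm[OF unitary_gate[OF unitary_reflection_oracle]] by simp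

lemma nrm_run: "(\<And>g. g \<in> set gs \<Longrightarrow> valid_gate W g) \<Longrightarrow> nrm W (run A gs \<psi>) = nrm W \<psi>"
  by (induction gs arbitrary: \<psi>) (simp_all add: run_def nrm_act)

definition gate_change :: "answers \<Rightarrow> answers \<Rightarrow> gate \<Rightarrow> state \<Rightarrow> state" where
  "gate_change A B g \<psi> x = act A g \<psi> x - act B g \<psi> x"

text \<open>The hybrid argument: the difference of two runs telescopes over the gates.\<close>

lemma run_change:
  "run A gs \<psi> x - run B gs \<psi> x =
    (\<Sum>t<length gs. run A (drop (Suc t) gs) (gate_change A B (gs ! t) (run B (take t gs) \<psi>)) x)"
proof (induction gs arbitrary: x rule: rev_induct)
  case (snoc g gs)
  let ?d = "\<lambda>t. gate_change A B (gs ! t) (run B (take t gs) \<psi>)"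
  have "run A (gs @ [g]) \<psi> x - run B (gs @ [g]) \<psi> x =
    act A g (\<lambda>x. run A gs \<psi> x - run B gs \<psi> x) x + gate_change A B g (run B gs \<psi>) x"
    by (simp add: run_append act_diff gate_change_def)
  also have "(\<lambda>x. run A gs \<psi> x - run B gs \<psi> x) = (\<lambda>x. \<Sum>t<length gs. run A (drop (Suc t) gs) (?d t) x)"
    by (rule ext) (rule snoc.IH)
  also have "act A g \<dots> x = (\<Sum>t<length gs. run A (drop (Suc t) (gs @ [g])) (gate_change A B ((gs @ [g]) ! t) (run B (take t (gs @ [g])) \<psi>)) x)"
    unfolding act_sum by (rule sum.cong) (simp_all add: run_append nth_append)
  finally show ?case by simp
qed simp

lemma nrm_run_change:
  assumes "\<And>g. g \<in> set gs \<Longrightarrow> valid_gate W g"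
  shows "nrm W (\<lambda>x. run A gs \<psi> x - run B gs \<psi> x) \<le>
    (\<Sum>t<length gs. nrm W (gate_change A B (gs ! t) (run B (take t gs) \<psi>)))"
proof -
  have "nrm W (\<lambda>x. run A gs \<psi> x - run B gs \<psi> x) \<le>
    (\<Sum>t<length gs. nrm W (run A (drop (Suc t) gs) (gate_change A B (gs ! t) (run B (take t gs) \<psi>))))"
    unfolding run_change by (rule nrm_sum)
  also have "\<dots> = (\<Sum>t<length gs. nrm W (gate_change A B (gs ! t) (run B (take t gs) \<psi>)))"
    by (intro sum.cong refl nrm_run assms) (auto dest: in_set_dropD)
  finally show ?thesis .
qed

subsection \<open>Operators of rank one on every block\<close>

text \<open>
  On every block with query \<open>w\<close> and active control, the operator \<open>u v^T\<close> with the real vectors \<open>u w\<close> and \<open>v w\<close>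
  on the answer register; zero elsewhere.
\<close>

definition rank1 :: "nat option \<Rightarrow> nat list \<Rightarrow> (bool list \<Rightarrow> bool list \<Rightarrow> real) \<Rightarrow>
    (bool list \<Rightarrow> bool list \<Rightarrow> real) \<Rightarrow> state \<Rightarrow> state" where
  "rank1 c qs u v \<psi> x = (if control c x then complex_of_real (u (query_reg qs x) (answer_reg qs x)) *
     (\<Sum>y\<in>answer_block qs x. complex_of_real (v (query_reg qs x) (answer_reg qs y)) * \<psi> y) else 0)"

lemma rank1_add_left: "rank1 c qs (\<lambda>w a. u w a + u' w a) v \<psi> x = rank1 c qs u v \<psi> x + rank1 c qs u' v \<psi> x"
  by (simp add: rank1_def distrib_right)

lemma rank1_add_right: "rank1 c qs u (\<lambda>w a. v w a + v' w a) \<psi> x = rank1 c qs u v \<psi> x + rank1 c qs u v' \<psi> x"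
  by (simp add: rank1_def distrib_left distrib_right sum.distrib)

lemma rank1_diff: "rank1 c qs u v (\<lambda>x. \<psi> x - \<phi> x) x = rank1 c qs u v \<psi> x - rank1 c qs u v \<phi> x"
  by (simp add: rank1_def right_diff_distrib sum_subtractf)

lemma answer_block_regs:
  assumes "distinct qs" "set qs \<subseteq> {..<length x}" "y \<in> answer_block qs x"
  shows "query_reg qs y = query_reg qs x" "length y = length x" "answer_block qs y = answer_block qs x"
    "x \<in> answer_block qs y"
proof -
  let ?m = "3 * (length qs div 4)"
  have "y \<in> {y \<in> agree_off qs x. map ((!) y) (drop ?m qs) = map ((!) x) (drop ?m qs)}"
    using assms(3) unfolding agree_off_drop[OF assms(1,2), of ?m] answer_block_def .
  then show "query_reg qs y = query_reg qs x" by (simp add: query_reg_def)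
  show "length y = length x" using assms(3) unfolding answer_block_def by (rule agree_off_length)
  show "answer_block qs y = answer_block qs x" using assms(3) unfolding answer_block_def by (rule agree_off_eq)
  show "x \<in> answer_block qs y" using assms(3) unfolding answer_block_def by (simp add: agree_off_sym)
qed

lemma sum_answer_block:
  assumes "distinct qs" "set qs \<subseteq> {..<length x}" "length qs = 4 * n"
  shows "(\<Sum>y\<in>answer_block qs x. h (answer_reg qs y)) = (\<Sum>a\<in>bits (3 * n). h a)"
proof -
  have "set (take (3 * n) qs) \<subseteq> {..<length x}" using assms(2) set_take_subset[of "3 * n" qs] by blast
  then have "bij_betw (\<lambda>y. map ((!) y) (take (3 * n) qs)) (agree_off (take (3 * n) qs) x) (bits (3 * n))"
    using agree_off_bij[of "take (3 * n) qs" x] assms(1,3) by simp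
  then show ?thesis
    using sum.reindex_bij_betw[of _ "agree_off (take (3 * n) qs) x" "bits (3 * n)" h] assms(3)
    by (simp add: answer_block_def answer_reg_def)
qed

lemma sum_answer_block_swap:
  assumes "distinct qs" "set qs \<subseteq> {..<W}"
  shows "(\<Sum>x\<in>bits W. \<Sum>y\<in>answer_block qs x. F x y) = (\<Sum>y\<in>bits W. \<Sum>x\<in>answer_block qs y. F x y)"
proof -
  have sub: "answer_block qs x \<subseteq> bits W" if "x \<in> bits W" for x
    using that unfolding answer_block_def by (auto simp: agree_off_def bits_def)
  have "(\<Sum>x\<in>bits W. \<Sum>y\<in>answer_block qs x. F x y) = (\<Sum>x\<in>bits W. \<Sum>y\<in>{y \<in> bits W. y \<in> answer_block qs x}. F x y)"
    using sub by (intro sum.cong) auto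
  also have "\<dots> = (\<Sum>y\<in>bits W. \<Sum>x\<in>{x \<in> bits W. y \<in> answer_block qs x}. F x y)"
    by (rule sum.swap_restrict) (auto simp: finite_bits)
  also have "\<dots> = (\<Sum>y\<in>bits W. \<Sum>x\<in>answer_block qs y. F x y)"
  proof (rule sum.cong[OF refl])
    fix y assume y: "y \<in> bits W"
    have "{x \<in> bits W. y \<in> answer_block qs x} = answer_block qs y"
      using sub[OF y] unfolding answer_block_def using agree_off_sym by blast
    then show "(\<Sum>x\<in>{x \<in> bits W. y \<in> answer_block qs x}. F x y) = (\<Sum>x\<in>answer_block qs y. F x y)" by simp
  qed
  finally show ?thesis .
qed

text \<open>Only the part of the state on the support of \<open>v\<close> matters.\<close>

lemma rank1_norm:
  assumes qs: "distinct qs" "set qs \<subseteq> {..<W}" "length qs = 4 * n"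
    and K: "\<And>w. length w = n \<Longrightarrow> (\<Sum>a\<in>bits (3 * n). (u w a)\<^sup>2) * (\<Sum>a\<in>bits (3 * n). (v w a)\<^sup>2) \<le> K"
  shows "(nrm W (rank1 c qs u v \<psi>))\<^sup>2 \<le> K * mass W (\<lambda>x. v (query_reg qs x) (answer_reg qs x) \<noteq> 0) \<psi>"
proof -
  define h where "h = (\<lambda>x. if v (query_reg qs x) (answer_reg qs x) \<noteq> 0 then (cmod (\<psi> x))\<^sup>2 else 0)"
  let ?U = "\<lambda>w. \<Sum>a\<in>bits (3 * n). (u w a)\<^sup>2" and ?V = "\<lambda>w. \<Sum>a\<in>bits (3 * n). (v w a)\<^sup>2"
  let ?w = "query_reg qs" and ?a = "answer_reg qs"
  have len: "length (?w x) = n" for x using qs(3) by (simp add: query_reg_def)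
  have point: "(cmod (rank1 c qs u v \<psi> x))\<^sup>2 \<le> (\<Sum>y\<in>answer_block qs x. ?V (?w x) * (u (?w x) (?a x))\<^sup>2 * h y)"
    if x: "x \<in> bits W" for x
  proof -
    have qx: "set qs \<subseteq> {..<length x}" using qs(2) x by (simp add: bits_def)
    let ?S = "\<Sum>y\<in>answer_block qs x. complex_of_real (v (?w x) (?a y)) * \<psi> y"
    have reg: "?w y = ?w x" if "y \<in> answer_block qs x" for y
      by (rule answer_block_regs(1)[OF qs(1) qx that])
    let ?h = "\<lambda>y. if v (?w x) (?a y) \<noteq> 0 then cmod (\<psi> y) else 0"
    have "cmod ?S \<le> (\<Sum>y\<in>answer_block qs x. cmod (complex_of_real (v (?w x) (?a y)) * \<psi> y))"
      by (rule norm_sum)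
    also have "\<dots> = (\<Sum>y\<in>answer_block qs x. \<bar>v (?w x) (?a y)\<bar> * \<bar>?h y\<bar>)"
      by (intro sum.cong) (auto simp: norm_mult)
    also have "\<dots> \<le> L2_set (\<lambda>y. v (?w x) (?a y)) (answer_block qs x) * L2_set ?h (answer_block qs x)"
      by (rule L2_set_mult_ineq)
    finally have "(cmod ?S)\<^sup>2 \<le> (L2_set (\<lambda>y. v (?w x) (?a y)) (answer_block qs x) * L2_set ?h (answer_block qs x))\<^sup>2"
      by (rule power_mono) simp
    also have "\<dots> = (\<Sum>y\<in>answer_block qs x. (v (?w x) (?a y))\<^sup>2) * (\<Sum>y\<in>answer_block qs x. (?h y)\<^sup>2)"
      by (simp add: power_mult_distrib L2_set_def sum_nonneg)
    also have "(\<Sum>y\<in>answer_block qs x. (v (?w x) (?a y))\<^sup>2) = ?V (?w x)"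
      by (rule sum_answer_block[OF qs(1) qx qs(3)])
    also have "(\<Sum>y\<in>answer_block qs x. (?h y)\<^sup>2) = (\<Sum>y\<in>answer_block qs x. h y)"
      by (rule sum.cong) (simp_all add: h_def reg)
    finally have S: "(cmod ?S)\<^sup>2 \<le> ?V (?w x) * (\<Sum>y\<in>answer_block qs x. h y)" .
    have "(cmod (rank1 c qs u v \<psi> x))\<^sup>2 \<le> (u (?w x) (?a x))\<^sup>2 * (cmod ?S)\<^sup>2"
      by (simp add: rank1_def norm_mult power_mult_distrib)
    also have "\<dots> \<le> (u (?w x) (?a x))\<^sup>2 * (?V (?w x) * (\<Sum>y\<in>answer_block qs x. h y))"
      by (rule mult_left_mono[OF S]) simp
    also have "\<dots> = (\<Sum>y\<in>answer_block qs x. ?V (?w x) * (u (?w x) (?a x))\<^sup>2 * h y)"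
      by (subst sum_distrib_left[symmetric]) (simp only: mult_ac)
    finally show ?thesis .
  qed
  have "(nrm W (rank1 c qs u v \<psi>))\<^sup>2 \<le> (\<Sum>x\<in>bits W. \<Sum>y\<in>answer_block qs x. ?V (?w x) * (u (?w x) (?a x))\<^sup>2 * h y)"
    unfolding nrm_sq by (rule sum_mono) (rule point)
  also have "\<dots> = (\<Sum>y\<in>bits W. \<Sum>x\<in>answer_block qs y. ?V (?w x) * (u (?w x) (?a x))\<^sup>2 * h y)"
    by (rule sum_answer_block_swap[OF qs(1,2)])
  also have "\<dots> = (\<Sum>y\<in>bits W. ?V (?w y) * ?U (?w y) * h y)"
  proof (rule sum.cong[OF refl])
    fix y assume y: "y \<in> bits W"
    have qy: "set qs \<subseteq> {..<length y}" using qs(2) y by (simp add: bits_def)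
    have "(\<Sum>x\<in>answer_block qs y. ?V (?w x) * (u (?w x) (?a x))\<^sup>2 * h y) =
        (\<Sum>x\<in>answer_block qs y. ?V (?w y) * h y * (u (?w y) (?a x))\<^sup>2)"
      by (rule sum.cong) (simp_all add: answer_block_regs(1)[OF qs(1) qy])
    also have "\<dots> = ?V (?w y) * h y * (\<Sum>x\<in>answer_block qs y. (u (?w y) (?a x))\<^sup>2)"
      by (rule sum_distrib_left[symmetric])
    also have "(\<Sum>x\<in>answer_block qs y. (u (?w y) (?a x))\<^sup>2) = ?U (?w y)"
      by (rule sum_answer_block[OF qs(1) qy qs(3)])
    finally show "(\<Sum>x\<in>answer_block qs y. ?V (?w x) * (u (?w x) (?a x))\<^sup>2 * h y) = ?V (?w y) * ?U (?w y) * h y"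
      by simp
  qed
  also have "\<dots> \<le> (\<Sum>y\<in>bits W. K * h y)"
    using K[OF len] by (intro sum_mono mult_right_mono) (auto simp: h_def mult.commute)
  also have "\<dots> = K * mass W (\<lambda>x. v (?w x) (?a x) \<noteq> 0) \<psi>"
    by (simp add: mass_def h_def sum_distrib_left)
  finally show ?thesis .
qed

text \<open>
  With \<open>d = b - a\<close>, the difference of the reflections is \<open>b b^T - a a^T = d b^T + a d^T\<close>.
\<close>

lemma gate_change_rank1:
  assumes "valid_gate W (Query c v qs)" "length qs = 4 * n" "x \<in> bits W"
    and D: "\<And>w a. D w a = reflector (3 * n) (B w) a - reflector (3 * n) (A w) a"
  shows "gate_change A B (Query c v qs) \<psi> x =
    rank1 c qs D (\<lambda>w. reflector (3 * n) (B w)) \<psi> x + rank1 c qs (\<lambda>w. reflector (3 * n) (A w)) D \<psi> x"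
proof -
  have len: "length x = W" using assms(3) by (simp add: bits_def)
  let ?A = "\<lambda>w. reflector (3 * n) (A w)" and ?B = "\<lambda>w. reflector (3 * n) (B w)"
  have "act C (Query c v qs) \<psi> x = \<psi> x - rank1 c qs (\<lambda>w. reflector (3 * n) (C w)) (\<lambda>w. reflector (3 * n) (C w)) \<psi> x" for C
    using act_query[of c v qs x n C \<psi>] assms(1,2) len by (auto simp: valid_gate_def rank1_def)
  then have "gate_change A B (Query c v qs) \<psi> x = rank1 c qs ?B ?B \<psi> x - rank1 c qs ?A ?A \<psi> x"
    by (simp add: gate_change_def)
  moreover have "?B = (\<lambda>w a. D w a + ?A w a)" by (simp add: D)
  then have "rank1 c qs ?B ?B \<psi> x = rank1 c qs D ?B \<psi> x + rank1 c qs ?A ?B \<psi> x"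
    and "rank1 c qs ?A ?B \<psi> x = rank1 c qs ?A D \<psi> x + rank1 c qs ?A ?A \<psi> x"
    by (simp only: rank1_add_left[symmetric], simp only: rank1_add_right[symmetric])
  ultimately show ?thesis by simp
qed

subsection \<open>The effect of hiding keys on a gate\<close>

text \<open>
  The squared amplitude with which gate \<open>g\<close> makes the query \<open>w\<close> of length \<open>n\<close>.
\<close>

definition query_mass :: "nat \<Rightarrow> nat \<Rightarrow> gate \<Rightarrow> bool list \<Rightarrow> state \<Rightarrow> real" where
  "query_mass W n g w \<psi> = (case g of Query c v qs \<Rightarrow>
     if length qs = 4 * n then mass W (\<lambda>x. query_reg qs x = w) \<psi> else 0 | _ \<Rightarrow> 0)"

lemma query_mass_nonneg [simp]: "0 \<le> query_mass W n g w \<psi>"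
  by (simp add: query_mass_def split: gate.split)

lemma sum_query_mass: "finite D \<Longrightarrow> (\<Sum>w\<in>D. query_mass W n g w \<psi>) \<le> (nrm W \<psi>)\<^sup>2"
proof (cases g)
  case (Query c v qs)
  assume D: "finite D"
  show ?thesis
  proof (cases "length qs = 4 * n")
    case True
    then show ?thesis using sum_mass_le[OF D, of W "\<lambda>w x. query_reg qs x = w" \<psi>] by (simp add: Query query_mass_def)
  qed (simp add: Query query_mass_def)
qed (simp_all add: query_mass_def)

lemma sum_reflector_le: "(\<Sum>a\<in>bits n. (reflector n S a)\<^sup>2) \<le> 2"
  by (simp add: sum_reflector_sq)

text \<open>
  Hiding the keys of a set \<open>R\<close> of puzzles of length \<open>m\<close>, seen by gates on fewer than \<open>2^m\<close> qubits.
  Queries of length \<open>2 * m + 1\<close> are those that can sample puzzles of length \<open>m\<close>, and queries of length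
  \<open>6 * m + 2\<close> those that can verify keys for them.  Keys outside \<open>R\<close> may already be hidden.
\<close>

locale hidden_keys =
  fixes m :: nat and f :: "bool list \<Rightarrow> bool list" and R :: "bool list set" and W :: nat
  assumes m: "0 < m" and W: "W < 2 ^ m" and R: "R \<subseteq> bits m"
    and key: "\<And>s. s \<in> R \<Longrightarrow> length (f s) = 2 * m"
    and key_le: "\<And>s. s \<in> bits m \<Longrightarrow> length (f s) \<le> 2 * m"
begin

definition "old = answers f"
definition "new = answers (hide R f)"

text \<open>The change of the reflection vector, for queries of length \<open>n\<close>.\<close>

definition D :: "nat \<Rightarrow> bool list \<Rightarrow> bool list \<Rightarrow> real" where
  "D n w a = reflector (3 * n) (new w) a - reflector (3 * n) (old w) a"

lemma finite_R: "finite R"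
  using R finite_bits finite_subset by blast

lemma same_answers:
  assumes "length w < 2 ^ m" "w \<noteq> enc_strs [unary m]"
    "\<And>s k. w = enc_strs [s, k] \<Longrightarrow> length s = m \<Longrightarrow> length k \<noteq> 2 * m"
  shows "new w = old w"
  unfolding new_def old_def using assms R
  by (intro answers_level[of m]) (auto simp: hide_def bits_def)

lemma length_queries: "length (enc_strs [unary m]) = 2 * m + 1"
  "length s = m \<Longrightarrow> length k = 2 * m \<Longrightarrow> length (enc_strs [s, k]) = 6 * m + 2"
  by (simp_all add: length_enc_strs1 length_enc_strs2 unary_def)

lemma D_other:
  assumes "length w = n" "n < 2 ^ m" "n \<noteq> 2 * m + 1" "n \<noteq> 6 * m + 2"
  shows "D n w a = 0"
proof -
  have "new w = old w"
  proof (rule same_answers)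
    show "length w < 2 ^ m" using assms(1,2) by simp
    show "w \<noteq> enc_strs [unary m]" using assms(1,3) length_queries(1) by metis
    show "length k \<noteq> 2 * m" if "w = enc_strs [s, k]" "length s = m" for s k
      using assms(1,4) length_queries(2)[OF that(2)] that(1) by metis
  qed
  then show ?thesis by (simp add: D_def)
qed

lemma D_sample:
  assumes "length w = 2 * m + 1" "2 * m + 1 < 2 ^ m"
  shows "D (2 * m + 1) w a = (if w = enc_strs [unary m]
     then (of_bool (a \<in> (\<lambda>s. sample_point s (f s)) ` R) - of_bool (a \<in> (\<lambda>s. sample_point s []) ` R)) / sqrt (2 ^ m)
     else 0)"
proof (cases "w = enc_strs [unary m]")
  case False
  have "new w = old w"
  proof (rule same_answers[OF _ False])
    show "length w < 2 ^ m" using assms by simp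
    show "length k \<noteq> 2 * m" if "w = enc_strs [s, k]" "length s = m" for s k
      using assms(1) length_queries(2)[OF that(2), of k] that(1) m by auto
  qed
  then show ?thesis using False by (simp add: D_def)
next
  case True
  have hide_le: "length (hide R f s) \<le> 2 * m" if "s \<in> bits m" for s
    using key_le[OF that] by (simp add: hide_def)
  let ?P = "\<lambda>f. (\<lambda>s. sample_point s (f s)) ` bits m"
  let ?Y = "(\<lambda>s. sample_point s (f s)) ` R" and ?Z = "(\<lambda>s. sample_point s []) ` R"
    and ?X = "(\<lambda>s. sample_point s (f s)) ` (bits m - R)"
  have P: "?P f = ?X \<union> ?Y" using R by blast
  have hideR: "(\<lambda>s. sample_point s (hide R f s)) ` R = ?Z"
    by (intro image_cong) (simp_all add: hide_def)
  have hideX: "(\<lambda>s. sample_point s (hide R f s)) ` (bits m - R) = ?X"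
    by (intro image_cong) (simp_all add: hide_def)
  have P': "?P (hide R f) = ?X \<union> ?Z"
    unfolding hideR[symmetric] hideX[symmetric] using R by blast
  have disj: "a \<notin> ?Y \<and> a \<notin> ?Z" if "a \<in> ?X" for a
    using that by (auto simp: sample_point_inj)
  have eq: "of_bool (a \<in> ?P f) - of_bool (a \<in> ?P (hide R f)) = (of_bool (a \<in> ?Y) - of_bool (a \<in> ?Z) :: real)"
    unfolding P P' using disj[of a] by (cases "a \<in> ?X") simp_all
  have r1: "reflector (3 * (2 * m + 1)) (new w) a =
      of_bool (a = zeros (3 * (2 * m + 1))) - of_bool (a \<in> ?P (hide R f)) / sqrt (2 ^ m)"
    unfolding new_def True by (rule reflector_sample[OF m hide_le])
  have r2: "reflector (3 * (2 * m + 1)) (old w) a =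
      of_bool (a = zeros (3 * (2 * m + 1))) - of_bool (a \<in> ?P f) / sqrt (2 ^ m)"
    unfolding old_def True by (rule reflector_sample[OF m key_le])
  have "c - q / r - (c - p / r) = (p - q) / r" for c p q r :: real
    by (simp add: diff_divide_distrib)
  then have "D (2 * m + 1) w a = (of_bool (a \<in> ?P f) - of_bool (a \<in> ?P (hide R f))) / sqrt (2 ^ m)"
    unfolding D_def r1 r2 .
  then show ?thesis unfolding eq using True by (simp only: if_True simp_thms)
qed

lemma D_sample_norm:
  assumes "length w = 2 * m + 1" "2 * m + 1 < 2 ^ m"
  shows "(\<Sum>a\<in>bits (3 * (2 * m + 1)). (D (2 * m + 1) w a)\<^sup>2) \<le> 2 * real (card R) / 2 ^ m"
proof -
  let ?Y = "(\<lambda>s. sample_point s (f s)) ` R" and ?Z = "(\<lambda>s. sample_point s []) ` R"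
  let ?B = "bits (3 * (2 * m + 1))"
  have pt: "(D (2 * m + 1) w a)\<^sup>2 \<le> (of_bool (a \<in> ?Y) + of_bool (a \<in> ?Z)) / 2 ^ m" for a
  proof -
    have "((of_bool (a \<in> ?Y) - of_bool (a \<in> ?Z)) / sqrt (2 ^ m) :: real)\<^sup>2 =
       (of_bool (a \<in> ?Y) - of_bool (a \<in> ?Z))\<^sup>2 / 2 ^ m" by (simp add: power_divide)
    also have "\<dots> \<le> (of_bool (a \<in> ?Y) + of_bool (a \<in> ?Z)) / 2 ^ m"
      by (intro divide_right_mono) (auto simp: of_bool_def)
    finally have "((of_bool (a \<in> ?Y) - of_bool (a \<in> ?Z)) / sqrt (2 ^ m) :: real)\<^sup>2 \<le>
      (of_bool (a \<in> ?Y) + of_bool (a \<in> ?Z)) / 2 ^ m" .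
    then show ?thesis unfolding D_sample[OF assms] by simp
  qed
  have ind: "(\<Sum>a\<in>?B. of_bool (a \<in> S)) \<le> real (card S)" if "finite S" for S :: "bool list set"
  proof -
    have "(\<Sum>a\<in>?B. of_bool (a \<in> S)) = real (card (?B \<inter> S))"
      using finite_bits by (simp add: of_bool_def sum.If_cases Int_def)
    also have "\<dots> \<le> real (card S)" using that by (simp add: card_mono)
    finally show ?thesis .
  qed
  have "(\<Sum>a\<in>?B. (D (2 * m + 1) w a)\<^sup>2) \<le> (\<Sum>a\<in>?B. (of_bool (a \<in> ?Y) + of_bool (a \<in> ?Z)) / 2 ^ m)"
    by (rule sum_mono) (rule pt)
  also have "\<dots> = ((\<Sum>a\<in>?B. of_bool (a \<in> ?Y)) + (\<Sum>a\<in>?B. of_bool (a \<in> ?Z))) / 2 ^ m"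
    by (simp add: sum_divide_distrib[symmetric] sum.distrib)
  also have "\<dots> \<le> (real (card ?Y) + real (card ?Z)) / 2 ^ m"
    by (intro divide_right_mono add_mono ind) (use finite_R in auto)
  also have "\<dots> \<le> (real (card R) + real (card R)) / 2 ^ m"
    using finite_R by (intro divide_right_mono add_mono) (simp_all add: card_image_le)
  finally show ?thesis by simp
qed

lemma D_verify:
  assumes "length w = 6 * m + 2" "6 * m + 2 < 2 ^ m" "D (6 * m + 2) w a \<noteq> 0"
  shows "\<exists>s\<in>R. w = enc_strs [s, f s]"
proof (rule ccontr)
  assume no: "\<not> (\<exists>s\<in>R. w = enc_strs [s, f s])"
  have "new w = old w"
  proof (cases "\<exists>s k. w = enc_strs [s, k] \<and> length s = m \<and> length k = 2 * m")
    case True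
    then obtain s k where sk: "w = enc_strs [s, k]" "length s = m" "length k = 2 * m" by blast
    have k: "length k = 2 * length s" using sk by simp
    have "hide R f s = k \<longleftrightarrow> f s = k" using no sk m by (auto simp: hide_def)
    then show ?thesis unfolding new_def old_def sk(1) answers_verify[OF k] by simp
  next
    case False
    show ?thesis
    proof (rule same_answers)
      show "length w < 2 ^ m" using assms by simp
      show "w \<noteq> enc_strs [unary m]" using assms(1) length_queries(1) m by auto
      show "length k \<noteq> 2 * m" if "w = enc_strs [s, k]" "length s = m" for s k
        using False that by blast
    qed
  qed
  then show False using assms(3) by (simp add: D_def)
qed

lemma new_verify: "s \<in> R \<Longrightarrow> reflector n (new (enc_strs [s, f s])) a = 0"
proof -
  assume s: "s \<in> R"
  have k: "length (f s) = 2 * length s" using key[OF s] s R by (auto simp: bits_def)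
  have "hide R f s \<noteq> f s" using s key[OF s] m by (auto simp: hide_def)
  then have "new (enc_strs [s, f s]) = {}" unfolding new_def answers_verify[OF k] by simp
  then show ?thesis by (simp add: reflector_def nonzero_part_def)
qed

lemma length_qs:
  assumes "valid_gate W (Query c v qs)" "length qs = 4 * n" "0 < n"
  shows "n < 2 ^ m" "distinct qs" "set qs \<subseteq> {..<W}"
proof -
  show qs: "distinct qs" "set qs \<subseteq> {..<W}"
    using assms(1) by (cases c; simp add: valid_gate_def)+
  have "length qs \<le> W" using card_mono[OF _ qs(2)] distinct_card[OF qs(1)] by simp
  then show "n < 2 ^ m" using assms(2,3) W by simp
qed

lemma gate_change_D:
  assumes "valid_gate W (Query c v qs)" "length qs = 4 * n" "x \<in> bits W"
  shows "gate_change old new (Query c v qs) \<psi> x =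
    rank1 c qs (D n) (\<lambda>w. reflector (3 * n) (new w)) \<psi> x + rank1 c qs (\<lambda>w. reflector (3 * n) (old w)) (D n) \<psi> x"
  by (rule gate_change_rank1[OF assms]) (simp add: D_def)

lemma gate_change_zero:
  assumes "valid_gate W g" "x \<in> bits W"
    "\<And>c v qs. g = Query c v qs \<Longrightarrow> length qs \<noteq> 4 * (2 * m + 1) \<and> length qs \<noteq> 4 * (6 * m + 2)"
  shows "gate_change old new g \<psi> x = 0"
proof (cases "\<exists>c v qs n. g = Query c v qs \<and> length qs = 4 * n \<and> 0 < n")
  case True
  then obtain c v qs n where g: "g = Query c v qs" "length qs = 4 * n" "0 < n" by blast
  have ne: "n \<noteq> 2 * m + 1" "n \<noteq> 6 * m + 2" using assms(3)[OF g(1)] g(2) by auto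
  have len: "length (query_reg qs x) = n" using g(2) by (simp add: query_reg_def)
  have "D n (query_reg qs x) a = 0" for a
    by (rule D_other[OF len length_qs(1)[OF assms(1)[unfolded g(1)] g(2,3)] ne])
  then show ?thesis
    unfolding g(1) gate_change_D[OF assms(1)[unfolded g(1)] g(2) assms(2)] by (simp add: rank1_def)
next
  case False
  have "act old g = act new g"
    by (rule act_other) (use False in \<open>auto elim!: dvdE\<close>)
  then show ?thesis by (simp add: gate_change_def)
qed

text \<open>A verification query changes only on the hidden puzzles together with their keys.\<close>

lemma nrm_gate_change_verify:
  assumes "valid_gate W (Query c v qs)" "length qs = 4 * (6 * m + 2)"
  shows "nrm W (gate_change old new (Query c v qs) \<psi>) \<le>
    2 * sqrt (\<Sum>s\<in>R. query_mass W (6 * m + 2) (Query c v qs) (enc_strs [s, f s]) \<psi>)"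
proof -
  let ?n = "6 * m + 2" and ?g = "Query c v qs"
  have pos: "0 < ?n" by simp
  note qs = length_qs[OF assms pos]
  have len: "length (query_reg qs x) = ?n" for x using assms(2) by (simp add: query_reg_def)
  have "gate_change old new ?g \<psi> x = rank1 c qs (\<lambda>w. reflector (3 * ?n) (old w)) (D ?n) \<psi> x" if x: "x \<in> bits W" for x
  proof -
    have "rank1 c qs (D ?n) (\<lambda>w. reflector (3 * ?n) (new w)) \<psi> x = 0"
    proof (cases "D ?n (query_reg qs x) (answer_reg qs x) = 0")
      case False
      then obtain s where "s \<in> R" "query_reg qs x = enc_strs [s, f s]"
        using D_verify[OF len] qs(1) by blast
      then show ?thesis using new_verify by (simp add: rank1_def)
    qed (simp add: rank1_def)
    then show ?thesis using gate_change_D[OF assms x, of \<psi>] by simp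
  qed
  then have "nrm W (gate_change old new ?g \<psi>) = nrm W (rank1 c qs (\<lambda>w. reflector (3 * ?n) (old w)) (D ?n) \<psi>)"
    by (rule nrm_cong)
  moreover have "(nrm W (rank1 c qs (\<lambda>w. reflector (3 * ?n) (old w)) (D ?n) \<psi>))\<^sup>2 \<le>
     4 * mass W (\<lambda>x. D ?n (query_reg qs x) (answer_reg qs x) \<noteq> 0) \<psi>"
  proof (rule rank1_norm[OF qs(2,3) assms(2)])
    fix w :: "bool list" assume w: "length w = ?n"
    have "(\<Sum>a\<in>bits (3 * ?n). (D ?n w a)\<^sup>2) \<le> 2"
    proof (cases "\<exists>s\<in>R. w = enc_strs [s, f s]")
      case True
      then have "(D ?n w a)\<^sup>2 = (reflector (3 * ?n) (old w) a)\<^sup>2" for a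
        using new_verify by (auto simp: D_def)
      then show ?thesis using sum_reflector_le by simp
    next
      case False
      then have "D ?n w a = 0" for a using D_verify[OF w qs(1)] by blast
      then show ?thesis by simp
    qed
    then have "(\<Sum>a\<in>bits (3 * ?n). (reflector (3 * ?n) (old w) a)\<^sup>2) * (\<Sum>a\<in>bits (3 * ?n). (D ?n w a)\<^sup>2) \<le> 2 * 2"
      by (intro mult_mono sum_reflector_le) (simp_all add: sum_nonneg)
    then show "(\<Sum>a\<in>bits (3 * ?n). (reflector (3 * ?n) (old w) a)\<^sup>2) * (\<Sum>a\<in>bits (3 * ?n). (D ?n w a)\<^sup>2) \<le> 4"
      by simp
  qed
  moreover have "mass W (\<lambda>x. D ?n (query_reg qs x) (answer_reg qs x) \<noteq> 0) \<psi> \<le>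
      (\<Sum>s\<in>R. query_mass W ?n ?g (enc_strs [s, f s]) \<psi>)"
  proof -
    have "mass W (\<lambda>x. D ?n (query_reg qs x) (answer_reg qs x) \<noteq> 0) \<psi> \<le>
      (\<Sum>x\<in>bits W. \<Sum>s\<in>R. if query_reg qs x = enc_strs [s, f s] then (cmod (\<psi> x))\<^sup>2 else 0)"
      unfolding mass_def
    proof (rule sum_mono)
      fix x
      show "(if D ?n (query_reg qs x) (answer_reg qs x) \<noteq> 0 then (cmod (\<psi> x))\<^sup>2 else 0) \<le>
        (\<Sum>s\<in>R. if query_reg qs x = enc_strs [s, f s] then (cmod (\<psi> x))\<^sup>2 else 0)"
      proof (cases "D ?n (query_reg qs x) (answer_reg qs x) = 0")
        case False
        then obtain s where s: "s \<in> R" "query_reg qs x = enc_strs [s, f s]"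
          using D_verify[OF len] qs(1) by blast
        have "(if query_reg qs x = enc_strs [s, f s] then (cmod (\<psi> x))\<^sup>2 else 0) \<le>
          (\<Sum>s\<in>R. if query_reg qs x = enc_strs [s, f s] then (cmod (\<psi> x))\<^sup>2 else 0)"
          by (rule member_le_sum[OF s(1) _ finite_R]) simp
        then show ?thesis using False s(2) by simp
      qed (simp add: sum_nonneg)
    qed
    also have "\<dots> = (\<Sum>s\<in>R. query_mass W ?n ?g (enc_strs [s, f s]) \<psi>)"
      unfolding query_mass_def mass_def using assms(2) by (subst sum.swap) simp
    finally show ?thesis .
  qed
  ultimately have "(nrm W (gate_change old new ?g \<psi>))\<^sup>2 \<le>
      (2 * sqrt (\<Sum>s\<in>R. query_mass W ?n ?g (enc_strs [s, f s]) \<psi>))\<^sup>2"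
    by (simp add: power_mult_distrib sum_nonneg)
  then show ?thesis by (rule power2_le_imp_le) (simp add: sum_nonneg)
qed

lemma nrm_rank1_sample:
  assumes "valid_gate W (Query c v qs)" "length qs = 4 * (2 * m + 1)" "\<And>w. length w = 2 * m + 1 \<Longrightarrow> (\<Sum>a\<in>bits (3 * (2 * m + 1)). (u w a)\<^sup>2) \<le> 2"
  shows "nrm W (rank1 c qs (D (2 * m + 1)) u \<psi>) \<le> 2 * sqrt (card R / 2 ^ m) * nrm W \<psi>"
    and "nrm W (rank1 c qs u (D (2 * m + 1)) \<psi>) \<le> 2 * sqrt (card R / 2 ^ m) *
      sqrt (mass W (\<lambda>x. D (2 * m + 1) (query_reg qs x) (answer_reg qs x) \<noteq> 0) \<psi>)"
proof -
  let ?n = "2 * m + 1" and ?e = "real (card R) / 2 ^ m"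
  have pos: "0 < ?n" by simp
  note qs = length_qs[OF assms(1,2) pos]
  note n = qs(1)
  have K: "(\<Sum>a\<in>bits (3 * ?n). (u w a)\<^sup>2) * (\<Sum>a\<in>bits (3 * ?n). (D ?n w a)\<^sup>2) \<le> 4 * ?e" if "length w = ?n" for w
  proof -
    have "(\<Sum>a\<in>bits (3 * ?n). (u w a)\<^sup>2) * (\<Sum>a\<in>bits (3 * ?n). (D ?n w a)\<^sup>2) \<le> 2 * (2 * real (card R) / 2 ^ m)"
      by (intro mult_mono assms(3)[OF that] D_sample_norm[OF that n]) (simp_all add: sum_nonneg)
    then show ?thesis by simp
  qed
  have "(nrm W (rank1 c qs (D ?n) u \<psi>))\<^sup>2 \<le> 4 * ?e * mass W (\<lambda>x. u (query_reg qs x) (answer_reg qs x) \<noteq> 0) \<psi>"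
    by (rule rank1_norm[OF qs(2,3) assms(2)]) (use K in \<open>simp add: mult.commute\<close>)
  also have "\<dots> \<le> 4 * ?e * (nrm W \<psi>)\<^sup>2" by (rule mult_left_mono[OF mass_le_nrm]) simp
  also have "\<dots> = (2 * sqrt ?e * nrm W \<psi>)\<^sup>2" by (simp add: power_mult_distrib)
  finally show "nrm W (rank1 c qs (D ?n) u \<psi>) \<le> 2 * sqrt ?e * nrm W \<psi>"
    by (rule power2_le_imp_le) simp
  let ?M = "mass W (\<lambda>x. D ?n (query_reg qs x) (answer_reg qs x) \<noteq> 0) \<psi>"
  have "(nrm W (rank1 c qs u (D ?n) \<psi>))\<^sup>2 \<le> 4 * ?e * ?M"
    by (rule rank1_norm[OF qs(2,3) assms(2)]) (rule K)
  also have "\<dots> = (2 * sqrt ?e * sqrt ?M)\<^sup>2" by (simp add: power_mult_distrib)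
  finally show "nrm W (rank1 c qs u (D ?n) \<psi>) \<le> 2 * sqrt ?e * sqrt ?M"
    by (rule power2_le_imp_le) simp
qed

lemma nrm_gate_change_sample:
  assumes "valid_gate W (Query c v qs)" "length qs = 4 * (2 * m + 1)"
  shows "nrm W (gate_change old new (Query c v qs) \<psi>) \<le> 4 * sqrt (card R / 2 ^ m) * nrm W \<psi>"
proof -
  let ?n = "2 * m + 1" and ?g = "Query c v qs" and ?e = "sqrt (card R / 2 ^ m)"
  let ?old = "\<lambda>w. reflector (3 * ?n) (old w)" and ?new = "\<lambda>w. reflector (3 * ?n) (new w)"
  have "nrm W (gate_change old new ?g \<psi>) = nrm W (\<lambda>x. rank1 c qs (D ?n) ?new \<psi> x + rank1 c qs ?old (D ?n) \<psi> x)"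
    by (rule nrm_cong) (rule gate_change_D[OF assms])
  also have "\<dots> \<le> nrm W (rank1 c qs (D ?n) ?new \<psi>) + nrm W (rank1 c qs ?old (D ?n) \<psi>)"
    by (rule nrm_triangle)
  also have "\<dots> \<le> 2 * ?e * nrm W \<psi> + 2 * ?e * nrm W \<psi>"
  proof (rule add_mono)
    show "nrm W (rank1 c qs (D ?n) ?new \<psi>) \<le> 2 * ?e * nrm W \<psi>"
      by (rule nrm_rank1_sample(1)[OF assms]) (rule sum_reflector_le)
    have "nrm W (rank1 c qs ?old (D ?n) \<psi>) \<le> 2 * ?e * sqrt (mass W (\<lambda>x. D ?n (query_reg qs x) (answer_reg qs x) \<noteq> 0) \<psi>)"
      by (rule nrm_rank1_sample(2)[OF assms]) (rule sum_reflector_le)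
    also have "\<dots> \<le> 2 * ?e * nrm W \<psi>"
      by (intro mult_left_mono real_le_lsqrt mass_le_nrm) simp_all
    finally show "nrm W (rank1 c qs ?old (D ?n) \<psi>) \<le> 2 * ?e * nrm W \<psi>" .
  qed
  finally show ?thesis by linarith
qed

lemma nrm_gate_change:
  assumes "valid_gate W g"
  shows "nrm W (gate_change old new g \<psi>) \<le> 4 * sqrt (card R / 2 ^ m) * nrm W \<psi> +
    2 * sqrt (\<Sum>s\<in>R. query_mass W (6 * m + 2) g (enc_strs [s, f s]) \<psi>)"
proof -
  have nn: "0 \<le> 4 * sqrt (card R / 2 ^ m) * nrm W \<psi>" "0 \<le> 2 * sqrt (\<Sum>s\<in>R. query_mass W (6 * m + 2) g (enc_strs [s, f s]) \<psi>)"
    by (simp_all add: sum_nonneg)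
  consider (sample) c v qs where "g = Query c v qs" "length qs = 4 * (2 * m + 1)"
    | (verify) c v qs where "g = Query c v qs" "length qs = 4 * (6 * m + 2)"
    | (other) "\<And>c v qs. g = Query c v qs \<Longrightarrow> length qs \<noteq> 4 * (2 * m + 1) \<and> length qs \<noteq> 4 * (6 * m + 2)"
    by blast
  then show ?thesis
  proof cases
    case sample
    show ?thesis using nrm_gate_change_sample[OF assms[unfolded sample(1)] sample(2), of \<psi>] nn(2) unfolding sample(1) by linarith
  next
    case verify
    show ?thesis using nrm_gate_change_verify[OF assms[unfolded verify(1)] verify(2), of \<psi>] nn(1) unfolding verify(1) by linarith
  next
    case other
    have "nrm W (gate_change old new g \<psi>) = nrm W (\<lambda>x. 0)"
      by (rule nrm_cong) (rule gate_change_zero[OF assms _ other])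
    then show ?thesis using nn by simp
  qed
qed

lemma gate_change_commute: "gate_change new old g \<psi> = (\<lambda>x. - gate_change old new g \<psi> x)"
  by (rule ext) (simp add: gate_change_def)

text \<open>How far hiding the keys of \<open>R\<close> moves a run; either run can be used to measure the query masses.\<close>

lemma nrm_run_hide:
  assumes gs: "\<And>g. g \<in> set gs \<Longrightarrow> valid_gate W g" and \<psi>: "nrm W \<psi> = 1" and A: "A = old \<or> A = new"
  shows "nrm W (\<lambda>x. run old gs \<psi> x - run new gs \<psi> x) \<le>
    (\<Sum>t<length gs. 4 * sqrt (card R / 2 ^ m) +
       2 * sqrt (\<Sum>s\<in>R. query_mass W (6 * m + 2) (gs ! t) (enc_strs [s, f s]) (run A (take t gs) \<psi>)))"
proof -
  have unit: "nrm W (run A (take t gs) \<psi>) = 1" for t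
    using nrm_run[of "take t gs" W A \<psi>] gs \<psi> by (auto dest: in_set_takeD)
  have "nrm W (\<lambda>x. run old gs \<psi> x - run new gs \<psi> x) \<le> (\<Sum>t<length gs. nrm W (gate_change old new (gs ! t) (run A (take t gs) \<psi>)))"
  proof (cases "A = new")
    case True
    then show ?thesis using nrm_run_change[OF gs, where A = old and B = new and \<psi> = \<psi>] by simp
  next
    case False
    then have A: "A = old" using A by simp
    have "nrm W (\<lambda>x. run old gs \<psi> x - run new gs \<psi> x) = nrm W (\<lambda>x. run new gs \<psi> x - run old gs \<psi> x)"
      by (rule nrm_minus_commute)
    also have "\<dots> \<le> (\<Sum>t<length gs. nrm W (gate_change new old (gs ! t) (run old (take t gs) \<psi>)))"
      by (rule nrm_run_change[OF gs])
    finally show ?thesis unfolding A gate_change_commute nrm_uminus .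
  qed
  also have "\<dots> \<le> (\<Sum>t<length gs. 4 * sqrt (card R / 2 ^ m) +
       2 * sqrt (\<Sum>s\<in>R. query_mass W (6 * m + 2) (gs ! t) (enc_strs [s, f s]) (run A (take t gs) \<psi>)))"
  proof (rule sum_mono)
    fix t assume "t \<in> {..<length gs}"
    then show "nrm W (gate_change old new (gs ! t) (run A (take t gs) \<psi>)) \<le> 4 * sqrt (card R / 2 ^ m) +
       2 * sqrt (\<Sum>s\<in>R. query_mass W (6 * m + 2) (gs ! t) (enc_strs [s, f s]) (run A (take t gs) \<psi>))"
      using nrm_gate_change[of "gs ! t" "run A (take t gs) \<psi>"] gs unit[of t] by simp
  qed
  finally show ?thesis .
qed

end

section \<open>Output distributions hardly depend on a single key\<close>

subsection \<open>Inner products\<close>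

definition ip :: "nat \<Rightarrow> state \<Rightarrow> state \<Rightarrow> complex" where
  "ip W \<eta> \<psi> = (\<Sum>x\<in>bits W. cnj (\<eta> x) * \<psi> x)"

lemma ip_sum: "ip W \<eta> (\<lambda>x. \<Sum>i\<in>I. c i * \<psi> i x) = (\<Sum>i\<in>I. c i * ip W \<eta> (\<psi> i))"
proof -
  have "ip W \<eta> (\<lambda>x. \<Sum>i\<in>I. c i * \<psi> i x) = (\<Sum>x\<in>bits W. \<Sum>i\<in>I. c i * (cnj (\<eta> x) * \<psi> i x))"
    unfolding ip_def by (rule sum.cong) (simp_all add: sum_distrib_left mult.left_commute)
  also have "\<dots> = (\<Sum>i\<in>I. c i * ip W \<eta> (\<psi> i))"
    unfolding ip_def by (subst sum.swap) (simp add: sum_distrib_left)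
  finally show ?thesis .
qed

lemma ip_add: "ip W \<eta> (\<lambda>x. \<psi> x + \<phi> x) = ip W \<eta> \<psi> + ip W \<eta> \<phi>"
  by (simp add: ip_def distrib_left sum.distrib)

lemma mass_mono: "(\<And>x. P x \<Longrightarrow> Q x) \<Longrightarrow> mass W P \<psi> \<le> mass W Q \<psi>"
  unfolding mass_def by (rule sum_mono) auto

lemma cmod_ip_le: "cmod (ip W \<eta> \<psi>) \<le> nrm W \<eta> * nrm W \<psi>"
proof -
  have "cmod (ip W \<eta> \<psi>) \<le> (\<Sum>x\<in>bits W. cmod (cnj (\<eta> x) * \<psi> x))"
    unfolding ip_def by (rule norm_sum)
  also have "\<dots> = (\<Sum>x\<in>bits W. \<bar>cmod (\<eta> x)\<bar> * \<bar>cmod (\<psi> x)\<bar>)"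
    by (simp add: norm_mult)
  also have "\<dots> \<le> nrm W \<eta> * nrm W \<psi>" unfolding nrm_def by (rule L2_set_mult_ineq)
  finally show ?thesis .
qed

text \<open>Bessel's inequality for states with disjoint supports.\<close>

lemma Bessel:
  assumes fin: "finite I" and gs: "\<And>g. g \<in> set gs \<Longrightarrow> valid_gate W g"
    and disj: "\<And>x i j. i \<in> I \<Longrightarrow> j \<in> I \<Longrightarrow> \<xi> i x \<noteq> 0 \<Longrightarrow> \<xi> j x \<noteq> 0 \<Longrightarrow> i = j"
    and B: "\<And>i. i \<in> I \<Longrightarrow> (nrm W (\<xi> i))\<^sup>2 \<le> B" and B0: "0 \<le> B"
  shows "(\<Sum>i\<in>I. (cmod (ip W \<eta> (run A gs (\<xi> i))))\<^sup>2) \<le> B * (nrm W \<eta>)\<^sup>2"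
proof -
  define c where "c = (\<lambda>i. ip W \<eta> (run A gs (\<xi> i)))"
  define S where "S = (\<Sum>i\<in>I. (cmod (c i))\<^sup>2)"
  define \<xi>' where "\<xi>' = (\<lambda>x. \<Sum>i\<in>I. cnj (c i) * \<xi> i x)"
  have S0: "0 \<le> S" by (simp add: S_def sum_nonneg)
  have "complex_of_real S = (\<Sum>i\<in>I. cnj (c i) * c i)"
    unfolding S_def of_real_sum by (rule sum.cong) (simp_all only: complex_norm_square mult.commute)
  also have "\<dots> = ip W \<eta> (run A gs \<xi>')"
  proof -
    have "run A gs \<xi>' = (\<lambda>x. \<Sum>i\<in>I. cnj (c i) * run A gs (\<xi> i) x)"
      unfolding \<xi>'_def by (rule ext) (rule run_linear)
    then show ?thesis by (simp add: ip_sum c_def)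
  qed
  finally have "S = cmod (ip W \<eta> (run A gs \<xi>'))" using S0 by (metis abs_of_nonneg norm_of_real)
  also have "\<dots> \<le> nrm W \<eta> * nrm W \<xi>'" using cmod_ip_le[of W \<eta> "run A gs \<xi>'"] nrm_run[OF gs] by simp
  finally have S1: "S\<^sup>2 \<le> (nrm W \<eta>)\<^sup>2 * (nrm W \<xi>')\<^sup>2"
    using S0 by (metis power_mono power_mult_distrib)
  have "(nrm W \<xi>')\<^sup>2 = (\<Sum>x\<in>bits W. \<Sum>i\<in>I. (cmod (c i))\<^sup>2 * (cmod (\<xi> i x))\<^sup>2)"
    unfolding nrm_sq
  proof (rule sum.cong[OF refl])
    fix x
    show "(cmod (\<xi>' x))\<^sup>2 = (\<Sum>i\<in>I. (cmod (c i))\<^sup>2 * (cmod (\<xi> i x))\<^sup>2)"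
    proof (cases "\<exists>i\<in>I. \<xi> i x \<noteq> 0")
      case True
      then obtain i where i: "i \<in> I" "\<xi> i x \<noteq> 0" by blast
      have z: "\<xi> j x = 0" if "j \<in> I" "j \<noteq> i" for j using disj[OF that(1) i(1) _ i(2)] that(2) by blast
      have "\<xi>' x = (\<Sum>j\<in>I. if j = i then cnj (c i) * \<xi> i x else 0)"
        unfolding \<xi>'_def by (rule sum.cong) (auto simp: z)
      moreover have "(\<Sum>j\<in>I. (cmod (c j))\<^sup>2 * (cmod (\<xi> j x))\<^sup>2) = (\<Sum>j\<in>I. if j = i then (cmod (c i))\<^sup>2 * (cmod (\<xi> i x))\<^sup>2 else 0)"
        by (rule sum.cong) (auto simp: z)
      ultimately show ?thesis using fin i(1) by (simp add: norm_mult power_mult_distrib)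
    next
      case False
      then have "\<xi>' x = (\<Sum>i\<in>I. 0)" unfolding \<xi>'_def by (intro sum.cong) auto
      moreover have "(\<Sum>i\<in>I. (cmod (c i))\<^sup>2 * (cmod (\<xi> i x))\<^sup>2) = (\<Sum>i\<in>I. 0)" using False by (intro sum.cong) auto
      ultimately show ?thesis by simp
    qed
  qed
  also have "\<dots> = (\<Sum>i\<in>I. (cmod (c i))\<^sup>2 * (nrm W (\<xi> i))\<^sup>2)"
    unfolding nrm_sq by (subst sum.swap) (simp add: sum_distrib_left)
  also have "\<dots> \<le> (\<Sum>i\<in>I. (cmod (c i))\<^sup>2 * B)" by (intro sum_mono mult_left_mono B) simp_all
  also have "\<dots> = B * S" by (simp add: S_def sum_distrib_left mult.commute)
  finally have "S\<^sup>2 \<le> (nrm W \<eta>)\<^sup>2 * (B * S)" using S1 by (meson mult_left_mono order_trans zero_le_power2)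
  then have "S * S \<le> (B * (nrm W \<eta>)\<^sup>2) * S" by (simp add: power2_eq_square mult_ac)
  moreover have "0 \<le> B * (nrm W \<eta>)\<^sup>2" using B0 by simp
  ultimately have "S \<le> B * (nrm W \<eta>)\<^sup>2" using S0 by (cases "S = 0") simp_all
  then show ?thesis by (simp add: S_def c_def)
qed

subsection \<open>The leading term of the change of a sampling query\<close>

text \<open>
  The change \<open>d\<close> of the reflection vector for samples of length \<open>m\<close> when the key of \<open>s\<close> is hidden, and
  the resulting operator \<open>d a^T\<close> with the unchanged vector \<open>a\<close>.  It has norm \<open>O(1 / sqrt (2^m))\<close> on
  every state, but its range is spanned by basis states with \<open>s\<close> in the answer register; this makes the
  ranges orthogonal for different \<open>s\<close>.  All other terms are small after summation over \<open>s\<close>, as they are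
  of second order or involve the mass of the state on such basis states or on verifications of the right keys.
\<close>

definition sample_diff :: "nat \<Rightarrow> (bool list \<Rightarrow> bool list) \<Rightarrow> bool list \<Rightarrow> bool list \<Rightarrow> bool list \<Rightarrow> real" where
  "sample_diff m f s w a = (if w = enc_strs [unary m]
     then (of_bool (a = sample_point s (f s)) - of_bool (a = sample_point s [])) / sqrt (2 ^ m) else 0)"

definition main_change :: "nat \<Rightarrow> (bool list \<Rightarrow> bool list) \<Rightarrow> bool list \<Rightarrow> gate \<Rightarrow> state \<Rightarrow> state" where
  "main_change m f s g \<psi> x = (case g of Query c v qs \<Rightarrow> if length qs = 4 * (2 * m + 1)
     then rank1 c qs (sample_diff m f s) (\<lambda>w. reflector (3 * (2 * m + 1)) (answers f w)) \<psi> x else 0 | _ \<Rightarrow> 0)"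

text \<open>The mass of the two samples that present the puzzle \<open>s\<close>.\<close>

definition point_mass :: "nat \<Rightarrow> nat \<Rightarrow> (bool list \<Rightarrow> bool list) \<Rightarrow> bool list \<Rightarrow> gate \<Rightarrow> state \<Rightarrow> real" where
  "point_mass W m f s g \<psi> = (case g of Query c v qs \<Rightarrow> if length qs = 4 * (2 * m + 1)
     then mass W (\<lambda>x. answer_reg qs x \<in> {sample_point s (f s), sample_point s []}) \<psi> else 0 | _ \<Rightarrow> 0)"

lemma point_mass_nonneg [simp]: "0 \<le> point_mass W m f s g \<psi>"
  by (simp add: point_mass_def split: gate.split)

lemma sum_point_mass: "(\<Sum>s\<in>bits m. point_mass W m f s g \<psi>) \<le> (nrm W \<psi>)\<^sup>2"
proof (cases g)
  case (Query c v qs)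
  show ?thesis
  proof (cases "length qs = 4 * (2 * m + 1)")
    case True
    have "(\<Sum>s\<in>bits m. mass W (\<lambda>x. answer_reg qs x \<in> {sample_point s (f s), sample_point s []}) \<psi>) \<le> (nrm W \<psi>)\<^sup>2"
      by (rule sum_mass_le[OF finite_bits]) (auto simp: sample_point_inj)
    then show ?thesis using True by (simp add: Query point_mass_def)
  qed (simp add: Query point_mass_def)
qed (simp_all add: point_mass_def)

lemma main_change_disjoint:
  "main_change m f s g \<psi> x \<noteq> 0 \<Longrightarrow> main_change m f s' g \<psi> x \<noteq> 0 \<Longrightarrow> s = s'"
proof (cases g)
  case (Query c v qs)
  assume *: "main_change m f s g \<psi> x \<noteq> 0" "main_change m f s' g \<psi> x \<noteq> 0"
  have "answer_reg qs x = sample_point s (f s) \<or> answer_reg qs x = sample_point s []"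
    if "main_change m f s g \<psi> x \<noteq> 0" for s
    using that by (auto simp: Query main_change_def rank1_def sample_diff_def split: if_splits)
  from this[OF *(1)] this[OF *(2)] show "s = s'" by (auto simp: sample_point_inj)
qed (simp_all add: main_change_def)

text \<open>
  The total query mass on the verification of the right key of \<open>s\<close>, in the run with this key hidden.
\<close>

definition puzzle_mass :: "nat \<Rightarrow> nat \<Rightarrow> (bool list \<Rightarrow> bool list) \<Rightarrow> gate list \<Rightarrow> state \<Rightarrow> bool list \<Rightarrow> real" where
  "puzzle_mass W m f gs \<psi> s = (\<Sum>t<length gs. query_mass W (6 * m + 2) (gs ! t) (enc_strs [s, f s])
     (run (answers (hide {s} f)) (take t gs) \<psi>))"

context
  fixes m :: nat and f :: "bool list \<Rightarrow> bool list" and W :: nat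
  assumes m: "0 < m" and W: "W < 2 ^ m" and key: "\<And>s. s \<in> bits m \<Longrightarrow> length (f s) = 2 * m"
begin

lemma hidden_key: "s \<in> bits m \<Longrightarrow> hidden_keys m f {s} W"
  using m W key by unfold_locales auto

lemma main_change_norm:
  assumes s: "s \<in> bits m" and g: "valid_gate W g"
  shows "(nrm W (main_change m f s g \<psi>))\<^sup>2 \<le> 4 / 2 ^ m * (nrm W \<psi>)\<^sup>2"
proof -
  interpret hidden_keys m f "{s}" W by (rule hidden_key[OF s])
  show ?thesis
  proof (cases "\<exists>c v qs. g = Query c v qs \<and> length qs = 4 * (2 * m + 1)")
    case True
    then obtain c v qs where q: "g = Query c v qs" "length qs = 4 * (2 * m + 1)" by blast
    have pos: "0 < 2 * m + 1" by simp
    note n = length_qs(1)[OF g[unfolded q(1)] q(2) pos]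
    have len: "length (query_reg qs x) = 2 * m + 1" for x using q(2) by (simp add: query_reg_def)
    have "main_change m f s g \<psi> = rank1 c qs (D (2 * m + 1)) (\<lambda>w. reflector (3 * (2 * m + 1)) (answers f w)) \<psi>"
      using D_sample[OF len n] q by (intro ext) (simp add: main_change_def rank1_def sample_diff_def)
    moreover have "nrm W (rank1 c qs (D (2 * m + 1)) (\<lambda>w. reflector (3 * (2 * m + 1)) (answers f w)) \<psi>) \<le>
        2 * sqrt (card {s} / 2 ^ m) * nrm W \<psi>"
      by (rule nrm_rank1_sample(1)[OF g[unfolded q(1)] q(2)]) (rule sum_reflector_le)
    ultimately have "nrm W (main_change m f s g \<psi>) \<le> 2 * sqrt (1 / 2 ^ m) * nrm W \<psi>" by simp
    then have "(nrm W (main_change m f s g \<psi>))\<^sup>2 \<le> (2 * sqrt (1 / 2 ^ m) * nrm W \<psi>)\<^sup>2"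
      by (rule power_mono) simp
    then show ?thesis by (simp add: power_mult_distrib)
  next
    case False
    then have "main_change m f s g \<psi> = (\<lambda>x. 0)"
      by (intro ext) (cases g, auto simp: main_change_def)
    then show ?thesis by simp
  qed
qed

text \<open>
  The change of a gate on the perturbed state \<open>\<psi> - \<delta>\<close>, up to the main term on \<open>\<psi>\<close>, is of second order.
\<close>

lemma nrm_gate_change_minus_main:
  assumes s: "s \<in> bits m" and g: "valid_gate W g"
  shows "nrm W (\<lambda>x. gate_change (answers f) (answers (hide {s} f)) g (\<lambda>x. \<psi> x - \<delta> x) x - main_change m f s g \<psi> x) \<le>
    4 * sqrt (1 / 2 ^ m) * (sqrt (point_mass W m f s g \<psi>) + nrm W \<delta>) +
    2 * sqrt (query_mass W (6 * m + 2) g (enc_strs [s, f s]) (\<lambda>x. \<psi> x - \<delta> x))"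
proof -
  interpret hidden_keys m f "{s}" W by (rule hidden_key[OF s])
  let ?e = "sqrt (1 / 2 ^ m)" and ?\<phi> = "\<lambda>x. \<psi> x - \<delta> x"
  have nn: "0 \<le> 4 * ?e * (sqrt (point_mass W m f s g \<psi>) + nrm W \<delta>)"
    "0 \<le> 2 * sqrt (query_mass W (6 * m + 2) g (enc_strs [s, f s]) ?\<phi>)" by simp_all
  consider (sample) c v qs where "g = Query c v qs" "length qs = 4 * (2 * m + 1)"
    | (other) "\<And>c v qs. g = Query c v qs \<Longrightarrow> length qs \<noteq> 4 * (2 * m + 1)"
    by blast
  then show ?thesis
  proof cases
    case other
    have "main_change m f s g \<psi> x = 0" for x
      using other by (cases g) (auto simp: main_change_def)
    then have "nrm W (\<lambda>x. gate_change old new g ?\<phi> x - main_change m f s g \<psi> x) = nrm W (gate_change old new g ?\<phi>)"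
      by simp
    also have "\<dots> \<le> 2 * sqrt (query_mass W (6 * m + 2) g (enc_strs [s, f s]) ?\<phi>)"
    proof (cases "\<exists>c v qs. g = Query c v qs \<and> length qs = 4 * (6 * m + 2)")
      case True
      then obtain c v qs where q: "g = Query c v qs" "length qs = 4 * (6 * m + 2)" by blast
      show ?thesis using nrm_gate_change_verify[OF g[unfolded q(1)] q(2), of ?\<phi>] unfolding q(1) by simp
    next
      case False
      have "nrm W (gate_change old new g ?\<phi>) = nrm W (\<lambda>x. 0)"
        by (rule nrm_cong) (rule gate_change_zero[OF g], assumption, use other False in blast)
      then show ?thesis using nn(2) by simp
    qed
    finally show ?thesis using nn(1) unfolding old_def new_def by linarith
  next
    case sample
    let ?n = "2 * m + 1"
    let ?old = "\<lambda>w. reflector (3 * ?n) (old w)" and ?new = "\<lambda>w. reflector (3 * ?n) (new w)"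
    let ?R = "rank1 c qs"
    have card_single: "real (card {s}) = 1" by simp
    have pos: "0 < ?n" by simp
    note n = length_qs(1)[OF g[unfolded sample(1)] sample(2) pos]
    have len: "length (query_reg qs x) = ?n" for x using sample(2) by (simp add: query_reg_def)
    have main: "main_change m f s g \<psi> x = ?R (D ?n) ?old \<psi> x" for x
      using D_sample[OF len n] sample by (simp add: main_change_def rank1_def sample_diff_def old_def)
    have "?new = (\<lambda>w a. ?old w a + D ?n w a)" by (simp add: D_def)
    then have "?R (D ?n) ?new \<psi> x = ?R (D ?n) ?old \<psi> x + ?R (D ?n) (D ?n) \<psi> x" for x
      by (simp only: rank1_add_right)
    then have new: "?R (D ?n) ?new \<psi> x = ?R (D ?n) ?old \<psi> x + ?R (D ?n) (D ?n) \<psi> x" for x .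
    have "gate_change old new g ?\<phi> x - main_change m f s g \<psi> x =
        (?R (D ?n) (D ?n) \<psi> x - ?R (D ?n) ?new \<delta> x) + (?R ?old (D ?n) \<psi> x - ?R ?old (D ?n) \<delta> x)"
      if "x \<in> bits W" for x
    proof -
      have eq: "gate_change old new g ?\<phi> x = (?R (D ?n) ?new \<psi> x - ?R (D ?n) ?new \<delta> x) +
          (?R ?old (D ?n) \<psi> x - ?R ?old (D ?n) \<delta> x)"
        using gate_change_D[OF g[unfolded sample(1)] sample(2) that, of ?\<phi>]
        unfolding sample(1) rank1_diff .
      have "(a + b - c) + (d - e) - a = (b - c) + (d - e)" for a b c d e :: complex by simp
      then show ?thesis unfolding eq main new .
    qed
    then have "nrm W (\<lambda>x. gate_change old new g ?\<phi> x - main_change m f s g \<psi> x) =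
        nrm W (\<lambda>x. (?R (D ?n) (D ?n) \<psi> x - ?R (D ?n) ?new \<delta> x) + (?R ?old (D ?n) \<psi> x - ?R ?old (D ?n) \<delta> x))"
      by (rule nrm_cong)
    also have "\<dots> \<le> (nrm W (?R (D ?n) (D ?n) \<psi>) + nrm W (?R (D ?n) ?new \<delta>)) +
        (nrm W (?R ?old (D ?n) \<psi>) + nrm W (?R ?old (D ?n) \<delta>))"
      by (rule order_trans[OF nrm_triangle add_mono[OF nrm_triangle_diff nrm_triangle_diff]])
    also have "\<dots> \<le> (2 * ?e * sqrt (point_mass W m f s g \<psi>) + 2 * ?e * nrm W \<delta>) +
        (2 * ?e * sqrt (point_mass W m f s g \<psi>) + 2 * ?e * nrm W \<delta>)"
    proof -
      have "mass W (\<lambda>x. D ?n (query_reg qs x) (answer_reg qs x) \<noteq> 0) \<psi> \<le> point_mass W m f s g \<psi>"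
      proof -
        have "answer_reg qs x \<in> {sample_point s (f s), sample_point s []}"
          if "D ?n (query_reg qs x) (answer_reg qs x) \<noteq> 0" for x
          using that unfolding D_sample[OF len n] by (auto split: if_splits)
        then have "mass W (\<lambda>x. D ?n (query_reg qs x) (answer_reg qs x) \<noteq> 0) \<psi> \<le>
            mass W (\<lambda>x. answer_reg qs x \<in> {sample_point s (f s), sample_point s []}) \<psi>"
          by (rule mass_mono)
        then show ?thesis unfolding point_mass_def sample(1) using sample(2) by simp
      qed
      then have pm: "2 * ?e * sqrt (mass W (\<lambda>x. D ?n (query_reg qs x) (answer_reg qs x) \<noteq> 0) \<psi>) \<le>
          2 * ?e * sqrt (point_mass W m f s g \<psi>)" by (intro mult_left_mono) simp_all
      have D2: "(\<Sum>a\<in>bits (3 * ?n). (D ?n w a)\<^sup>2) \<le> 2" if "length w = ?n" for w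
      proof -
        have "(\<Sum>a\<in>bits (3 * ?n). (D ?n w a)\<^sup>2) \<le> 2 / 2 ^ m" using D_sample_norm[OF that n] by simp
        also have "\<dots> \<le> 2" by (simp add: divide_le_eq)
        finally show ?thesis .
      qed
      have 1: "nrm W (?R (D ?n) (D ?n) \<psi>) \<le> 2 * ?e * sqrt (point_mass W m f s g \<psi>)"
      proof -
        have "nrm W (?R (D ?n) (D ?n) \<psi>) \<le> 2 * ?e * sqrt (mass W (\<lambda>x. D ?n (query_reg qs x) (answer_reg qs x) \<noteq> 0) \<psi>)"
          by (rule nrm_rank1_sample(2)[OF g[unfolded sample(1)] sample(2), unfolded card_single]) (rule D2)
        then show ?thesis using pm by (rule order_trans)
      qed
      have 2: "nrm W (?R (D ?n) ?new \<delta>) \<le> 2 * ?e * nrm W \<delta>"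
        using nrm_rank1_sample(1)[OF g[unfolded sample(1)] sample(2) sum_reflector_le, where \<psi> = \<delta>] by simp
      have 3: "nrm W (?R ?old (D ?n) \<psi>) \<le> 2 * ?e * sqrt (point_mass W m f s g \<psi>)"
        using nrm_rank1_sample(2)[OF g[unfolded sample(1)] sample(2) sum_reflector_le, where \<psi> = \<psi>] pm
        by (simp only: card_single) (rule order_trans, assumption+)
      have "nrm W (?R ?old (D ?n) \<delta>) \<le> 2 * ?e * sqrt (mass W (\<lambda>x. D ?n (query_reg qs x) (answer_reg qs x) \<noteq> 0) \<delta>)"
        using nrm_rank1_sample(2)[OF g[unfolded sample(1)] sample(2) sum_reflector_le, where \<psi> = \<delta>] by simp
      also have "\<dots> \<le> 2 * ?e * nrm W \<delta>"
        by (intro mult_left_mono real_le_lsqrt mass_le_nrm) simp_all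
      finally have 4: "nrm W (?R ?old (D ?n) \<delta>) \<le> 2 * ?e * nrm W \<delta>" .
      show ?thesis using 1 2 3 4 by linarith
    qed
    also have "\<dots> = 4 * ?e * (sqrt (point_mass W m f s g \<psi>) + nrm W \<delta>)" by (simp add: algebra_simps)
    finally show ?thesis using nn(2) unfolding old_def new_def by linarith
  qed
qed

subsection \<open>The influence of all keys of one length\<close>

context
  fixes gs :: "gate list" and \<psi> :: state and rd :: "bool list \<Rightarrow> 'y" and Y :: "'y set"
  assumes gs: "\<And>g. g \<in> set gs \<Longrightarrow> valid_gate W g" and \<psi>: "nrm W \<psi> = 1" and Y: "finite Y"
begin

text \<open>
  For a fixed run with \<open>T\<close> gates: the states \<open>stage t\<close> of the run with all keys; \<open>deviation s t\<close> of the
  run with the key of \<open>s\<close> hidden, which is at most \<open>drift s\<close> in norm; the splitting of the deviation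
  into the contributions \<open>lead_term s t\<close> of the individual gates and a \<open>remainder s\<close>; and the
  probability of reading the output \<open>y\<close> at the end, with \<open>out_part y\<close> the component of the final
  state that yields \<open>y\<close>.  The amplitude of a single sample is \<open>amp\<close>; \<open>qmass s t\<close> and
  \<open>pmass s t\<close> are the masses of the verification and of the samples of \<open>s\<close> at gate \<open>t\<close>.
\<close>

definition "hidden_answers s = answers (hide {s} f)"
definition "stage t = run (answers f) (take t gs) \<psi>"
definition "deviation s t = (\<lambda>x. stage t x - run (hidden_answers s) (take t gs) \<psi> x)"
definition "qmass s t = query_mass W (6 * m + 2) (gs ! t) (enc_strs [s, f s]) (run (hidden_answers s) (take t gs) \<psi>)"
definition "amp = sqrt (1 / 2 ^ m)"
definition "drift s = (\<Sum>t<length gs. 4 * amp + 2 * sqrt (qmass s t))"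
definition "lead_term s t = main_change m f s (gs ! t) (stage t)"
definition "rest_term s t = (\<lambda>x. gate_change (answers f) (hidden_answers s) (gs ! t) (\<lambda>x. stage t x - deviation s t x) x - lead_term s t x)"
definition "remainder s = (\<lambda>x. \<Sum>t<length gs. run (answers f) (drop (Suc t) gs) (rest_term s t) x)"
definition "pmass s t = point_mass W m f s (gs ! t) (stage t)"
definition "out_part y = (\<lambda>x. if rd x = y then stage (length gs) x else 0)"
definition "output_prob A y = mass W (\<lambda>x. rd x = y) (run A gs \<psi>)"

lemma qmass_nonneg [simp]: "0 \<le> qmass s t" and pmass_nonneg [simp]: "0 \<le> pmass s t" and amp_nonneg [simp]: "0 \<le> amp"
  by (simp_all add: qmass_def pmass_def amp_def)

lemma amp_sq: "amp\<^sup>2 = 1 / 2 ^ m"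
  by (simp add: amp_def)

lemma puzzle_mass_qmass: "puzzle_mass W m f gs \<psi> s = (\<Sum>t<length gs. qmass s t)"
  by (simp add: puzzle_mass_def qmass_def hidden_answers_def)

lemma gate_at: "t < length gs \<Longrightarrow> valid_gate W (gs ! t)"
  by (simp add: gs)

lemma nrm_stage: "nrm W (stage t) = 1"
  unfolding stage_def using nrm_run[of "take t gs" W "answers f" \<psi>] gs \<psi> by (auto dest: in_set_takeD)

lemma nrm_deviation_le_drift:
  assumes s: "s \<in> bits m" and t: "t \<le> length gs" shows "nrm W (deviation s t) \<le> drift s"
proof -
  interpret hidden_keys m f "{s}" W by (rule hidden_key[OF s])
  have "nrm W (\<lambda>x. run old (take t gs) \<psi> x - run new (take t gs) \<psi> x) \<le>
    (\<Sum>t'<length (take t gs). 4 * sqrt (card {s} / 2 ^ m) +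
       2 * sqrt (\<Sum>s\<in>{s}. query_mass W (6 * m + 2) (take t gs ! t') (enc_strs [s, f s]) (run new (take t' (take t gs)) \<psi>)))"
    by (rule nrm_run_hide[OF _ \<psi>]) (auto intro: gs dest: in_set_takeD)
  also have "\<dots> = (\<Sum>t'<t. 4 * amp + 2 * sqrt (qmass s t'))"
    using t by (intro sum.cong) (simp_all add: amp_def qmass_def hidden_answers_def new_def min_def)
  also have "\<dots> \<le> drift s"
    unfolding drift_def using t by (intro sum_mono2) auto
  finally show ?thesis by (simp add: deviation_def stage_def hidden_answers_def old_def new_def)
qed

lemma sum_sq_le: "(\<Sum>t<length gs. a t :: real)\<^sup>2 \<le> real (length gs) * (\<Sum>t<length gs. (a t)\<^sup>2)"
  using sum_squared_le_sum_of_squares[of a "{..<length gs}"] by (simp add: mult.commute)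

lemma drift_sq: "(drift s)\<^sup>2 \<le> 32 * amp\<^sup>2 * (real (length gs))\<^sup>2 + 8 * real (length gs) * puzzle_mass W m f gs \<psi> s"
proof -
  have two: "(a + b)\<^sup>2 \<le> 2 * a\<^sup>2 + 2 * b\<^sup>2" for a b :: real
    using sum_squares_bound[of a b] by (simp add: power2_sum)
  have eq: "drift s = 4 * amp * real (length gs) + 2 * (\<Sum>t<length gs. sqrt (qmass s t))"
    by (simp add: drift_def sum.distrib sum_distrib_left)
  have "(drift s)\<^sup>2 \<le> 2 * (4 * amp * real (length gs))\<^sup>2 + 2 * (2 * (\<Sum>t<length gs. sqrt (qmass s t)))\<^sup>2"
    unfolding eq by (rule two)
  also have "\<dots> = 32 * amp\<^sup>2 * (real (length gs))\<^sup>2 + 8 * (\<Sum>t<length gs. sqrt (qmass s t))\<^sup>2"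
    by (simp add: power_mult_distrib)
  also have "(\<Sum>t<length gs. sqrt (qmass s t))\<^sup>2 \<le> real (length gs) * (\<Sum>t<length gs. qmass s t)"
    using sum_sq_le[of "\<lambda>t. sqrt (qmass s t)"] by simp
  finally show ?thesis by (simp add: puzzle_mass_qmass)
qed

lemma deviation_decomposition: "deviation s (length gs) x = (\<Sum>t<length gs. run (answers f) (drop (Suc t) gs) (lead_term s t) x) + remainder s x"
proof -
  have run_hidden_answers: "run (hidden_answers s) (take t gs) \<psi> = (\<lambda>x. stage t x - deviation s t x)" for t by (simp add: deviation_def)
  have "deviation s (length gs) x = (\<Sum>t<length gs. run (answers f) (drop (Suc t) gs)
      (gate_change (answers f) (hidden_answers s) (gs ! t) (\<lambda>x. stage t x - deviation s t x)) x)"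
    unfolding run_hidden_answers[symmetric] deviation_def stage_def
    using run_change[of "answers f" gs \<psi> x "hidden_answers s"] by simp
  also have "\<dots> = (\<Sum>t<length gs. run (answers f) (drop (Suc t) gs) (lead_term s t) x + run (answers f) (drop (Suc t) gs) (rest_term s t) x)"
  proof (rule sum.cong[OF refl])
    fix t
    show "run (answers f) (drop (Suc t) gs) (gate_change (answers f) (hidden_answers s) (gs ! t) (\<lambda>x. stage t x - deviation s t x)) x =
      run (answers f) (drop (Suc t) gs) (lead_term s t) x + run (answers f) (drop (Suc t) gs) (rest_term s t) x"
      unfolding rest_term_def run_diff by simp
  qed
  finally show ?thesis by (simp add: sum.distrib remainder_def)
qed

lemma nrm_remainder_sq:
  assumes s: "s \<in> bits m"
  shows "(nrm W (remainder s))\<^sup>2 \<le> 48 * amp\<^sup>2 * real (length gs) * (\<Sum>t<length gs. pmass s t) + 48 * amp\<^sup>2 * (real (length gs))\<^sup>2 * (drift s)\<^sup>2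
     + 12 * real (length gs) * puzzle_mass W m f gs \<psi> s"
proof -
  have run_hidden_answers: "(\<lambda>x. stage t x - deviation s t x) = run (hidden_answers s) (take t gs) \<psi>" for t by (simp add: deviation_def)
  have b: "nrm W (run (answers f) (drop (Suc t) gs) (rest_term s t)) \<le> 4 * amp * (sqrt (pmass s t) + drift s) + 2 * sqrt (qmass s t)"
    if t: "t < length gs" for t
  proof -
    have "nrm W (run (answers f) (drop (Suc t) gs) (rest_term s t)) = nrm W (rest_term s t)"
      by (rule nrm_run) (auto intro: gs dest: in_set_dropD)
    also have "\<dots> \<le> 4 * amp * (sqrt (pmass s t) + nrm W (deviation s t)) + 2 * sqrt (qmass s t)"
      using nrm_gate_change_minus_main[OF s gate_at[OF t], of "stage t" "deviation s t"]
      unfolding rest_term_def lead_term_def hidden_answers_def[symmetric] amp_def[symmetric] pmass_def[symmetric] run_hidden_answers qmass_def[symmetric] .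
    also have "\<dots> \<le> 4 * amp * (sqrt (pmass s t) + drift s) + 2 * sqrt (qmass s t)"
      using nrm_deviation_le_drift[OF s less_imp_le[OF t]] by (intro add_mono mult_left_mono) simp_all
    finally show ?thesis .
  qed
  have "nrm W (remainder s) \<le> (\<Sum>t<length gs. nrm W (run (answers f) (drop (Suc t) gs) (rest_term s t)))"
    unfolding remainder_def by (rule nrm_sum)
  also have "\<dots> \<le> (\<Sum>t<length gs. 4 * amp * (sqrt (pmass s t) + drift s) + 2 * sqrt (qmass s t))"
    by (rule sum_mono) (simp add: b)
  finally have "(nrm W (remainder s))\<^sup>2 \<le> (\<Sum>t<length gs. 4 * amp * (sqrt (pmass s t) + drift s) + 2 * sqrt (qmass s t))\<^sup>2"
    by (rule power_mono) simp
  also have "\<dots> \<le> real (length gs) * (\<Sum>t<length gs. (4 * amp * (sqrt (pmass s t) + drift s) + 2 * sqrt (qmass s t))\<^sup>2)"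
    by (rule sum_sq_le)
  also have "\<dots> \<le> real (length gs) * (\<Sum>t<length gs. 48 * amp\<^sup>2 * pmass s t + 48 * amp\<^sup>2 * (drift s)\<^sup>2 + 12 * qmass s t)"
  proof (intro mult_left_mono sum_mono)
    fix t
    have three: "(a + b + c)\<^sup>2 \<le> 3 * a\<^sup>2 + 3 * b\<^sup>2 + 3 * c\<^sup>2" for a b c :: real
      using sum_squares_bound[of a b] sum_squares_bound[of a c] sum_squares_bound[of b c]
      by (simp add: power2_eq_square algebra_simps)
    have eq: "4 * amp * (sqrt (pmass s t) + drift s) + 2 * sqrt (qmass s t) = 4 * amp * sqrt (pmass s t) + 4 * amp * drift s + 2 * sqrt (qmass s t)"
      by (simp add: distrib_left)
    have "(4 * amp * (sqrt (pmass s t) + drift s) + 2 * sqrt (qmass s t))\<^sup>2 \<le>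
        3 * (4 * amp * sqrt (pmass s t))\<^sup>2 + 3 * (4 * amp * drift s)\<^sup>2 + 3 * (2 * sqrt (qmass s t))\<^sup>2"
      unfolding eq by (rule three)
    then show "(4 * amp * (sqrt (pmass s t) + drift s) + 2 * sqrt (qmass s t))\<^sup>2 \<le> 48 * amp\<^sup>2 * pmass s t + 48 * amp\<^sup>2 * (drift s)\<^sup>2 + 12 * qmass s t"
      by (simp add: power_mult_distrib)
  qed simp
  also have "\<dots> = 48 * amp\<^sup>2 * real (length gs) * (\<Sum>t<length gs. pmass s t) + 48 * amp\<^sup>2 * (real (length gs))\<^sup>2 * (drift s)\<^sup>2 + 12 * real (length gs) * puzzle_mass W m f gs \<psi> s"
    by (simp add: sum.distrib sum_distrib_left[symmetric] puzzle_mass_qmass power2_eq_square algebra_simps)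
  finally show ?thesis .
qed

lemma nrm_out_part_sq: "(nrm W (out_part y))\<^sup>2 = output_prob (answers f) y"
  unfolding nrm_sq output_prob_def mass_def out_part_def stage_def by (rule sum.cong) simp_all

lemma sum_output_prob: "(\<Sum>y\<in>Y. (nrm W (out_part y))\<^sup>2) \<le> 1"
  unfolding nrm_out_part_sq output_prob_def using sum_mass_le[OF Y, of W "\<lambda>y x. rd x = y" "run (answers f) gs \<psi>"]
    nrm_stage[of "length gs"] by (simp add: stage_def)

lemma output_prob_change:
  "output_prob (answers f) y - output_prob (hidden_answers s) y = 2 * Re (ip W (out_part y) (deviation s (length gs))) - mass W (\<lambda>x. rd x = y) (deviation s (length gs))"
proof -
  have "output_prob (answers f) y - output_prob (hidden_answers s) y = (\<Sum>x\<in>bits W. if rd x = y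
      then (cmod (stage (length gs) x))\<^sup>2 - (cmod (stage (length gs) x - deviation s (length gs) x))\<^sup>2 else 0)"
    unfolding output_prob_def mass_def sum_subtractf[symmetric]
    by (rule sum.cong) (simp_all add: stage_def deviation_def)
  also have "\<dots> = (\<Sum>x\<in>bits W. 2 * Re (cnj (out_part y x) * deviation s (length gs) x) - (if rd x = y then (cmod (deviation s (length gs) x))\<^sup>2 else 0))"
  proof (rule sum.cong[OF refl])
    fix x
    have "(cmod a)\<^sup>2 - (cmod (a - b))\<^sup>2 = 2 * Re (cnj a * b) - (cmod b)\<^sup>2" for a b
      by (simp add: cmod_power2 power2_diff algebra_simps)
    then show "(if rd x = y then (cmod (stage (length gs) x))\<^sup>2 - (cmod (stage (length gs) x - deviation s (length gs) x))\<^sup>2 else 0) =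
        2 * Re (cnj (out_part y x) * deviation s (length gs) x) - (if rd x = y then (cmod (deviation s (length gs) x))\<^sup>2 else 0)"
      by (simp add: out_part_def)
  qed
  finally show ?thesis by (simp add: ip_def mass_def sum_subtractf sum_distrib_left)
qed

lemma nrm_deviation_le_2: "nrm W (deviation s (length gs)) \<le> 2"
proof -
  have "nrm W (deviation s (length gs)) \<le> nrm W (stage (length gs)) + nrm W (run (hidden_answers s) (take (length gs) gs) \<psi>)"
    unfolding deviation_def by (rule nrm_triangle_diff)
  then show ?thesis using nrm_stage[of "length gs"] nrm_run[OF gs, where A = "hidden_answers s" and \<psi> = \<psi>] \<psi> by simp
qed

text \<open>
  The fourth power has a bound that is linear in the query mass, because deviations have norm at most 2.
\<close>

lemma nrm_deviation_4:
  assumes s: "s \<in> bits m"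
  shows "((nrm W (deviation s (length gs)))\<^sup>2)\<^sup>2 \<le> 2048 * (amp\<^sup>2 * (real (length gs))\<^sup>2)\<^sup>2 + 64 * real (length gs) * puzzle_mass W m f gs \<psi> s"
proof -
  define a where "a = 32 * amp\<^sup>2 * (real (length gs))\<^sup>2"
  define b where "b = 8 * real (length gs) * puzzle_mass W m f gs \<psi> s"
  define x where "x = (nrm W (deviation s (length gs)))\<^sup>2"
  have a: "0 \<le> a" and b: "0 \<le> b" by (simp_all add: a_def b_def puzzle_mass_qmass sum_nonneg)
  have "x \<le> (drift s)\<^sup>2" unfolding x_def by (rule power_mono[OF nrm_deviation_le_drift[OF s]]) simp_all
  then have x1: "x \<le> a + b" using drift_sq[of s] by (simp add: a_def b_def)
  have "x \<le> 2\<^sup>2" unfolding x_def by (rule power_mono[OF nrm_deviation_le_2]) simp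
  then have x2: "x \<le> 4" by simp
  define b' where "b' = min b 4"
  have b': "0 \<le> b'" "b' \<le> 4" "b' \<le> b" using b by (simp_all add: b'_def)
  have "x \<le> a + b'" using x1 x2 a by (auto simp: b'_def min_def)
  then have "x\<^sup>2 \<le> (a + b')\<^sup>2" by (rule power_mono) (simp add: x_def)
  also have "\<dots> \<le> 2 * a\<^sup>2 + 2 * b'\<^sup>2" using sum_squares_bound[of a b'] by (simp add: power2_sum)
  also have "b'\<^sup>2 \<le> 4 * b" using mult_mono[OF b'(2,3)] b' by (simp add: power2_eq_square)
  finally show ?thesis by (simp add: x_def a_def b_def power_mult_distrib)
qed

lemma output_prob_change_sq:
  "(\<Sum>y\<in>Y. (output_prob (answers f) y - output_prob (hidden_answers s) y)\<^sup>2) \<le>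
    8 * (\<Sum>y\<in>Y. (cmod (ip W (out_part y) (deviation s (length gs))))\<^sup>2) + 2 * ((nrm W (deviation s (length gs)))\<^sup>2)\<^sup>2"
proof -
  let ?z = "\<lambda>y. ip W (out_part y) (deviation s (length gs))" and ?\<mu> = "\<lambda>y. mass W (\<lambda>x. rd x = y) (deviation s (length gs))"
  let ?n = "(nrm W (deviation s (length gs)))\<^sup>2"
  have "(output_prob (answers f) y - output_prob (hidden_answers s) y)\<^sup>2 \<le> 8 * (cmod (?z y))\<^sup>2 + 2 * (?n * ?\<mu> y)" for y
  proof -
    have two: "(a - b)\<^sup>2 \<le> 2 * a\<^sup>2 + 2 * b\<^sup>2" for a b :: real
      using sum_squares_bound[of a "- b"] by (simp add: power2_diff)
    have "(output_prob (answers f) y - output_prob (hidden_answers s) y)\<^sup>2 \<le> 2 * (2 * Re (?z y))\<^sup>2 + 2 * (?\<mu> y)\<^sup>2"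
      unfolding output_prob_change by (rule two)
    also have "\<dots> = 8 * (Re (?z y))\<^sup>2 + 2 * (?\<mu> y)\<^sup>2" by (simp add: power_mult_distrib)
    also have "\<dots> \<le> 8 * (cmod (?z y))\<^sup>2 + 2 * (?n * ?\<mu> y)"
    proof -
      have "(Re (?z y))\<^sup>2 \<le> (cmod (?z y))\<^sup>2" by (simp add: cmod_power2)
      moreover have "(?\<mu> y)\<^sup>2 \<le> ?n * ?\<mu> y"
        unfolding power2_eq_square[of "?\<mu> y"] by (rule mult_right_mono[OF mass_le_nrm]) simp
      ultimately show ?thesis by linarith
    qed
    finally show ?thesis .
  qed
  then have "(\<Sum>y\<in>Y. (output_prob (answers f) y - output_prob (hidden_answers s) y)\<^sup>2) \<le> (\<Sum>y\<in>Y. 8 * (cmod (?z y))\<^sup>2 + 2 * (?n * ?\<mu> y))"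
    by (rule sum_mono)
  also have "\<dots> = 8 * (\<Sum>y\<in>Y. (cmod (?z y))\<^sup>2) + 2 * (?n * (\<Sum>y\<in>Y. ?\<mu> y))"
    by (simp only: sum.distrib sum_distrib_left)
  also have "(\<Sum>y\<in>Y. ?\<mu> y) \<le> ?n" by (rule sum_mass_le[OF Y]) simp
  then have "2 * (?n * (\<Sum>y\<in>Y. ?\<mu> y)) \<le> 2 * ?n\<^sup>2"
    unfolding power2_eq_square[of ?n] by (intro mult_left_mono) simp_all
  finally show ?thesis by simp
qed

lemma ip_deviation_sq:
  "(\<Sum>y\<in>Y. (cmod (ip W (out_part y) (deviation s (length gs))))\<^sup>2) \<le>
    2 * real (length gs) * (\<Sum>t<length gs. \<Sum>y\<in>Y. (cmod (ip W (out_part y) (run (answers f) (drop (Suc t) gs) (lead_term s t))))\<^sup>2)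
    + 2 * (nrm W (remainder s))\<^sup>2"
proof -
  let ?c = "\<lambda>y t. ip W (out_part y) (run (answers f) (drop (Suc t) gs) (lead_term s t))"
  let ?r = "(nrm W (remainder s))\<^sup>2"
  have pmass: "(cmod (ip W (out_part y) (deviation s (length gs))))\<^sup>2 \<le> 2 * real (length gs) * (\<Sum>t<length gs. (cmod (?c y t))\<^sup>2)
      + 2 * ((nrm W (out_part y))\<^sup>2 * ?r)" for y
  proof -
    have eq: "deviation s (length gs) = (\<lambda>x. (\<Sum>t<length gs. 1 * run (answers f) (drop (Suc t) gs) (lead_term s t) x) + remainder s x)"
      by (rule ext) (simp add: deviation_decomposition)
    have "ip W (out_part y) (deviation s (length gs)) =
        ip W (out_part y) (\<lambda>x. \<Sum>t<length gs. 1 * run (answers f) (drop (Suc t) gs) (lead_term s t) x) + ip W (out_part y) (remainder s)"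
      unfolding eq by (rule ip_add)
    also have "ip W (out_part y) (\<lambda>x. \<Sum>t<length gs. 1 * run (answers f) (drop (Suc t) gs) (lead_term s t) x) = (\<Sum>t<length gs. 1 * ?c y t)"
      by (rule ip_sum)
    finally have "ip W (out_part y) (deviation s (length gs)) = (\<Sum>t<length gs. ?c y t) + ip W (out_part y) (remainder s)" by simp
    then have "cmod (ip W (out_part y) (deviation s (length gs))) \<le> cmod (\<Sum>t<length gs. ?c y t) + cmod (ip W (out_part y) (remainder s))"
      by (simp add: norm_triangle_ineq)
    also have "\<dots> \<le> (\<Sum>t<length gs. cmod (?c y t)) + nrm W (out_part y) * nrm W (remainder s)"
      by (intro add_mono norm_sum cmod_ip_le)
    finally have "(cmod (ip W (out_part y) (deviation s (length gs))))\<^sup>2 \<le> ((\<Sum>t<length gs. cmod (?c y t)) + nrm W (out_part y) * nrm W (remainder s))\<^sup>2"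
      by (rule power_mono) simp
    also have "\<dots> \<le> 2 * (\<Sum>t<length gs. cmod (?c y t))\<^sup>2 + 2 * (nrm W (out_part y) * nrm W (remainder s))\<^sup>2"
      using sum_squares_bound[of "\<Sum>t<length gs. cmod (?c y t)" "nrm W (out_part y) * nrm W (remainder s)"]
      by (simp add: power2_sum)
    also have "(\<Sum>t<length gs. cmod (?c y t))\<^sup>2 \<le> real (length gs) * (\<Sum>t<length gs. (cmod (?c y t))\<^sup>2)" by (rule sum_sq_le)
    finally show ?thesis by (simp add: power_mult_distrib)
  qed
  have "(\<Sum>y\<in>Y. (cmod (ip W (out_part y) (deviation s (length gs))))\<^sup>2) \<le>
    (\<Sum>y\<in>Y. 2 * real (length gs) * (\<Sum>t<length gs. (cmod (?c y t))\<^sup>2) + 2 * ((nrm W (out_part y))\<^sup>2 * ?r))"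
    by (rule sum_mono) (rule pmass)
  also have "\<dots> = 2 * real (length gs) * (\<Sum>y\<in>Y. \<Sum>t<length gs. (cmod (?c y t))\<^sup>2) + 2 * ((\<Sum>y\<in>Y. (nrm W (out_part y))\<^sup>2) * ?r)"
    by (simp only: sum.distrib sum_distrib_left sum_distrib_right)
  also have "(\<Sum>y\<in>Y. \<Sum>t<length gs. (cmod (?c y t))\<^sup>2) = (\<Sum>t<length gs. \<Sum>y\<in>Y. (cmod (?c y t))\<^sup>2)" by (rule sum.swap)
  also have "(\<Sum>y\<in>Y. (nrm W (out_part y))\<^sup>2) * ?r \<le> 1 * ?r"
    by (rule mult_right_mono[OF sum_output_prob]) simp
  finally show ?thesis by simp
qed

text \<open>
  Bessel's inequality over the puzzles \<open>s\<close>, for the evolution of the main parts to the end of the run.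
\<close>

lemma sum_main_sq:
  assumes t: "t < length gs"
  shows "(\<Sum>s\<in>bits m. \<Sum>y\<in>Y. (cmod (ip W (out_part y) (run (answers f) (drop (Suc t) gs) (lead_term s t))))\<^sup>2) \<le> 4 * amp\<^sup>2"
proof -
  have "(\<Sum>s\<in>bits m. (cmod (ip W (out_part y) (run (answers f) (drop (Suc t) gs) (lead_term s t))))\<^sup>2) \<le>
     4 * amp\<^sup>2 * (nrm W (out_part y))\<^sup>2" for y
  proof (rule Bessel)
    show "i = j" if "lead_term i t x \<noteq> 0" "lead_term j t x \<noteq> 0" for i j x
      using that unfolding lead_term_def by (rule main_change_disjoint)
    show "(nrm W (lead_term s t))\<^sup>2 \<le> 4 * amp\<^sup>2" if "s \<in> bits m" for s
      using main_change_norm[OF that gate_at[OF t], of "stage t"] nrm_stage by (simp add: lead_term_def amp_sq)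
  qed (auto simp: finite_bits intro: gs dest: in_set_dropD)
  then have "(\<Sum>y\<in>Y. \<Sum>s\<in>bits m. (cmod (ip W (out_part y) (run (answers f) (drop (Suc t) gs) (lead_term s t))))\<^sup>2) \<le>
     (\<Sum>y\<in>Y. 4 * amp\<^sup>2 * (nrm W (out_part y))\<^sup>2)" by (rule sum_mono)
  also have "\<dots> = 4 * amp\<^sup>2 * (\<Sum>y\<in>Y. (nrm W (out_part y))\<^sup>2)" by (rule sum_distrib_left[symmetric])
  also have "\<dots> \<le> 4 * amp\<^sup>2 * 1" by (rule mult_left_mono[OF sum_output_prob]) simp
  finally show ?thesis by (subst sum.swap) simp
qed

lemma bits_amp: "real (card (bits m)) * amp\<^sup>2 = 1"
  by (simp add: card_bits amp_sq)

text \<open>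
  The squared changes of all output probabilities, summed over all keys of length \<open>m\<close>.  The masses on the
  right-hand side are small on average over \<open>f\<close> (\<open>avg_puzzle_mass\<close>), because the state in each of them does not depend on the key
  whose query mass is taken.
\<close>

lemma key_influence_output_probut_prob:
  defines "T \<equiv> real (length gs)" and "M \<equiv> (\<Sum>s\<in>bits m. puzzle_mass W m f gs \<psi> s)"
  shows "(\<Sum>s\<in>bits m. \<Sum>y\<in>Y. (output_prob (answers f) y - output_prob (answers (hide {s} f)) y)\<^sup>2) \<le>
    (832 * T\<^sup>2 + 28672 * (T\<^sup>2)\<^sup>2) / 2 ^ m + (6144 * T ^ 3 / 2 ^ m + 320 * T) * M"
proof -
  let ?ip = "\<lambda>s t y. (cmod (ip W (out_part y) (run (answers f) (drop (Suc t) gs) (lead_term s t))))\<^sup>2"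
  let ?P = "puzzle_mass W m f gs \<psi>"
  have T: "0 \<le> T" by (simp add: T_def)
  have P0: "0 \<le> ?P s" for s by (simp add: puzzle_mass_qmass sum_nonneg)
  have M0: "0 \<le> M" by (simp add: M_def P0 sum_nonneg)
  have c: "real (card (bits m)) = 2 ^ m" by (simp add: card_bits)
  have remainder: "(\<Sum>s\<in>bits m. (nrm W (remainder s))\<^sup>2) \<le> 48 * amp\<^sup>2 * T\<^sup>2 + 48 * amp\<^sup>2 * T\<^sup>2 * (32 * T\<^sup>2 + 8 * T * M) + 12 * T * M"
  proof -
    have "(\<Sum>s\<in>bits m. (nrm W (remainder s))\<^sup>2) \<le> (\<Sum>s\<in>bits m. 48 * amp\<^sup>2 * T * (\<Sum>t<length gs. pmass s t)
       + 48 * amp\<^sup>2 * T\<^sup>2 * (32 * amp\<^sup>2 * T\<^sup>2 + 8 * T * ?P s) + 12 * T * ?P s)"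
    proof (rule sum_mono)
      fix s assume s: "s \<in> bits m"
      have "48 * amp\<^sup>2 * T\<^sup>2 * (drift s)\<^sup>2 \<le> 48 * amp\<^sup>2 * T\<^sup>2 * (32 * amp\<^sup>2 * T\<^sup>2 + 8 * T * ?P s)"
        using drift_sq[of s] unfolding T_def by (intro mult_left_mono) simp_all
      then show "(nrm W (remainder s))\<^sup>2 \<le> 48 * amp\<^sup>2 * T * (\<Sum>t<length gs. pmass s t)
         + 48 * amp\<^sup>2 * T\<^sup>2 * (32 * amp\<^sup>2 * T\<^sup>2 + 8 * T * ?P s) + 12 * T * ?P s"
        using nrm_remainder_sq[OF s] unfolding T_def by linarith
    qed
    also have "\<dots> = 48 * amp\<^sup>2 * T * (\<Sum>s\<in>bits m. \<Sum>t<length gs. pmass s t)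
       + 48 * amp\<^sup>2 * T\<^sup>2 * (32 * (real (card (bits m)) * amp\<^sup>2) * T\<^sup>2 + 8 * T * M) + 12 * T * M"
      unfolding M_def by (simp add: sum.distrib sum_distrib_left algebra_simps)
    also have "(\<Sum>s\<in>bits m. \<Sum>t<length gs. pmass s t) \<le> T"
    proof -
      have "(\<Sum>s\<in>bits m. \<Sum>t<length gs. pmass s t) = (\<Sum>t<length gs. \<Sum>s\<in>bits m. pmass s t)" by (rule sum.swap)
      also have "\<dots> \<le> (\<Sum>t<length gs. 1)"
        using sum_point_mass[of W m f _ "stage _"] nrm_stage by (intro sum_mono) (simp add: pmass_def)
      finally show ?thesis by (simp add: T_def)
    qed
    then have "48 * amp\<^sup>2 * T * (\<Sum>s\<in>bits m. \<Sum>t<length gs. pmass s t) \<le> 48 * amp\<^sup>2 * T\<^sup>2"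
      using T mult_left_mono[of _ T "48 * amp\<^sup>2 * T"] by (simp add: power2_eq_square mult.assoc)
    finally show ?thesis unfolding bits_amp by simp
  qed
  have main: "(\<Sum>s\<in>bits m. \<Sum>t<length gs. \<Sum>y\<in>Y. ?ip s t y) \<le> 4 * amp\<^sup>2 * T"
  proof -
    have "(\<Sum>s\<in>bits m. \<Sum>t<length gs. \<Sum>y\<in>Y. ?ip s t y) = (\<Sum>t<length gs. \<Sum>s\<in>bits m. \<Sum>y\<in>Y. ?ip s t y)" by (rule sum.swap)
    also have "\<dots> \<le> (\<Sum>t<length gs. 4 * amp\<^sup>2)" by (rule sum_mono) (simp add: sum_main_sq)
    finally show ?thesis by (simp add: T_def mult.commute mult.left_commute)
  qed
  have four: "(\<Sum>s\<in>bits m. ((nrm W (deviation s (length gs)))\<^sup>2)\<^sup>2) \<le> 2048 * amp\<^sup>2 * (T\<^sup>2)\<^sup>2 + 64 * T * M"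
  proof -
    have "(\<Sum>s\<in>bits m. ((nrm W (deviation s (length gs)))\<^sup>2)\<^sup>2) \<le> (\<Sum>s\<in>bits m. 2048 * (amp\<^sup>2 * T\<^sup>2)\<^sup>2 + 64 * T * ?P s)"
      unfolding T_def by (rule sum_mono) (rule nrm_deviation_4)
    also have "\<dots> = 2048 * (real (card (bits m)) * amp\<^sup>2) * amp\<^sup>2 * (T\<^sup>2)\<^sup>2 + 64 * T * M"
      by (simp add: M_def sum.distrib sum_distrib_left power2_eq_square algebra_simps)
    finally show ?thesis unfolding bits_amp by simp
  qed
  have "(\<Sum>s\<in>bits m. \<Sum>y\<in>Y. (output_prob (answers f) y - output_prob (hidden_answers s) y)\<^sup>2) \<le>
    (\<Sum>s\<in>bits m. 16 * T * (\<Sum>t<length gs. \<Sum>y\<in>Y. ?ip s t y) + 16 * (nrm W (remainder s))\<^sup>2 + 2 * ((nrm W (deviation s (length gs)))\<^sup>2)\<^sup>2)"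
  proof (rule sum_mono)
    fix s
    show "(\<Sum>y\<in>Y. (output_prob (answers f) y - output_prob (hidden_answers s) y)\<^sup>2) \<le>
      16 * T * (\<Sum>t<length gs. \<Sum>y\<in>Y. ?ip s t y) + 16 * (nrm W (remainder s))\<^sup>2 + 2 * ((nrm W (deviation s (length gs)))\<^sup>2)\<^sup>2"
      using output_prob_change_sq[of s] ip_deviation_sq[of s] unfolding T_def by linarith
  qed
  also have "\<dots> = 16 * T * (\<Sum>s\<in>bits m. \<Sum>t<length gs. \<Sum>y\<in>Y. ?ip s t y) + 16 * (\<Sum>s\<in>bits m. (nrm W (remainder s))\<^sup>2)
      + 2 * (\<Sum>s\<in>bits m. ((nrm W (deviation s (length gs)))\<^sup>2)\<^sup>2)"
    by (simp only: sum.distrib sum_distrib_left)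
  also have "\<dots> \<le> 16 * T * (4 * amp\<^sup>2 * T) + 16 * (48 * amp\<^sup>2 * T\<^sup>2 + 48 * amp\<^sup>2 * T\<^sup>2 * (32 * T\<^sup>2 + 8 * T * M) + 12 * T * M)
      + 2 * (2048 * amp\<^sup>2 * (T\<^sup>2)\<^sup>2 + 64 * T * M)"
    by (intro add_mono mult_left_mono main remainder four) (simp_all add: T)
  also have "\<dots> = (832 * T\<^sup>2 + 28672 * (T\<^sup>2)\<^sup>2) * amp\<^sup>2 + (6144 * T ^ 3 * amp\<^sup>2 + 320 * T) * M"
    by (simp add: power2_eq_square power3_eq_cube algebra_simps)
  finally show ?thesis by (simp add: amp_sq hidden_answers_def)
qed

lemmas key_influence = key_influence_output_probut_prob[unfolded output_prob_def]

end

end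

subsection \<open>Circuits see only the answers to queries that fit into them\<close>

lemma oracle_mat_cong:
  assumes "\<And>w. length w = n \<Longrightarrow> A w = B w"
  shows "oracle_mat A n = oracle_mat B n"
proof (rule eq_matI)
  fix i j assume "i < dim_row (oracle_mat B n)" "j < dim_col (oracle_mat B n)"
  then have ij: "i < 2 ^ (4 * n)" "j < 2 ^ (4 * n)" by (simp_all add: oracle_mat_def)
  let ?x = "inv_into (bits (4 * n)) basis_index i"
  have "i \<in> basis_index ` bits (4 * n)" using ij(1) basis_index_bij[of "4 * n"] by (simp add: bij_betw_def)
  then have "?x \<in> bits (4 * n)" by (rule inv_into_into)
  then have eq: "A (drop (3 * n) ?x) = B (drop (3 * n) ?x)" by (intro assms) (simp add: bits_def)
  have "oracle_entry A n ?x y = oracle_entry B n ?x y" for y by (simp only: oracle_entry_def eq)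
  then show "oracle_mat A n $$ (i, j) = oracle_mat B n $$ (i, j)" using ij by (simp add: oracle_mat_def)
qed (simp_all add: oracle_mat_def)

lemma act_cong:
  assumes g: "valid_gate W g" and AB: "\<And>w. 4 * length w \<le> W \<Longrightarrow> A w = B w"
  shows "act A g = act B g"
proof (cases g)
  case (Query c v qs)
  have qs: "distinct qs" "set qs \<subseteq> {..<W}" using g by (cases c; simp add: valid_gate_def Query)+
  have "length qs \<le> W" using card_mono[OF _ qs(2)] distinct_card[OF qs(1)] by simp
  then have "oracle_mat A (length qs div 4) = oracle_mat B (length qs div 4)"
    by (intro oracle_mat_cong AB) simp
  then have "reflection_oracle A (length qs) = reflection_oracle B (length qs)" by (simp add: reflection_oracle_def)
  then show ?thesis using Query by (cases c) (simp_all add: act_def)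
qed (simp_all add: act_def)

lemma run_cong:
  assumes "\<And>g. g \<in> set gs \<Longrightarrow> valid_gate W g" and AB: "\<And>w. 4 * length w \<le> W \<Longrightarrow> A w = B w"
  shows "run A gs = run B gs"
proof -
  have "act A g = act B g" if "g \<in> set gs" for g by (rule act_cong[OF assms(1)[OF that] AB])
  then have "run A gs \<psi> = run B gs \<psi>" for \<psi> unfolding run_def by (rule List.fold_cong[OF refl refl])
  then show ?thesis by (rule ext)
qed

lemma valid_circuit_gates: "valid_circuit C \<Longrightarrow> g \<in> set (gates C) \<Longrightarrow> valid_gate (width C) g"
  by (simp add: valid_circuit_def valid_gate_def)

lemma nrm_initial: "nrm W (initial_state W) = 1"
proof -
  have "(nrm W (initial_state W))\<^sup>2 = (\<Sum>x\<in>bits W. if x = zeros W then 1 else 0)"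
    unfolding nrm_sq by (rule sum.cong) (simp_all add: initial_state_def zeros_def)
  also have "\<dots> = 1" using finite_bits zeros_in_bits by simp
  finally show ?thesis by (simp add: power2_eq_1_iff) (smt (verit) nrm_nonneg)
qed

lemma pmf_run:
  assumes "valid_circuit C"
  shows "pmf (map_pmf rd (measure_all (reflection_oracle A) C)) y =
    mass (width C) (\<lambda>x. rd x = y) (run A (gates C) (initial_state (width C)))"
proof -
  let ?p = "measure_all (reflection_oracle A) C"
  have pmf: "pmf ?p x = (if x \<in> bits (width C) then (cmod (run A (gates C) (initial_state (width C)) x))\<^sup>2 else 0)" for x
    using pmf_measure_all[OF unitary_reflection_oracle assms, of A x] by (simp add: final_state_act run_def)
  have "pmf (map_pmf rd ?p) y = measure ?p (rd -` {y})" by (rule pmf_map)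
  also have "\<dots> = measure ?p (rd -` {y} \<inter> bits (width C))"
  proof (rule measure_eq_AE)
    show "AE x in measure_pmf ?p. (x \<in> rd -` {y}) = (x \<in> rd -` {y} \<inter> bits (width C))"
      by (rule AE_pmfI) (use pmf in \<open>auto simp: set_pmf_iff split: if_splits\<close>)
  qed simp_all
  also have "\<dots> = (\<Sum>x\<in>rd -` {y} \<inter> bits (width C). pmf ?p x)"
    by (rule measure_measure_pmf_finite) (simp add: finite_bits)
  also have "\<dots> = (\<Sum>x\<in>{x \<in> bits (width C). rd x = y}. (cmod (run A (gates C) (initial_state (width C)) x))\<^sup>2)"
    by (rule sum.cong) (auto simp: pmf)
  also have "\<dots> = mass (width C) (\<lambda>x. rd x = y) (run A (gates C) (initial_state (width C)))"
    unfolding mass_def by (rule sum.inter_filter) (rule finite_bits)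
  finally show ?thesis .
qed

section \<open>Concentration of output probabilities\<close>

interpretation keys: finite_product keys by (rule finite_product_keys)

lemma hide_upd: "hide {s} h = h(s := [])"
  by (rule ext) (simp add: hide_def)

lemma sum_over_coords: "(\<Sum>s\<in>set (coords a b). F s) = (\<Sum>k=a..<b. \<Sum>s\<in>bits k. F s)"
proof -
  have "set (coords a b) = (\<Union>k\<in>{a..<b}. bits k)" by (auto simp: set_coords bits_def)
  moreover have "(\<Sum>s\<in>(\<Union>k\<in>{a..<b}. bits k). F s) = (\<Sum>k=a..<b. \<Sum>s\<in>bits k. F s)"
    by (rule sum.UNION_disjoint) (simp_all add: finite_bits, auto simp: bits_def)
  ultimately show ?thesis by (simp only:)
qed

lemma geometric_tail: "(\<Sum>k=a..<b. 1 / 2 ^ k) \<le> 2 / (2 ^ a :: real)"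
proof (cases "a \<le> b")
  case True
  have "(\<Sum>k=a..<b. 1 / 2 ^ k) = 2 / 2 ^ a - 2 / (2 ^ b :: real)"
    using True by (induction b rule: dec_induct) simp_all
  then show ?thesis by simp
qed simp

lemma avg_puzzle_mass:
  assumes gs: "\<And>g. g \<in> set gs \<Longrightarrow> valid_gate W g" and \<psi>: "nrm W \<psi> = 1"
    and "distinct ss" "s \<in> set ss" "length s = m"
  shows "avg keys ss (\<lambda>h. puzzle_mass W m h gs \<psi> s) f \<le> real (length gs) / 2 ^ (2 * m)"
proof -
  have "avg keys ss (\<lambda>h. puzzle_mass W m h gs \<psi> s) f \<le> avg keys ss (\<lambda>h. real (length gs) / 2 ^ (2 * m)) f"
  proof (rule keys.avg_le_coordinate[OF assms(3,4)])
    fix h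
    let ?st = "\<lambda>t. run (answers (hide {s} h)) (take t gs) \<psi>"
    have st: "nrm W (?st t) = 1" for t
      using nrm_run[of "take t gs" W "answers (hide {s} h)" \<psi>] gs \<psi> by (auto dest: in_set_takeD)
    have "(\<Sum>k\<in>keys s. puzzle_mass W m (h(s := k)) gs \<psi> s) =
        (\<Sum>k\<in>keys s. \<Sum>t<length gs. query_mass W (6 * m + 2) (gs ! t) (enc_strs [s, k]) (?st t))"
      by (simp add: puzzle_mass_def hide_upd)
    also have "\<dots> = (\<Sum>t<length gs. \<Sum>k\<in>keys s. query_mass W (6 * m + 2) (gs ! t) (enc_strs [s, k]) (?st t))"
      by (rule sum.swap)
    also have "\<dots> \<le> (\<Sum>t<length gs. 1)"
    proof (rule sum_mono)
      fix t
      have "inj_on (\<lambda>k. enc_strs [s, k]) (keys s)" by (rule inj_onI) (simp add: enc_strs_eq_iff)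
      then have "(\<Sum>k\<in>keys s. query_mass W (6 * m + 2) (gs ! t) (enc_strs [s, k]) (?st t)) =
          (\<Sum>w\<in>(\<lambda>k. enc_strs [s, k]) ` keys s. query_mass W (6 * m + 2) (gs ! t) w (?st t))"
        by (simp add: sum.reindex)
      also have "\<dots> \<le> (nrm W (?st t))\<^sup>2" by (rule sum_query_mass) (simp add: keys.finite_D)
      finally show "(\<Sum>k\<in>keys s. query_mass W (6 * m + 2) (gs ! t) (enc_strs [s, k]) (?st t)) \<le> 1" by (simp add: st)
    qed
    finally have "(\<Sum>k\<in>keys s. puzzle_mass W m (h(s := k)) gs \<psi> s) \<le> real (length gs)" by simp
    moreover have c: "card (keys s) = 2 ^ (2 * m)" using assms(5) by (simp add: keys_def card_bits)
    ultimately have "(\<Sum>k\<in>keys s. puzzle_mass W m (h(s := k)) gs \<psi> s) / real (card (keys s)) \<le> real (length gs) / 2 ^ (2 * m)"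
      by (simp add: divide_right_mono)
    then show "avg keys [s] (\<lambda>h. puzzle_mass W m h gs \<psi> s) h \<le> avg keys [s] (\<lambda>h. real (length gs) / 2 ^ (2 * m)) h"
      unfolding keys.avg_const by simp
  qed
  then show ?thesis by simp
qed

text \<open>
  Efron--Stein, with the output probability for the hidden key as the estimate that ignores this key.  The
  geometric sum over the hidden lengths is dominated by the first one, where \<open>\<theta> < 2 ^ first_hidden \<theta>\<close>.
\<close>

lemma output_concentration:
  fixes rd :: "bool list \<Rightarrow> 'y"
  assumes gs: "\<And>g. g \<in> set gs \<Longrightarrow> valid_gate W g" and \<psi>: "nrm W \<psi> = 1" and Y: "finite Y"
    and S: "1 \<le> S" "real (length gs) \<le> S" and W: "W < \<theta>"
  defines "cs \<equiv> coords (first_hidden \<theta>) \<theta>" and "p \<equiv> (\<lambda>h y. mass W (\<lambda>x. rd x = y) (run (answers h) gs \<psi>))"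
  shows "(\<Sum>y\<in>Y. avg keys cs (\<lambda>h. (p h y - avg keys cs (\<lambda>h. p h y) f)\<^sup>2) f) \<le> 72000 * S ^ 4 / real \<theta>"
proof -
  let ?k = "first_hidden \<theta>" and ?T = "real (length gs)"
  have \<theta>: "\<theta> > 0" using W by simp
  have dist: "distinct cs" by (simp add: cs_def distinct_coords)
  let ?I = "\<lambda>m h. \<Sum>s\<in>bits m. \<Sum>y\<in>Y. (p h y - p (h(s := [])) y)\<^sup>2"
  let ?M = "\<lambda>m h. \<Sum>s\<in>bits m. puzzle_mass W m h gs \<psi> s"
  have hidden: "\<theta> < 2 ^ m" "0 < m" if "?k \<le> m" for m
  proof -
    show 1: "\<theta> < 2 ^ m" using that below_first_hidden[of m \<theta>] by simp
    show "0 < m" using 1 \<theta> by (cases m) auto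
  qed
  have level: "avg keys cs (?I m) f \<le> 35968 * S ^ 4 * (1 / 2 ^ m)" if m: "?k \<le> m" "m < \<theta>" for m
  proof -
    let ?a = "(832 * ?T\<^sup>2 + 28672 * (?T\<^sup>2)\<^sup>2) / 2 ^ m" and ?b = "6144 * ?T ^ 3 / 2 ^ m + 320 * ?T"
    have "avg keys cs (?I m) f \<le> avg keys cs (\<lambda>h. ?a + ?b * ?M m h) f"
    proof (rule keys.avg_mono)
      fix h assume h: "h \<in> redraws keys cs f"
      have "length (h s) = 2 * m" if "s \<in> bits m" for s
        using h that m by (auto simp: redraws_def cs_def set_coords keys_def bits_def)
      then show "?I m h \<le> ?a + ?b * ?M m h"
        using key_influence[of m W h gs \<psi> Y rd, OF hidden(2)[OF m(1)] less_trans[OF W hidden(1)[OF m(1)]] _ gs \<psi> Y]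
        unfolding p_def hide_upd by blast
    qed
    also have "\<dots> = ?a + ?b * (\<Sum>s\<in>bits m. avg keys cs (\<lambda>h. puzzle_mass W m h gs \<psi> s) f)"
      by (simp only: keys.avg_add keys.avg_const keys.avg_cmult keys.avg_sum)
    also have "\<dots> \<le> ?a + ?b * (\<Sum>s\<in>bits m. ?T / 2 ^ (2 * m))"
    proof (intro add_left_mono mult_left_mono sum_mono)
      fix s assume s: "s \<in> bits m"
      then have "s \<in> set cs" using m by (simp add: cs_def set_coords bits_def)
      then show "avg keys cs (\<lambda>h. puzzle_mass W m h gs \<psi> s) f \<le> ?T / 2 ^ (2 * m)"
        using s by (intro avg_puzzle_mass[OF gs \<psi> dist]) (simp_all add: bits_def)
    qed simp
    also have "(\<Sum>s\<in>bits m. ?T / 2 ^ (2 * m)) = ?T / 2 ^ m"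
      by (simp add: card_bits power_mult power2_eq_square[of "2 ^ m :: real"] power_mult_distrib mult_2 power_add)
    also have "?a + ?b * (?T / 2 ^ m) \<le> 35968 * S ^ 4 * (1 / 2 ^ m)"
    proof -
      have pw: "?T ^ k \<le> S ^ 4" if "k \<le> 4" for k
        using power_mono[OF S(2), of k] power_increasing[OF that S(1)] by simp
      have "6144 * ?T ^ 3 / 2 ^ m * ?T \<le> 6144 * ?T ^ 4"
      proof -
        have "6144 * ?T ^ 3 / 2 ^ m * ?T = 6144 * ?T ^ 4 / 2 ^ m" by (simp add: power3_eq_cube power4_eq_xxxx)
        also have "\<dots> \<le> 6144 * ?T ^ 4 / 1" by (rule divide_left_mono) simp_all
        finally show ?thesis by simp
      qed
      then have "832 * ?T\<^sup>2 + 28672 * (?T\<^sup>2)\<^sup>2 + (6144 * ?T ^ 3 / 2 ^ m * ?T + 320 * ?T * ?T) \<le> 35968 * S ^ 4"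
        using pw[of 2] pw[of 4] by (simp add: power2_eq_square power4_eq_xxxx mult.assoc)
      then have "(832 * ?T\<^sup>2 + 28672 * (?T\<^sup>2)\<^sup>2 + (6144 * ?T ^ 3 / 2 ^ m * ?T + 320 * ?T * ?T)) / 2 ^ m \<le> 35968 * S ^ 4 / 2 ^ m"
        by (rule divide_right_mono) simp
      then show ?thesis by (simp add: add_divide_distrib distrib_right)
    qed
    finally show ?thesis .
  qed
  have "(\<Sum>y\<in>Y. avg keys cs (\<lambda>h. (p h y - avg keys cs (\<lambda>h. p h y) f)\<^sup>2) f) \<le>
     (\<Sum>y\<in>Y. \<Sum>s\<in>set cs. avg keys cs (\<lambda>h. (p h y - p (h(s := [])) y)\<^sup>2) f)"
    by (intro sum_mono keys.Efron_Stein dist) simp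
  also have "\<dots> = (\<Sum>s\<in>set cs. \<Sum>y\<in>Y. avg keys cs (\<lambda>h. (p h y - p (h(s := [])) y)\<^sup>2) f)" by (rule sum.swap)
  also have "\<dots> = (\<Sum>m=?k..<\<theta>. avg keys cs (?I m) f)"
    unfolding cs_def sum_over_coords by (simp only: keys.avg_sum)
  also have "\<dots> \<le> (\<Sum>m=?k..<\<theta>. 35968 * S ^ 4 * (1 / 2 ^ m))" by (rule sum_mono) (rule level, auto)
  also have "\<dots> = 35968 * S ^ 4 * (\<Sum>m=?k..<\<theta>. 1 / 2 ^ m)" by (rule sum_distrib_left[symmetric])
  also have "\<dots> \<le> 35968 * S ^ 4 * (2 / 2 ^ ?k)"
    using S(1) by (intro mult_left_mono geometric_tail) simp
  also have "\<dots> \<le> 35968 * S ^ 4 * (2 / real \<theta>)"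
  proof -
    have "real \<theta> \<le> 2 ^ ?k" using hidden(1)[OF order_refl] by (metis less_imp_le of_nat_le_iff of_nat_numeral of_nat_power)
    then have "2 / 2 ^ ?k \<le> 2 / real \<theta>" using \<theta> by (intro divide_left_mono) simp_all
    then show ?thesis using S(1) by (intro mult_left_mono) simp_all
  qed
  also have "\<dots> \<le> 72000 * S ^ 4 / real \<theta>"
    using S(1) by (simp add: divide_right_mono)
  finally show ?thesis .
qed

section \<open>No attack guesses many hidden keys\<close>

text \<open>
  Some vertex of a finite digraph with out-degrees at most \<open>d\<close> also has in-degree at most \<open>d\<close>.  Choosing
  it and deleting its at most \<open>2 * d\<close> neighbours leaves a digraph of the same kind.
\<close>

lemma exists_independent_set:
  fixes w :: "'a \<Rightarrow> 'a \<Rightarrow> bool"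
  assumes "finite K" and deg: "\<And>s. s \<in> K \<Longrightarrow> card {s' \<in> K. w s s'} \<le> d" and "r * (2 * d + 1) \<le> card K"
  shows "\<exists>R\<subseteq>K. card R = r \<and> (\<forall>s\<in>R. \<forall>s'\<in>R. s \<noteq> s' \<longrightarrow> \<not> w s s')"
  using assms
proof (induction r arbitrary: K)
  case 0
  show ?case by (rule exI[of _ "{}"]) simp
next
  case (Suc r)
  have K: "K \<noteq> {}" using Suc.prems(3) by auto
  have "\<exists>s\<in>K. card {s' \<in> K. w s' s} \<le> d"
  proof (rule ccontr)
    assume "\<not> (\<exists>s\<in>K. card {s' \<in> K. w s' s} \<le> d)"
    then have "(\<Sum>s\<in>K. d) < (\<Sum>s\<in>K. card {s' \<in> K. w s' s})"
      using Suc.prems(1) K by (intro sum_strict_mono) auto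
    also have "\<dots> = (\<Sum>s\<in>K. card {s' \<in> K. w s s'})"
    proof -
      have "(\<Sum>s\<in>K. card {s' \<in> K. w s' s}) = (\<Sum>s\<in>K. \<Sum>s'\<in>K. of_bool (w s' s))"
        using Suc.prems(1) by (simp add: sum_of_bool_eq Collect_conj_eq)
      also have "\<dots> = (\<Sum>s'\<in>K. \<Sum>s\<in>K. of_bool (w s' s))" by (rule sum.swap)
      finally show ?thesis using Suc.prems(1) by (simp add: sum_of_bool_eq Collect_conj_eq)
    qed
    also have "\<dots> \<le> (\<Sum>s\<in>K. d)" by (rule sum_mono) (rule Suc.prems(2))
    finally show False by simp
  qed
  then obtain s where s: "s \<in> K" "card {s' \<in> K. w s' s} \<le> d" by blast
  define N where "N = insert s ({s' \<in> K. w s' s} \<union> {s' \<in> K. w s s'})"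
  have N: "finite N" "N \<subseteq> K" using Suc.prems(1) s(1) by (auto simp: N_def)
  have "card N \<le> Suc (card ({s' \<in> K. w s' s} \<union> {s' \<in> K. w s s'}))"
    unfolding N_def by (rule card_insert_le_m1) simp_all
  also have "card ({s' \<in> K. w s' s} \<union> {s' \<in> K. w s s'}) \<le> d + d"
    by (rule order_trans[OF card_Un_le]) (rule add_mono[OF s(2) Suc.prems(2)[OF s(1)]])
  finally have cN: "card N \<le> 2 * d + 1" by simp
  have "\<exists>R\<subseteq>K - N. card R = r \<and> (\<forall>s\<in>R. \<forall>s'\<in>R. s \<noteq> s' \<longrightarrow> \<not> w s s')"
  proof (rule Suc.IH)
    show "finite (K - N)" using Suc.prems(1) by simp
    show "card {s' \<in> K - N. w s s'} \<le> d" if "s \<in> K - N" for s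
    proof -
      have "card {s' \<in> K - N. w s s'} \<le> card {s' \<in> K. w s s'}"
        using Suc.prems(1) by (intro card_mono) auto
      also have "\<dots> \<le> d" using that by (intro Suc.prems(2)) simp
      finally show ?thesis .
    qed
    have "card (K - N) = card K - card N" using N by (rule card_Diff_subset)
    then show "r * (2 * d + 1) \<le> card (K - N)" using Suc.prems(3) cN by simp
  qed
  then obtain R where R: "R \<subseteq> K - N" "card R = r" "\<forall>s\<in>R. \<forall>s'\<in>R. s \<noteq> s' \<longrightarrow> \<not> w s s'" by blast
  have "finite R" using R(1) Suc.prems(1) by (meson finite_Diff finite_subset)
  moreover have "s \<notin> R" "\<And>s'. s' \<in> R \<Longrightarrow> \<not> w s s' \<and> \<not> w s' s" using R(1) by (auto simp: N_def)
  ultimately show ?case using R s(1) N(2)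
    by (intro exI[of _ "insert s R"]) auto
qed

text \<open>
  If the small sets \<open>H s h\<close> for \<open>s\<close> in \<open>Q\<close> do not depend on the coordinates in \<open>Q\<close>, then the events
  \<open>h s \<in> H s h\<close> are independent; in the statement, all of them hold with probability at most \<open>a ^ card R\<close>.
\<close>

lemma (in finite_product) avg_all_in:
  assumes "distinct ss" "finite R" "R \<subseteq> set ss" "R \<subseteq> Q" "0 \<le> a"
    and H: "\<And>h s s' k. s \<in> Q \<Longrightarrow> s' \<in> Q \<Longrightarrow> H s (h(s' := k)) = H s h"
    and small: "\<And>h s. s \<in> Q \<Longrightarrow> real (card {k \<in> D s. k \<in> H s h}) \<le> a * real (card (D s))"
  shows "avg D ss (\<lambda>h. of_bool (\<forall>s\<in>R. h s \<in> H s h)) f \<le> a ^ card R"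
  using assms(2,3,4)
proof (induction R)
  case empty
  then show ?case by simp
next
  case (insert s R)
  have sQ: "s \<in> Q" and RQ: "R \<subseteq> Q" using insert.prems(2) by auto
  have "avg D ss (\<lambda>h. of_bool (\<forall>s\<in>insert s R. h s \<in> H s h)) f \<le>
      avg D ss (\<lambda>h. a * of_bool (\<forall>s\<in>R. h s \<in> H s h)) f"
  proof (rule avg_le_coordinate[OF assms(1)])
    show "s \<in> set ss" using insert.prems(1) by simp
    fix h
    have 1: "(\<forall>s'\<in>R. (h(s := k)) s' \<in> H s' (h(s := k))) \<longleftrightarrow> (\<forall>s'\<in>R. h s' \<in> H s' h)" for k
    proof (rule ball_cong[OF refl])
      fix s' assume s': "s' \<in> R"
      then have "s' \<noteq> s" using insert.hyps(2) by blast
      moreover have "H s' (h(s := k)) = H s' h" using s' RQ sQ by (intro H) auto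
      ultimately show "((h(s := k)) s' \<in> H s' (h(s := k))) = (h s' \<in> H s' h)" by simp
    qed
    have 2: "(h(s := k)) s \<in> H s (h(s := k)) \<longleftrightarrow> k \<in> H s h" for k
      using H[OF sQ sQ, of h k] by simp
    let ?A = "\<forall>s'\<in>R. h s' \<in> H s' h"
    have "(\<Sum>k\<in>D s. of_bool (\<forall>s'\<in>insert s R. (h(s := k)) s' \<in> H s' (h(s := k))) :: real) =
        (\<Sum>k\<in>D s. of_bool ?A * of_bool (k \<in> H s h))"
      unfolding ball_simps(7) 1 2 by (rule sum.cong) auto
    also have "\<dots> = of_bool ?A * real (card {k \<in> D s. k \<in> H s h})"
      using finite_D[of s] by (simp add: sum_distrib_left[symmetric] sum_of_bool_eq Collect_conj_eq)
    also have "\<dots> \<le> of_bool ?A * (a * real (card (D s)))" by (intro mult_left_mono small sQ) simp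
    also have "\<dots> = (\<Sum>k\<in>D s. a * of_bool (\<forall>s'\<in>R. (h(s := k)) s' \<in> H s' (h(s := k))))"
      unfolding 1 by simp
    finally have "(\<Sum>k\<in>D s. of_bool (\<forall>s'\<in>insert s R. (h(s := k)) s' \<in> H s' (h(s := k))) :: real) \<le>
       (\<Sum>k\<in>D s. a * of_bool (\<forall>s'\<in>R. (h(s := k)) s' \<in> H s' (h(s := k))))" .
    then show "avg D [s] (\<lambda>h. of_bool (\<forall>s\<in>insert s R. h s \<in> H s h)) h \<le>
      avg D [s] (\<lambda>h. a * of_bool (\<forall>s\<in>R. h s \<in> H s h)) h"
      unfolding avg.simps by (rule divide_right_mono) simp
  qed
  also have "\<dots> = a * avg D ss (\<lambda>h. of_bool (\<forall>s\<in>R. h s \<in> H s h)) f" by (rule avg_cmult)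
  also have "\<dots> \<le> a * a ^ card R"
    using insert.prems assms(5) by (intro mult_left_mono insert.IH) auto
  finally show ?case using insert.hyps by simp
qed

lemma sqrt_mass_triangle: "sqrt (mass W P \<psi>) \<le> sqrt (mass W P \<phi>) + nrm W (\<lambda>x. \<psi> x - \<phi> x)"
proof -
  have m: "sqrt (mass W P \<psi>) = nrm W (\<lambda>x. if P x then \<psi> x else 0)" for \<psi>
    unfolding mass_def nrm_def L2_set_def by (intro arg_cong[where f = sqrt] sum.cong) auto
  have "nrm W (\<lambda>x. if P x then \<psi> x else 0) =
      nrm W (\<lambda>x. (if P x then \<phi> x else 0) + (if P x then \<psi> x - \<phi> x else 0))"
    by (rule nrm_cong) simp
  also have "\<dots> \<le> nrm W (\<lambda>x. if P x then \<phi> x else 0) + nrm W (\<lambda>x. if P x then \<psi> x - \<phi> x else 0)"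
    by (rule nrm_triangle)
  also have "nrm W (\<lambda>x. if P x then \<psi> x - \<phi> x else 0) \<le> nrm W (\<lambda>x. \<psi> x - \<phi> x)"
    unfolding nrm_def by (rule L2_set_mono) simp_all
  finally show ?thesis unfolding m by simp
qed

text \<open>
  An attack with fixed advice on the puzzles of length \<open>m\<close>: circuit \<open>C s\<close> tries to find the key of
  \<open>s\<close>, and \<open>rd\<close> reads the guess off the measured string.  The success probability in question is \<open>\<delta>\<close>, and
  \<open>r\<close> is the number of puzzles that are hidden together.
\<close>

locale attack =
  fixes m T r :: nat and \<delta> :: real and C :: "bool list \<Rightarrow> circuit" and rd :: "bool list \<Rightarrow> bool list"
  assumes m: "0 < m" and T: "0 < T" and r: "0 < r" and \<delta>: "0 < \<delta>" "\<delta> \<le> 1"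
    and valid: "\<And>s. s \<in> bits m \<Longrightarrow> valid_circuit (C s)"
    and width: "\<And>s. s \<in> bits m \<Longrightarrow> width (C s) < 2 ^ m"
    and steps: "\<And>s. s \<in> bits m \<Longrightarrow> length (gates (C s)) \<le> T"
    and large1: "576 * real T ^ 2 * real r < \<delta> * 2 ^ m"
    and large2: "real r * (2 * (36 * real T ^ 3 * real r / \<delta>) + 1) \<le> \<delta> * 2 ^ m"
    and large3: "162 * (real T + 1) * real T ^ 2 \<le> \<delta> * 2 ^ m"
begin

text \<open>
  \<open>guess s h k\<close> is the probability that the attack on \<open>s\<close> outputs \<open>k\<close> when the keys are given by
  \<open>h\<close>, and \<open>puzzle_query s h w\<close> its total query mass on the verification \<open>w\<close>.  Masses below
  \<open>\<eta>\<close> for other puzzles, or below \<open>\<eta>'\<close> for the puzzle itself, change the run too little to matter; the heavy keys are the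
  few that are output or verified with larger mass.
\<close>

definition "state_at s h t = run (answers h) (take t (gates (C s))) (initial_state (width (C s)))"

definition "guess s h k = mass (width (C s)) (\<lambda>x. rd x = k) (state_at s h (length (gates (C s))))"

definition "puzzle_query s h w =
  (\<Sum>t<length (gates (C s)). query_mass (width (C s)) (6 * m + 2) (gates (C s) ! t) w (state_at s h t))"

definition "\<eta> = \<delta> / (36 * real T ^ 2 * real r)"

definition "\<eta>' = \<delta> / (81 * real T ^ 2)"

definition "heavy s h = {k. \<eta>' < puzzle_query s h (enc_strs [s, k]) + guess s h k}"

lemma gate_valid: "s \<in> bits m \<Longrightarrow> g \<in> set (gates (C s)) \<Longrightarrow> valid_gate (width (C s)) g"
  by (rule valid_circuit_gates[OF valid])

lemma nrm_state_at: "s \<in> bits m \<Longrightarrow> nrm (width (C s)) (state_at s h t) = 1"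
  unfolding state_at_def using nrm_run[of "take t (gates (C s))" "width (C s)"] nrm_initial gate_valid
  by (metis in_set_takeD)

lemma guess_nonneg [simp]: "0 \<le> guess s h k" and puzzle_query_nonneg [simp]: "0 \<le> puzzle_query s h w"
  by (simp_all add: guess_def puzzle_query_def sum_nonneg)

lemma sum_guess: "s \<in> bits m \<Longrightarrow> finite Y \<Longrightarrow> (\<Sum>k\<in>Y. guess s h k) \<le> 1"
  unfolding guess_def
  using sum_mass_le[of Y "width (C s)" "\<lambda>k x. rd x = k" "state_at s h (length (gates (C s)))"] nrm_state_at by simp

lemma sum_puzzle_query:
  assumes s: "s \<in> bits m" and Y: "finite Y"
  shows "(\<Sum>w\<in>Y. puzzle_query s h w) \<le> real T"
proof -
  have "(\<Sum>w\<in>Y. puzzle_query s h w) =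
    (\<Sum>t<length (gates (C s)). \<Sum>w\<in>Y. query_mass (width (C s)) (6 * m + 2) (gates (C s) ! t) w (state_at s h t))"
    unfolding puzzle_query_def by (rule sum.swap)
  also have "\<dots> \<le> (\<Sum>t<length (gates (C s)). 1)"
    using sum_query_mass[OF Y, of "width (C s)"] nrm_state_at[OF s] by (intro sum_mono) (metis one_power2)
  also have "\<dots> \<le> real T" using steps[OF s] by simp
  finally show ?thesis .
qed

lemma sum_puzzle_query_inj:
  assumes s: "s \<in> bits m" and Y: "finite Y" and inj: "inj_on e Y"
  shows "(\<Sum>k\<in>Y. puzzle_query s h (e k)) \<le> real T"
  using sum_puzzle_query[OF s, of "e ` Y" h] Y by (simp add: sum.reindex[OF inj])

lemma small_count:
  assumes "finite Y" "0 < c" "\<And>k. k \<in> Y \<Longrightarrow> 0 \<le> F k" "(\<Sum>k\<in>Y. F k) \<le> b"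
  shows "real (card {k \<in> Y. c < F k}) \<le> b / (c :: real)"
proof -
  have "real (card {k \<in> Y. c < F k}) * c = (\<Sum>k\<in>{k \<in> Y. c < F k}. c)" by simp
  also have "\<dots> \<le> (\<Sum>k\<in>{k \<in> Y. c < F k}. F k)" by (rule sum_mono) simp
  also have "\<dots> \<le> (\<Sum>k\<in>Y. F k)" using assms(1,3) by (intro sum_mono2) auto
  also note assms(4)
  finally show ?thesis using assms(2) by (simp add: pos_le_divide_eq)
qed

lemma \<eta>_pos: "0 < \<eta>" "0 < \<eta>'"
  using \<delta> T r by (simp_all add: \<eta>_def \<eta>'_def)

lemma heavy_small:
  assumes s: "s \<in> bits m"
  shows "real (card {k \<in> keys s. k \<in> heavy s h}) \<le> (1 / 2 ^ Suc m) * real (card (keys s))"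
proof -
  have ks: "real (card (keys s)) = 2 ^ m * 2 ^ m" using s by (simp add: keys_def bits_def[of m] card_bits mult_2 power_add)
  have fin: "finite (keys s)" by (simp add: keys.finite_D)
  have inj: "inj_on (\<lambda>k. enc_strs [s, k]) (keys s)" by (rule inj_onI) (simp add: enc_strs_eq_iff)
  have "(\<Sum>k\<in>keys s. puzzle_query s h (enc_strs [s, k]) + guess s h k) \<le> real T + 1"
    unfolding sum.distrib by (intro add_mono sum_puzzle_query_inj sum_guess s fin inj)
  then have "real (card {k \<in> keys s. \<eta>' < puzzle_query s h (enc_strs [s, k]) + guess s h k}) \<le> (real T + 1) / \<eta>'"
    by (intro small_count fin \<eta>_pos) simp_all
  also have "\<dots> = 162 * (real T + 1) * real T ^ 2 / (2 * \<delta>)" using \<delta> T by (simp add: \<eta>'_def field_simps)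
  also have "\<dots> \<le> \<delta> * 2 ^ m / (2 * \<delta>)" using large3 \<delta> by (intro divide_right_mono) simp_all
  also have "\<dots> = (1 / 2 ^ Suc m) * (2 ^ m * 2 ^ m)" using \<delta> by simp
  finally show ?thesis unfolding ks heavy_def by simp
qed

text \<open>
  If the attack finds the key of \<open>s\<close> and hardly queries the other keys of \<open>R\<close>, then it still
  finds or queries this key when all keys of \<open>R\<close> are hidden from it.  The hybrid argument goes in two steps:
  the other keys are hidden first, with the masses measured in the original run, and then that of \<open>s\<close>,
  with the mass measured in the final run.
\<close>

lemma found_key_heavy:
  assumes R: "R \<subseteq> bits m" "card R = r" and s: "s \<in> R"
    and key: "\<And>s. s \<in> bits m \<Longrightarrow> length (f s) = 2 * m"
    and found: "\<delta> \<le> guess s f (f s)"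
    and indep: "\<And>s'. s' \<in> R \<Longrightarrow> s' \<noteq> s \<Longrightarrow> puzzle_query s f (enc_strs [s', f s']) \<le> \<eta>"
  shows "f s \<in> heavy s (hide R f)"
proof (rule ccontr)
  assume "f s \<notin> heavy s (hide R f)"
  then have light: "puzzle_query s (hide R f) (enc_strs [s, f s]) + guess s (hide R f) (f s) \<le> \<eta>'"
    by (simp add: heavy_def)
  have l1: "puzzle_query s (hide R f) (enc_strs [s, f s]) \<le> \<eta>'" and l2: "guess s (hide R f) (f s) \<le> \<eta>'"
    using light guess_nonneg[of s "hide R f" "f s"] puzzle_query_nonneg[of s "hide R f" "enc_strs [s, f s]"] by linarith+
  have sm: "s \<in> bits m" using s R by blast
  let ?W = "width (C s)" and ?gs = "gates (C s)" and ?f = "hide (R - {s}) f"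
  let ?\<psi> = "initial_state ?W"
  have finR: "finite R" by (rule finite_subset[OF R(1)]) (rule finite_bits)
  have gs: "valid_gate ?W g" if "g \<in> set ?gs" for g by (rule gate_valid[OF sm that])
  have hf: "hide {s} ?f = hide R f" by (rule ext) (use s in \<open>auto simp: hide_def\<close>)
  have fs: "?f s = f s" by (simp add: hide_def)
  interpret A: hidden_keys m f "R - {s}" ?W
    using m width[OF sm] R(1) key by unfold_locales auto
  interpret B: hidden_keys m ?f "{s}" ?W
    using m width[OF sm] sm key by unfold_locales (auto simp: hide_def)
  let ?e = "sqrt (real r / 2 ^ m)"
  have cR: "real (card (R - {s})) \<le> real r" using R finR by (simp add: card_Diff_singleton_if)
  have "nrm ?W (\<lambda>x. run A.old ?gs ?\<psi> x - run A.new ?gs ?\<psi> x) \<le> (\<Sum>t<length ?gs. 4 * sqrt (real (card (R - {s})) / 2 ^ m) +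
       2 * sqrt (\<Sum>s'\<in>R - {s}. query_mass ?W (6 * m + 2) (?gs ! t) (enc_strs [s', f s']) (run A.old (take t ?gs) ?\<psi>)))"
    by (rule A.nrm_run_hide[OF gs nrm_initial]) simp_all
  also have "\<dots> \<le> (\<Sum>t<length ?gs. 4 * ?e + 2 * sqrt (real r * \<eta>))"
  proof (intro sum_mono add_mono mult_left_mono real_sqrt_le_mono divide_right_mono cR)
    fix t assume t: "t \<in> {..<length ?gs}"
    have "(\<Sum>s'\<in>R - {s}. query_mass ?W (6 * m + 2) (?gs ! t) (enc_strs [s', f s']) (run A.old (take t ?gs) ?\<psi>)) \<le>
        (\<Sum>s'\<in>R - {s}. \<eta>)"
    proof (rule sum_mono)
      fix s' assume s': "s' \<in> R - {s}"
      have "query_mass ?W (6 * m + 2) (?gs ! t) (enc_strs [s', f s']) (state_at s f t) \<le> puzzle_query s f (enc_strs [s', f s'])"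
        unfolding puzzle_query_def using t
        by (intro member_le_sum[of t "{..<length ?gs}" "\<lambda>t. query_mass ?W (6 * m + 2) (?gs ! t) (enc_strs [s', f s']) (state_at s f t)"]) simp_all
      also have "\<dots> \<le> \<eta>" using s' by (intro indep) auto
      finally show "query_mass ?W (6 * m + 2) (?gs ! t) (enc_strs [s', f s']) (run A.old (take t ?gs) ?\<psi>) \<le> \<eta>"
        unfolding state_at_def A.old_def .
    qed
    also have "\<dots> \<le> real r * \<eta>" using cR \<eta>_pos(1) by (simp add: mult_right_mono)
    finally show "(\<Sum>s'\<in>R - {s}. query_mass ?W (6 * m + 2) (?gs ! t) (enc_strs [s', f s']) (run A.old (take t ?gs) ?\<psi>)) \<le> real r * \<eta>" .
  qed simp_all
  also have "\<dots> = real (length ?gs) * (4 * ?e + 2 * sqrt (real r * \<eta>))" by simp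
  also have "\<dots> \<le> real T * (4 * ?e + 2 * sqrt (real r * \<eta>))"
    using steps[OF sm] \<eta>_pos by (intro mult_right_mono) simp_all
  finally have d1: "nrm ?W (\<lambda>x. run A.old ?gs ?\<psi> x - run A.new ?gs ?\<psi> x) \<le> real T * (4 * ?e + 2 * sqrt (real r * \<eta>))" .
  have "nrm ?W (\<lambda>x. run B.old ?gs ?\<psi> x - run B.new ?gs ?\<psi> x) \<le> (\<Sum>t<length ?gs. 4 * sqrt (real (card {s}) / 2 ^ m) +
       2 * sqrt (\<Sum>s'\<in>{s}. query_mass ?W (6 * m + 2) (?gs ! t) (enc_strs [s', ?f s']) (run B.new (take t ?gs) ?\<psi>)))"
    by (rule B.nrm_run_hide[OF gs nrm_initial]) simp_all
  also have "\<dots> \<le> (\<Sum>t<length ?gs. 4 * ?e + 2 * sqrt \<eta>')"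
  proof (intro sum_mono add_mono mult_left_mono real_sqrt_le_mono divide_right_mono)
    fix t assume t: "t \<in> {..<length ?gs}"
    have "query_mass ?W (6 * m + 2) (?gs ! t) (enc_strs [s, f s]) (state_at s (hide R f) t) \<le> puzzle_query s (hide R f) (enc_strs [s, f s])"
      unfolding puzzle_query_def using t
      by (intro member_le_sum[of t "{..<length ?gs}" "\<lambda>t. query_mass ?W (6 * m + 2) (?gs ! t) (enc_strs [s, f s]) (state_at s (hide R f) t)"]) simp_all
    then show "(\<Sum>s'\<in>{s}. query_mass ?W (6 * m + 2) (?gs ! t) (enc_strs [s', ?f s']) (run B.new (take t ?gs) ?\<psi>)) \<le> \<eta>'"
      using l1 by (simp add: state_at_def B.new_def hf fs)
  qed (use r in simp_all)
  also have "\<dots> = real (length ?gs) * (4 * ?e + 2 * sqrt \<eta>')" by simp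
  also have "\<dots> \<le> real T * (4 * ?e + 2 * sqrt \<eta>')"
    using steps[OF sm] \<eta>_pos by (intro mult_right_mono) simp_all
  finally have d2: "nrm ?W (\<lambda>x. run B.old ?gs ?\<psi> x - run B.new ?gs ?\<psi> x) \<le> real T * (4 * ?e + 2 * sqrt \<eta>')" .
  have runs: "run A.old ?gs ?\<psi> = state_at s f (length ?gs)" "run B.new ?gs ?\<psi> = state_at s (hide R f) (length ?gs)"
    "A.new = B.old"
    by (simp_all add: state_at_def A.old_def B.new_def hf A.new_def B.old_def)
  have "sqrt (guess s f (f s)) \<le> sqrt (mass ?W (\<lambda>x. rd x = f s) (run A.new ?gs ?\<psi>)) +
      nrm ?W (\<lambda>x. run A.old ?gs ?\<psi> x - run A.new ?gs ?\<psi> x)"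
    unfolding guess_def runs(1)[symmetric] by (rule sqrt_mass_triangle)
  moreover have "sqrt (mass ?W (\<lambda>x. rd x = f s) (run A.new ?gs ?\<psi>)) \<le> sqrt (guess s (hide R f) (f s)) +
      nrm ?W (\<lambda>x. run B.old ?gs ?\<psi> x - run B.new ?gs ?\<psi> x)"
    unfolding guess_def runs(2)[symmetric] runs(3) by (rule sqrt_mass_triangle)
  moreover have "sqrt (guess s (hide R f) (f s)) \<le> sqrt \<eta>'" using l2 by simp
  moreover have "sqrt \<delta> \<le> sqrt (guess s f (f s))" using found by simp
  ultimately have "sqrt \<delta> \<le> sqrt \<eta>' + real T * (4 * ?e + 2 * sqrt (real r * \<eta>)) + real T * (4 * ?e + 2 * sqrt \<eta>')"
    using d1 d2 by linarith
  also have "\<dots> = sqrt \<eta>' + 2 * (real T * sqrt \<eta>') + 2 * (real T * sqrt (real r * \<eta>)) + 8 * (real T * ?e)"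
    by (simp add: algebra_simps)
  also have "\<dots> < sqrt \<delta>"
  proof -
    have T1: "1 \<le> real T" using T by simp
    have sT: "real T * sqrt x = sqrt (real T ^ 2 * x)" for x by (simp add: real_sqrt_mult)
    have "real T * sqrt \<eta>' = sqrt (\<delta> / 9\<^sup>2)" unfolding sT using T by (simp add: \<eta>'_def)
    also have "\<dots> = sqrt \<delta> / 9" by (simp add: real_sqrt_divide)
    finally have 1: "real T * sqrt \<eta>' = sqrt \<delta> / 9" .
    have "1 * sqrt \<eta>' \<le> real T * sqrt \<eta>'" by (rule mult_right_mono[OF T1]) (use \<eta>_pos(2) in simp)
    then have 2: "sqrt \<eta>' \<le> sqrt \<delta> / 9" unfolding 1 by simp
    have "real T * sqrt (real r * \<eta>) = sqrt (\<delta> / 6\<^sup>2)" unfolding sT using T r by (simp add: \<eta>_def)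
    also have "\<dots> = sqrt \<delta> / 6" by (simp add: real_sqrt_divide)
    finally have 3: "real T * sqrt (real r * \<eta>) = sqrt \<delta> / 6" .
    have "24 * (real T * ?e) = sqrt (576 * real T ^ 2 * real r / 2 ^ m)"
    proof -
      have "sqrt (576 * real T ^ 2 * real r / 2 ^ m) = sqrt (24\<^sup>2 * (real T ^ 2 * (real r / 2 ^ m)))" by simp
      also have "\<dots> = 24 * (real T * ?e)" unfolding sT by (simp only: real_sqrt_mult real_sqrt_abs abs_numeral)
      finally show ?thesis by simp
    qed
    also have "\<dots> < sqrt \<delta>" using large1 by (simp add: pos_divide_less_eq)
    finally have 4: "24 * (real T * ?e) < sqrt \<delta>" .
    show ?thesis using 1 2 3 4 by linarith
  qed
  finally show False by simp
qed

text \<open>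
  A successful attack provides a set \<open>R\<close> of \<open>r\<close> puzzles whose keys are all heavy with respect to
  \<open>hide R h\<close>, by the previous lemma and \<open>exists_independent_set\<close>.  The union bound is over at most
  \<open>(2^m)^r\<close> sets \<open>R\<close>, and each of them has probability at most \<open>(1 / 2^(m + 1))^r\<close>.
\<close>

lemma attack_fails:
  assumes ss: "distinct ss" "bits m \<subseteq> set ss"
  shows "avg keys ss (\<lambda>h. of_bool (2 * \<delta> * 2 ^ m < (\<Sum>s\<in>bits m. guess s h (h s)))) f \<le> (1 / 2) ^ r"
proof -
  let ?\<R> = "{R. R \<subseteq> bits m \<and> card R = r}"
  have fin: "finite ?\<R>" by (rule finite_subset[OF _ finite_Pow_iff[THEN iffD2, OF finite_bits]]) auto
  have "avg keys ss (\<lambda>h. of_bool (2 * \<delta> * 2 ^ m < (\<Sum>s\<in>bits m. guess s h (h s)))) f \<le>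
      avg keys ss (\<lambda>h. \<Sum>R\<in>?\<R>. of_bool (\<forall>s\<in>R. h s \<in> heavy s (hide R h))) f"
  proof (rule keys.avg_mono)
    fix h assume h: "h \<in> redraws keys ss f"
    have key: "length (h s) = 2 * m" if "s \<in> bits m" for s
      using h that ss(2) by (auto simp: redraws_def keys_def bits_def)
    show "of_bool (2 * \<delta> * 2 ^ m < (\<Sum>s\<in>bits m. guess s h (h s))) \<le>
       (\<Sum>R\<in>?\<R>. of_bool (\<forall>s\<in>R. h s \<in> heavy s (hide R h)) :: real)"
    proof (cases "2 * \<delta> * 2 ^ m < (\<Sum>s\<in>bits m. guess s h (h s))")
      case True
      define K where "K = {s \<in> bits m. \<delta> \<le> guess s h (h s)}"
      have K: "finite K" "K \<subseteq> bits m" by (auto simp: K_def finite_bits)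
      have "guess s h (h s) \<le> 1" if "s \<in> bits m" for s using sum_guess[OF that, of "{h s}"] by simp
      then have "(\<Sum>s\<in>bits m. guess s h (h s)) \<le> (\<Sum>s\<in>bits m. of_bool (s \<in> K) + \<delta>)"
        using \<delta> by (intro sum_mono) (auto simp: K_def add_increasing2)
      also have "\<dots> = real (card K) + \<delta> * 2 ^ m"
        using K by (simp add: sum.distrib sum_of_bool_eq finite_bits card_bits Int_absorb1 Int_absorb2)
      finally have cK: "\<delta> * 2 ^ m \<le> real (card K)" using True by simp
      let ?w = "\<lambda>s s'. \<eta> < puzzle_query s h (enc_strs [s', h s'])"
      define d where "d = nat \<lfloor>real T / \<eta>\<rfloor>"
      have d: "real d \<le> real T / \<eta>" using \<eta>_pos by (simp add: d_def)
      have "\<exists>R\<subseteq>K. card R = r \<and> (\<forall>s\<in>R. \<forall>s'\<in>R. s \<noteq> s' \<longrightarrow> \<not> ?w s s')"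
      proof (rule exists_independent_set[OF K(1)])
        show "card {s' \<in> K. ?w s s'} \<le> d" if "s \<in> K" for s
        proof -
          have "inj_on (\<lambda>s'. enc_strs [s', h s']) K" by (rule inj_onI) (simp add: enc_strs_eq_iff)
          then have "real (card {s' \<in> K. ?w s s'}) \<le> real T / \<eta>"
            using that K by (intro small_count \<eta>_pos sum_puzzle_query_inj) auto
          then show ?thesis using \<eta>_pos by (simp add: d_def le_nat_floor)
        qed
        have "real T / \<eta> = 36 * real T ^ 3 * real r / \<delta>" by (simp add: \<eta>_def power3_eq_cube power2_eq_square)
        then have "real r * (2 * real d + 1) \<le> real r * (2 * (36 * real T ^ 3 * real r / \<delta>) + 1)"
          using d by (intro mult_left_mono) simp_all
        also note large2
        also note cK
        finally have "real (r * (2 * d + 1)) \<le> real (card K)"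
          by (simp only: of_nat_mult of_nat_add of_nat_numeral of_nat_1)
        then show "r * (2 * d + 1) \<le> card K" by (simp only: of_nat_le_iff)
      qed
      then obtain R where R: "R \<subseteq> K" "card R = r" "\<And>s s'. s \<in> R \<Longrightarrow> s' \<in> R \<Longrightarrow> s \<noteq> s' \<Longrightarrow> \<not> ?w s s'" by blast
      have Rm: "R \<subseteq> bits m" using R(1) K(2) by blast
      have "h s \<in> heavy s (hide R h)" if s: "s \<in> R" for s
      proof (rule found_key_heavy[OF Rm R(2) s key])
        show "\<delta> \<le> guess s h (h s)" using s R(1) by (auto simp: K_def)
        show "puzzle_query s h (enc_strs [s', h s']) \<le> \<eta>" if "s' \<in> R" "s' \<noteq> s" for s'
          using R(3)[OF s that(1)] that(2) by force
      qed
      then have "(1 :: real) = of_bool (\<forall>s\<in>R. h s \<in> heavy s (hide R h))" by simp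
      also have "\<dots> \<le> (\<Sum>R\<in>?\<R>. of_bool (\<forall>s\<in>R. h s \<in> heavy s (hide R h)))"
        using Rm R(2) fin by (intro member_le_sum[of R ?\<R> "\<lambda>R. of_bool (\<forall>s\<in>R. h s \<in> heavy s (hide R h))"]) simp_all
      finally show ?thesis using True by simp
    qed (simp add: sum_nonneg)
  qed
  also have "\<dots> = (\<Sum>R\<in>?\<R>. avg keys ss (\<lambda>h. of_bool (\<forall>s\<in>R. h s \<in> heavy s (hide R h))) f)" by (rule keys.avg_sum)
  also have "\<dots> \<le> (\<Sum>R\<in>?\<R>. (1 / 2 ^ Suc m) ^ r)"
  proof (rule sum_mono)
    fix R assume "R \<in> ?\<R>"
    then have R: "R \<subseteq> bits m" "card R = r" by auto
    have finR: "finite R" by (rule finite_subset[OF R(1)]) (rule finite_bits)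
    have "avg keys ss (\<lambda>h. of_bool (\<forall>s\<in>R. h s \<in> heavy s (hide R h))) f \<le> (1 / 2 ^ Suc m) ^ card R"
    proof (rule keys.avg_all_in[OF ss(1) finR _ order_refl])
      show "heavy s (hide R (h(s' := k))) = heavy s (hide R h)" if "s' \<in> R" for h s s' k
      proof -
        have "hide R (h(s' := k)) = hide R h" using that by (intro ext) (simp add: hide_def)
        then show ?thesis by simp
      qed
    qed (use R ss(2) heavy_small in auto)
    then show "avg keys ss (\<lambda>h. of_bool (\<forall>s\<in>R. h s \<in> heavy s (hide R h))) f \<le> (1 / 2 ^ Suc m) ^ r"
      by (simp only: R(2))
  qed
  also have "\<dots> = real (card ?\<R>) * (1 / 2 ^ Suc m) ^ r" by simp
  also have "\<dots> \<le> (2 ^ m) ^ r * (1 / 2 ^ Suc m) ^ r"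
  proof (rule mult_right_mono)
    have "card ?\<R> = 2 ^ m choose r" using n_subsets[OF finite_bits, of m r] by (simp add: card_bits)
    also have "\<dots> \<le> (2 ^ m) ^ r"
      by (cases "r \<le> 2 ^ m") (simp_all add: binomial_le_pow binomial_eq_0)
    finally show "real (card ?\<R>) \<le> (2 ^ m) ^ r" by (metis of_nat_le_iff of_nat_numeral of_nat_power)
  qed simp
  also have "\<dots> = (1 / 2) ^ r" by (simp add: power_mult_distrib[symmetric])
  finally show ?thesis .
qed

end

section \<open>A key function that avoids all bad events\<close>

lemma out_cong:
  assumes "valid_circuit (B (enc_strs us))" and "\<And>w. 4 * length w \<le> width (B (enc_strs us)) \<Longrightarrow> A w = A' w"
  shows "pmf (out (reflection_oracle A) B us) y = pmf (out (reflection_oracle A') B us) y"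
proof -
  have "run A (gates (B (enc_strs us))) = run A' (gates (B (enc_strs us)))"
    by (rule run_cong[OF _ assms(2)]) (rule valid_circuit_gates[OF assms(1)])
  then show ?thesis unfolding out_def pmf_run[OF assms(1)] by simp
qed

lemma valid_alg: "valid_circuit (alg g w)"
  using QPT_alg[of g] by (simp add: QPT_def)

lemma out_local:
  assumes "width (alg g (enc_strs us)) \<le> N" and agree: "\<And>s. length s < N \<Longrightarrow> f s = f' s"
  shows "pmf (out (reflection_oracle (answers f)) (alg g) us) y = pmf (out (reflection_oracle (answers f')) (alg g) us) y"
proof (rule out_cong[where B = "alg g", OF valid_alg])
  fix w :: "bool list" assume "4 * length w \<le> width (alg g (enc_strs us))"
  then have "f s = f' s" if "length s < length w" for s using that assms(1) by (intro agree) simp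
  then show "answers f w = answers f' w" by (rule answers_local)
qed

lemma out_shorter:
  assumes "width (alg g (enc_strs us)) < \<theta>"
  shows "pmf (out (reflection_oracle (shorter \<theta> A)) (alg g) us) y = pmf (out (reflection_oracle A) (alg g) us) y"
  by (rule out_cong[where B = "alg g", OF valid_alg]) (use assms in \<open>simp add: shorter_def\<close>)

subsection \<open>Puzzles of one length are hard\<close>

text \<open>
  The superpolynomial bound \<open>2 ^ (m div 16)\<close> on advice, circuits and reciprocal success probability against
  which puzzles of length \<open>m\<close> are secure.
\<close>

definition strength :: "nat \<Rightarrow> nat" where
  "strength m = 2 ^ (m div 16)"

text \<open>
  The success probability of algorithm \<open>g\<close> with advice \<open>c\<close> on a random puzzle of length \<open>m\<close>.
\<close>

definition puzzle_success :: "nat \<Rightarrow> nat \<Rightarrow> bool list \<Rightarrow> (bool list \<Rightarrow> bool list) \<Rightarrow> real" where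
  "puzzle_success m g c f =
     (\<Sum>s\<in>bits m. pmf (out (reflection_oracle (answers f)) (alg g) [s, c]) (f s)) / 2 ^ m"

text \<open>
  Algorithm \<open>g\<close> competes from length \<open>g\<close> on, so that finitely many algorithms compete at each length.
\<close>

definition admissible :: "nat \<Rightarrow> nat \<Rightarrow> bool list \<Rightarrow> bool" where
  "admissible m g c \<longleftrightarrow> g \<le> m \<and> length c \<le> strength m \<and>
     (\<forall>s\<in>bits m. size_of (alg g (enc_strs [s, c])) \<le> strength m)"

text \<open>
  Some admissible attack does better than the bound.  Lengths below 160 are exempt, where \<open>strength_bounds\<close> fails.
\<close>

definition broken :: "nat \<Rightarrow> (bool list \<Rightarrow> bool list) \<Rightarrow> bool" where
  "broken m f \<longleftrightarrow> 160 \<le> m \<and> (\<exists>g c. admissible m g c \<and> 2 / real (strength m) < puzzle_success m g c f)"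

lemma strength_bounds:
  assumes "160 \<le> m" shows "1024 \<le> strength m" "real (strength m) ^ 16 \<le> 2 ^ m"
    "4 * (m + 1) * (m + 1) * (m + 2) * 2 ^ (strength m + 1) \<le> (2::nat) ^ (strength m ^ 4)"
proof -
  let ?j = "m div 16" and ?u = "strength m"
  have j: "10 \<le> ?j" using assms by simp
  have "(2::nat) ^ 10 \<le> 2 ^ ?j" using j by (rule power_increasing) simp
  then show u: "1024 \<le> ?u" by (simp add: strength_def)
  have "(2::real) ^ (?j * 16) \<le> 2 ^ m" by (rule power_increasing) simp_all
  then show "real ?u ^ 16 \<le> 2 ^ m" by (simp add: strength_def power_mult)
  have "?j < ?u" unfolding strength_def by (rule less_exp)
  moreover have "m < 16 * ?j + 16" by simp
  ultimately have m: "m + 2 \<le> 32 * ?u" using u by linarith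
  have "4 * (m + 1) * (m + 1) * (m + 2) \<le> 4 * (32 * ?u) * (32 * ?u) * (32 * ?u)"
    using m by (intro mult_mono) simp_all
  also have "\<dots> = 131072 * ?u ^ 3" by (simp add: power3_eq_cube)
  also have "\<dots> \<le> ?u ^ 2 * ?u ^ 3"
    using power_mono[OF u, of 2] by (intro mult_right_mono) simp_all
  also have "\<dots> = ?u ^ 5" by (simp flip: power_add)
  also have "\<dots> \<le> (2 ^ ?u) ^ 5" by (intro power_mono less_imp_le[OF less_exp]) simp
  finally have "4 * (m + 1) * (m + 1) * (m + 2) * 2 ^ (?u + 1) \<le> (2 ^ ?u) ^ 5 * 2 ^ (?u + 1)"
    by (rule mult_right_mono) simp
  also have "\<dots> = 2 ^ (?u * 5 + (?u + 1))" by (simp only: power_mult power_add)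
  also have "\<dots> \<le> 2 ^ (?u ^ 4)"
  proof (rule power_increasing)
    have "?u * 5 + (?u + 1) \<le> 7 * ?u" using u by simp
    also have "\<dots> \<le> ?u * ?u" using u by (intro mult_right_mono) simp_all
    also have "\<dots> = ?u ^ 2" by (simp add: power2_eq_square)
    also have "\<dots> \<le> ?u ^ 4" using u by (intro power_increasing) simp_all
    finally show "?u * 5 + (?u + 1) \<le> ?u ^ 4" .
  qed simp
  finally show "4 * (m + 1) * (m + 1) * (m + 2) * 2 ^ (?u + 1) \<le> 2 ^ (?u ^ 4)" .
qed

lemma admissible_attack:
  assumes m: "160 \<le> m" and adm: "admissible m g c" and ss: "distinct ss" "bits m \<subseteq> set ss"
  shows "avg keys ss (\<lambda>h. of_bool (2 / real (strength m) < puzzle_success m g c h)) f \<le> (1 / 2) ^ (strength m ^ 4)"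
proof -
  let ?u = "strength m" and ?C = "\<lambda>s. alg g (enc_strs [s, c])" and ?rd = "\<lambda>x. fst (read_str x)"
  define U where "U = real ?u"
  have U: "1024 \<le> U" "U ^ 16 \<le> 2 ^ m" using strength_bounds(1,2)[OF m] by (simp_all add: U_def)
  have pw: "1024 * U ^ k \<le> U ^ Suc k" for k using U(1) by (simp add: mult_right_mono)
  have pu: "U ^ k * U ^ l = U ^ (k + l)" for k l by (simp add: power_add)
  have big: "1024 * U ^ k \<le> 2 ^ m" if "k \<le> 15" for k
  proof -
    have "1024 * U ^ k \<le> U ^ Suc k" by (rule pw)
    also have "\<dots> \<le> U ^ 16" using U(1) that by (intro power_increasing) simp_all
    finally show ?thesis using U(2) by simp
  qed
  have le: "x \<le> 1 / U * 2 ^ m" if "U * x \<le> 2 ^ m" for x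
    using that U(1) by (simp add: field_simps)
  interpret attack m ?u "?u ^ 4" "1 / U" ?C ?rd
  proof
    show "0 < m" "0 < ?u" "0 < ?u ^ 4" "0 < 1 / U" "1 / U \<le> 1" using m U(1) by (simp_all add: strength_def)
    show "valid_circuit (?C s)" for s by (rule valid_alg)
    fix s assume s: "s \<in> bits m"
    have sz: "size_of (?C s) \<le> ?u" using adm s by (simp add: admissible_def)
    have "?u \<le> 2 ^ m" unfolding strength_def by (intro power_increasing) simp_all
    then show "width (?C s) < 2 ^ m" using width_le_size[of "?C s"] sz by linarith
    show "length (gates (?C s)) \<le> ?u" using gates_le_size[of "?C s"] sz by simp
  next
    have "576 * U ^ 2 * U ^ 4 < 1024 * U ^ 6" using U(1) by (simp add: mult.assoc flip: power_add)
    also have "\<dots> \<le> 1 / U * 2 ^ m"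
    proof (rule le)
      have "U * (1024 * U ^ 6) = 1024 * U ^ 7" by (simp add: power_Suc[symmetric] mult.left_commute del: power_Suc)
      then show "U * (1024 * U ^ 6) \<le> 2 ^ m" using big[of 7] by simp
    qed
    finally show "576 * real ?u ^ 2 * real (?u ^ 4) < 1 / U * 2 ^ m" by (simp add: U_def)
  next
    have "1 \<le> U ^ 8" using U(1) by simp
    then have "U ^ 4 * (2 * (36 * U ^ 3 * U ^ 4 / (1 / U)) + 1) \<le> U ^ 4 * (72 * U ^ 8 + U ^ 8)"
      by (intro mult_left_mono add_mono) (use U(1) in \<open>simp_all flip: power_Suc2 power_add\<close>)
    also have "\<dots> = 73 * U ^ 12" by (simp add: distrib_left flip: power_add)
    also have "\<dots> \<le> 1 / U * 2 ^ m"
    proof (rule le)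
      have "U * (73 * U ^ 12) = 73 * U ^ 13" by (simp add: power_Suc[symmetric] mult.left_commute del: power_Suc)
      also have "\<dots> \<le> 1024 * U ^ 13" using U(1) by (intro mult_right_mono) simp_all
      finally show "U * (73 * U ^ 12) \<le> 2 ^ m" using big[of 13] by simp
    qed
    finally show "real (?u ^ 4) * (2 * (36 * real ?u ^ 3 * real (?u ^ 4) / (1 / U)) + 1) \<le> 1 / U * 2 ^ m"
      by (simp add: U_def)
  next
    have "162 * (U + 1) * U ^ 2 \<le> (1024 * U) * U ^ 2" using U(1) by (intro mult_right_mono) simp_all
    also have "\<dots> = 1024 * U ^ 3" by (simp add: power2_eq_square power3_eq_cube)
    also have "\<dots> \<le> 1 / U * 2 ^ m"
    proof (rule le)
      have "U * (1024 * U ^ 3) = 1024 * U ^ 4" by (simp add: power_Suc[symmetric] mult.left_commute del: power_Suc)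
      then show "U * (1024 * U ^ 3) \<le> 2 ^ m" using big[of 4] by simp
    qed
    finally show "162 * (real ?u + 1) * real ?u ^ 2 \<le> 1 / U * 2 ^ m" by (simp add: U_def)
  qed
  have guess: "guess s h k = pmf (out (reflection_oracle (answers h)) (alg g) [s, c]) k" if "s \<in> bits m" for s h k
    unfolding out_def pmf_run[OF valid_alg] guess_def state_at_def by simp
  have "(2 / real ?u < puzzle_success m g c h) = (2 * (1 / U) * 2 ^ m < (\<Sum>s\<in>bits m. guess s h (h s)))" for h
    unfolding puzzle_success_def by (simp add: pos_less_divide_eq U_def guess)
  then show ?thesis using attack_fails[OF ss, of f] by simp
qed

lemma broken_rare:
  assumes ss: "distinct ss" "bits m \<subseteq> set ss"
  shows "avg keys ss (\<lambda>h. of_bool (broken m h)) f \<le> 1 / (4 * ((real m + 1) * (real m + 2)))"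
proof (cases "160 \<le> m")
  case m: True
  let ?u = "strength m"
  define I where "I = {(g, c). admissible m g c}"
  have sub: "I \<subseteq> {..m} \<times> set (coords 0 (?u + 1))"
    by (auto simp: I_def admissible_def set_coords)
  then have fin: "finite I" by (rule finite_subset) simp
  have "card (set (coords 0 (?u + 1))) = (\<Sum>k<?u + 1. 2 ^ k)"
    using sum_over_coords[of "\<lambda>_. 1::nat" 0 "?u + 1"] by (simp add: card_bits atLeast0LessThan)
  also have "\<dots> \<le> 2 ^ (?u + 1)" using mask_eq_sum_exp_nat[of "?u + 1"] by (simp flip: lessThan_def)
  finally have "card I \<le> (m + 1) * 2 ^ (?u + 1)"
    using card_mono[OF _ sub] by (simp add: card_cartesian_product) (meson le_trans mult_le_mono2 add_mono order_refl)
  have "avg keys ss (\<lambda>h. of_bool (broken m h)) f \<le>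
     avg keys ss (\<lambda>h. \<Sum>(g, c)\<in>I. of_bool (2 / real ?u < puzzle_success m g c h)) f"
  proof (rule keys.avg_mono)
    fix h
    show "of_bool (broken m h) \<le> (\<Sum>(g, c)\<in>I. of_bool (2 / real ?u < puzzle_success m g c h) :: real)"
    proof (cases "broken m h")
      case True
      then obtain g c where gc: "(g, c) \<in> I" "2 / real ?u < puzzle_success m g c h" by (auto simp: broken_def I_def)
      then have "(1 :: real) = (case (g, c) of (g, c) \<Rightarrow> of_bool (2 / real ?u < puzzle_success m g c h))" by simp
      also have "\<dots> \<le> (\<Sum>(g, c)\<in>I. of_bool (2 / real ?u < puzzle_success m g c h))"
        by (rule member_le_sum[OF gc(1) _ fin]) auto
      finally show ?thesis using True by simp
    qed (simp add: sum_nonneg split: prod.split)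
  qed
  also have "\<dots> = (\<Sum>i\<in>I. avg keys ss (\<lambda>h. case i of (g, c) \<Rightarrow> of_bool (2 / real ?u < puzzle_success m g c h)) f)"
    by (rule keys.avg_sum)
  also have "\<dots> \<le> (\<Sum>i\<in>I. (1 / 2) ^ (?u ^ 4))"
    by (rule sum_mono) (use admissible_attack[OF m _ ss] in \<open>auto simp: I_def\<close>)
  also have "\<dots> = real (card I) / 2 ^ (?u ^ 4)" by (simp add: power_one_over divide_simps)
  also have "\<dots> \<le> real ((m + 1) * 2 ^ (?u + 1)) / 2 ^ (?u ^ 4)"
    by (rule divide_right_mono) (simp_all only: of_nat_le_iff \<open>card I \<le> _\<close>, simp)
  also have "\<dots> \<le> 1 / (4 * ((real m + 1) * (real m + 2)))"
  proof -
    have "real (4 * (m + 1) * (m + 1) * (m + 2) * 2 ^ (?u + 1)) \<le> real (2 ^ (?u ^ 4))"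
      by (rule of_nat_mono[OF strength_bounds(3)[OF m]])
    moreover have "real (4 * (m + 1) * (m + 1) * (m + 2) * 2 ^ (?u + 1)) =
        real ((m + 1) * 2 ^ (?u + 1)) * (4 * ((real m + 1) * (real m + 2)))"
      by (simp only: of_nat_mult of_nat_add of_nat_numeral of_nat_1 mult_ac)
    moreover have "real (2 ^ (?u ^ 4)) = 2 ^ (?u ^ 4)" by simp
    ultimately have le: "real ((m + 1) * 2 ^ (?u + 1)) * (4 * ((real m + 1) * (real m + 2))) \<le> 2 ^ (?u ^ 4)" by (simp only:)
    have "a / b \<le> 1 / c" if "a * c \<le> b" "0 < b" "0 < c" for a b c :: real
      using that by (simp add: divide_simps)
    from this[OF le] show ?thesis by (simp add: add_pos_nonneg)
  qed
  finally show ?thesis .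
qed (simp add: broken_def)

subsection \<open>Likely outputs of algorithms are not determined by hidden keys\<close>

text \<open>The inputs with a likely output that is not likely on average over the hidden keys.\<close>

definition inconsistent :: "nat \<Rightarrow> nat \<Rightarrow> nat \<Rightarrow> (bool list \<Rightarrow> bool list) \<Rightarrow> bool list set" where
  "inconsistent g l n f = {x \<in> bits n. \<exists>y. 3 / 4 \<le> pmf (out (reflection_oracle (answers f)) (alg g) [unary l, x]) y \<and>
     avg_output g l n f x y \<le> 1 / 2}"

text \<open>More than a sixth of the inputs are inconsistent.\<close>

definition deviating :: "nat \<Rightarrow> nat \<Rightarrow> nat \<Rightarrow> (bool list \<Rightarrow> bool list) \<Rightarrow> bool" where
  "deviating g l n f \<longleftrightarrow> 2 ^ n / 6 < real (card (inconsistent g l n f))"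

lemma size_le_max_size: "x \<in> bits n \<Longrightarrow> size_of (alg g (enc_strs [unary l, x])) \<le> max_size g l n"
  unfolding max_size_def by (rule Max_ge) (auto simp: finite_bits)

lemma max_size_less_threshold: "max_size g l n < threshold g l n"
proof -
  have "max_size g l n + 1 \<le> (max_size g l n + 1) ^ 4" by (rule self_le_power) simp_all
  also have "\<dots> \<le> threshold g l n" by (simp add: threshold_def)
  finally show ?thesis by simp
qed

lemma first_hidden_le: "0 < \<theta> \<Longrightarrow> first_hidden \<theta> \<le> \<theta>"
  unfolding first_hidden_def by (rule Least_le) (rule less_exp)

text \<open>
  By Markov's inequality: every inconsistent input has an output whose probability deviates from its average
  by at least \<open>1/4\<close>.
\<close>

lemma deviating_rare:
  assumes L: "threshold g l n \<le> L"
  shows "avg keys (coords 0 L) (\<lambda>h. of_bool (deviating g l n h)) f \<le>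
    1 / (4 * ((real (code g l n) + 1) * (real (code g l n) + 2)))"
proof -
  let ?\<theta> = "threshold g l n" and ?k = "first_hidden (threshold g l n)"
  define cs where "cs = coords ?k ?\<theta>"
  define C where "C = (\<lambda>x. alg g (enc_strs [unary l, x]))"
  define p where "p = (\<lambda>x h y. pmf (out (reflection_oracle (answers h)) (alg g) [unary l, x]) y)"
  define Y where "Y = (\<lambda>x. (\<lambda>a. fst (read_str a)) ` bits (width (C x)))"
  define S where "S = real (max_size g l n) + 1"
  define b where "b = (real (code g l n) + 1) * (real (code g l n) + 2)"
  have finY: "finite (Y x)" for x by (simp add: Y_def finite_bits)
  have \<theta>: "real ?\<theta> = 30000000 * S ^ 4 * b" by (simp add: threshold_def S_def b_def algebra_simps)
  have p_run: "p x h y = mass (width (C x)) (\<lambda>a. fst (read_str a) = y) (run (answers h) (gates (C x)) (initial_state (width (C x))))"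
    for x h y unfolding p_def out_def C_def by (rule pmf_run[OF valid_alg])
  have W: "width (C x) < ?\<theta>" if "x \<in> bits n" for x
    using width_le_size[of "C x"] size_le_max_size[OF that, of g l] max_size_less_threshold[of g l n] by (simp add: C_def)
  have avg_p: "avg_output g l n h x y = avg keys cs (\<lambda>h. p x h y) h" if "x \<in> bits n" for h x y
    unfolding avg_output_def cs_def p_def using W[OF that] by (simp add: out_shorter C_def)
  have split: "coords 0 L = coords 0 ?k @ cs @ coords ?\<theta> L"
    unfolding cs_def using L first_hidden_le[OF threshold_pos, of g l n]
    by (metis coords_append le0 order_trans)
  let ?dev = "\<lambda>h. \<Sum>x\<in>bits n. \<Sum>y\<in>Y x. (p x h y - avg_output g l n h x y)\<^sup>2"
  have "avg keys (coords 0 L) (\<lambda>h. of_bool (deviating g l n h)) f \<le> avg keys (coords 0 L) (\<lambda>h. 96 / 2 ^ n * ?dev h) f"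
  proof (rule keys.avg_mono)
    fix h
    show "of_bool (deviating g l n h) \<le> 96 / 2 ^ n * ?dev h"
    proof (cases "deviating g l n h")
      case True
      have fin: "finite (inconsistent g l n h)" by (simp add: inconsistent_def finite_bits)
      have "2 ^ n / 6 * (1 / 16) \<le> real (card (inconsistent g l n h)) * (1 / 16)"
        using True by (intro mult_right_mono) (simp_all add: deviating_def)
      also have "\<dots> = (\<Sum>x\<in>inconsistent g l n h. 1 / 16)" by simp
      also have "\<dots> \<le> (\<Sum>x\<in>inconsistent g l n h. \<Sum>y\<in>Y x. (p x h y - avg_output g l n h x y)\<^sup>2)"
      proof (rule sum_mono)
        fix x assume "x \<in> inconsistent g l n h"
        then obtain y where y: "3 / 4 \<le> p x h y" "avg_output g l n h x y \<le> 1 / 2"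
          by (auto simp: inconsistent_def p_def)
        have "y \<in> Y x"
        proof (rule ccontr)
          assume "y \<notin> Y x"
          then have "p x h y = 0" unfolding p_run mass_def by (intro sum.neutral) (auto simp: Y_def)
          then show False using y(1) by simp
        qed
        have "(1 / 4 :: real)\<^sup>2 \<le> (p x h y - avg_output g l n h x y)\<^sup>2" using y by (intro power_mono) simp_all
        then have "1 / 16 \<le> (p x h y - avg_output g l n h x y)\<^sup>2" by (simp add: power2_eq_square)
        also have "\<dots> \<le> (\<Sum>y\<in>Y x. (p x h y - avg_output g l n h x y)\<^sup>2)"
          by (rule member_le_sum[OF \<open>y \<in> Y x\<close>, where f = "\<lambda>y. (p x h y - avg_output g l n h x y)\<^sup>2"]) (simp_all add: finY)
        finally show "1 / 16 \<le> (\<Sum>y\<in>Y x. (p x h y - avg_output g l n h x y)\<^sup>2)" .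
      qed
      also have "\<dots> \<le> ?dev h"
        by (rule sum_mono2) (auto simp: finite_bits inconsistent_def sum_nonneg)
      finally show ?thesis using True by (simp add: field_simps)
    qed (simp add: sum_nonneg)
  qed
  also have "\<dots> = 96 / 2 ^ n * avg keys (coords 0 L) ?dev f" by (rule keys.avg_cmult)
  also have "avg keys (coords 0 L) ?dev f \<le> avg keys (coords 0 L) (\<lambda>_. 2 ^ n * (72000 * S ^ 4 / real ?\<theta>)) f"
    unfolding split
  proof (rule keys.avg_le_block)
    show "distinct (coords 0 ?k @ cs @ coords ?\<theta> L)" unfolding split[symmetric] by (rule distinct_coords)
    fix h
    have "avg keys cs ?dev h \<le> avg keys cs (\<lambda>h'. \<Sum>x\<in>bits n. \<Sum>y\<in>Y x. (p x h' y - avg keys cs (\<lambda>h. p x h y) h)\<^sup>2) h"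
    proof (rule keys.avg_mono)
      fix h' assume h': "h' \<in> redraws keys cs h"
      have "avg_output g l n h' x y = avg_output g l n h x y" for x y
      proof (rule avg_output_local)
        fix s :: "bool list" assume "2 ^ length s \<le> ?\<theta>"
        then have "s \<notin> set cs" by (simp add: cs_def set_coords below_first_hidden[symmetric])
        then show "h' s = h s" using h' by (simp add: redraws_def)
      qed
      then show "?dev h' \<le> (\<Sum>x\<in>bits n. \<Sum>y\<in>Y x. (p x h' y - avg keys cs (\<lambda>h. p x h y) h)\<^sup>2)"
        by (simp add: avg_p[symmetric])
    qed
    also have "\<dots> = (\<Sum>x\<in>bits n. \<Sum>y\<in>Y x. avg keys cs (\<lambda>h'. (p x h' y - avg keys cs (\<lambda>h. p x h y) h)\<^sup>2) h)"
      by (simp only: keys.avg_sum)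
    also have "\<dots> \<le> (\<Sum>x\<in>bits n. 72000 * S ^ 4 / real ?\<theta>)"
    proof (rule sum_mono)
      fix x assume x: "x \<in> bits n"
      show "(\<Sum>y\<in>Y x. avg keys cs (\<lambda>h'. (p x h' y - avg keys cs (\<lambda>h. p x h y) h)\<^sup>2) h) \<le> 72000 * S ^ 4 / real ?\<theta>"
        unfolding p_run cs_def
      proof (rule output_concentration[OF _ nrm_initial finY _ _ W[OF x]])
        show "valid_gate (width (C x)) a" if "a \<in> set (gates (C x))" for a
          using that unfolding C_def by (rule valid_circuit_gates[OF valid_alg])
        show "1 \<le> S" by (simp add: S_def)
        show "real (length (gates (C x))) \<le> S"
          using gates_le_size[of "C x"] size_le_max_size[OF x, of g l] by (simp add: S_def C_def)
      qed
    qed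
    also have "\<dots> = 2 ^ n * (72000 * S ^ 4 / real ?\<theta>)" by (simp add: card_bits)
    finally show "avg keys cs ?dev h \<le> avg keys cs (\<lambda>_. 2 ^ n * (72000 * S ^ 4 / real ?\<theta>)) h" by simp
  qed
  also have "\<dots> = 2 ^ n * (72000 * S ^ 4 / real ?\<theta>)" by simp
  finally have "avg keys (coords 0 L) (\<lambda>h. of_bool (deviating g l n h)) f \<le> 96 / 2 ^ n * (2 ^ n * (72000 * S ^ 4 / real ?\<theta>))"
    by (simp add: mult_left_mono divide_right_mono)
  also have "96 / 2 ^ n * (2 ^ n * (72000 * S ^ 4 / real ?\<theta>)) = 6912000 * (S ^ 4 / real ?\<theta>)" by simp
  also have "\<dots> = 6912000 / (30000000 * b)" using S_def by (simp add: \<theta>)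
  also have "\<dots> \<le> 1 / (4 * b)" by (simp add: b_def divide_simps)
  finally show ?thesis by (simp add: b_def)
qed

subsection \<open>Both properties at once\<close>

text \<open>
  Event number \<open>j\<close> concerns puzzles of length \<open>j\<close> and the algorithm and lengths with code \<open>j\<close>.
\<close>

definition bad :: "nat \<Rightarrow> (bool list \<Rightarrow> bool list) \<Rightarrow> bool" where
  "bad j f \<longleftrightarrow> broken j f \<or> (case prod_decode j of (g, i) \<Rightarrow> case prod_decode i of (l, n) \<Rightarrow> deviating g l n f)"

lemma bad_local:
  "\<exists>S. finite S \<and> (\<forall>h h'. (\<forall>s\<in>S. h s = h' s) \<longrightarrow> bad j h \<longrightarrow> bad j h')"
proof -
  obtain g i where gi: "prod_decode j = (g, i)" by (cases "prod_decode j")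
  obtain l n where ln: "prod_decode i = (l, n)" by (cases "prod_decode i")
  define N where "N = Suc j + strength j + threshold g l n"
  show ?thesis
  proof (intro exI[of _ "set (coords 0 N)"] conjI allI impI)
    show "finite (set (coords 0 N))" by simp
    fix h h' assume "\<forall>s\<in>set (coords 0 N). h s = h' s" and bad: "bad j h"
    then have agree: "h s = h' s" if "length s < N" for s using that by (simp add: set_coords)
    have "puzzle_success j a c h = puzzle_success j a c h'" if "admissible j a c" for a c
      unfolding puzzle_success_def
    proof (intro arg_cong2[where f = "(/)"] sum.cong refl)
      fix s assume s: "s \<in> bits j"
      have "h s = h' s" using s by (intro agree) (simp add: bits_def N_def)
      moreover have "width (alg a (enc_strs [s, c])) \<le> N"
        using that s width_le_size[of "alg a (enc_strs [s, c])"] by (force simp: admissible_def N_def)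
      ultimately show "pmf (out (reflection_oracle (answers h)) (alg a) [s, c]) (h s) =
          pmf (out (reflection_oracle (answers h')) (alg a) [s, c]) (h' s)"
        using out_local[OF _ agree, of a "[s, c]"] by simp
    qed
    then have "broken j h \<Longrightarrow> broken j h'" unfolding broken_def by metis
    moreover have "inconsistent g l n h = inconsistent g l n h'"
    proof -
      have "avg_output g l n h x y = avg_output g l n h' x y" for x y
      proof (rule avg_output_local)
        fix s :: "bool list" assume "2 ^ length s \<le> threshold g l n"
        then have "length s < threshold g l n" using less_exp[of "length s"] by linarith
        then show "h s = h' s" by (intro agree) (simp add: N_def)
      qed
      moreover have "pmf (out (reflection_oracle (answers h)) (alg g) [unary l, x]) y =
          pmf (out (reflection_oracle (answers h')) (alg g) [unary l, x]) y" if "x \<in> bits n" for x y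
      proof (rule out_local[OF _ agree])
        show "width (alg g (enc_strs [unary l, x])) \<le> N"
          using width_le_size[of "alg g (enc_strs [unary l, x])"] size_le_max_size[OF that, of g l]
            max_size_less_threshold[of g l n] by (simp add: N_def)
      qed
      ultimately show ?thesis unfolding inconsistent_def by auto
    qed
    ultimately show "bad j h'" using bad by (auto simp: bad_def gi ln deviating_def)
  qed
qed

lemma bad_rare:
  assumes ss: "bits j \<subseteq> set (coords 0 L)" and L: "\<And>g l n. code g l n = j \<Longrightarrow> threshold g l n \<le> L"
  shows "avg keys (coords 0 L) (\<lambda>h. of_bool (bad j h)) f \<le> 1 / (2 * ((real j + 1) * (real j + 2)))"
proof -
  obtain g i where gi: "prod_decode j = (g, i)" by (cases "prod_decode j")
  obtain l n where ln: "prod_decode i = (l, n)" by (cases "prod_decode i")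
  have j: "code g l n = j" using gi ln by (simp add: code_def) (metis prod_decode_inverse)
  have "avg keys (coords 0 L) (\<lambda>h. of_bool (bad j h)) f \<le>
     avg keys (coords 0 L) (\<lambda>h. of_bool (broken j h) + of_bool (deviating g l n h)) f"
    by (rule keys.avg_mono) (simp add: bad_def gi ln)
  also have "\<dots> = avg keys (coords 0 L) (\<lambda>h. of_bool (broken j h)) f + avg keys (coords 0 L) (\<lambda>h. of_bool (deviating g l n h)) f"
    by (rule keys.avg_add)
  also have "\<dots> \<le> 1 / (4 * ((real j + 1) * (real j + 2))) + 1 / (4 * ((real j + 1) * (real j + 2)))"
    using broken_rare[OF distinct_coords ss, of f] deviating_rare[OF L[OF j], of f] unfolding j by (rule add_mono)
  also have "\<dots> = 1 / (2 * ((real j + 1) * (real j + 2)))"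
  proof -
    have "1 / (4 * b) + 1 / (4 * b) = 1 / (2 * b)" for b :: real by simp
    then show ?thesis .
  qed
  finally show ?thesis .
qed

lemma sum_bad_bound: "(\<Sum>j<J. 1 / (2 * ((real j + 1) * (real j + 2)))) = 1 / 2 - 1 / (2 * (real J + 1))"
proof -
  have "1 / (2 * ((real j + 1) * (real j + 2))) = 1 / (2 * (real j + 1)) - 1 / (2 * (real (Suc j) + 1))" for j
  proof -
    have "1 / (2 * (a * (a + 1))) = 1 / (2 * a) - 1 / (2 * (a + 1))" if "0 < a" for a :: real
      using that by (simp add: field_simps)
    from this[of "real j + 1"] show ?thesis by (simp add: add.assoc)
  qed
  then have "(\<Sum>j<J. 1 / (2 * ((real j + 1) * (real j + 2)))) = (\<Sum>j<J. 1 / (2 * (real j + 1)) - 1 / (2 * (real (Suc j) + 1)))"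
    by (simp only:)
  also have "\<dots> = 1 / (2 * (real 0 + 1)) - 1 / (2 * (real J + 1))" by (rule sum_lessThan_telescope')
  finally show ?thesis by simp
qed

lemma exists_good_keys: "\<exists>f. (\<forall>s. f s \<in> keys s) \<and> (\<forall>j. \<not> bad j f)"
proof (rule avoid_all_events[OF keys.finite_D bad_local])
  fix J
  define thr where "thr = (\<lambda>j. case prod_decode j of (g, i) \<Rightarrow> case prod_decode i of (l, n) \<Rightarrow> threshold g l n)"
  have thr: "threshold g l n = thr (code g l n)" for g l n by (simp add: thr_def code_def)
  define L where "L = J + (\<Sum>j<J. thr j)"
  define f0 :: "bool list \<Rightarrow> bool list" where "f0 = (\<lambda>s. zeros (2 * length s))"
  have "avg keys (coords 0 L) (\<lambda>h. \<Sum>j<J. of_bool (bad j h)) f0 = (\<Sum>j<J. avg keys (coords 0 L) (\<lambda>h. of_bool (bad j h)) f0)"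
    by (rule keys.avg_sum)
  also have "\<dots> \<le> (\<Sum>j<J. 1 / (2 * ((real j + 1) * (real j + 2))))"
  proof (intro sum_mono bad_rare)
    fix j assume j: "j \<in> {..<J}"
    show "bits j \<subseteq> set (coords 0 L)" using j by (auto simp: set_coords bits_def L_def)
    have "thr j \<le> (\<Sum>j<J. thr j)" using j by (intro member_le_sum) simp_all
    then show "threshold g l n \<le> L" if "code g l n = j" for g l n using that by (simp add: thr L_def)
  qed
  also have "\<dots> < 1" unfolding sum_bad_bound 
  proof -
    have "0 \<le> 1 / (2 * (real J + 1))" by simp
    then show "1 / 2 - 1 / (2 * (real J + 1)) < 1" by linarith
  qed
  finally obtain h where h: "h \<in> redraws keys (coords 0 L) f0" "(\<Sum>j<J. of_bool (bad j h)) < (1 :: real)"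
    using keys.avg_exists_less by blast
  have "\<not> bad j h" if j: "j < J" for j
  proof
    assume "bad j h"
    then have "(1 :: real) = of_bool (bad j h)" by simp
    also have "\<dots> \<le> (\<Sum>j<J. of_bool (bad j h))"
      using j by (intro member_le_sum[of j "{..<J}" "\<lambda>j. of_bool (bad j h)"]) simp_all
    finally show False using h(2) by simp
  qed
  moreover have "h s \<in> keys s" for s
    using h(1) by (cases "s \<in> set (coords 0 L)") (auto simp: redraws_def f0_def keys_def zeros_in_bits)
  ultimately show "\<exists>h. (\<forall>s. h s \<in> keys s) \<and> (\<forall>j<J. \<not> bad j h)" by blast
qed

section \<open>The puzzle relative to the oracle\<close>

lemma out_loader:
  "out (reflection_oracle A) loader us =
    map_pmf (\<lambda>a. fst (read_str (a @ enc_strs us))) (pmf_of_set (measured_answers A (enc_strs us)))"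
  by (simp add: out_def measure_loader pmf.map_comp comp_def)

lemma measured_answersD:
  "a \<in> measured_answers A w \<Longrightarrow> a \<in> A w \<or> a = zeros (3 * length w)"
  by (auto simp: measured_answers_def nonzero_part_def Let_def split: if_splits)

lemma measured_answers_nonzero:
  "A w \<subseteq> bits (3 * length w) - {zeros (3 * length w)} \<Longrightarrow> A w \<noteq> {} \<Longrightarrow> measured_answers A w = A w"
  by (auto simp: measured_answers_def nonzero_part_def Let_def)

lemma enc_strs_nonempty: "us \<noteq> [] \<Longrightarrow> enc_strs us \<noteq> []"
  by (cases us; cases "hd us") (auto simp: enc_strs_def)

lemma read_zeros: "0 < n \<Longrightarrow> fst (read_str (zeros n @ w)) = []"
  by (cases n) (simp_all add: zeros_def)

lemma read_pad_enc_str: "fst (read_str (pad n (enc_str x) @ w)) = x"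
  by (simp add: pad_def read_str_enc_str)

lemma sampler_out:
  assumes l: "0 < l" and key: "\<And>s. f s \<in> keys s"
  shows "out_pair (reflection_oracle (answers f)) loader [unary l] = map_pmf (\<lambda>s. (s, f s)) (pmf_of_set (bits l))"
proof -
  let ?w = "enc_strs [unary l]"
  have len: "length ?w = 2 * l + 1" by (simp add: length_enc_strs1 unary_def)
  have k: "length (f s) \<le> 2 * l" if "s \<in> bits l" for s
    using key[of s] that by (simp add: keys_def bits_def)
  let ?S = "(\<lambda>s. sample_point s (f s)) ` bits l"
  have np: "nonzero_part (3 * length ?w) (answers f ?w) = ?S"
    unfolding len by (rule nonzero_sample[OF l k])
  have ne: "bits l \<noteq> {}" using zeros_in_bits by blast
  then have ms: "measured_answers (answers f) ?w = ?S"
    unfolding measured_answers_def np by simp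
  have inj: "inj_on (\<lambda>s. sample_point s (f s)) (bits l)" by (rule inj_onI) (simp add: sample_point_inj)
  have "out_pair (reflection_oracle (answers f)) loader [unary l] =
      map_pmf (\<lambda>a. read_pair (a @ ?w)) (pmf_of_set ?S)"
    by (simp add: out_pair_def measure_loader pmf.map_comp comp_def ms)
  also have "pmf_of_set ?S = map_pmf (\<lambda>s. sample_point s (f s)) (pmf_of_set (bits l))"
    by (rule map_pmf_of_set_inj[symmetric, OF inj ne finite_bits])
  finally show ?thesis by (simp add: pmf.map_comp comp_def read_pair_sample_point)
qed

lemma verifier_complete:
  assumes k: "f s \<in> keys s" shows "out (reflection_oracle (answers f)) loader [s, f s] = return_pmf [True]"
proof -
  let ?w = "enc_strs [s, f s]"
  have lk: "length (f s) = 2 * length s" using k by (simp add: keys_def bits_def)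
  have len: "length ?w = 6 * length s + 2" by (simp add: length_enc_strs2 lk)
  let ?a = "pad (3 * length ?w) [True, True]"
  have A: "answers f ?w = {?a}" using answers_verify[OF lk, of f] len by simp
  have "?a \<in> bits (3 * length ?w)" by (rule pad_length) (simp add: len)
  moreover have "?a \<noteq> zeros (3 * length ?w)" by (cases "3 * length ?w") (simp_all add: pad_def zeros_def)
  ultimately have "measured_answers (answers f) ?w = {?a}"
    using measured_answers_nonzero[of "answers f" ?w] A by simp
  moreover have "fst (read_str (?a @ ?w)) = [True]"
  proof -
    have "?a = True # True # zeros (4 + 18 * length s)" by (simp add: pad_def len)
    moreover have "fst (read_str (True # b # u)) = b # fst (read_str u)" for b u by (simp split: prod.split)
    ultimately show ?thesis by (simp add: read_zeros)
  qed
  ultimately show ?thesis by (simp add: out_loader pmf_of_set_singleton)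
qed

text \<open>
  The key may be an arbitrary string here, even a request; then the answers are preimages, which are never \<open>[True]\<close>.
\<close>

lemma verifier_sound:
  assumes "k \<noteq> f s" shows "pmf (out (reflection_oracle (answers f)) loader [s, k]) [True] = 0"
proof -
  let ?w = "enc_strs [s, k]"
  have w: "?w \<noteq> []" by (rule enc_strs_nonempty) simp
  have no: "fst (read_str (a @ ?w)) \<noteq> [True]" if "a \<in> measured_answers (answers f) ?w" for a
  proof (cases "a = zeros (3 * length ?w)")
    case True
    then show ?thesis using w read_zeros[of "3 * length ?w" ?w] by simp
  next
    case False
    then have a: "a \<in> answers f ?w" using measured_answersD[OF that] by blast
    show ?thesis
    proof (cases ?w rule: answers_cases)
      case (sample l)
      then show ?thesis by (simp add: enc_strs_eq_iff)
    next
      case (verify s' k')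
      then have "answers f ?w = {}" using assms answers_verify[of k s f] by (simp add: enc_strs_eq_iff)
      then show ?thesis using a by simp
    next
      case (invert y g l n)
      then obtain x where "x \<noteq> [True]" "a = pad (3 * length ?w) (enc_str x)"
        using a answers_invert[OF invert(2), of f] by auto
      then show ?thesis by (simp add: read_pad_enc_str)
    next
      case other
      then show ?thesis using a by simp
    qed
  qed
  have "[True] \<notin> (\<lambda>a. fst (read_str (a @ ?w))) ` set_pmf (pmf_of_set (measured_answers (answers f) ?w))"
  proof
    assume "[True] \<in> (\<lambda>a. fst (read_str (a @ ?w))) ` set_pmf (pmf_of_set (measured_answers (answers f) ?w))"
    then obtain a where a: "[True] = fst (read_str (a @ ?w))" "a \<in> set_pmf (pmf_of_set (measured_answers (answers f) ?w))"
      by (rule imageE)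
    have "a \<in> measured_answers (answers f) ?w"
      using a(2) unfolding set_pmf_of_set[OF measured_answers_finite(2,1)] .
    from no[OF this] a(1)[symmetric] show False by (rule notE)
  qed
  then show ?thesis unfolding out_loader by (rule pmf_map_outside)
qed

subsection \<open>Polynomial bounds\<close>

text \<open>Bounded by a polynomial with natural coefficients.\<close>

definition poly_bounded :: "(nat \<Rightarrow> nat) \<Rightarrow> bool" where
  "poly_bounded h \<longleftrightarrow> (\<exists>p :: nat poly. \<forall>l. h l \<le> poly p l)"

lemma poly_mono_nat: "a \<le> b \<Longrightarrow> poly p a \<le> poly p (b :: nat)"
  by (induction p) (auto intro: add_mono mult_mono)

lemma poly_bounded_le: "poly_bounded h \<Longrightarrow> (\<And>l. h' l \<le> h l) \<Longrightarrow> poly_bounded h'"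
  unfolding poly_bounded_def by (meson order_trans)

lemma poly_bounded_const: "poly_bounded (\<lambda>_. c)"
  unfolding poly_bounded_def by (rule exI[of _ "[:c:]"]) simp

lemma poly_bounded_id: "poly_bounded (\<lambda>l. l)"
  unfolding poly_bounded_def by (rule exI[of _ "[:0, 1:]"]) simp

lemma poly_bounded_add: "poly_bounded h \<Longrightarrow> poly_bounded h' \<Longrightarrow> poly_bounded (\<lambda>l. h l + h' l)"
proof -
  assume "poly_bounded h" "poly_bounded h'"
  then obtain p q where "\<And>l. h l \<le> poly p l" "\<And>l. h' l \<le> poly q l" unfolding poly_bounded_def by blast
  then show ?thesis unfolding poly_bounded_def by (intro exI[of _ "p + q"]) (simp add: add_mono)
qed

lemma poly_bounded_mult: "poly_bounded h \<Longrightarrow> poly_bounded h' \<Longrightarrow> poly_bounded (\<lambda>l. h l * h' l)"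
proof -
  assume "poly_bounded h" "poly_bounded h'"
  then obtain p q where "\<And>l. h l \<le> poly p l" "\<And>l. h' l \<le> poly q l" unfolding poly_bounded_def by blast
  then show ?thesis unfolding poly_bounded_def by (intro exI[of _ "p * q"]) (simp add: mult_mono)
qed

lemma poly_bounded_poly: "poly_bounded h \<Longrightarrow> poly_bounded (\<lambda>l. poly q (h l))"
proof -
  assume "poly_bounded h"
  then obtain p where "\<And>l. h l \<le> poly p l" unfolding poly_bounded_def by blast
  then show ?thesis unfolding poly_bounded_def by (intro exI[of _ "pcompose q p"]) (simp add: poly_pcompose poly_mono_nat)
qed

lemma poly_bounded_power: "poly_bounded h \<Longrightarrow> poly_bounded (\<lambda>l. h l ^ k)"
proof (induction k)
  case 0
  show ?case unfolding power_0 by (rule poly_bounded_const)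
qed (simp add: poly_bounded_mult)

lemma polynomial_bounded: "polynomial n \<Longrightarrow> poly_bounded n"
proof -
  assume "polynomial n"
  then obtain p where p: "\<And>l. real (n l) = poly p (real l)" unfolding polynomial_def by blast
  have "\<exists>q :: nat poly. \<forall>l. poly p (real l) \<le> real (poly q l)"
  proof (induction p)
    case 0
    then show ?case by (intro exI[of _ 0]) simp
  next
    case (pCons a p)
    then obtain q :: "nat poly" where q: "\<And>l. poly p (real l) \<le> real (poly q l)" by blast
    have "poly (pCons a p) (real l) \<le> real (poly (pCons (nat \<lceil>a\<rceil>) q) l)" for l
      using mult_left_mono[OF q[of l], of "real l"] real_nat_ceiling_ge[of a] by simp
    then show ?case by blast
  qed
  then obtain q :: "nat poly" where "\<forall>l. poly p (real l) \<le> real (poly q l)" by (rule exE)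
  then have "n l \<le> poly q l" for l using p[of l] by (metis of_nat_le_iff)
  then show ?thesis unfolding poly_bounded_def by blast
qed

lemma poly_bounded_monomial:
  assumes "poly_bounded h" obtains k where "eventually (\<lambda>l. h l \<le> l ^ k) sequentially"
proof -
  obtain p :: "nat poly" where p: "\<And>l. h l \<le> poly p l" using assms unfolding poly_bounded_def by blast
  have "\<exists>k. eventually (\<lambda>l. poly p l \<le> l ^ k) sequentially"
  proof (induction p)
    case 0
    show ?case by simp
  next
    case (pCons a p)
    then obtain k where "eventually (\<lambda>l. poly p l \<le> l ^ k) sequentially" by blast
    then have "eventually (\<lambda>l. poly (pCons a p) l \<le> l ^ (k + 2)) sequentially"
      using eventually_ge_at_top[of "a + 2"]
    proof eventually_elim
      case (elim l)
      have "poly (pCons a p) l \<le> a + l * l ^ k" using elim(1) by simp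
      also have "\<dots> \<le> l * l ^ k + l * l ^ k"
      proof (rule add_right_mono)
        have "a * 1 \<le> l * l ^ k" using elim(2) by (intro mult_mono) simp_all
        then show "a \<le> l * l ^ k" by simp
      qed
      also have "\<dots> = 2 * (l * l ^ k)" by simp
      also have "\<dots> \<le> l * (l * l ^ k)" using elim(2) by (intro mult_right_mono) simp_all
      finally show ?case by simp
    qed
    then show ?case by blast
  qed
  then obtain k where "eventually (\<lambda>l. poly p l \<le> l ^ k) sequentially" by (rule exE)
  then have "eventually (\<lambda>l. h l \<le> l ^ k) sequentially"
    by (rule eventually_mono) (rule order_trans[OF p])
  then show ?thesis by (rule that)
qed

lemma strength_superpolynomial: "eventually (\<lambda>l. l ^ k \<le> strength l) sequentially"
proof -
  have "((\<lambda>j::nat. (real j * 16 + 16) ^ k / 2 ^ j) \<longlongrightarrow> 0) sequentially" by real_asymp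
  then have "eventually (\<lambda>j::nat. (real j * 16 + 16) ^ k / 2 ^ j < 1) sequentially"
    by (rule order_tendstoD) simp
  then obtain J where J: "\<And>j. J \<le> j \<Longrightarrow> (real j * 16 + 16) ^ k / 2 ^ j < 1"
    unfolding eventually_sequentially by blast
  have "l ^ k \<le> strength l" if "16 * J \<le> l" for l
  proof -
    let ?j = "l div 16"
    have "real l ^ k \<le> (real ?j * 16 + 16) ^ k" by (rule power_mono) simp_all
    also have "\<dots> < 2 ^ ?j" using J[of ?j] that by (simp add: pos_divide_less_eq)
    finally have "real (l ^ k) \<le> real (strength l)" by (simp add: strength_def)
    then show ?thesis by (simp only: of_nat_le_iff)
  qed
  then show ?thesis unfolding eventually_sequentially by blast
qed

lemma poly_bounded_strength: "poly_bounded h \<Longrightarrow> eventually (\<lambda>l. h l \<le> strength l) sequentially"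
proof (erule poly_bounded_monomial)
  fix k assume "eventually (\<lambda>l. h l \<le> l ^ k) sequentially"
  then show ?thesis using strength_superpolynomial[of k] by eventually_elim (rule order_trans)
qed

lemma negligible_inverse_strength: 
  assumes "eventually (\<lambda>l. \<bar>\<epsilon> l\<bar> \<le> 2 / real (strength l)) sequentially"
  shows "negligible \<epsilon>"
  unfolding negligible_def
proof
  fix c :: nat
  show "eventually (\<lambda>l. \<bar>\<epsilon> l\<bar> \<le> 1 / real l ^ c) sequentially"
    using assms strength_superpolynomial[of "Suc c"] eventually_ge_at_top[of 2]
  proof eventually_elim
    case (elim l)
    have "2 * real l ^ c \<le> real l * real l ^ c" using elim(3) by (intro mult_right_mono) simp_all
    also have "\<dots> = real (l ^ Suc c)" by simp
    also have "\<dots> \<le> real (strength l)" using elim(2) by (simp only: of_nat_le_iff)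
    finally have "2 / real (strength l) \<le> 1 / real l ^ c"
      using elim(3) by (simp add: divide_simps strength_def)
    then show ?case using elim(1) by linarith
  qed
qed

text \<open>The loader is both sampler and verifier.\<close>

lemma loader_puzzle:
  assumes key: "\<And>s. f s \<in> keys s" and safe: "\<And>m. \<not> broken m f" and acc: "(False, Forward) \<in> acc"
  shows "EV_OWPuzz (reflection_oracle (answers f)) acc loader loader"
proof -
  let ?U = "reflection_oracle (answers f)"
  have ne: "bits l \<noteq> {}" for l using zeros_in_bits by blast
  have sample: "do { (s, k) \<leftarrow> out_pair ?U loader [unary l]; F s k } = pmf_of_set (bits l) \<bind> (\<lambda>s. F s (f s))"
    if "0 < l" for l and F :: "bool list \<Rightarrow> bool list \<Rightarrow> bool list pmf"
    unfolding sampler_out[OF that key] bind_map_pmf by simp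
  have "\<exists>\<epsilon>. negligible \<epsilon> \<and> (\<forall>l. pmf (do { (s, k) \<leftarrow> out_pair ?U loader [unary l]; out ?U loader [s, k] }) [True] \<ge> 1 - \<epsilon> l)"
  proof (intro exI conjI allI)
    show "negligible (\<lambda>l. of_bool (l = 0))"
      by (rule negligible_inverse_strength) (rule eventually_mono[OF eventually_gt_at_top[of 0]], simp)
    fix l
    show "pmf (do { (s, k) \<leftarrow> out_pair ?U loader [unary l]; out ?U loader [s, k] }) [True] \<ge> 1 - of_bool (l = 0)"
    proof (cases "l = 0")
      case False
      then show ?thesis by (simp add: sample verifier_complete key)
    qed simp
  qed
  moreover have "\<exists>\<epsilon>. negligible \<epsilon> \<and> (\<forall>l.
        pmf (do { (s, _) \<leftarrow> out_pair ?U loader [unary l];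
                  k \<leftarrow> out ?U A [s, c l];
                  out ?U loader [s, k] }) [True] \<le> \<epsilon> l)" if A: "QPT acc A" and c: "advice c" for A c
  proof -
    let ?win = "\<lambda>l. pmf (do { (s, _) \<leftarrow> out_pair ?U loader [unary l];
                  k \<leftarrow> out ?U A [s, c l];
                  out ?U loader [s, k] }) [True]"
    obtain g where g: "alg g = A" using alg_surj[OF A] .
    obtain q :: "nat poly" where q: "\<And>w. size_of (A w) \<le> poly q (length w)" using QPT_size[OF A] by blast
    have pc: "poly_bounded (\<lambda>l. length (c l))" using c unfolding advice_def poly_bounded_def .
    have win: "?win l \<le> puzzle_success l g (c l) f" if l: "0 < l" for l
    proof -
      have "pmf (out ?U A [s, c l] \<bind> (\<lambda>k. out ?U loader [s, k])) [True] \<le> pmf (out ?U A [s, c l]) (f s)" for s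
      proof -
        have "pmf (out ?U A [s, c l] \<bind> (\<lambda>k. out ?U loader [s, k])) [True] =
            measure_pmf.expectation (out ?U A [s, c l]) (\<lambda>k. pmf (out ?U loader [s, k]) [True])" by (rule pmf_bind)
        also have "\<dots> \<le> measure_pmf.expectation (out ?U A [s, c l]) (indicator {f s})"
        proof (rule integral_mono)
          show "pmf (out ?U loader [s, k]) [True] \<le> indicator {f s} k" for k
            using verifier_sound[of k f s] by (cases "k = f s") (simp_all add: pmf_le_1)
        qed (auto intro!: measure_pmf.integrable_const_bound[where B = 1] simp: pmf_le_1)
        also have "\<dots> = pmf (out ?U A [s, c l]) (f s)" by (simp add: measure_pmf_single)
        finally show ?thesis .
      qed
      then have "(\<Sum>s\<in>bits l. pmf (out ?U A [s, c l] \<bind> (\<lambda>k. out ?U loader [s, k])) [True]) \<le>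
          (\<Sum>s\<in>bits l. pmf (out ?U A [s, c l]) (f s))" by (rule sum_mono)
      then show ?thesis
        unfolding sample[OF l] puzzle_success_def g
        by (subst pmf_bind_pmf_of_set[OF ne finite_bits]) (simp add: card_bits divide_right_mono)
    qed
    have "eventually (\<lambda>l. length (c l) \<le> strength l) sequentially" by (rule poly_bounded_strength[OF pc])
    moreover have "eventually (\<lambda>l. poly q (2 * l + 2 * length (c l) + 2) \<le> strength l) sequentially"
      by (intro poly_bounded_strength poly_bounded_poly poly_bounded_add poly_bounded_mult poly_bounded_const poly_bounded_id pc)
    ultimately have "eventually (\<lambda>l. \<bar>?win l\<bar> \<le> 2 / real (strength l)) sequentially"
      using eventually_ge_at_top[of "max 160 g"]
    proof eventually_elim
      case (elim l)
      have "size_of (A (enc_strs [s, c l])) \<le> strength l" if "s \<in> bits l" for s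
        using q[of "enc_strs [s, c l]"] elim(2) that by (simp add: length_enc_strs2 bits_def)
      then have "admissible l g (c l)" using elim by (simp add: admissible_def g)
      then have "puzzle_success l g (c l) f \<le> 2 / real (strength l)"
        using safe[of l] elim(3) by (auto simp: broken_def not_less)
      then show ?case using win[of l] elim(3) by simp
    qed
    then have "negligible ?win" by (rule negligible_inverse_strength)
    then show ?thesis by blast
  qed
  ultimately show ?thesis using QPT_loader[OF acc] unfolding EV_OWPuzz_def by blast
qed

section \<open>Inverting every pseudodeterministic function\<close>

text \<open>The answers to an inversion request for \<open>y\<close>.\<close>

definition preimages :: "nat \<Rightarrow> nat \<Rightarrow> nat \<Rightarrow> (bool list \<Rightarrow> bool list) \<Rightarrow> bool list \<Rightarrow> bool list set" where
  "preimages g l n f y = {x \<in> bits n. x \<noteq> [True] \<and> 1 / 2 < avg_output g l n f x y}"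

lemma finite_preimages: "finite (preimages g l n f y)"
  by (simp add: preimages_def finite_bits)

text \<open>
  For \<open>n = 0\<close> the only preimage is encoded by 0, which is measured because there are no proper answers.
\<close>

lemma inverter_out:
  assumes len: "length (request g l n) \<noteq> 2 * length y" and ne: "preimages g l n f y \<noteq> {}"
  shows "out (reflection_oracle (answers f)) loader [y, request g l n] = pmf_of_set (preimages g l n f y)"
proof -
  let ?w = "enc_strs [y, request g l n]" and ?F = "preimages g l n f y"
  let ?a = "\<lambda>x. pad (3 * length ?w) (enc_str x)"
  have w: "?w \<noteq> []" by (rule enc_strs_nonempty) simp
  have A: "answers f ?w = ?a ` ?F" unfolding preimages_def by (rule answers_invert[OF len])
  show ?thesis
  proof (cases "n = 0")
    case True
    then have F: "?F = {[]}" using ne by (auto simp: preimages_def bits_def)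
    have "?a [] = zeros (3 * length ?w)" using w
      by (simp add: pad_def zeros_def replicate_Suc[symmetric] Suc_diff_1 del: replicate_Suc)
    then have "answers f ?w = {zeros (3 * length ?w)}" by (simp add: A F)
    then have "measured_answers (answers f) ?w = {zeros (3 * length ?w)}"
      by (simp add: measured_answers_def nonzero_part_def)
    then show ?thesis using w read_zeros[of "3 * length ?w" ?w] by (simp add: out_loader pmf_of_set_singleton F)
  next
    case False
    have inj: "inj_on ?a ?F" by (rule inj_onI) (metis read_pad_enc_str)
    have "?a x \<in> bits (3 * length ?w) \<and> ?a x \<noteq> zeros (3 * length ?w)" if "x \<in> ?F" for x
    proof
      have lx: "length x = n" using that by (simp add: preimages_def bits_def)
      then show "?a x \<in> bits (3 * length ?w)"
        by (intro pad_length) (simp add: length_enc_str length_enc_strs2 length_request)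
      obtain b x' where "x = b # x'" using lx False by (cases x) auto
      then show "?a x \<noteq> zeros (3 * length ?w)" by (cases "3 * length ?w") (simp_all add: pad_def zeros_def)
    qed
    then have "measured_answers (answers f) ?w = ?a ` ?F"
      unfolding A[symmetric] by (intro measured_answers_nonzero) (use ne A in auto)
    then have "out (reflection_oracle (answers f)) loader [y, request g l n] =
        map_pmf (\<lambda>a. fst (read_str (a @ ?w))) (pmf_of_set (?a ` ?F))" by (simp add: out_loader)
    also have "pmf_of_set (?a ` ?F) = map_pmf ?a (pmf_of_set ?F)"
      by (rule map_pmf_of_set_inj[symmetric, OF inj ne finite_preimages])
    finally show ?thesis by (simp add: pmf.map_comp comp_def read_pad_enc_str)
  qed
qed

lemma avg_output_unique:
  assumes "1 / 2 < avg_output g l n f x y" "1 / 2 < avg_output g l n f x y'"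
  shows "y = y'"
proof (rule ccontr)
  assume "y \<noteq> y'"
  then have "pmf p y + pmf p y' \<le> 1" for p :: "bool list pmf"
    using measure_pmf.prob_le_1[of p "{y, y'}"] by (simp add: measure_measure_pmf_finite)
  then have "avg_output g l n f x y + avg_output g l n f x y' \<le> 1"
    unfolding avg_output_def keys.avg_add[symmetric] by (intro keys.avg_le_const)
  then show False using assms by linarith
qed

text \<open>
  Let \<open>K\<close> be the set of consistent inputs in \<open>\<G>\<close> other than \<open>[True]\<close>; it contains at least half of all
  inputs.  The sets \<open>F y\<close> of answers for different \<open>y\<close> are disjoint, and \<open>F y\<close> contains all \<open>x\<close> in \<open>K\<close>
  with \<open>H x = y\<close>.  With \<open>a\<close> the number of these, the loader inverts \<open>y\<close> with probability at
  least \<open>a / card (F y)\<close>, and summing \<open>a * a / card (F y) \<ge> a - card (F y) / 4\<close> over all \<open>y\<close> gives the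
  bound.
\<close>

lemma inversion_probability:
  assumes notdev: "\<not> deviating g l n f" and G: "\<G> \<subseteq> bits n" "2 / 3 * 2 ^ n \<le> real (card \<G>)"
    and gen: "\<And>x. x \<in> \<G> \<Longrightarrow> 3 / 4 \<le> pmf (out (reflection_oracle (answers f)) (alg g) [unary l, x]) (H x)"
    and len: "\<And>x. x \<in> bits n \<Longrightarrow> length (request g l n) \<noteq> 2 * length (H x)"
  shows "1 / 4 \<le> measure_pmf.prob
     (do { x \<leftarrow> pmf_of_set (bits n); let y = H x;
           x' \<leftarrow> out (reflection_oracle (answers f)) loader [y, request g l n];
           return_pmf (y, x') })
     {(y, x'). x' \<in> bits n \<and> H x' = y}"
    (is "_ \<le> measure_pmf.prob ?M ?X")
proof -
  let ?U = "reflection_oracle (answers f)" and ?F = "preimages g l n f"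
  define K where "K = \<G> - inconsistent g l n f - {[True]}"
  have K: "K \<subseteq> bits n" "finite K" using G(1) finite_subset[OF _ finite_bits] by (auto simp: K_def)
  have KF: "x \<in> ?F (H x)" if "x \<in> K" for x
  proof -
    have x: "x \<in> \<G>" "x \<notin> inconsistent g l n f" "x \<noteq> [True]" "x \<in> bits n" using that G(1) by (auto simp: K_def)
    then have "\<not> avg_output g l n f x (H x) \<le> 1 / 2" using gen[OF x(1)] unfolding inconsistent_def by blast
    then show ?thesis using x by (simp add: preimages_def)
  qed
  have cK: "2 ^ n / 2 \<le> real (card K)"
  proof -
    have fin: "finite \<G>" "finite (inconsistent g l n f)" using G(1) finite_subset[OF _ finite_bits]
      by (auto simp: inconsistent_def finite_bits)
    have c: "real (card (inconsistent g l n f)) \<le> 2 ^ n / 6" using notdev by (simp add: deviating_def)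
    have d: "real (card \<G>) - real (card (inconsistent g l n f)) \<le> real (card (\<G> - inconsistent g l n f))"
      using diff_card_le_card_Diff[OF fin(2), of \<G>] by linarith
    show ?thesis
    (* Removing the input [True] matters only for n = 1; then no input is inconsistent, and G is everything. *)
    proof (cases "n = 1")
      case True
      have "card \<G> - card (inconsistent g l n f) - card {[True]} \<le> card K"
        unfolding K_def using diff_card_le_card_Diff[OF fin(2), of \<G>] diff_card_le_card_Diff[of "{[True]}" "\<G> - inconsistent g l n f"]
        by simp
      moreover have "card (inconsistent g l n f) = 0" using c True by simp
      moreover have "2 \<le> card \<G>" using G(2) True by simp
      ultimately show ?thesis using True by simp
    next
      case False
      then have "[True] \<notin> \<G>" using G(1) by (auto simp: bits_def)
      then have "K = \<G> - inconsistent g l n f" by (auto simp: K_def)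
      then show ?thesis using G(2) c d by simp
    qed
  qed
  define hit where "hit = (\<lambda>x. pmf (map_pmf (\<lambda>z. z \<in> ?X) (out ?U loader [H x, request g l n] \<bind> (\<lambda>x'. return_pmf (H x, x')))) True)"
  have "measure_pmf.prob ?M ?X = pmf (map_pmf (\<lambda>z. z \<in> ?X) ?M) True"
    by (simp add: pmf_map vimage_def)
  also have "\<dots> = (\<Sum>x\<in>bits n. hit x) / 2 ^ n"
    unfolding hit_def map_bind_pmf Let_def
    by (subst pmf_bind_pmf_of_set) (use zeros_in_bits finite_bits in \<open>auto simp: card_bits map_bind_pmf\<close>)
  finally have prob: "measure_pmf.prob ?M ?X = (\<Sum>x\<in>bits n. hit x) / 2 ^ n" .
  let ?a = "\<lambda>y. {x \<in> K. H x = y}"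
  have hit: "real (card (?a (H x))) / real (card (?F (H x))) \<le> hit x" if x: "x \<in> K" for x
  proof -
    have ne: "?F (H x) \<noteq> {}" using KF[OF x] by blast
    have "out ?U loader [H x, request g l n] = pmf_of_set (?F (H x))"
      using x K(1) by (intro inverter_out len ne) auto
    then have "hit x = measure (pmf_of_set (?F (H x))) {x'. x' \<in> bits n \<and> H x' = H x}"
      by (simp add: hit_def map_pmf_def[symmetric] pmf.map_comp comp_def pmf_map vimage_def)
    also have "\<dots> = real (card (?F (H x) \<inter> {x'. x' \<in> bits n \<and> H x' = H x})) / real (card (?F (H x)))"
      by (rule measure_pmf_of_set[OF ne finite_preimages])
    also have "\<dots> \<ge> real (card (?a (H x))) / real (card (?F (H x)))"
    proof (intro divide_right_mono)
      have "?a (H x) \<subseteq> ?F (H x) \<inter> {x'. x' \<in> bits n \<and> H x' = H x}"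
        using KF K(1) by force
      then show "real (card (?a (H x))) \<le> real (card (?F (H x) \<inter> {x'. x' \<in> bits n \<and> H x' = H x}))"
        using finite_preimages by (simp add: card_mono)
    qed simp
    finally show ?thesis .
  qed
  let ?Y = "H ` K"
  have finY: "finite ?Y" using K(2) by simp
  have "2 ^ n / 4 \<le> real (card K) - 2 ^ n / 4" using cK by simp
  also have "\<dots> \<le> (\<Sum>y\<in>?Y. real (card (?a y)) - real (card (?F y)) / 4)"
  proof -
    have "card K = (\<Sum>y\<in>?Y. card (?a y))"
      using card_UN_disjoint[OF finY, of ?a] K(2) by (subst card_UN_disjoint[symmetric]) (auto intro!: arg_cong[where f = card])
    then have a: "real (card K) = (\<Sum>y\<in>?Y. real (card (?a y)))" by simp
    have "(\<Sum>y\<in>?Y. card (?F y)) = card (\<Union>y\<in>?Y. ?F y)"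
    proof (rule card_UN_disjoint[symmetric, OF finY])
      show "\<forall>y\<in>?Y. \<forall>y'\<in>?Y. y \<noteq> y' \<longrightarrow> ?F y \<inter> ?F y' = {}"
        using avg_output_unique by (fastforce simp: preimages_def)
    qed (simp add: finite_preimages)
    also have "\<dots> \<le> card (bits n)" by (rule card_mono[OF finite_bits]) (auto simp: preimages_def)
    finally have "(\<Sum>y\<in>?Y. real (card (?F y))) \<le> 2 ^ n"
      by (simp add: card_bits) (metis of_nat_le_iff of_nat_numeral of_nat_power of_nat_sum)
    then show ?thesis by (simp add: sum_subtractf a sum_divide_distrib[symmetric])
  qed
  also have "\<dots> \<le> (\<Sum>y\<in>?Y. real (card (?a y)) * (real (card (?a y)) / real (card (?F y))))"
  proof (rule sum_mono)
    fix y assume "y \<in> ?Y"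
    then have "?F y \<noteq> {}" using KF by blast
    then have F: "0 < real (card (?F y))" using finite_preimages by (simp add: card_gt_0_iff)
    have "0 \<le> (real (card (?a y)) - real (card (?F y)) / 2)\<^sup>2" by simp
    then have "(real (card (?a y)) - real (card (?F y)) / 4) * real (card (?F y)) \<le> real (card (?a y)) * real (card (?a y))"
      by (simp add: power2_eq_square algebra_simps)
    then show "real (card (?a y)) - real (card (?F y)) / 4 \<le> real (card (?a y)) * (real (card (?a y)) / real (card (?F y)))"
      using F by (simp add: pos_le_divide_eq)
  qed
  also have "\<dots> = (\<Sum>y\<in>?Y. \<Sum>x\<in>?a y. real (card (?a (H x))) / real (card (?F (H x))))"
    by (rule sum.cong) simp_all
  also have "\<dots> = (\<Sum>x\<in>K. real (card (?a (H x))) / real (card (?F (H x))))"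
    using sum.image_gen[OF K(2), of "\<lambda>x. real (card (?a (H x))) / real (card (?F (H x)))" H] by simp
  also have "\<dots> \<le> (\<Sum>x\<in>K. hit x)" by (rule sum_mono) (rule hit)
  also have "\<dots> \<le> (\<Sum>x\<in>bits n. hit x)"
    by (rule sum_mono2[OF finite_bits K(1)]) (simp add: hit_def)
  finally show ?thesis unfolding prob by (simp add: field_simps)
qed

lemma length_read_str: "length (fst (read_str x)) \<le> length x"
  by (induction x rule: read_str.induct) (auto split: prod.splits)

lemma out_length:
  assumes "y \<in> set_pmf (out (reflection_oracle A) (alg g) us)"
  shows "length y \<le> width (alg g (enc_strs us))"
proof -
  let ?C = "alg g (enc_strs us)"
  obtain x where x: "x \<in> set_pmf (measure_all (reflection_oracle A) ?C)" "y = fst (read_str x)"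
    using assms by (auto simp: out_def)
  then have "x \<in> bits (width ?C)"
    using pmf_measure_all[OF unitary_reflection_oracle valid_alg, of A g "enc_strs us" x]
    by (auto simp: set_pmf_iff split: if_splits)
  then show ?thesis using x(2) length_read_str[of x] by (simp add: bits_def)
qed

text \<open>
  The image \<open>y\<close> is too short for the request to be mistaken for a key of \<open>y\<close>.
\<close>

lemma request_long: "2 * max_size g l n < length (request g l n)"
proof -
  have "max_size g l n + 1 \<le> (max_size g l n + 1) ^ 4" by (rule self_le_power) simp_all
  then have "2 * (max_size g l n + 1) \<le> 30000000 * (max_size g l n + 1) ^ 4 * 1" by simp
  also have "\<dots> \<le> threshold g l n" unfolding threshold_def by (intro mult_left_mono) simp_all
  finally show ?thesis by (simp add: length_request)
qed

lemma poly_bounded_request: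
  assumes n: "poly_bounded n" shows "poly_bounded (\<lambda>l. length (request g l (n l)))"
proof -
  obtain q :: "nat poly" where q: "\<And>w. size_of (alg g w) \<le> poly q (length w)" using QPT_size[OF QPT_alg] by blast
  have "poly_bounded (\<lambda>l. poly q (2 * l + 2 * n l + 2))"
    by (intro poly_bounded_poly poly_bounded_add poly_bounded_mult poly_bounded_const poly_bounded_id n)
  moreover have "max_size g l (n l) \<le> poly q (2 * l + 2 * n l + 2)" for l
    unfolding max_size_def
  proof (rule Max.boundedI)
    show "(\<lambda>x. size_of (alg g (enc_strs [unary l, x]))) ` bits (n l) \<noteq> {}" using zeros_in_bits by blast
    fix a assume "a \<in> (\<lambda>x. size_of (alg g (enc_strs [unary l, x]))) ` bits (n l)"
    then obtain x where "length x = n l" "a = size_of (alg g (enc_strs [unary l, x]))" by (auto simp: bits_def)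
    then show "a \<le> poly q (2 * l + 2 * n l + 2)"
      using q[of "enc_strs [unary l, x]"] by (simp add: length_enc_strs2 unary_def)
  qed (simp add: finite_bits)
  ultimately have size: "poly_bounded (\<lambda>l. max_size g l (n l))" by (rule poly_bounded_le)
  have enc: "poly_bounded (\<lambda>l. prod_encode (a l, b l))" if "poly_bounded a" "poly_bounded b" for a b
  proof (rule poly_bounded_le)
    show "poly_bounded (\<lambda>l. (a l + b l) * (a l + b l + 1) + a l)"
      by (intro poly_bounded_add poly_bounded_mult poly_bounded_const that)
    show "prod_encode (a l, b l) \<le> (a l + b l) * (a l + b l + 1) + a l" for l
      by (simp add: prod_encode_def triangle_def)
  qed
  have code: "poly_bounded (\<lambda>l. code g l (n l))"
    unfolding code_def by (intro enc poly_bounded_const poly_bounded_id n)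
  show ?thesis unfolding length_request threshold_def
    by (intro poly_bounded_add poly_bounded_mult poly_bounded_power poly_bounded_const poly_bounded_id n size code)
qed

text \<open>The advice of the inverter is the request for the generator.\<close>

lemma no_pd_OWF:
  assumes good: "\<And>g l n. \<not> deviating g l n f" and acc: "(False, Forward) \<in> acc"
  shows "\<not> pd_OWF (reflection_oracle (answers f)) acc n m Gen"
proof
  let ?U = "reflection_oracle (answers f)"
  assume pd: "pd_OWF ?U acc n m Gen"
  then obtain g where g: "alg g = Gen" using alg_surj unfolding pd_OWF_def by blast
  have n: "poly_bounded n" using pd polynomial_bounded unfolding pd_OWF_def by blast
  have out: "set_pmf (out ?U Gen [unary l, x]) \<subseteq> bits (m l)" if "x \<in> bits (n l)" for l x
    using pd that unfolding pd_OWF_def by blast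
  from pd obtain H \<G> where
    dom: "eventually (\<lambda>l. H l \<in> bits (n l) \<rightarrow> bits (m l) \<and> \<G> l \<subseteq> bits (n l)) sequentially"
    and gen: "\<exists>\<epsilon>. negligible \<epsilon> \<and> (\<forall>\<^sub>F l in sequentially. \<forall>x \<in> \<G> l. pmf (out ?U Gen [unary l, x]) (H l x) \<ge> 1 - \<epsilon> l)"
    and card: "\<exists>\<mu> :: nat \<Rightarrow> real. \<forall>\<^sub>F l in sequentially. \<mu> l \<le> 1 / 3 \<and> real (card (\<G> l)) \<ge> (1 - \<mu> l) * 2 ^ n l"
    and sec: "\<And>A c. QPT acc A \<Longrightarrow> advice c \<Longrightarrow> \<exists>\<epsilon>. negligible \<epsilon> \<and> (\<forall>\<^sub>F l in sequentially.
           measure_pmf.prob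
             (do { x \<leftarrow> pmf_of_set (bits (n l));
                   let y = H l x;
                   x' \<leftarrow> out ?U A [y, c l];
                   return_pmf (y, x') })
             {(y, x'). x' \<in> bits (n l) \<and> H l x' = y} \<le> \<epsilon> l)"
    unfolding pd_OWF_def by blast
  obtain \<epsilon> where \<epsilon>: "negligible \<epsilon>" "\<forall>\<^sub>F l in sequentially. \<forall>x \<in> \<G> l. pmf (out ?U Gen [unary l, x]) (H l x) \<ge> 1 - \<epsilon> l"
    using gen by blast
  obtain \<mu> :: "nat \<Rightarrow> real" where \<mu>: "\<forall>\<^sub>F l in sequentially. \<mu> l \<le> 1 / 3 \<and> real (card (\<G> l)) \<ge> (1 - \<mu> l) * 2 ^ n l"
    using card by blast
  have adv: "advice (\<lambda>l. request g l (n l))"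
    using poly_bounded_request[OF n] unfolding advice_def poly_bounded_def .
  obtain \<epsilon>' where \<epsilon>': "negligible \<epsilon>'" "\<forall>\<^sub>F l in sequentially.
           measure_pmf.prob
             (do { x \<leftarrow> pmf_of_set (bits (n l));
                   let y = H l x;
                   x' \<leftarrow> out ?U loader [y, request g l (n l)];
                   return_pmf (y, x') })
             {(y, x'). x' \<in> bits (n l) \<and> H l x' = y} \<le> \<epsilon>' l"
    using sec[OF QPT_loader[OF acc] adv] by blast
  have "eventually (\<lambda>l. \<bar>\<epsilon> l\<bar> \<le> 1 / real l ^ 1) sequentially" "eventually (\<lambda>l. \<bar>\<epsilon>' l\<bar> \<le> 1 / real l ^ 1) sequentially"
    using \<epsilon>(1) \<epsilon>'(1) unfolding negligible_def by blast+
  then have "eventually (\<lambda>l. False) sequentially"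
    using dom \<epsilon>(2) \<epsilon>'(2) \<mu> eventually_ge_at_top[of 5]
  proof eventually_elim
    case (elim l)
    have "1 / real l \<le> 1 / 5" using elim(7) by (simp add: divide_simps)
    then have e: "\<epsilon> l \<le> 1 / 5" "\<epsilon>' l \<le> 1 / 5" using elim(1,2) by simp_all
    have "1 / 4 \<le> measure_pmf.prob
             (do { x \<leftarrow> pmf_of_set (bits (n l));
                   let y = H l x;
                   x' \<leftarrow> out ?U loader [y, request g l (n l)];
                   return_pmf (y, x') })
             {(y, x'). x' \<in> bits (n l) \<and> H l x' = y}"
    proof (rule inversion_probability[OF good])
      show "\<G> l \<subseteq> bits (n l)" using elim(3) by blast
      have "2 / 3 * 2 ^ n l \<le> (1 - \<mu> l) * 2 ^ n l" using elim(6) by (intro mult_right_mono) simp_all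
      then show "2 / 3 * 2 ^ n l \<le> real (card (\<G> l))" using elim(6) by linarith
      show "3 / 4 \<le> pmf (out ?U (alg g) [unary l, x]) (H l x)" if "x \<in> \<G> l" for x
        using elim(4) that e(1) unfolding g by force
      show "length (request g l (n l)) \<noteq> 2 * length (H l x)" if x: "x \<in> bits (n l)" for x
      proof -
        obtain y where y: "y \<in> set_pmf (out ?U (alg g) [unary l, x])"
          using set_pmf_not_empty[of "out ?U (alg g) [unary l, x]"] by blast
        have "m l = length y" using out[OF x] y unfolding g by (auto simp: bits_def)
        also have "\<dots> \<le> width (alg g (enc_strs [unary l, x]))" by (rule out_length[OF y])
        also have "\<dots> \<le> max_size g l (n l)"
          using width_le_size[of "alg g (enc_strs [unary l, x])"] size_le_max_size[OF x, of g l] by linarith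
        finally have "2 * m l < length (request g l (n l))" using request_long[of g l "n l"] by linarith
        moreover have "length (H l x) = m l" using elim(3) x by (auto simp: bits_def)
        ultimately show ?thesis by simp
      qed
    qed
    then show False using elim(5) e(2) by linarith
  qed
  then show False by simp
qed

theorem theorem4p1:
  "\<exists>U. unitary_oracle U \<and>
     (\<forall>acc \<in> {plain_access, full_access}.
        (\<exists>Samp Ver. EV_OWPuzz U acc Samp Ver) \<and> \<not> (\<exists>n m Gen. pd_OWF U acc n m Gen))"
proof -
  obtain f where f: "\<And>s. f s \<in> keys s" "\<And>j. \<not> bad j f" using exists_good_keys by blast
  have safe: "\<not> broken m f" for m using f(2)[of m] by (simp add: bad_def)
  have good: "\<not> deviating g l n f" for g l n using f(2)[of "code g l n"] by (simp add: bad_def code_def)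
  show ?thesis
  proof (intro exI[of _ "reflection_oracle (answers f)"] conjI ballI)
    show "unitary_oracle (reflection_oracle (answers f))" by (rule unitary_reflection_oracle)
    fix acc assume "acc \<in> {plain_access, full_access}"
    then have acc: "(False, Forward) \<in> acc" by (auto simp: plain_access_def full_access_def)
    show "\<exists>Samp Ver. EV_OWPuzz (reflection_oracle (answers f)) acc Samp Ver"
      using loader_puzzle[OF f(1) safe acc] by blast
    show "\<not> (\<exists>n m Gen. pd_OWF (reflection_oracle (answers f)) acc n m Gen)"
      using no_pd_OWF[OF good acc] by blast
  qed
qed

end
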